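(* Let $\delta>0$ be the fixed level, let $b\in\mathcal L$, and let $w_n(b)$ be the estimate of $b$ described in the context. If $\left|\int_{-\pi}^{\pi}f_b(\mu)\,d\mu\right|>\delta$ and Assumptions 1–3 (stated in the context) hold, then $$E\hat f_{w_n(b)}(\eta)=E\left[\frac{\sin\left(\frac{n+1}{2}\,y(b,w_n(b))\right)}{\frac{n+1}{2}\,y(b,w_n(b))}\int_{-\pi}^{\pi}f_b(\mu)K_n(\mu-\eta)\,d\mu\right]+O\left(\frac{\log n}{n}\right),$$ and the right-hand side is $$f_b(\eta)+\frac{b_n^2}{2}f_b''(\eta)\int_{-\infty}^{\infty}x^2K(x)\,dx+O(b_n^2)+O\left(n^{-1/2}(\log n)^{1/2}\right)+O\left(\frac1{nb_n}\right).$$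
   Context: Setting. $\{X_k\}_{k\in\mathbb Z}$ is a real-valued process with $EX_k\equiv0$. It is harmonizable: $X_k=\int_{-\pi}^{\pi}e^{ik\lambda}\,dZ(\lambda)$ in mean square, where the spectral covariance $F(\lambda,\mu)=\mathrm{cov}(Z(\lambda),Z(\mu))$ satisfies $\int_{-\pi}^{\pi}\int_{-\pi}^{\pi}|dF(\lambda,\mu)|<\infty$. Its covariance function $r_{k,m}=EX_kX_m$ is almost periodic: $r_{s+t,\tau+t}=\sum_j\alpha_j(s,\tau)e^{i\lambda_j(s,\tau)t}$ with real $\lambda_j(s,\tau)$ and $\sum_j|\alpha_j(s,\tau)|<\infty$, the convergence being uniform in $s,\tau$. Then $F$ has mass only on at most countably many lines $\lambda=\mu+b$ (taken mod $2\pi$). The spectra on these lines are absolutely continuous with (complex) spectral densities $f_b(\mu)$, and $\mathcal L$ denotes the collection of $b$'s corresponding to lines with nontrivial spectral support. Thus $$r_{k,m}=\sum_{b\in\mathcal L}\int_{-\pi}^{\pi}e^{ik(\mu+b)}e^{-im\mu}f_b(\mu)\,d\mu=\sum_{b\in\mathcal L}e^{ikb}c_b(k-m),\qquad c_b(j)=\int_{-\pi}^{\pi}e^{ij\lambda}f_b(\lambda)\,d\lambda .$$ Assumption 1: $\{X_k\}$, $EX_k=0$, is a harmonizable Gaussian sequence with almost periodic covariance function; the set $\mathcal L$ is finite; and the $f_b(\mu)$, $b\in\mathcal L$, are continuously differentiable on the curve $\lambda=(b+\mu)\bmod 2\pi$ on the torus of points $(\lambda,\mu)\in[-\pi,\pi]^2$,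 with $(-\pi,\mu)$ identified with $(\pi,\mu)$ and $(\lambda,-\pi)$ with $(\lambda,\pi)$. Assumption 2: there is a function $c(j)\ge0$ on the integers with $|c_b(j)|\le c(j)$ for all $b\in\mathcal L$ and $\sum_jc(j)<\infty$. Assumption 3: $\int_{-\pi}^{\pi}f_b(\mu)\,d\mu\neq0$ for every $b\in\mathcal L$. Notation. $n$ is an even positive integer, $F_n(\lambda)=\sum_{t=-n/2}^{n/2}X_te^{-it\lambda}$, and $I_n(\lambda,\mu)=\frac{1}{2\pi(n+1)}F_n(\lambda)\overline{F_n(\mu)}$. "$Z\bmod 2\pi$" denotes the representative in $(-\pi,\pi]$, and $y(b,w)=(b-w)\bmod2\pi$. Kernel estimate. $K$ is a continuous nonnegative symmetric weight function with finite support and $\int_{-\infty}^{\infty}K(x)\,dx=1$; $K_n(x)=b_n^{-1}K(b_n^{-1}x)$, with bandwidths $b_n\downarrow0$, $nb_n\to\infty$ as $n\to\infty$ (the bandwidth $b_n$ is unrelated to $b\in\mathcal L$); and $\hat f_w(\eta)=\int_{-\pi}^{\pi}I_n(\mu+w,\mu)K_n(\mu-\eta)\,d\mu$. Estimates $w_n(b)$ at level $\delta>0$. Take a sequence $c(n)$ (not the function in Assumption 2) with $c(n)\to\infty$ and $c(n)=o(n)$, e.g. $c(n)=\log n$ or $c(n)=n^{1/2}$. Divide the range $-\pi\le w\le\pi$ into blocks of length $c(n)/n$ and compute the global maximum of $\left|\int_{-\pi}^{\pi}I_n(\mu+w,\mu)\,d\mu\right|$ in each block. Throw out the blocks with maxima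 less than or equal to $\delta+\left(\frac{\log n}{n}\right)^{1/4}$; also, if two maxima are located within $c(n)/n$ of each other, throw out the block with the smaller maximum. The locations at which the remaining maxima occur are the estimates $w_n(b)$ of the $b\in\mathcal L$ with $\left|\int_{-\pi}^{\pi}f_b(\mu)\,d\mu\right|>\delta$; they satisfy $n|w_n(b)-b|<n^{-1/5}$ except for a set of probability $O(\log n/n^2)$ if $n$ is sufficiently large.
   Formalization: The second display is stated for η in the open interval (-π,π), since at η=±π the kernel window over [-π,π] loses half its mass and the formula fails, and under the hypothesis that f_b''(η) exists, which Assumption 1 does not give. *)

theory Defs
  imports "HOL-Probability.Probability" "HOL-Library.Landau_Symbols"
begin

(* the representative in (-pi, pi] *)
definition wrap :: "real \<Rightarrow> real" where
  "wrap z = z - 2 * pi * of_int \<lceil>(z - pi) / (2 * pi)\<rceil>"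

definition ydiff :: "real \<Rightarrow> real \<Rightarrow> real" where
  "ydiff b w = wrap (b - w)"

definition even_at_top :: "nat filter" where
  "even_at_top = inf sequentially (principal {n. even n})"

(* Degenerate (constant) normal laws are allowed. *)
definition gaussian_sequence :: "'a measure \<Rightarrow> (int \<Rightarrow> 'a \<Rightarrow> real) \<Rightarrow> bool" where
  "gaussian_sequence M X \<longleftrightarrow>
     (\<forall>k. X k \<in> borel_measurable M) \<and>
     (\<forall>S a. finite S \<longrightarrow>
        (\<exists>m \<sigma>. (\<sigma> > 0 \<and> distributed M lborel (\<lambda>\<omega>. \<Sum>k\<in>S. a k * X k \<omega>) (normal_density m \<sigma>)) \<or>
               (AE \<omega> in M. (\<Sum>k\<in>S. a k * X k \<omega>) = m)))"

definition covariance_fun :: "'a measure \<Rightarrow> (int \<Rightarrow> 'a \<Rightarrow> real) \<Rightarrow> int \<Rightarrow> int \<Rightarrow> real" where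
  "covariance_fun M X k m = (\<integral>\<omega>. X k \<omega> * X m \<omega> \<partial>M)"

definition almost_periodic_covariance :: "'a measure \<Rightarrow> (int \<Rightarrow> 'a \<Rightarrow> real) \<Rightarrow> bool" where
  "almost_periodic_covariance M X \<longleftrightarrow>
     (\<exists>(\<alpha> :: nat \<Rightarrow> int \<Rightarrow> int \<Rightarrow> complex) (l :: nat \<Rightarrow> int \<Rightarrow> int \<Rightarrow> real).
        (\<forall>s \<tau> t. (\<lambda>j. \<alpha> j s \<tau> * cis (l j s \<tau> * of_int t)) sums
                   complex_of_real (covariance_fun M X (s + t) (\<tau> + t))) \<and>
        (\<forall>s \<tau>. summable (\<lambda>j. cmod (\<alpha> j s \<tau>))) \<and>
        uniformly_convergent_on UNIV (\<lambda>N (s, \<tau>). \<Sum>j<N. cmod (\<alpha> j s \<tau>)))"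

definition spectral_cov :: "'a measure \<Rightarrow> (real \<Rightarrow> 'a \<Rightarrow> complex) \<Rightarrow> real \<Rightarrow> real \<Rightarrow> complex" where
  "spectral_cov M Z l \<mu> =
     (\<integral>\<omega>. (Z l \<omega> - (\<integral>\<omega>'. Z l \<omega>' \<partial>M)) * cnj (Z \<mu> \<omega> - (\<integral>\<omega>'. Z \<mu> \<omega>' \<partial>M)) \<partial>M)"

(* the mass which F gives to the rectangle (l1, l2] x (m1, m2] *)
definition rect_incr :: "(real \<Rightarrow> real \<Rightarrow> complex) \<Rightarrow> real \<Rightarrow> real \<Rightarrow> real \<Rightarrow> real \<Rightarrow> complex" where
  "rect_incr F l1 l2 m1 m2 = F l2 m2 - F l1 m2 - F l2 m1 + F l1 m1"

definition circle_partition :: "nat \<Rightarrow> (nat \<Rightarrow> real) \<Rightarrow> bool" where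
  "circle_partition N p \<longleftrightarrow> p 0 = - pi \<and> p N = pi \<and> (\<forall>i<N. p i \<le> p (Suc i))"

definition finite_variation2 :: "(real \<Rightarrow> real \<Rightarrow> complex) \<Rightarrow> bool" where
  "finite_variation2 F \<longleftrightarrow>
     (\<exists>B. \<forall>N N' p q. circle_partition N p \<and> circle_partition N' q \<longrightarrow>
        (\<Sum>i<N. \<Sum>j<N'. cmod (rect_incr F (p i) (p (Suc i)) (q j) (q (Suc j)))) \<le> B)"

(* Y is the integral of g against dZ over [-pi, pi], as the mean square limit of
   Riemann-Stieltjes sums *)
definition mean_square_integral ::
  "'a measure \<Rightarrow> (real \<Rightarrow> 'a \<Rightarrow> complex) \<Rightarrow> (real \<Rightarrow> complex) \<Rightarrow> ('a \<Rightarrow> complex) \<Rightarrow> bool" where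
  "mean_square_integral M Z g Y \<longleftrightarrow>
     (\<forall>e>0. \<exists>d>0. \<forall>N p \<xi>.
        circle_partition N p \<and> (\<forall>i<N. p (Suc i) - p i < d \<and> \<xi> i \<in> {p i..p (Suc i)}) \<longrightarrow>
        (\<integral>\<omega>. (cmod (Y \<omega> - (\<Sum>i<N. g (\<xi> i) * (Z (p (Suc i)) \<omega> - Z (p i) \<omega>))))\<^sup>2 \<partial>M) < e)"

definition harmonizable_via ::
  "'a measure \<Rightarrow> (int \<Rightarrow> 'a \<Rightarrow> real) \<Rightarrow> (real \<Rightarrow> 'a \<Rightarrow> complex) \<Rightarrow> bool" where
  "harmonizable_via M X Z \<longleftrightarrow>
     (\<forall>l\<in>{-pi..pi}. Z l \<in> borel_measurable M \<and> integrable M (\<lambda>\<omega>. (cmod (Z l \<omega>))\<^sup>2)) \<and>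
     finite_variation2 (spectral_cov M Z) \<and>
     (\<forall>k. mean_square_integral M Z (\<lambda>l. cis (of_int k * l)) (\<lambda>\<omega>. complex_of_real (X k \<omega>)))"

(* F is carried by the lines l = mu + b (mod 2 pi), b in L, and its restriction to the line
   indexed by b has density f b with respect to d mu. L contains only lines that carry mass. *)
definition spectral_lines ::
  "(real \<Rightarrow> real \<Rightarrow> complex) \<Rightarrow> real set \<Rightarrow> (real \<Rightarrow> real \<Rightarrow> complex) \<Rightarrow> bool" where
  "spectral_lines F L f \<longleftrightarrow>
     L \<subseteq> {-pi<..pi} \<and>
     (\<forall>b\<in>L. \<not> (AE \<mu> in lborel. \<mu> \<in> {-pi..pi} \<longrightarrow> f b \<mu> = 0)) \<and>
     (\<forall>l1 l2 m1 m2. -pi \<le> l1 \<and> l1 \<le> l2 \<and> l2 \<le> pi \<and> -pi \<le> m1 \<and> m1 \<le> m2 \<and> m2 \<le> pi \<longrightarrow>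
        rect_incr F l1 l2 m1 m2 =
          (\<Sum>b\<in>L. integral {\<mu> \<in> {m1<..m2}. wrap (\<mu> + b) \<in> {l1<..l2}} (f b)))"

(* Smoothness of f b on the closed curve l = (b + mu) mod 2 pi of the torus is smoothness on
   the real line of f b as a function of period 2 pi. *)
definition assumption1 ::
  "'a measure \<Rightarrow> (int \<Rightarrow> 'a \<Rightarrow> real) \<Rightarrow> (real \<Rightarrow> 'a \<Rightarrow> complex) \<Rightarrow> real set \<Rightarrow>
     (real \<Rightarrow> real \<Rightarrow> complex) \<Rightarrow> bool" where
  "assumption1 M X Z L f \<longleftrightarrow>
     gaussian_sequence M X \<and> (\<forall>k. (\<integral>\<omega>. X k \<omega> \<partial>M) = 0) \<and>
     harmonizable_via M X Z \<and> almost_periodic_covariance M X \<and>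
     finite L \<and> spectral_lines (spectral_cov M Z) L f \<and>
     (\<forall>b\<in>L. (\<forall>\<mu>. f b (\<mu> + 2 * pi) = f b \<mu>) \<and> f b C1_differentiable_on UNIV)"

definition line_coeff :: "(real \<Rightarrow> real \<Rightarrow> complex) \<Rightarrow> real \<Rightarrow> int \<Rightarrow> complex" where
  "line_coeff f b j = integral {-pi..pi} (\<lambda>l. cis (of_int j * l) * f b l)"

definition assumption2 :: "real set \<Rightarrow> (real \<Rightarrow> real \<Rightarrow> complex) \<Rightarrow> bool" where
  "assumption2 L f \<longleftrightarrow>
     (\<exists>C :: int \<Rightarrow> real. (\<forall>j. 0 \<le> C j) \<and> (\<forall>b\<in>L. \<forall>j. cmod (line_coeff f b j) \<le> C j) \<and>
        C summable_on UNIV)"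

definition assumption3 :: "real set \<Rightarrow> (real \<Rightarrow> real \<Rightarrow> complex) \<Rightarrow> bool" where
  "assumption3 L f \<longleftrightarrow> (\<forall>b\<in>L. integral {-pi..pi} (f b) \<noteq> 0)"

definition finite_fourier :: "(int \<Rightarrow> 'a \<Rightarrow> real) \<Rightarrow> nat \<Rightarrow> real \<Rightarrow> 'a \<Rightarrow> complex" where
  "finite_fourier X n l \<omega> =
     (\<Sum>t = - int (n div 2)..int (n div 2). complex_of_real (X t \<omega>) * cis (- (of_int t * l)))"

definition bi_periodogram ::
  "(int \<Rightarrow> 'a \<Rightarrow> real) \<Rightarrow> nat \<Rightarrow> real \<Rightarrow> real \<Rightarrow> 'a \<Rightarrow> complex" where
  "bi_periodogram X n l \<mu> \<omega> =
     finite_fourier X n l \<omega> * cnj (finite_fourier X n \<mu> \<omega>) / of_real (2 * pi * (real n + 1))"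

definition weight_function :: "(real \<Rightarrow> real) \<Rightarrow> bool" where
  "weight_function K \<longleftrightarrow>
     continuous_on UNIV K \<and> (\<forall>x. 0 \<le> K x) \<and> (\<forall>x. K (- x) = K x) \<and>
     (\<exists>R. \<forall>x. R < \<bar>x\<bar> \<longrightarrow> K x = 0) \<and> (K has_integral 1) UNIV"

definition bandwidth_sequence :: "(nat \<Rightarrow> real) \<Rightarrow> bool" where
  "bandwidth_sequence bw \<longleftrightarrow>
     (\<forall>n. 0 < bw n) \<and> decseq bw \<and> bw \<longlonglongrightarrow> 0 \<and>
     filterlim (\<lambda>n. real n * bw n) at_top sequentially"

definition scaled_kernel :: "(real \<Rightarrow> real) \<Rightarrow> (nat \<Rightarrow> real) \<Rightarrow> nat \<Rightarrow> real \<Rightarrow> real" where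
  "scaled_kernel K bw n x = inverse (bw n) * K (inverse (bw n) * x)"

definition kernel_estimate ::
  "(int \<Rightarrow> 'a \<Rightarrow> real) \<Rightarrow> (real \<Rightarrow> real) \<Rightarrow> (nat \<Rightarrow> real) \<Rightarrow> nat \<Rightarrow> real \<Rightarrow> real \<Rightarrow> 'a \<Rightarrow> complex" where
  "kernel_estimate X K bw n w \<eta> \<omega> =
     integral {-pi..pi}
       (\<lambda>\<mu>. bi_periodogram X n (\<mu> + w) \<mu> \<omega> * of_real (scaled_kernel K bw n (\<mu> - \<eta>)))"

definition line_statistic :: "(int \<Rightarrow> 'a \<Rightarrow> real) \<Rightarrow> nat \<Rightarrow> 'a \<Rightarrow> real \<Rightarrow> real" where
  "line_statistic X n \<omega> w = cmod (integral {-pi..pi} (\<lambda>\<mu>. bi_periodogram X n (\<mu> + w) \<mu> \<omega>))"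

(* Blocks are closed so that maxima are attained; the last one is cut off at pi. *)
definition blocks :: "(nat \<Rightarrow> real) \<Rightarrow> nat \<Rightarrow> real set set" where
  "blocks c n =
     (\<lambda>j. {-pi + real j * (c n / real n)..min pi (-pi + (real j + 1) * (c n / real n))}) `
       {j. -pi + real j * (c n / real n) < pi}"

definition block_maxima ::
  "(int \<Rightarrow> 'a \<Rightarrow> real) \<Rightarrow> (nat \<Rightarrow> real) \<Rightarrow> real \<Rightarrow> nat \<Rightarrow> 'a \<Rightarrow> real set" where
  "block_maxima X c \<delta> n \<omega> =
     {w. (\<exists>B\<in>blocks c n. is_arg_max (line_statistic X n \<omega>) (\<lambda>v. v \<in> B) w) \<and>
         \<delta> + (ln (real n) / real n) powr (1/4) < line_statistic X n \<omega> w}"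

definition retained_maxima ::
  "(int \<Rightarrow> 'a \<Rightarrow> real) \<Rightarrow> (nat \<Rightarrow> real) \<Rightarrow> real \<Rightarrow> nat \<Rightarrow> 'a \<Rightarrow> real set" where
  "retained_maxima X c \<delta> n \<omega> =
     {w \<in> block_maxima X c \<delta> n \<omega>. \<forall>v\<in>block_maxima X c \<delta> n \<omega>.
        \<bar>v - w\<bar> \<le> c n / real n \<longrightarrow> line_statistic X n \<omega> v \<le> line_statistic X n \<omega> w}"

(* w n is a random variable which selects, among the retained locations, one that is closest
   to b modulo 2 pi. It is arbitrary in [-pi, pi] where no location is retained. *)
definition line_estimate ::
  "'a measure \<Rightarrow> (int \<Rightarrow> 'a \<Rightarrow> real) \<Rightarrow> (nat \<Rightarrow> real) \<Rightarrow> real \<Rightarrow> real \<Rightarrow> (nat \<Rightarrow> 'a \<Rightarrow> real) \<Rightarrow> bool" where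
  "line_estimate M X c \<delta> b w \<longleftrightarrow>
     (\<forall>n>0. even n \<longrightarrow>
        w n \<in> borel_measurable M \<and>
        (\<forall>\<omega>\<in>space M. w n \<omega> \<in> {-pi..pi} \<and>
           (retained_maxima X c \<delta> n \<omega> \<noteq> {} \<longrightarrow>
              is_arg_min (\<lambda>v. \<bar>ydiff b v\<bar>) (\<lambda>v. v \<in> retained_maxima X c \<delta> n \<omega>) (w n \<omega>))))"

(* The library's sinc has the value 1 at 0. *)
definition main_term ::
  "'a measure \<Rightarrow> (real \<Rightarrow> real) \<Rightarrow> (nat \<Rightarrow> real) \<Rightarrow> (real \<Rightarrow> real \<Rightarrow> complex) \<Rightarrow> real \<Rightarrow>
     (nat \<Rightarrow> 'a \<Rightarrow> real) \<Rightarrow> real \<Rightarrow> nat \<Rightarrow> complex" where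
  "main_term M K bw f b w \<eta> n =
     (\<integral>\<omega>. of_real (sinc ((real n + 1) / 2 * ydiff b (w n \<omega>))) *
            integral {-pi..pi} (\<lambda>\<mu>. f b \<mu> * of_real (scaled_kernel K bw n (\<mu> - \<eta>))) \<partial>M)"

end

(* For n = 2h and N = n + 1, the line statistic S(w), the integral of I_n(mu + w, mu) over mu, equals
   the sum of X_t^2 exp(-itw) / N over |t| <= h.  Its mean is a sum over the lines b' of the mass of
   b' times D(b' - w) / N, with D the Dirichlet kernel.  Its centred part P(w), like that of the kernel
   estimate, is a quadratic form in a Gaussian family with absolutely summable covariance.  Gaussian
   integration by parts bounds the moments of such forms: P(w) is of order N^(-1/2), and sup |P| is
   small off an event of probability O(N^-6).  On the good event the selected maximum is a critical
   point w = b + u/N (mod 2 pi) of |S| with |u| <= 1, and expanding the critical equation gives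
     u = (a linear functional of P near b) + O(|P|^2 + 1/N).
   At the frequency b + u/N the mean of the kernel estimate is the sinc factor times the smoothed
   density up to O(log N / N), the logarithm being the Lebesgue constant.  Its centred part has mean
   zero at u = 0, and its variation with u has mean O(1/N): after replacing u by its linear part this
   is a covariance of two quadratic forms with coefficients O(1/N), one of them diagonal, which
   Isserlis' formula evaluates.  Finally E u^2 = O(1/N), so the sinc factor is 1 + O(1/N) in mean,
   and Taylor expansion of f_b at eta gives the last claim. *)
theory Submission
  imports Defs "HOL-Real_Asymp.Real_Asymp"
begin

section \<open>Moments of Gaussian families\<close>

text \<open>The obstacle is that the frequency \<open>w n\<close> is computed from the same data as
  the estimate, so the mean cannot be taken at a fixed frequency. Two devices deal with it. First,
  since |t / N| <= 1/2, the sums over t at b + u / N expand in powers of u with coefficients whose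
  moments decay geometrically; one random variable dominates all coefficients, and with them the
  sums for every |u| <= 1, whatever u depends on. Second, the L2 bound for the centred estimate is
  of order one and u is of order N^(-1/2), so Cauchy-Schwarz would leave an error N^(-1/2). The rate
  comes from the cancellation in the covariance of the first-order coefficient with the linear part
  of u; only quadratic remainders are estimated in absolute value, and for them fourth moments of
  the fluctuation suffice. The exponent 6 of the bad event pays for a crude pathwise bound there,
  quadratic in the sum of the X_t^2.\<close>

definition all_moments :: "'a measure \<Rightarrow> ('a \<Rightarrow> real) \<Rightarrow> bool" where
  "all_moments M g \<longleftrightarrow> g \<in> borel_measurable M \<and> (\<forall>p::nat. integrable M (\<lambda>\<omega>. \<bar>g \<omega>\<bar> ^ p))"

context prob_space
begin

lemma all_moments_measurable: "all_moments M g \<Longrightarrow> g \<in> borel_measurable M"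
  by (simp add: all_moments_def)

lemma all_moments_integrable: "all_moments M g \<Longrightarrow> integrable M g"
  unfolding all_moments_def
  by (elim conjE) (drule spec[of _ 1], simp add: integrable_abs_iff)

text \<open>Normal laws come with formulas for even central moments; |x|^p <= 1 + x^(2 p) reduces
  all absolute moments to these.\<close>

lemma all_moments_even:
  assumes "g \<in> borel_measurable M" "\<And>p. integrable M (\<lambda>\<omega>. g \<omega> ^ (2 * p))"
  shows "all_moments M g"
  unfolding all_moments_def
proof (intro conjI allI)
  fix p
  have [measurable]: "g \<in> borel_measurable M" by fact
  have le: "\<bar>x\<bar> ^ p \<le> 1 + x ^ (2 * p)" for x :: real
  proof -
    have "0 \<le> (\<bar>x\<bar> ^ p - 1)\<^sup>2 + \<bar>x\<bar> ^ p * 0" by simp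
    then have "2 * \<bar>x\<bar> ^ p \<le> 1 + (\<bar>x\<bar> ^ p)\<^sup>2" by (simp add: power2_diff)
    moreover have "(\<bar>x\<bar> ^ p)\<^sup>2 = x ^ (2 * p)"
      by (metis power_mult power2_abs mult.commute)
    moreover have "0 \<le> \<bar>x\<bar> ^ p" by simp
    ultimately show ?thesis by linarith
  qed
  show "integrable M (\<lambda>\<omega>. \<bar>g \<omega>\<bar> ^ p)"
    by (rule Bochner_Integration.integrable_bound[where f = "\<lambda>\<omega>. 1 + g \<omega> ^ (2 * p)"])
       (use assms(2) le in \<open>auto intro!: AE_I2 simp: power_abs order_trans[OF _ abs_ge_self]\<close>)
qed fact

lemma all_moments_const [simp]: "all_moments M (\<lambda>_. c)"
  by (simp add: all_moments_def)

lemma all_moments_add: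
  assumes "all_moments M g" "all_moments M h"
  shows "all_moments M (\<lambda>\<omega>. g \<omega> + h \<omega>)"
proof -
  have [measurable]: "g \<in> borel_measurable M" "h \<in> borel_measurable M"
    using assms by (auto simp: all_moments_def)
  have le: "\<bar>x + y\<bar> ^ p \<le> 2 ^ p * (\<bar>x\<bar> ^ p + \<bar>y\<bar> ^ p)" for x y :: real and p :: nat
  proof -
    have "\<bar>x + y\<bar> ^ p \<le> (2 * max \<bar>x\<bar> \<bar>y\<bar>) ^ p"
      by (intro power_mono) auto
    also have "\<dots> \<le> 2 ^ p * (\<bar>x\<bar> ^ p + \<bar>y\<bar> ^ p)"
      by (auto simp: power_mult_distrib max_def)
    finally show ?thesis .
  qed
  show ?thesis
    unfolding all_moments_def
  proof (intro conjI allI)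
    fix p
    show "integrable M (\<lambda>\<omega>. \<bar>g \<omega> + h \<omega>\<bar> ^ p)"
      by (rule Bochner_Integration.integrable_bound[where f = "\<lambda>\<omega>. 2 ^ p * (\<bar>g \<omega>\<bar> ^ p + \<bar>h \<omega>\<bar> ^ p)"])
         (use assms le in \<open>auto simp: all_moments_def intro!: AE_I2\<close>)
  qed measurable
qed

lemma all_moments_mult:
  assumes "all_moments M g" "all_moments M h"
  shows "all_moments M (\<lambda>\<omega>. g \<omega> * h \<omega>)"
proof -
  have [measurable]: "g \<in> borel_measurable M" "h \<in> borel_measurable M"
    using assms by (auto simp: all_moments_def)
  have le: "\<bar>x * y\<bar> ^ p \<le> \<bar>x\<bar> ^ (2 * p) + \<bar>y\<bar> ^ (2 * p)" for x y :: real and p :: nat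
  proof -
    have "0 \<le> (\<bar>x\<bar> ^ p - \<bar>y\<bar> ^ p)\<^sup>2" "0 \<le> \<bar>x\<bar> ^ p * \<bar>y\<bar> ^ p" by simp_all
    then have "\<bar>x\<bar> ^ p * \<bar>y\<bar> ^ p \<le> (\<bar>x\<bar> ^ p)\<^sup>2 + (\<bar>y\<bar> ^ p)\<^sup>2"
      unfolding power2_diff by linarith
    then show ?thesis
      by (simp add: abs_mult power_mult_distrib power_mult[symmetric] mult.commute[of p])
  qed
  show ?thesis
    unfolding all_moments_def
  proof (intro conjI allI)
    fix p
    show "integrable M (\<lambda>\<omega>. \<bar>g \<omega> * h \<omega>\<bar> ^ p)"
      by (rule Bochner_Integration.integrable_bound[where f = "\<lambda>\<omega>. \<bar>g \<omega>\<bar> ^ (2 * p) + \<bar>h \<omega>\<bar> ^ (2 * p)"])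
         (use assms le in \<open>auto simp: all_moments_def intro!: AE_I2\<close>)
  qed measurable
qed

lemma all_moments_cmult: "all_moments M g \<Longrightarrow> all_moments M (\<lambda>\<omega>. c * g \<omega>)"
  by (rule all_moments_mult) auto

lemma all_moments_diff:
  "all_moments M g \<Longrightarrow> all_moments M h \<Longrightarrow> all_moments M (\<lambda>\<omega>. g \<omega> - h \<omega>)"
  using all_moments_add[of g "\<lambda>\<omega>. -1 * h \<omega>"] all_moments_cmult[of h "-1"] by simp

lemma all_moments_power: "all_moments M g \<Longrightarrow> all_moments M (\<lambda>\<omega>. g \<omega> ^ k)"
  by (induction k) (auto intro: all_moments_mult)

lemma all_moments_sum:
  "(\<And>i. i \<in> I \<Longrightarrow> all_moments M (g i)) \<Longrightarrow> all_moments M (\<lambda>\<omega>. \<Sum>i\<in>I. g i \<omega>)"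
  by (induction I rule: infinite_finite_induct) (auto intro: all_moments_add)

text \<open>Integrability of a product does not follow from that of its factors. Having all moments
  is stable under sums and products, so integrability goals about polynomials in the
  \<open>X k\<close> reduce to these rules.\<close>

lemmas all_moments_intros =
  all_moments_add all_moments_mult all_moments_diff all_moments_power all_moments_sum

end

section \<open>Gaussian integration by parts for polynomials in linear forms\<close>

locale gaussian_family = prob_space M for M :: "'a measure" +
  fixes X :: "int \<Rightarrow> 'a \<Rightarrow> real"
  assumes gauss: "gaussian_sequence M X"
    and mean_zero: "\<And>k. (\<integral>\<omega>. X k \<omega> \<partial>M) = 0"
begin

definition linear_forms :: "('a \<Rightarrow> real) set" where
  "linear_forms = {l. \<exists>S a. finite S \<and> l = (\<lambda>\<omega>. \<Sum>k\<in>S. a k * X k \<omega>)}"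

abbreviation cov :: "int \<Rightarrow> int \<Rightarrow> real" where
  "cov \<equiv> covariance_fun M X"

lemma linear_forms_X [simp]: "X k \<in> linear_forms"
  unfolding linear_forms_def by (auto intro!: exI[of _ "{k}"] exI[of _ "\<lambda>_. 1"])

text \<open>The perturbation l + s x stays Gaussian for every real s. Comparing derivatives at s = 0
  of the moment formulas along this family is the source of integration by parts.\<close>

lemma linear_forms_combine:
  assumes "l \<in> linear_forms" "x \<in> linear_forms"
  shows "(\<lambda>\<omega>. l \<omega> + s * x \<omega>) \<in> linear_forms"
proof -
  obtain S a where S: "finite S" "l = (\<lambda>\<omega>. \<Sum>k\<in>S. a k * X k \<omega>)"
    using assms(1) by (auto simp: linear_forms_def)
  obtain T c where T: "finite T" "x = (\<lambda>\<omega>. \<Sum>k\<in>T. c k * X k \<omega>)"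
    using assms(2) by (auto simp: linear_forms_def)
  define d where "d k = (if k \<in> S then a k else 0) + s * (if k \<in> T then c k else 0)" for k
  have "l \<omega> + s * x \<omega> = (\<Sum>k\<in>S \<union> T. d k * X k \<omega>)" for \<omega>
  proof -
    have "l \<omega> = (\<Sum>k\<in>S \<union> T. (if k \<in> S then a k else 0) * X k \<omega>)"
      unfolding S(2) using S(1) T(1) by (intro sum.mono_neutral_cong_left) auto
    moreover have "x \<omega> = (\<Sum>k\<in>S \<union> T. (if k \<in> T then c k else 0) * X k \<omega>)"
      unfolding T(2) using S(1) T(1) by (intro sum.mono_neutral_cong_left) auto
    ultimately show ?thesis
      by (simp only: d_def sum_distrib_left distrib_right sum.distrib mult.assoc)
  qed
  then show ?thesis
    unfolding linear_forms_def using S(1) T(1) by (auto intro!: exI[of _ "S \<union> T"] exI[of _ d])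
qed

lemma linear_forms_law:
  assumes "l \<in> linear_forms"
  obtains m \<sigma> where
    "(\<sigma> > 0 \<and> distributed M lborel l (normal_density m \<sigma>)) \<or> (AE \<omega> in M. l \<omega> = m)"
  using assms gauss unfolding linear_forms_def gaussian_sequence_def by blast

lemma linear_forms_measurable:
  assumes "l \<in> linear_forms"
  shows "l \<in> borel_measurable M"
proof -
  have [measurable]: "X k \<in> borel_measurable M" for k
    using gauss by (auto simp: gaussian_sequence_def)
  show ?thesis using assms by (auto simp: linear_forms_def)
qed

text \<open>The normal moment formulas concern central moments, so the variable is first shifted by
  the parameter m of its law; a degenerate law contributes only the constant m. The shift is undone
  by adding a constant.\<close>

lemma linear_forms_all_moments:
  assumes l: "l \<in> linear_forms"
  shows "all_moments M l"
proof -
  note [measurable] = linear_forms_measurable[OF l]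
  obtain m \<sigma> where "(\<sigma> > 0 \<and> distributed M lborel l (normal_density m \<sigma>)) \<or> (AE \<omega> in M. l \<omega> = m)"
    using linear_forms_law[OF l] .
  then have "all_moments M (\<lambda>\<omega>. l \<omega> - m)"
  proof (elim disjE conjE)
    assume *: "\<sigma> > 0" "distributed M lborel l (normal_density m \<sigma>)"
    show ?thesis
    proof (rule all_moments_even)
      fix p
      have "integrable lborel (\<lambda>x. normal_density m \<sigma> x * (x - m) ^ (2 * p))"
        using normal_moment_even[OF *(1)] by (rule has_bochner_integral_iff[THEN iffD1, THEN conjunct1])
      then show "integrable M (\<lambda>\<omega>. (l \<omega> - m) ^ (2 * p))"
        using distributed_integrable[OF *(2), of "\<lambda>x. (x - m) ^ (2 * p)"] by simp
    qed measurable
  next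
    assume *: "AE \<omega> in M. l \<omega> = m"
    show ?thesis
    proof (rule all_moments_even)
      fix p
      show "integrable M (\<lambda>\<omega>. (l \<omega> - m) ^ (2 * p))"
        by (rule integrable_cong_AE_imp[where g = "\<lambda>_. 0 ^ (2 * p)"]) (use * in auto)
    qed measurable
  qed
  from all_moments_add[OF this all_moments_const[of m]] show ?thesis by simp
qed

lemma linear_forms_mean:
  assumes l: "l \<in> linear_forms"
  shows "expectation l = 0"
proof -
  obtain S a where S: "finite S" "l = (\<lambda>\<omega>. \<Sum>k\<in>S. a k * X k \<omega>)"
    using assms(1) by (auto simp: linear_forms_def)
  have "integrable M (X k)" for k
    by (intro all_moments_integrable linear_forms_all_moments) simp
  then show ?thesis unfolding S(2) by (simp add: mean_zero)
qed

text \<open>\<open>fact (2 * k) / (2 ^ k * fact k)\<close> is the moment of order 2 k of the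
  standard normal law. The degenerate case obeys the same formula because zero mean forces m = 0,
  with 0^0 = 1 for k = 0.\<close>

lemma linear_forms_moments:
  assumes l: "l \<in> linear_forms"
  shows "expectation (\<lambda>\<omega>. l \<omega> ^ (2 * k)) = fact (2 * k) / (2 ^ k * fact k) * expectation (\<lambda>\<omega>. (l \<omega>)\<^sup>2) ^ k" (is ?A)
    and "expectation (\<lambda>\<omega>. l \<omega> ^ (2 * k + 1)) = 0" (is ?B)
proof -
  note [measurable] = linear_forms_measurable[OF l]
  obtain m \<sigma> where "(\<sigma> > 0 \<and> distributed M lborel l (normal_density m \<sigma>)) \<or> (AE \<omega> in M. l \<omega> = m)"
    using linear_forms_law[OF l] .
  then have "?A \<and> ?B"
  proof (elim disjE conjE)
    assume *: "\<sigma> > 0" "distributed M lborel l (normal_density m \<sigma>)"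
    have m: "m = 0"
      using normal_distributed_expectation[OF *] linear_forms_mean[OF l] by simp
    have ev: "expectation (\<lambda>\<omega>. l \<omega> ^ (2 * k)) = fact (2 * k) / ((2 / \<sigma>\<^sup>2) ^ k * fact k)" for k
      using distributed_integral[OF *(2), of "\<lambda>x. x ^ (2 * k)"] 
        integral_normal_moment_even[OF *(1), of m k] by (simp add: m)
    have od: ?B
      using distributed_integral[OF *(2), of "\<lambda>x. x ^ (2 * k + 1)"] 
        integral_normal_moment_odd[OF *(1), of m k] by (simp add: m)
    show ?thesis using ev[of k] ev[of 1] od by (simp add: power_divide)
  next
    assume *: "AE \<omega> in M. l \<omega> = m"
    then have ev: "expectation (\<lambda>\<omega>. l \<omega> ^ j) = m ^ j" for j
    proof -
      have "expectation (\<lambda>\<omega>. l \<omega> ^ j) = expectation (\<lambda>\<omega>. m ^ j)"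
        by (rule integral_cong_AE) (use * in auto)
      then show ?thesis by (simp add: prob_space)
    qed
    have "m = 0" using ev[of 1] linear_forms_mean[OF l] by simp
    then show ?thesis using ev[of "2 * k"] ev[of 2] ev[of "2 * k + 1"] by (cases k) auto
  qed
  then show ?A ?B by auto
qed

text \<open>By the binomial theorem the expectation is a polynomial in s, and its derivative at 0 is
  the coefficient of order one. No differentiation under the integral sign is involved.\<close>

lemma moment_has_derivative:
  assumes W: "all_moments M W" and l: "all_moments M l" and x: "all_moments M x"
  shows "((\<lambda>s. expectation (\<lambda>\<omega>. W \<omega> * (l \<omega> + s * x \<omega>) ^ k)) has_real_derivative
     k * expectation (\<lambda>\<omega>. W \<omega> * x \<omega> * l \<omega> ^ (k - 1))) (at 0)"
proof -
  have int: "integrable M (\<lambda>\<omega>. W \<omega> * (x \<omega> ^ i * l \<omega> ^ j))" for i j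
    by (intro all_moments_integrable all_moments_intros W l x)
  have eq: "expectation (\<lambda>\<omega>. W \<omega> * (l \<omega> + s * x \<omega>) ^ k) =
      (\<Sum>j\<le>k. s ^ j * (of_nat (k choose j) * expectation (\<lambda>\<omega>. W \<omega> * (x \<omega> ^ j * l \<omega> ^ (k - j)))))" for s
  proof -
    have "W \<omega> * (l \<omega> + s * x \<omega>) ^ k =
        (\<Sum>j\<le>k. s ^ j * of_nat (k choose j) * (W \<omega> * (x \<omega> ^ j * l \<omega> ^ (k - j))))" for \<omega>
      by (subst add.commute, subst binomial_ring)
         (simp add: sum_distrib_left power_mult_distrib mult_ac)
    then have "expectation (\<lambda>\<omega>. W \<omega> * (l \<omega> + s * x \<omega>) ^ k) =
        expectation (\<lambda>\<omega>. \<Sum>j\<le>k. s ^ j * of_nat (k choose j) * (W \<omega> * (x \<omega> ^ j * l \<omega> ^ (k - j))))"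
      by simp
    also have "\<dots> = (\<Sum>j\<le>k. s ^ j * of_nat (k choose j) * expectation (\<lambda>\<omega>. W \<omega> * (x \<omega> ^ j * l \<omega> ^ (k - j))))"
      by (subst Bochner_Integration.integral_sum) (use int in \<open>auto intro!: integrable_mult_right\<close>)
    finally show ?thesis by (simp add: mult_ac)
  qed
  have "((\<lambda>s. \<Sum>j\<le>k. s ^ j * (of_nat (k choose j) * expectation (\<lambda>\<omega>. W \<omega> * (x \<omega> ^ j * l \<omega> ^ (k - j)))))
      has_real_derivative (\<Sum>j\<le>k. (real j * 0 ^ (j - 1)) * (of_nat (k choose j) * expectation (\<lambda>\<omega>. W \<omega> * (x \<omega> ^ j * l \<omega> ^ (k - j)))))) (at 0)"
    by (auto intro!: derivative_eq_intros sum.cong simp: )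
  moreover have "(\<Sum>j\<le>k. (real j * 0 ^ (j - 1)) * (of_nat (k choose j) * expectation (\<lambda>\<omega>. W \<omega> * (x \<omega> ^ j * l \<omega> ^ (k - j))))) =
     k * expectation (\<lambda>\<omega>. W \<omega> * x \<omega> * l \<omega> ^ (k - 1))"
  proof (cases k)
    case (Suc m)
    have "(\<Sum>j\<le>k. (real j * 0 ^ (j - 1)) * (of_nat (k choose j) * expectation (\<lambda>\<omega>. W \<omega> * (x \<omega> ^ j * l \<omega> ^ (k - j))))) =
      (\<Sum>j\<in>{1}. (real j * 0 ^ (j - 1)) * (of_nat (k choose j) * expectation (\<lambda>\<omega>. W \<omega> * (x \<omega> ^ j * l \<omega> ^ (k - j)))))"
      by (rule sum.mono_neutral_right) (auto simp: Suc power_0_left)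
    then show ?thesis by (simp add: Suc mult_ac)
  qed simp
  ultimately show ?thesis by (simp add: eq)
qed

text \<open>The derivative at s = 0 of the moment of order k + 1 of l + s Y is computed in two ways,
  by \<open>moment_has_derivative\<close> and from \<open>linear_forms_moments\<close>. For even k
  this moment vanishes for all s; for odd k it is a constant times a power of the variance.\<close>

lemma stein_power:
  assumes Y: "Y \<in> linear_forms" and l: "l \<in> linear_forms"
  shows "expectation (\<lambda>\<omega>. Y \<omega> * l \<omega> ^ k) =
    k * expectation (\<lambda>\<omega>. Y \<omega> * l \<omega>) * expectation (\<lambda>\<omega>. l \<omega> ^ (k - 1))"
proof -
  note lin = linear_forms_all_moments[OF Y] linear_forms_all_moments[OF l]
  have D: "((\<lambda>s. expectation (\<lambda>\<omega>. (l \<omega> + s * Y \<omega>) ^ j)) has_real_derivative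
     j * expectation (\<lambda>\<omega>. Y \<omega> * l \<omega> ^ (j - 1))) (at 0)" for j
    using moment_has_derivative[OF all_moments_const[of 1] lin(2,1), of j] by simp
  show ?thesis
  proof (cases "even k")
    case True
    then obtain i where i: "k = 2 * i" by blast
    have "(\<lambda>s. expectation (\<lambda>\<omega>. (l \<omega> + s * Y \<omega>) ^ (2 * i + 1))) = (\<lambda>s. 0)"
      using linear_forms_moments(2)[OF linear_forms_combine[OF l Y]] by simp
    with D[of "2 * i + 1"] have "((\<lambda>s::real. 0) has_real_derivative real (2 * i + 1) * expectation (\<lambda>\<omega>. Y \<omega> * l \<omega> ^ (2 * i))) (at 0)"
      by simp
    from DERIV_unique[OF this DERIV_const] have "expectation (\<lambda>\<omega>. Y \<omega> * l \<omega> ^ (2 * i)) = 0"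
      by (simp del: of_nat_add of_nat_mult of_nat_Suc)
    \<comment> \<open>For k = 0 the exponent k - 1 is truncated to 0, but the factor k makes the
      product vanish.\<close>
    moreover have "real k * expectation (\<lambda>\<omega>. l \<omega> ^ (k - 1)) = 0"
      using linear_forms_moments(2)[OF l, of "i - 1"] by (cases i) (auto simp: i)
    ultimately show ?thesis using i by auto
  next
    case False
    then obtain i where i: "k = 2 * i + 1" by (elim oddE)
    define c :: real where "c = fact (2 * Suc i) / (2 ^ Suc i * fact (Suc i))"
    define c' :: real where "c' = fact (2 * i) / (2 ^ i * fact i)"
    \<comment> \<open>The recursion (2 i + 1)!! = (2 i + 1) (2 i - 1)!! of double
      factorials.\<close>
    have c: "c = (2 * real i + 1) * c'"
    proof -
      have "2 * Suc i = Suc (Suc (2 * i))" by simp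
      then have "fact (2 * Suc i) = (2 * real i + 2) * ((2 * real i + 1) * fact (2 * i))"
        by (simp only: fact_Suc of_nat_Suc of_nat_mult of_nat_numeral) (simp add: algebra_simps)
      then show ?thesis unfolding c_def c'_def by (simp add: divide_simps)
    qed
    have "(\<lambda>s. expectation (\<lambda>\<omega>. (l \<omega> + s * Y \<omega>) ^ (2 * Suc i))) =
        (\<lambda>s. c * expectation (\<lambda>\<omega>. (l \<omega> + s * Y \<omega>)\<^sup>2) ^ Suc i)"
      using linear_forms_moments(1)[OF linear_forms_combine[OF l Y], of _ "Suc i"] by (simp add: c_def)
    with D[of "2 * Suc i"] have 1: "((\<lambda>s. c * expectation (\<lambda>\<omega>. (l \<omega> + s * Y \<omega>)\<^sup>2) ^ Suc i) has_real_derivative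
        real (2 * Suc i) * expectation (\<lambda>\<omega>. Y \<omega> * l \<omega> ^ (2 * Suc i - 1))) (at 0)"
      by (simp only:)
    have 2: "((\<lambda>s. c * expectation (\<lambda>\<omega>. (l \<omega> + s * Y \<omega>)\<^sup>2) ^ Suc i) has_real_derivative
        c * (Suc i * expectation (\<lambda>\<omega>. (l \<omega>)\<^sup>2) ^ i * (2 * expectation (\<lambda>\<omega>. Y \<omega> * l \<omega>)))) (at 0)"
      using DERIV_cmult[OF DERIV_power_Suc[OF D[of 2], of i], of c] by (simp add: mult_ac)
    have "2 * Suc i * expectation (\<lambda>\<omega>. Y \<omega> * l \<omega> ^ (2 * Suc i - 1)) =
        c * (Suc i * expectation (\<lambda>\<omega>. (l \<omega>)\<^sup>2) ^ i * (2 * expectation (\<lambda>\<omega>. Y \<omega> * l \<omega>)))"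
      using DERIV_unique[OF 1 2] by simp
    then have "2 * real (Suc i) * expectation (\<lambda>\<omega>. Y \<omega> * l \<omega> ^ k) =
        2 * real (Suc i) * (c * expectation (\<lambda>\<omega>. (l \<omega>)\<^sup>2) ^ i * expectation (\<lambda>\<omega>. Y \<omega> * l \<omega>))"
      by (simp add: i mult_ac)
    then have "expectation (\<lambda>\<omega>. Y \<omega> * l \<omega> ^ k) = 
        c * expectation (\<lambda>\<omega>. (l \<omega>)\<^sup>2) ^ i * expectation (\<lambda>\<omega>. Y \<omega> * l \<omega>)"
      by (simp del: of_nat_Suc)
    then show ?thesis
      using linear_forms_moments(1)[OF l, of i] by (simp add: i c c'_def mult_ac)
  qed
qed

text \<open>Polynomials in linear forms, paired with their derivative in the direction belonging to
  Y, in which a linear form l has the constant derivative E(Y l). A relation instead of a function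
  avoids showing that the derivative does not depend on how the polynomial is written.\<close>

inductive derivation :: "('a \<Rightarrow> real) \<Rightarrow> ('a \<Rightarrow> real) \<Rightarrow> ('a \<Rightarrow> real) \<Rightarrow> bool" for Y where
  const: "derivation Y (\<lambda>_. c) (\<lambda>_. 0)"
| add: "derivation Y g g' \<Longrightarrow> derivation Y h h' \<Longrightarrow> derivation Y (\<lambda>\<omega>. g \<omega> + h \<omega>) (\<lambda>\<omega>. g' \<omega> + h' \<omega>)"
| lin: "l \<in> linear_forms \<Longrightarrow> derivation Y g g' \<Longrightarrow>
     derivation Y (\<lambda>\<omega>. l \<omega> * g \<omega>) (\<lambda>\<omega>. expectation (\<lambda>\<omega>. Y \<omega> * l \<omega>) * g \<omega> + l \<omega> * g' \<omega>)"

lemma derivation_all_moments: "derivation Y g g' \<Longrightarrow> all_moments M g \<and> all_moments M g'"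
  by (induction rule: derivation.induct)
     (auto intro!: all_moments_intros intro: linear_forms_all_moments)

(* The extra factor l ^ k lets the induction hypothesis be applied to l + s * x for all real s;
   the derivative at s = 0 then gives the claim for the additional factor x. *)
lemma stein_derivation_power:
  assumes Y: "Y \<in> linear_forms" and "derivation Y g g'" "l \<in> linear_forms"
  shows "expectation (\<lambda>\<omega>. Y \<omega> * g \<omega> * l \<omega> ^ k) = expectation (\<lambda>\<omega>. g' \<omega> * l \<omega> ^ k) +
     k * expectation (\<lambda>\<omega>. Y \<omega> * l \<omega>) * expectation (\<lambda>\<omega>. g \<omega> * l \<omega> ^ (k - 1))"
  using assms(2,3)
proof (induction arbitrary: k l)
  case (const c)
  have "expectation (\<lambda>\<omega>. Y \<omega> * c * l \<omega> ^ k) = c * expectation (\<lambda>\<omega>. Y \<omega> * l \<omega> ^ k)"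
    by (subst integral_mult_right_zero[symmetric]) (simp add: mult_ac)
  then show ?case using stein_power[OF Y const, of k] by simp
next
  case (add g g' h h')
  note mom = derivation_all_moments[OF add.hyps(1)] derivation_all_moments[OF add.hyps(2)]
    linear_forms_all_moments[OF Y] linear_forms_all_moments[OF add.prems]
  have "expectation (\<lambda>\<omega>. Y \<omega> * (g \<omega> + h \<omega>) * l \<omega> ^ k) =
      expectation (\<lambda>\<omega>. Y \<omega> * g \<omega> * l \<omega> ^ k) + expectation (\<lambda>\<omega>. Y \<omega> * h \<omega> * l \<omega> ^ k)"
    by (subst Bochner_Integration.integral_add[symmetric])
       (use mom in \<open>auto simp: algebra_simps intro!: all_moments_integrable all_moments_intros\<close>)
  moreover have "expectation (\<lambda>\<omega>. (g' \<omega> + h' \<omega>) * l \<omega> ^ k) =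
      expectation (\<lambda>\<omega>. g' \<omega> * l \<omega> ^ k) + expectation (\<lambda>\<omega>. h' \<omega> * l \<omega> ^ k)"
    by (subst Bochner_Integration.integral_add[symmetric])
       (use mom in \<open>auto simp: algebra_simps intro!: all_moments_integrable all_moments_intros\<close>)
  moreover have "expectation (\<lambda>\<omega>. (g \<omega> + h \<omega>) * l \<omega> ^ (k - 1)) =
      expectation (\<lambda>\<omega>. g \<omega> * l \<omega> ^ (k - 1)) + expectation (\<lambda>\<omega>. h \<omega> * l \<omega> ^ (k - 1))"
    by (subst Bochner_Integration.integral_add[symmetric])
       (use mom in \<open>auto simp: algebra_simps intro!: all_moments_integrable all_moments_intros\<close>)
  ultimately show ?case
    using add.IH(1)[OF add.prems, of k] add.IH(2)[OF add.prems, of k] by (simp add: algebra_simps)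
next
  case (lin x g g')
  let ?l = "\<lambda>s \<omega>. l \<omega> + s * x \<omega>" and ?E = expectation
  note mom = derivation_all_moments[OF lin.hyps(2), THEN conjunct1] derivation_all_moments[OF lin.hyps(2), THEN conjunct2]
    linear_forms_all_moments[OF Y] linear_forms_all_moments[OF lin.prems] linear_forms_all_moments[OF lin.hyps(1)]
  define p where "p = ?E (\<lambda>\<omega>. Y \<omega> * l \<omega>)"
  define q where "q = ?E (\<lambda>\<omega>. Y \<omega> * x \<omega>)"
  have pq: "?E (\<lambda>\<omega>. Y \<omega> * ?l s \<omega>) = p + s * q" for s
  proof -
    have "?E (\<lambda>\<omega>. Y \<omega> * ?l s \<omega>) = ?E (\<lambda>\<omega>. Y \<omega> * l \<omega> + s * (Y \<omega> * x \<omega>))"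
      by (simp add: algebra_simps)
    also have "\<dots> = p + s * q"
      unfolding p_def q_def by (subst Bochner_Integration.integral_add)
        (use mom in \<open>auto intro!: all_moments_integrable all_moments_intros\<close>)
    finally show ?thesis .
  qed
  \<comment> \<open>The induction hypothesis is taken with exponent k + 1, since differentiation at
    s = 0 lowers the exponent by one; the resulting factor k + 1 is cancelled below.\<close>
  have eq: "(\<lambda>s. ?E (\<lambda>\<omega>. (Y \<omega> * g \<omega>) * ?l s \<omega> ^ (k + 1))) =
      (\<lambda>s. ?E (\<lambda>\<omega>. g' \<omega> * ?l s \<omega> ^ (k + 1)) + (k + 1) * (p + s * q) * ?E (\<lambda>\<omega>. g \<omega> * ?l s \<omega> ^ k))"
    by (rule ext, subst lin.IH[OF linear_forms_combine[OF lin.prems lin.hyps(1)]]) (simp add: pq)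
  have D1: "((\<lambda>s. ?E (\<lambda>\<omega>. (Y \<omega> * g \<omega>) * ?l s \<omega> ^ (k + 1))) has_real_derivative
      (k + 1) * ?E (\<lambda>\<omega>. Y \<omega> * g \<omega> * x \<omega> * l \<omega> ^ k)) (at 0)"
    using moment_has_derivative[OF all_moments_mult[OF mom(3,1)] mom(4,5), of "k + 1"] by simp
  have D2: "((\<lambda>s. ?E (\<lambda>\<omega>. g' \<omega> * ?l s \<omega> ^ (k + 1)) + (k + 1) * (p + s * q) * ?E (\<lambda>\<omega>. g \<omega> * ?l s \<omega> ^ k)) has_real_derivative
      (k + 1) * ?E (\<lambda>\<omega>. g' \<omega> * x \<omega> * l \<omega> ^ k) +
       (k + 1) * (q * ?E (\<lambda>\<omega>. g \<omega> * l \<omega> ^ k) + p * (k * ?E (\<lambda>\<omega>. g \<omega> * x \<omega> * l \<omega> ^ (k - 1))))) (at 0)"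
    using moment_has_derivative[OF mom(2,4,5), of "k + 1"] moment_has_derivative[OF mom(1,4,5), of k]
    by (auto intro!: derivative_eq_intros simp: algebra_simps)
  have "(k + 1) * ?E (\<lambda>\<omega>. Y \<omega> * g \<omega> * x \<omega> * l \<omega> ^ k) = 
      (k + 1) * ?E (\<lambda>\<omega>. g' \<omega> * x \<omega> * l \<omega> ^ k) +
       (k + 1) * (q * ?E (\<lambda>\<omega>. g \<omega> * l \<omega> ^ k) + p * (k * ?E (\<lambda>\<omega>. g \<omega> * x \<omega> * l \<omega> ^ (k - 1))))"
    using DERIV_unique[OF D1 D2[folded eq]] .
  then have "(k + 1) * ?E (\<lambda>\<omega>. Y \<omega> * g \<omega> * x \<omega> * l \<omega> ^ k) = 
      (k + 1) * (?E (\<lambda>\<omega>. g' \<omega> * x \<omega> * l \<omega> ^ k) +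
       (q * ?E (\<lambda>\<omega>. g \<omega> * l \<omega> ^ k) + p * (k * ?E (\<lambda>\<omega>. g \<omega> * x \<omega> * l \<omega> ^ (k - 1)))))"
    by (simp only: distrib_left)
  then have "?E (\<lambda>\<omega>. Y \<omega> * g \<omega> * x \<omega> * l \<omega> ^ k) = 
      ?E (\<lambda>\<omega>. g' \<omega> * x \<omega> * l \<omega> ^ k) +
       (q * ?E (\<lambda>\<omega>. g \<omega> * l \<omega> ^ k) + p * (k * ?E (\<lambda>\<omega>. g \<omega> * x \<omega> * l \<omega> ^ (k - 1))))"
    by (subst (asm) mult_cancel_left) linarith
  moreover have "?E (\<lambda>\<omega>. (q * g \<omega> + x \<omega> * g' \<omega>) * l \<omega> ^ k) =
      q * ?E (\<lambda>\<omega>. g \<omega> * l \<omega> ^ k) + ?E (\<lambda>\<omega>. g' \<omega> * x \<omega> * l \<omega> ^ k)"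
  proof -
    have "?E (\<lambda>\<omega>. (q * g \<omega> + x \<omega> * g' \<omega>) * l \<omega> ^ k) = ?E (\<lambda>\<omega>. q * (g \<omega> * l \<omega> ^ k) + g' \<omega> * x \<omega> * l \<omega> ^ k)"
      by (simp add: algebra_simps)
    also have "\<dots> = q * ?E (\<lambda>\<omega>. g \<omega> * l \<omega> ^ k) + ?E (\<lambda>\<omega>. g' \<omega> * x \<omega> * l \<omega> ^ k)"
      by (subst Bochner_Integration.integral_add)
        (use mom in \<open>auto intro!: all_moments_integrable all_moments_intros\<close>)
    finally show ?thesis .
  qed
  ultimately show ?case
    by (simp add: p_def q_def mult_ac)
qed

lemma stein:
  assumes "Y \<in> linear_forms" "derivation Y g g'"
  shows "expectation (\<lambda>\<omega>. Y \<omega> * g \<omega>) = expectation g'"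
  using stein_derivation_power[OF assms assms(1), of 0] by simp

lemma derivation_zero_ext: "derivation Y g g' \<Longrightarrow> g = h \<Longrightarrow> g' = h' \<Longrightarrow> derivation Y h h'"
  by simp

text \<open>The constructors multiply by linear forms only. The product rule for two polynomials
  follows by induction on the first, with an inner induction on the second when the first is
  constant.\<close>

lemma derivation_mult:
  assumes "derivation Y g g'" "derivation Y h h'"
  shows "derivation Y (\<lambda>\<omega>. g \<omega> * h \<omega>) (\<lambda>\<omega>. g' \<omega> * h \<omega> + g \<omega> * h' \<omega>)"
  using assms(1)
proof induction
  case (const c)
  show ?case
    using assms(2)
  proof induction
    case (const d)
    show ?case by (rule derivation_zero_ext[OF derivation.const[of Y "c * d"]]) auto
  next
    case (add g g' h h')
    show ?case by (rule derivation_zero_ext[OF derivation.add[OF add.IH]]) (auto simp: algebra_simps)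
  next
    case (lin l g g')
    show ?case by (rule derivation_zero_ext[OF derivation.lin[OF lin.hyps(1) lin.IH]]) (auto simp: algebra_simps)
  qed
next
  case (add g g' k k')
  show ?case by (rule derivation_zero_ext[OF derivation.add[OF add.IH]]) (auto simp: algebra_simps)
next
  case (lin l g g')
  show ?case by (rule derivation_zero_ext[OF derivation.lin[OF lin.hyps(1) lin.IH]]) (auto simp: algebra_simps)
qed

lemma derivation_linear:
  assumes "l \<in> linear_forms"
  shows "derivation Y l (\<lambda>_. expectation (\<lambda>\<omega>. Y \<omega> * l \<omega>))"
  by (rule derivation_zero_ext[OF derivation.lin[OF assms derivation.const[of Y 1]]]) auto

lemma derivation_power:
  assumes "derivation Y g g'"
  shows "derivation Y (\<lambda>\<omega>. g \<omega> ^ k) (\<lambda>\<omega>. k * g \<omega> ^ (k - 1) * g' \<omega>)"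
proof (induction k)
  case 0
  show ?case by (rule derivation_zero_ext[OF derivation.const[of Y 1]]) auto
next
  case (Suc k)
  show ?case
    by (rule derivation_zero_ext[OF derivation_mult[OF assms Suc]])
       (auto simp: algebra_simps fun_eq_iff power_eq_if)
qed

lemma derivation_sum:
  assumes "\<And>i. i \<in> I \<Longrightarrow> derivation Y (g i) (g' i)"
  shows "derivation Y (\<lambda>\<omega>. \<Sum>i\<in>I. g i \<omega>) (\<lambda>\<omega>. \<Sum>i\<in>I. g' i \<omega>)"
  using assms
  by (induction I rule: infinite_finite_induct) (auto intro: derivation.intros)

end

text \<open>Convexity of the power: with m the mean of the \<open>x i\<close>, Bernoulli's
  inequality is the tangent bound for (x i / m)^p at 1, and in the sum over i the linear terms
  cancel.\<close>

lemma power_sum_le: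
  fixes x :: "'b \<Rightarrow> real"
  assumes "finite I" "\<And>i. i \<in> I \<Longrightarrow> 0 \<le> x i" "p > 0"
  shows "(\<Sum>i\<in>I. x i) ^ p \<le> real (card I) ^ (p - 1) * (\<Sum>i\<in>I. x i ^ p)"
proof (cases "(\<Sum>i\<in>I. x i) = 0")
  case True
  then show ?thesis
    using assms by (auto simp: zero_power intro!: mult_nonneg_nonneg sum_nonneg)
next
  case False
  define m where "m = (\<Sum>i\<in>I. x i) / card I"
  have "I \<noteq> {}" using False by auto
  then have c: "card I > 0" using assms by (simp add: card_gt_0_iff)
  have "(\<Sum>i\<in>I. x i) \<ge> 0" using assms by (intro sum_nonneg) auto
  then have m: "m > 0" using False c by (simp add: m_def)
  have "m ^ p * (1 + p * (x i / m - 1)) \<le> x i ^ p" if "i \<in> I" for i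
  proof -
    have "-1 \<le> x i / m - 1" using assms(2)[OF that] m by simp
    from Bernoulli_inequality[OF this, of p] have "1 + p * (x i / m - 1) \<le> (x i / m) ^ p" by simp
    then have "m ^ p * (1 + p * (x i / m - 1)) \<le> m ^ p * (x i / m) ^ p"
      using m by (intro mult_left_mono) auto
    then show ?thesis using m by (simp add: power_divide)
  qed
  then have "(\<Sum>i\<in>I. m ^ p * (1 + p * (x i / m - 1))) \<le> (\<Sum>i\<in>I. x i ^ p)"
    by (rule sum_mono)
  also have "(\<Sum>i\<in>I. m ^ p * (1 + p * (x i / m - 1))) = m ^ p * (card I + p * ((\<Sum>i\<in>I. x i) / m - card I))"
    by (simp add: sum_distrib_left[symmetric] sum.distrib sum_subtractf sum_divide_distrib)
  also have "(\<Sum>i\<in>I. x i) / m = card I" using m c False by (simp add: m_def)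
  finally have "real (card I) ^ (p - 1) * (m ^ p * card I) \<le> real (card I) ^ (p - 1) * (\<Sum>i\<in>I. x i ^ p)"
    by (intro mult_left_mono) auto
  also have "real (card I) ^ (p - 1) * (m ^ p * card I) = (m * card I) ^ p"
    using assms(3) by (cases p) (simp_all add: power_mult_distrib mult_ac)
  also have "m * card I = (\<Sum>i\<in>I. x i)" using c by (simp add: m_def)
  finally show ?thesis .
qed

lemma abs_mult_le_squares: "\<bar>x * y\<bar> \<le> (x\<^sup>2 + y\<^sup>2) / 2" for x y :: real
  using sum_squares_bound[of "\<bar>x\<bar>" "\<bar>y\<bar>"] by (simp add: abs_mult)

lemma norm_power_le_Re_Im:
  fixes z :: complex
  shows "cmod z ^ (2 * p) \<le> 2 ^ p * (Re z ^ (2 * p) + Im z ^ (2 * p))"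
proof -
  have *: "(x + y) ^ p \<le> 2 ^ p * (x ^ p + y ^ p)" if "0 \<le> x" "0 \<le> y" for x y :: real
  proof -
    have "(x + y) ^ p \<le> (2 * max x y) ^ p"
      using that by (intro power_mono) auto
    also have "\<dots> \<le> 2 ^ p * (x ^ p + y ^ p)"
      using that by (auto simp: power_mult_distrib max_def)
    finally show ?thesis .
  qed
  have "cmod z ^ (2 * p) = ((Re z)\<^sup>2 + (Im z)\<^sup>2) ^ p"
    by (simp add: power_mult cmod_power2)
  also have "\<dots> \<le> 2 ^ p * ((Re z)\<^sup>2 ^ p + (Im z)\<^sup>2 ^ p)" by (rule *) auto
  finally show ?thesis by (simp add: power_mult)
qed

context gaussian_family
begin

lemma measurable_X [measurable]: "X k \<in> borel_measurable M"
  using gauss by (auto simp: gaussian_sequence_def)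

lemma all_moments_X: "all_moments M (X k)"
  by (intro linear_forms_all_moments) simp

lemma covariance_eq: "expectation (\<lambda>\<omega>. X a \<omega> * X b \<omega>) = cov a b"
  by (simp add: covariance_fun_def)

lemma cov_commute: "cov a b = cov b a"
  by (simp add: covariance_fun_def mult.commute)

lemma derivation_X: "derivation (X a) (X b) (\<lambda>_. cov a b)"
  using derivation_linear[of "X b" "X a"] by (simp add: covariance_fun_def)

text \<open>Integration by parts on \<open>X a\<close> pairs it with each of the other three factors
  in turn.\<close>

lemma isserlis4:
  "expectation (\<lambda>\<omega>. X a \<omega> * X b \<omega> * (X c \<omega> * X d \<omega>)) =
     cov a b * cov c d + cov a c * cov b d + cov a d * cov b c"
proof -
  have "expectation (\<lambda>\<omega>. X a \<omega> * (X b \<omega> * (X c \<omega> * X d \<omega>))) =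
    expectation (\<lambda>\<omega>. cov a b * (X c \<omega> * X d \<omega>) + X b \<omega> * (cov a c * X d \<omega> + X c \<omega> * cov a d))"
    by (rule stein) (simp, intro derivation_mult derivation_X)
  also have "\<dots> = expectation (\<lambda>\<omega>. cov a b * (X c \<omega> * X d \<omega>) + cov a c * (X b \<omega> * X d \<omega>) + cov a d * (X b \<omega> * X c \<omega>))"
    by (simp add: algebra_simps)
  also have "\<dots> = cov a b * cov c d + cov a c * cov b d + cov a d * cov b c"
    by (subst Bochner_Integration.integral_add Bochner_Integration.integral_mult_right,
        (intro all_moments_integrable all_moments_intros all_moments_const all_moments_X)+)+
       (simp add: covariance_eq)
  finally show ?thesis by (simp add: mult_ac)
qed

text \<open>Centring removes the pairing inside each product; the two pairings that remain connect
  the products.\<close>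

lemma covariance_products:
  "expectation (\<lambda>\<omega>. (X a \<omega> * X b \<omega> - cov a b) * (X c \<omega> * X d \<omega> - cov c d)) =
     cov a c * cov b d + cov a d * cov b c"
proof -
  have int: "integrable M (\<lambda>\<omega>. X a \<omega> * X b \<omega> * (X c \<omega> * X d \<omega>))" "integrable M (\<lambda>\<omega>. X a \<omega> * X b \<omega>)" for a b c d
    by (intro all_moments_integrable all_moments_intros all_moments_const all_moments_X)+
  have "expectation (\<lambda>\<omega>. (X a \<omega> * X b \<omega> - cov a b) * (X c \<omega> * X d \<omega> - cov c d)) =
     expectation (\<lambda>\<omega>. X a \<omega> * X b \<omega> * (X c \<omega> * X d \<omega>) - cov c d * (X a \<omega> * X b \<omega>) - cov a b * (X c \<omega> * X d \<omega>) + cov a b * cov c d)"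
    by (simp add: algebra_simps)
  also have "\<dots> = expectation (\<lambda>\<omega>. X a \<omega> * X b \<omega> * (X c \<omega> * X d \<omega>)) - cov c d * cov a b - cov a b * cov c d + cov a b * cov c d"
    using int by (simp add: covariance_eq prob_space)
  finally show ?thesis by (simp add: isserlis4)
qed

lemma all_moments_quadratic:
  "all_moments M (\<lambda>\<omega>. \<Sum>t\<in>T. a t * ((X t \<omega>)\<^sup>2 - cov t t))"
  by (intro all_moments_intros all_moments_const all_moments_X)

end

text \<open>A uniform bound for the row sums is what a Schur test needs: the quadratic form with
  entries |cov t s| is at most \<Lambda> times the sum of squares. Stating it for finite sums spares
  every summability condition later.\<close>

locale gaussian_summable = gaussian_family +
  fixes \<Lambda> :: real
  assumes cov_row_sum: "finite S \<Longrightarrow> (\<Sum>s\<in>S. \<bar>cov t s\<bar>) \<le> \<Lambda>"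
begin

lemma Lambda_nonneg: "0 \<le> \<Lambda>"
  using cov_row_sum[of "{}"] by simp

lemma cov_le: "\<bar>cov s t\<bar> \<le> \<Lambda>"
  using cov_row_sum[of "{t}" s] by simp

lemma cov_diag_nonneg: "0 \<le> cov t t"
  by (simp add: covariance_fun_def)

text \<open>One factor Q of Q^(2 p) is written out and integrated by parts in one of the two factors
  of (X t)^2. Differentiating the other factor gives a term that cancels against the centring;
  differentiating the remaining power of Q leaves a quadratic form in the a_t X_t.\<close>

lemma quadratic_moment_step:
  fixes a :: "int \<Rightarrow> real"
  assumes T: "finite T" and p: "p > 0"
  defines "Q \<equiv> \<lambda>\<omega>. \<Sum>t\<in>T. a t * ((X t \<omega>)\<^sup>2 - cov t t)"
    and "V \<equiv> \<lambda>\<omega>. \<Sum>t\<in>T. (a t)\<^sup>2 * (X t \<omega>)\<^sup>2"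
  shows "expectation (\<lambda>\<omega>. Q \<omega> ^ (2 * p)) \<le> 2 * real (2 * p) * \<Lambda> * expectation (\<lambda>\<omega>. Q \<omega> ^ (2 * p - 2) * V \<omega>)"
proof -
  define m where "m = 2 * p - 1"
  have m: "2 * p = Suc m" "2 * p - 2 = m - 1" "odd m" "m > 0" using p by (auto simp: m_def)
  have Q: "all_moments M Q" and V: "all_moments M V"
    unfolding Q_def V_def by (intro all_moments_intros all_moments_const all_moments_X)+
  have dQ: "derivation (X t) Q (\<lambda>\<omega>. \<Sum>s\<in>T. 2 * a s * cov t s * X s \<omega>)" for t
    unfolding Q_def
  proof (intro derivation_sum)
    fix s
    have "derivation (X t) (\<lambda>\<omega>. a s * ((X s \<omega>)\<^sup>2 + (- cov s s)))
       (\<lambda>\<omega>. 0 * ((X s \<omega>)\<^sup>2 + (- cov s s)) + a s * (real 2 * X s \<omega> ^ (2 - 1) * cov t s + 0))"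
      by (intro derivation_mult derivation.add derivation.const derivation_power derivation_X)
    then show "derivation (X t) (\<lambda>\<omega>. a s * ((X s \<omega>)\<^sup>2 - cov s s)) (\<lambda>\<omega>. 2 * a s * cov t s * X s \<omega>)"
      by (rule derivation_zero_ext) (auto simp: fun_eq_iff)
  qed
  have st: "expectation (\<lambda>\<omega>. (X t \<omega>)\<^sup>2 * Q \<omega> ^ m) = cov t t * expectation (\<lambda>\<omega>. Q \<omega> ^ m) +
      2 * m * expectation (\<lambda>\<omega>. Q \<omega> ^ (m - 1) * (\<Sum>s\<in>T. a s * cov t s * (X t \<omega> * X s \<omega>)))" for t
  proof -
    have "expectation (\<lambda>\<omega>. X t \<omega> * (X t \<omega> * Q \<omega> ^ m)) = expectation (\<lambda>\<omega>. cov t t * Q \<omega> ^ m +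
       X t \<omega> * (m * Q \<omega> ^ (m - 1) * (\<Sum>s\<in>T. 2 * a s * cov t s * X s \<omega>)))"
      by (intro stein derivation_mult derivation_X derivation_power dQ) simp
    also have "\<dots> = expectation (\<lambda>\<omega>. cov t t * Q \<omega> ^ m + 2 * m * (Q \<omega> ^ (m - 1) * (\<Sum>s\<in>T. a s * cov t s * (X t \<omega> * X s \<omega>))))"
      by (simp add: sum_distrib_left mult_ac)
    also have "\<dots> = cov t t * expectation (\<lambda>\<omega>. Q \<omega> ^ m) +
      2 * m * expectation (\<lambda>\<omega>. Q \<omega> ^ (m - 1) * (\<Sum>s\<in>T. a s * cov t s * (X t \<omega> * X s \<omega>)))"
      by (subst Bochner_Integration.integral_add)
         ((intro all_moments_integrable all_moments_intros all_moments_const all_moments_X Q)+, simp)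
    finally show ?thesis by (simp add: power2_eq_square mult_ac)
  qed
  have i1: "integrable M (\<lambda>\<omega>. (X t \<omega>)\<^sup>2 * Q \<omega> ^ m)" "integrable M (\<lambda>\<omega>. Q \<omega> ^ m)"
    "integrable M (\<lambda>\<omega>. Q \<omega> ^ (m - 1) * (\<Sum>s\<in>T. a s * cov t s * (X t \<omega> * X s \<omega>)))" for t
    by (intro all_moments_integrable all_moments_intros all_moments_const all_moments_X Q)+
  have i2: "integrable M (\<lambda>\<omega>. a t * (Q \<omega> ^ (m - 1) * (\<Sum>s\<in>T. a s * cov t s * (X t \<omega> * X s \<omega>))))" for t
    by (intro all_moments_integrable all_moments_intros all_moments_const all_moments_X Q)+
  have "expectation (\<lambda>\<omega>. Q \<omega> ^ (2 * p)) = expectation (\<lambda>\<omega>. \<Sum>t\<in>T. a t * ((X t \<omega>)\<^sup>2 * Q \<omega> ^ m - cov t t * Q \<omega> ^ m))"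
  proof (intro Bochner_Integration.integral_cong refl)
    fix \<omega>
    have "Q \<omega> ^ (2 * p) = Q \<omega> * Q \<omega> ^ m" by (simp add: m(1))
    also have "\<dots> = (\<Sum>t\<in>T. a t * ((X t \<omega>)\<^sup>2 - cov t t)) * Q \<omega> ^ m" by (simp only: Q_def)
    finally show "Q \<omega> ^ (2 * p) = (\<Sum>t\<in>T. a t * ((X t \<omega>)\<^sup>2 * Q \<omega> ^ m - cov t t * Q \<omega> ^ m))"
      by (simp add: sum_distrib_right left_diff_distrib mult.assoc)
  qed
  also have "\<dots> = (\<Sum>t\<in>T. a t * (expectation (\<lambda>\<omega>. (X t \<omega>)\<^sup>2 * Q \<omega> ^ m) - cov t t * expectation (\<lambda>\<omega>. Q \<omega> ^ m)))"
    using i1 by (subst Bochner_Integration.integral_sum) auto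
  also have "\<dots> = (\<Sum>t\<in>T. 2 * m * expectation (\<lambda>\<omega>. a t * (Q \<omega> ^ (m - 1) * (\<Sum>s\<in>T. a s * cov t s * (X t \<omega> * X s \<omega>)))))"
    by (intro sum.cong refl) (simp add: st del: of_nat_diff)
  also have "\<dots> = 2 * m * expectation (\<lambda>\<omega>. \<Sum>t\<in>T. a t * (Q \<omega> ^ (m - 1) * (\<Sum>s\<in>T. a s * cov t s * (X t \<omega> * X s \<omega>))))"
    by (subst Bochner_Integration.integral_sum[OF i2]) (rule sum_distrib_left[symmetric])
  also have "\<dots> \<le> 2 * m * expectation (\<lambda>\<omega>. \<Lambda> * (Q \<omega> ^ (m - 1) * V \<omega>))"
  proof (intro mult_left_mono integral_mono)
    fix \<omega>
    \<comment> \<open>Schur test: each product is split evenly between its row and its column, and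
      by symmetry of the covariance both halves give the same sum.\<close>
    have "(\<Sum>t\<in>T. a t * (\<Sum>s\<in>T. a s * cov t s * (X t \<omega> * X s \<omega>))) \<le> 
        (\<Sum>t\<in>T. \<Sum>s\<in>T. \<bar>cov t s\<bar> * ((a t * X t \<omega>)\<^sup>2 + (a s * X s \<omega>)\<^sup>2) / 2)"
      unfolding sum_distrib_left
    proof (intro sum_mono)
      fix t s
      have "a t * (a s * cov t s * (X t \<omega> * X s \<omega>)) \<le> \<bar>cov t s * ((a t * X t \<omega>) * (a s * X s \<omega>))\<bar>"
        by (intro order_trans[OF _ abs_ge_self]) (simp add: mult_ac)
      also have "\<dots> = \<bar>cov t s\<bar> * \<bar>(a t * X t \<omega>) * (a s * X s \<omega>)\<bar>" by (rule abs_mult)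
      also have "\<dots> \<le> \<bar>cov t s\<bar> * (((a t * X t \<omega>)\<^sup>2 + (a s * X s \<omega>)\<^sup>2) / 2)"
        by (intro mult_left_mono abs_mult_le_squares) simp
      finally show "a t * (a s * cov t s * (X t \<omega> * X s \<omega>)) \<le> \<bar>cov t s\<bar> * ((a t * X t \<omega>)\<^sup>2 + (a s * X s \<omega>)\<^sup>2) / 2" by simp
    qed
    also have "\<dots> = (\<Sum>t\<in>T. \<Sum>s\<in>T. \<bar>cov t s\<bar> * (a t * X t \<omega>)\<^sup>2) / 2 + (\<Sum>t\<in>T. \<Sum>s\<in>T. \<bar>cov t s\<bar> * (a s * X s \<omega>)\<^sup>2) / 2"
      by (simp add: sum_divide_distrib sum.distrib distrib_left add_divide_distrib)
    also have "(\<Sum>t\<in>T. \<Sum>s\<in>T. \<bar>cov t s\<bar> * (a s * X s \<omega>)\<^sup>2) = (\<Sum>t\<in>T. \<Sum>s\<in>T. \<bar>cov t s\<bar> * (a t * X t \<omega>)\<^sup>2)"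
      by (subst sum.swap) (simp add: cov_commute)
    also have "(\<Sum>t\<in>T. \<Sum>s\<in>T. \<bar>cov t s\<bar> * (a t * X t \<omega>)\<^sup>2) / 2 + (\<Sum>t\<in>T. \<Sum>s\<in>T. \<bar>cov t s\<bar> * (a t * X t \<omega>)\<^sup>2) / 2
       = (\<Sum>t\<in>T. (\<Sum>s\<in>T. \<bar>cov t s\<bar>) * (a t * X t \<omega>)\<^sup>2)"
      by (simp add: sum_distrib_right)
    also have "\<dots> \<le> (\<Sum>t\<in>T. \<Lambda> * (a t * X t \<omega>)\<^sup>2)"
      by (intro sum_mono mult_right_mono cov_row_sum T) simp
    also have "\<dots> = \<Lambda> * V \<omega>"
      by (simp add: V_def sum_distrib_left power_mult_distrib)
    finally have "Q \<omega> ^ (m - 1) * (\<Sum>t\<in>T. a t * (\<Sum>s\<in>T. a s * cov t s * (X t \<omega> * X s \<omega>))) \<le> Q \<omega> ^ (m - 1) * (\<Lambda> * V \<omega>)"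
      using m by (intro mult_left_mono) (auto intro!: zero_le_even_power)
    then show "(\<Sum>t\<in>T. a t * (Q \<omega> ^ (m - 1) * (\<Sum>s\<in>T. a s * cov t s * (X t \<omega> * X s \<omega>)))) \<le> \<Lambda> * (Q \<omega> ^ (m - 1) * V \<omega>)"
      by (simp add: sum_distrib_left mult_ac)
  qed (intro all_moments_integrable all_moments_intros all_moments_const all_moments_X Q V | simp)+
  also have "\<dots> = 2 * m * \<Lambda> * expectation (\<lambda>\<omega>. Q \<omega> ^ (2 * p - 2) * V \<omega>)"
    by (simp add: m)
  also have "\<dots> \<le> 2 * (2 * p) * \<Lambda> * expectation (\<lambda>\<omega>. Q \<omega> ^ (2 * p - 2) * V \<omega>)"
    using Lambda_nonneg m
    by (intro mult_right_mono Bochner_Integration.integral_nonneg mult_nonneg_nonneg)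
       (auto simp: m_def V_def intro!: sum_nonneg zero_le_even_power)
  finally show ?thesis by simp
qed

text \<open>Of the power (8 p \<Lambda>^2)^p, one part (8 p \<Lambda>)^p comes from the absorption
  step in \<open>quadratic_moment\<close>; the rest, \<Lambda>^p times the normal moment, bounds the
  moment of order 2 p of each \<open>X t\<close>.\<close>

definition moment_bound :: "nat \<Rightarrow> real" where
  "moment_bound p = (8 * real p * \<Lambda>\<^sup>2) ^ p * (fact (2 * p) / (2 ^ p * fact p))"

text \<open>Convexity of the p-th power reduces the sum to moments of single variables, which depend
  only on the variance \<open>cov t t\<close>, at most \<Lambda>.\<close>

lemma weighted_square_moment:
  assumes T: "finite T" and p: "p > 0" and a: "\<And>t. t \<in> T \<Longrightarrow> \<bar>a t\<bar> \<le> \<alpha>"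
  shows "expectation (\<lambda>\<omega>. (\<Sum>t\<in>T. (a t)\<^sup>2 * (X t \<omega>)\<^sup>2) ^ p) \<le>
    fact (2 * p) / (2 ^ p * fact p) * \<Lambda> ^ p * (\<alpha>\<^sup>2 * card T) ^ p"
proof -
  let ?c = "fact (2 * p) / (2 ^ p * fact p) :: real"
  have "expectation (\<lambda>\<omega>. (\<Sum>t\<in>T. (a t)\<^sup>2 * (X t \<omega>)\<^sup>2) ^ p) \<le>
    expectation (\<lambda>\<omega>. (\<alpha>\<^sup>2) ^ p * (real (card T) ^ (p - 1) * (\<Sum>t\<in>T. X t \<omega> ^ (2 * p))))"
  proof (intro integral_mono)
    fix \<omega>
    have "(\<Sum>t\<in>T. (a t)\<^sup>2 * (X t \<omega>)\<^sup>2) \<le> (\<Sum>t\<in>T. \<alpha>\<^sup>2 * (X t \<omega>)\<^sup>2)"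
    proof (intro sum_mono mult_right_mono)
      fix t assume "t \<in> T"
      from power_mono[OF a[OF this], of 2] show "(a t)\<^sup>2 \<le> \<alpha>\<^sup>2" by simp
    qed simp
    then have "(\<Sum>t\<in>T. (a t)\<^sup>2 * (X t \<omega>)\<^sup>2) ^ p \<le> (\<alpha>\<^sup>2 * (\<Sum>t\<in>T. (X t \<omega>)\<^sup>2)) ^ p"
      by (intro power_mono) (auto simp: sum_distrib_left intro!: sum_nonneg)
    also have "\<dots> \<le> (\<alpha>\<^sup>2) ^ p * (real (card T) ^ (p - 1) * (\<Sum>t\<in>T. ((X t \<omega>)\<^sup>2) ^ p))"
      unfolding power_mult_distrib by (intro mult_left_mono power_sum_le T p) auto
    finally show "(\<Sum>t\<in>T. (a t)\<^sup>2 * (X t \<omega>)\<^sup>2) ^ p \<le> (\<alpha>\<^sup>2) ^ p * (real (card T) ^ (p - 1) * (\<Sum>t\<in>T. X t \<omega> ^ (2 * p)))"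
      by (simp add: power_mult)
  qed (intro all_moments_integrable all_moments_intros all_moments_const all_moments_X)+
  also have "\<dots> = (\<alpha>\<^sup>2) ^ p * (real (card T) ^ (p - 1) * (\<Sum>t\<in>T. expectation (\<lambda>\<omega>. X t \<omega> ^ (2 * p))))"
    by (subst integral_mult_right_zero, subst integral_mult_right_zero, subst Bochner_Integration.integral_sum)
       (intro all_moments_integrable all_moments_intros all_moments_const all_moments_X refl)+
  also have "\<dots> \<le> (\<alpha>\<^sup>2) ^ p * (real (card T) ^ (p - 1) * (\<Sum>t\<in>T. ?c * \<Lambda> ^ p))"
  proof (intro mult_left_mono sum_mono)
    fix t
    have "expectation (\<lambda>\<omega>. (X t \<omega>)\<^sup>2) = cov t t"
      by (simp add: covariance_fun_def power2_eq_square)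
    then have "expectation (\<lambda>\<omega>. X t \<omega> ^ (2 * p)) = ?c * cov t t ^ p"
      using linear_forms_moments(1)[OF linear_forms_X[of t], of p] by simp
    also have "\<dots> \<le> ?c * \<Lambda> ^ p"
      using cov_le[of t t] cov_diag_nonneg[of t] by (intro mult_left_mono power_mono) auto
    finally show "expectation (\<lambda>\<omega>. X t \<omega> ^ (2 * p)) \<le> ?c * \<Lambda> ^ p" .
  qed auto
  also have "\<dots> = ?c * \<Lambda> ^ p * (\<alpha>\<^sup>2 * card T) ^ p"
    using p by (cases p) (simp_all add: power_mult_distrib mult_ac)
  finally show ?thesis .
qed

lemma quadratic_moment:
  assumes T: "finite T" and p: "p > 0" and a: "\<And>t. t \<in> T \<Longrightarrow> \<bar>a t\<bar> \<le> \<alpha>"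
  shows "expectation (\<lambda>\<omega>. (\<Sum>t\<in>T. a t * ((X t \<omega>)\<^sup>2 - cov t t)) ^ (2 * p)) \<le> moment_bound p * (\<alpha>\<^sup>2 * card T) ^ p"
proof -
  define Q where "Q \<omega> = (\<Sum>t\<in>T. a t * ((X t \<omega>)\<^sup>2 - cov t t))" for \<omega>
  define V where "V \<omega> = (\<Sum>t\<in>T. (a t)\<^sup>2 * (X t \<omega>)\<^sup>2)" for \<omega>
  \<comment> \<open>Twice the factor 4 p \<Lambda> of \<open>quadratic_moment_step\<close>: the
    inequality \<open>young\<close> then returns half of the left-hand side, which can be absorbed
    because it is finite.\<close>
  define K where "K = 8 * p * \<Lambda>"
  have K: "0 \<le> K" using Lambda_nonneg by (simp add: K_def)
  have Q: "all_moments M Q" and V: "all_moments M V"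
    unfolding Q_def V_def by (intro all_moments_intros all_moments_const all_moments_X)+
  have V0: "0 \<le> V \<omega>" for \<omega> unfolding V_def by (intro sum_nonneg) auto
  \<comment> \<open>Either K V <= Q^2, and K V is replaced by Q^2, or Q^2 < K V, and every factor
    Q^2 is replaced by K V.\<close>
  have young: "(K / 2) * (Q \<omega> ^ (2 * p - 2) * V \<omega>) \<le> Q \<omega> ^ (2 * p) / 2 + K ^ p * V \<omega> ^ p / 2" for \<omega>
  proof -
    have e: "Q \<omega> ^ (2 * p - 2) = ((Q \<omega>)\<^sup>2) ^ (p - 1)"
      unfolding power_mult[symmetric] using p by (simp add: diff_mult_distrib2)
    have e2: "Q \<omega> ^ (2 * p) = ((Q \<omega>)\<^sup>2) ^ (p - 1) * (Q \<omega>)\<^sup>2"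
      using p by (cases p) (simp_all add: power_mult power_Suc2 power_add power2_eq_square)
    show ?thesis
    proof (cases "K * V \<omega> \<le> (Q \<omega>)\<^sup>2")
      case True
      then have "((Q \<omega>)\<^sup>2) ^ (p - 1) * (K * V \<omega>) \<le> ((Q \<omega>)\<^sup>2) ^ (p - 1) * (Q \<omega>)\<^sup>2"
        by (intro mult_left_mono) auto
      moreover have "0 \<le> K ^ p * V \<omega> ^ p" using K V0 by simp
      ultimately show ?thesis unfolding e e2 by (simp add: mult_ac)
    next
      case False
      then have "((Q \<omega>)\<^sup>2) ^ (p - 1) * (K * V \<omega>) \<le> (K * V \<omega>) ^ (p - 1) * (K * V \<omega>)"
        using K V0 by (intro mult_right_mono power_mono) auto
      also have "\<dots> = K ^ p * V \<omega> ^ p" using p by (cases p) (simp_all add: power_mult_distrib mult_ac)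
      finally have "((Q \<omega>)\<^sup>2) ^ (p - 1) * (K * V \<omega>) \<le> K ^ p * V \<omega> ^ p" .
      moreover have "0 \<le> Q \<omega> ^ (2 * p)" by simp
      ultimately show ?thesis unfolding e by (simp add: mult_ac)
    qed
  qed
  have ints: "integrable M (\<lambda>\<omega>. (K / 2) * (Q \<omega> ^ (2 * p - 2) * V \<omega>))" "integrable M (\<lambda>\<omega>. Q \<omega> ^ (2 * p))"
    "integrable M (\<lambda>\<omega>. K ^ p * V \<omega> ^ p)"
    by (intro all_moments_integrable all_moments_intros all_moments_const Q V)+
  have "expectation (\<lambda>\<omega>. Q \<omega> ^ (2 * p)) \<le> K / 2 * expectation (\<lambda>\<omega>. Q \<omega> ^ (2 * p - 2) * V \<omega>)"
    using quadratic_moment_step[OF T p, of a] by (simp add: Q_def V_def K_def mult_ac)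
  also have "\<dots> = expectation (\<lambda>\<omega>. (K / 2) * (Q \<omega> ^ (2 * p - 2) * V \<omega>))" by simp
  also have "\<dots> \<le> expectation (\<lambda>\<omega>. Q \<omega> ^ (2 * p) / 2 + K ^ p * V \<omega> ^ p / 2)"
    by (intro integral_mono young Bochner_Integration.integrable_add integrable_divide ints)
  also have "\<dots> = expectation (\<lambda>\<omega>. Q \<omega> ^ (2 * p)) / 2 + K ^ p * expectation (\<lambda>\<omega>. V \<omega> ^ p) / 2"
    by (subst Bochner_Integration.integral_add) (intro integrable_divide ints | simp)+
  finally have "expectation (\<lambda>\<omega>. Q \<omega> ^ (2 * p)) \<le> K ^ p * expectation (\<lambda>\<omega>. V \<omega> ^ p)"
    by simp
  also have "\<dots> \<le> K ^ p * (fact (2 * p) / (2 ^ p * fact p) * \<Lambda> ^ p * (\<alpha>\<^sup>2 * card T) ^ p)"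
    unfolding V_def using K by (intro mult_left_mono weighted_square_moment T p a) auto
  also have "\<dots> = moment_bound p * (\<alpha>\<^sup>2 * card T) ^ p"
    by (simp add: moment_bound_def K_def power_mult_distrib power2_eq_square)
  finally show ?thesis by (simp add: Q_def)
qed

text \<open>The factor 2^(p + 1) consists of 2^p from splitting the modulus into real and imaginary
  part and of 2 from adding their two moments.\<close>

lemma quadratic_moment_complex:
  fixes z :: "int \<Rightarrow> complex"
  assumes T: "finite T" and p: "p > 0" and z: "\<And>t. t \<in> T \<Longrightarrow> cmod (z t) \<le> \<alpha>"
  shows "integrable M (\<lambda>\<omega>. cmod (\<Sum>t\<in>T. z t * of_real ((X t \<omega>)\<^sup>2 - cov t t)) ^ (2 * p))"
    and "expectation (\<lambda>\<omega>. cmod (\<Sum>t\<in>T. z t * of_real ((X t \<omega>)\<^sup>2 - cov t t)) ^ (2 * p))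
      \<le> 2 ^ Suc p * moment_bound p * (\<alpha>\<^sup>2 * card T) ^ p"
proof -
  define Q where "Q a \<omega> = (\<Sum>t\<in>T. a t * ((X t \<omega>)\<^sup>2 - cov t t))" for a \<omega>
  define D where "D \<omega> = (\<Sum>t\<in>T. z t * of_real ((X t \<omega>)\<^sup>2 - cov t t))" for \<omega>
  have RI: "Re (D \<omega>) = Q (\<lambda>t. Re (z t)) \<omega>" "Im (D \<omega>) = Q (\<lambda>t. Im (z t)) \<omega>" for \<omega>
    by (simp_all add: D_def Q_def)
  have Q: "all_moments M (Q a)" for a
    unfolding Q_def by (rule all_moments_quadratic)
  have int: "integrable M (\<lambda>\<omega>. Q a \<omega> ^ k)" for a k
    by (intro all_moments_integrable all_moments_intros Q)
  have b: "expectation (\<lambda>\<omega>. Q (\<lambda>t. Re (z t)) \<omega> ^ (2 * p)) \<le> moment_bound p * (\<alpha>\<^sup>2 * card T) ^ p"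
    "expectation (\<lambda>\<omega>. Q (\<lambda>t. Im (z t)) \<omega> ^ (2 * p)) \<le> moment_bound p * (\<alpha>\<^sup>2 * card T) ^ p"
    unfolding Q_def using z
    by (auto intro!: quadratic_moment T p intro: order_trans[OF abs_Re_le_cmod] order_trans[OF abs_Im_le_cmod])
  have le: "cmod (D \<omega>) ^ (2 * p) \<le> 2 ^ p * (Q (\<lambda>t. Re (z t)) \<omega> ^ (2 * p) + Q (\<lambda>t. Im (z t)) \<omega> ^ (2 * p))" for \<omega>
    using norm_power_le_Re_Im[of "D \<omega>" p] by (simp add: RI)
  have [measurable]: "D \<in> borel_measurable M" unfolding D_def by measurable
  show int2: "integrable M (\<lambda>\<omega>. cmod (\<Sum>t\<in>T. z t * of_real ((X t \<omega>)\<^sup>2 - cov t t)) ^ (2 * p))"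
    unfolding D_def[symmetric]
    by (rule Bochner_Integration.integrable_bound[where f = "\<lambda>\<omega>. 2 ^ p * (Q (\<lambda>t. Re (z t)) \<omega> ^ (2 * p) + Q (\<lambda>t. Im (z t)) \<omega> ^ (2 * p))"])
       (use int in \<open>auto intro!: AE_I2 order_trans[OF le] mult_left_mono\<close>)
  have "expectation (\<lambda>\<omega>. cmod (D \<omega>) ^ (2 * p)) \<le>
      expectation (\<lambda>\<omega>. 2 ^ p * (Q (\<lambda>t. Re (z t)) \<omega> ^ (2 * p) + Q (\<lambda>t. Im (z t)) \<omega> ^ (2 * p)))"
    using int2[folded D_def] int le by (intro integral_mono) auto
  also have "\<dots> = 2 ^ p * (expectation (\<lambda>\<omega>. Q (\<lambda>t. Re (z t)) \<omega> ^ (2 * p)) + expectation (\<lambda>\<omega>. Q (\<lambda>t. Im (z t)) \<omega> ^ (2 * p)))"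
    using int by simp
  also have "\<dots> \<le> 2 ^ p * (moment_bound p * (\<alpha>\<^sup>2 * card T) ^ p + moment_bound p * (\<alpha>\<^sup>2 * card T) ^ p)"
    by (intro mult_left_mono add_mono b) auto
  finally show "expectation (\<lambda>\<omega>. cmod (\<Sum>t\<in>T. z t * of_real ((X t \<omega>)\<^sup>2 - cov t t)) ^ (2 * p))
      \<le> 2 ^ Suc p * moment_bound p * (\<alpha>\<^sup>2 * card T) ^ p"
    by (simp add: D_def)
qed

end

section \<open>The Dirichlet kernel\<close>

text \<open>As a cosine sum the kernel has no exceptional points at the multiples of 2 pi; its
  closed form is stated without division in \<open>sin_mult_dirichlet\<close>.\<close>

definition dirichlet :: "nat \<Rightarrow> real \<Rightarrow> real" where
  "dirichlet h x = (\<Sum>t = - int h..int h. cos (of_int t * x))"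

text \<open>The value at 0 is a separate hypothesis because in a general abelian group g 0 = - g 0
  does not imply g 0 = 0.\<close>

lemma sum_symmetric_odd:
  fixes g :: "int \<Rightarrow> 'b::{ab_group_add}"
  assumes "\<And>t. g (- t) = - g t" "g 0 = 0"
  shows "(\<Sum>t = - int h..int h. g t) = 0"
proof (induction h)
  case (Suc h)
  have "{- int (Suc h)..int (Suc h)} = insert (- int (Suc h)) (insert (int (Suc h)) {- int h..int h})"
    by auto
  moreover have "g (- 1 - int h) = - g (1 + int h)"
    using assms(1)[of "1 + int h"] by (simp add: algebra_simps)
  ultimately show ?case using Suc by simp
qed (simp add: assms)

lemma sum_cis_eq_dirichlet:
  "(\<Sum>t = - int h..int h. cis (of_int t * x)) = of_real (dirichlet h x)"
proof -
  have "(\<Sum>t = - int h..int h. complex_of_real (sin (of_int t * x))) = 0"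
    by (rule sum_symmetric_odd) auto
  then have "(\<Sum>t = - int h..int h. complex_of_real (cos (of_int t * x)) + \<i> * of_real (sin (of_int t * x))) = of_real (dirichlet h x)"
    by (simp add: sum.distrib dirichlet_def flip: sum_distrib_left)
  moreover have "cis y = of_real (cos y) + \<i> * of_real (sin y)" for y
    by (simp add: complex_eq_iff)
  ultimately show ?thesis by simp
qed

lemma dirichlet_Suc: "dirichlet (Suc h) x = dirichlet h x + 2 * cos ((real h + 1) * x)"
proof -
  have "{- int (Suc h)..int (Suc h)} = insert (- int (Suc h)) (insert (int (Suc h)) {- int h..int h})"
    by auto
  then show ?thesis
    unfolding dirichlet_def by (simp add: algebra_simps) (simp add: cos_add cos_diff)
qed

lemma sin_mult_dirichlet: "sin (x / 2) * dirichlet h x = sin ((2 * real h + 1) * (x / 2))"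
proof (induction h)
  case 0
  then show ?case by (simp add: dirichlet_def)
next
  case (Suc h)
  have "2 * sin (x / 2) * cos ((real h + 1) * x) = sin ((2 * real (Suc h) + 1) * (x / 2)) - sin ((2 * real h + 1) * (x / 2))"
  proof -
    have 1: "(2 * real (Suc h) + 1) * (x / 2) = (real h + 1) * x + x / 2"
      by (simp add: field_simps)
    have 2: "(2 * real h + 1) * (x / 2) = (real h + 1) * x - x / 2"
      by (simp add: field_simps)
    show ?thesis unfolding 1 2 by (simp add: sin_add sin_diff)
  qed
  then show ?case using Suc by (simp add: dirichlet_Suc distrib_left mult_ac)
qed

lemma abs_dirichlet_le: "\<bar>dirichlet h x\<bar> \<le> 2 * real h + 1"
proof -
  have "\<bar>dirichlet h x\<bar> \<le> (\<Sum>t = - int h..int h. \<bar>cos (of_int t * x)\<bar>)"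
    unfolding dirichlet_def by (rule sum_abs)
  also have "\<dots> \<le> (\<Sum>t = - int h..int h. 1)"
    by (intro sum_mono) simp
  finally show ?thesis by simp
qed

lemma dirichlet_0: "dirichlet h 0 = 2 * real h + 1"
  by (simp add: dirichlet_def)

lemma abs_dirichlet_mult_sin_le: "\<bar>dirichlet h x\<bar> * \<bar>sin (x / 2)\<bar> \<le> 1"
  using sin_mult_dirichlet[of x h] by (metis abs_mult abs_sin_le_one mult.commute)

text \<open>By concavity the sine lies above its chord between 0 and pi / 2.\<close>

lemma jordan_inequality:
  fixes x :: real
  assumes "0 \<le> x" "x \<le> pi / 2"
  shows "2 * x / pi \<le> sin x"
proof -
  have "convex_on {0..pi / 2} (\<lambda>x. - sin x)"
    by (rule f''_ge0_imp_convex[where f' = "\<lambda>x. - cos x" and f'' = sin])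
       (auto intro!: derivative_eq_intros sin_ge_zero)
  from convex_onD_Icc'[OF this, of x] have "- sin x \<le> (- 1) / (pi / 2) * x"
    using assms by auto
  then show ?thesis by simp
qed

lemma abs_sin_half_ge:
  assumes "\<bar>x\<bar> \<le> pi"
  shows "\<bar>x\<bar> / pi \<le> \<bar>sin (x / 2)\<bar>"
proof -
  have "2 * (\<bar>x\<bar> / 2) / pi \<le> sin (\<bar>x\<bar> / 2)"
    using assms by (intro jordan_inequality) auto
  also have "\<dots> \<le> \<bar>sin (x / 2)\<bar>" by (cases "x \<ge> 0") auto
  finally show ?thesis by simp
qed

lemma abs_dirichlet_mult_le:
  assumes "\<bar>x\<bar> \<le> pi"
  shows "\<bar>x\<bar> * \<bar>dirichlet h x\<bar> \<le> pi"
proof -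
  have "\<bar>x\<bar> / pi * \<bar>dirichlet h x\<bar> \<le> \<bar>sin (x / 2)\<bar> * \<bar>dirichlet h x\<bar>"
    by (intro mult_right_mono abs_sin_half_ge assms) simp
  also have "\<dots> \<le> 1" using abs_dirichlet_mult_sin_le[of h x] by (simp add: mult.commute)
  finally show ?thesis by (simp add: field_simps)
qed

lemma continuous_on_dirichlet [continuous_intros]:
  fixes f :: "real \<Rightarrow> real"
  shows "continuous_on S f \<Longrightarrow> continuous_on S (\<lambda>x. dirichlet h (f x))"
  unfolding dirichlet_def by (auto intro!: continuous_intros)

lemma dirichlet_minus: "dirichlet h (- x) = dirichlet h x"
  by (simp add: dirichlet_def)

lemma dirichlet_periodic: "dirichlet h (x + 2 * pi * of_int k) = dirichlet h x"
proof -
  have "cos (of_int t * (x + 2 * pi * of_int k)) = cos (of_int t * x)" for t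
  proof -
    have "cos (of_int t * (x + 2 * pi * of_int k)) = cos (of_int t * x + 2 * pi * of_int (t * k))"
      by (simp add: algebra_simps)
    then show ?thesis by (simp only: cos_add cos_int_2pin sin_int_2pin)
  qed
  then show ?thesis by (simp add: dirichlet_def)
qed

text \<open>On [0, 1 / N] with N = 2 h + 1 the trivial bound N contributes 1; on [1 / N, pi] the
  bound pi / x integrates to pi (ln pi + ln N). Evenness doubles the result.\<close>

lemma lebesgue_constant_bound:
  "integral {-pi..pi} (\<lambda>x. \<bar>dirichlet h x\<bar>) \<le> 2 * (1 + pi * (ln pi + ln (2 * real h + 1)))"
proof -
  define N where "N = 2 * real h + 1"
  have N: "1 \<le> N" "0 < N" by (auto simp: N_def)
  have Npi: "1 / N \<le> pi" using N pi_gt3 by (simp add: field_simps) (smt (verit, best) mult_less_cancel_left2)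
  have int: "(\<lambda>x. \<bar>dirichlet h x\<bar>) integrable_on {a..b}" for a b
    by (intro integrable_continuous_real continuous_intros)
  have "integral {0..pi} (\<lambda>x. \<bar>dirichlet h x\<bar>) =
      integral {0..1 / N} (\<lambda>x. \<bar>dirichlet h x\<bar>) + integral {1 / N..pi} (\<lambda>x. \<bar>dirichlet h x\<bar>)"
    using N Npi int by (subst Henstock_Kurzweil_Integration.integral_combine) auto
  also have "integral {0..1 / N} (\<lambda>x. \<bar>dirichlet h x\<bar>) \<le> integral {0..1 / N} (\<lambda>x. N)"
    using abs_dirichlet_le[of h] by (intro integral_le int) (auto simp: N_def)
  also have "integral {0..1 / N} (\<lambda>x. N) = 1" using N by simp
  also have "integral {1 / N..pi} (\<lambda>x. \<bar>dirichlet h x\<bar>) \<le> integral {1 / N..pi} (\<lambda>x. pi * (1 / x))"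
  proof (intro integral_le int)
    show "(\<lambda>x. pi * (1 / x)) integrable_on {1 / N..pi}"
      using N by (intro integrable_continuous_real continuous_intros) auto
    fix x assume x: "x \<in> {1 / N..pi}"
    then have "x > 0" using N by (auto intro: less_le_trans[of 0 "1 / N"])
    then show "\<bar>dirichlet h x\<bar> \<le> pi * (1 / x)"
      using abs_dirichlet_mult_le[of x h] x by (simp add: field_simps)
  qed
  also have "integral {1 / N..pi} (\<lambda>x. pi * (1 / x)) = pi * ln pi - pi * ln (1 / N)"
  proof (rule integral_unique, rule fundamental_theorem_of_calculus[OF Npi])
    fix x assume x: "x \<in> {1 / N..pi}"
    then have "x > 0" using N by (auto intro: less_le_trans[of 0 "1 / N"])
    then show "((\<lambda>x. pi * ln x) has_vector_derivative pi * (1 / x)) (at x within {1 / N..pi})"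
      unfolding has_real_derivative_iff_has_vector_derivative[symmetric]
      by (auto intro!: derivative_eq_intros)
  qed
  finally have half: "integral {0..pi} (\<lambda>x. \<bar>dirichlet h x\<bar>) \<le> 1 + pi * (ln pi + ln N)"
    using N by (simp add: ln_div algebra_simps)
  have "integral {-pi..pi} (\<lambda>x. \<bar>dirichlet h x\<bar>) =
      integral {-pi..0} (\<lambda>x. \<bar>dirichlet h x\<bar>) + integral {0..pi} (\<lambda>x. \<bar>dirichlet h x\<bar>)"
    using int by (subst Henstock_Kurzweil_Integration.integral_combine) auto
  also have "integral {-pi..0} (\<lambda>x. \<bar>dirichlet h x\<bar>) = integral {0..pi} (\<lambda>x. \<bar>dirichlet h x\<bar>)"
    using Henstock_Kurzweil_Integration.integral_reflect_real[of pi 0 "\<lambda>x. \<bar>dirichlet h x\<bar>"] by (simp add: dirichlet_minus)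
  finally show ?thesis using half by (simp add: N_def)
qed

lemma integral_cis_int:
  "integral {-pi..pi} (\<lambda>x. cis (of_int k * x)) = (if k = 0 then of_real (2 * pi) else 0)"
proof (cases "k = 0")
  case False
  have "((\<lambda>x. cis (of_int k * x)) has_integral cis (of_int k * pi) / (\<i> * of_int k) - cis (of_int k * (- pi)) / (\<i> * of_int k)) {-pi..pi}"
  proof (rule fundamental_theorem_of_calculus)
    fix x
    show "((\<lambda>x. cis (of_int k * x) / (\<i> * of_int k)) has_vector_derivative cis (of_int k * x)) (at x within {-pi..pi})"
      unfolding has_vector_derivative_def using False
      by (auto intro!: derivative_eq_intros simp: fun_eq_iff scaleR_conv_of_real field_simps)
  qed simp
  moreover have "cis (of_int k * pi) = cis (of_int k * (- pi))"
    by (simp add: complex_eq_iff sin_zero_iff_int2)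
  ultimately show ?thesis using False by (simp add: integral_unique)
qed (simp add: scaleR_conv_of_real)

text \<open>The interval covered by the two windows of length 2 pi is cut in two ways, removing
  either window; the leftover end pieces are translates of each other by one period.\<close>

lemma integral_periodic_shift:
  fixes f :: "real \<Rightarrow> 'b::euclidean_space"
  assumes per: "\<And>x. f (x + 2 * pi) = f x" and cont: "continuous_on UNIV f"
  shows "integral {-pi..pi} (\<lambda>x. f (x + a)) = integral {-pi..pi} f"
proof -
  define F where "F u = integral {u - pi..u + pi} f" for u
  have int: "f integrable_on {u..v}" for u v
    by (intro integrable_continuous_real continuous_on_subset[OF cont]) auto
  have "F u = F 0" for u
  proof -
    define c where "c = min (u - pi) (- pi)"
    define d where "d = max (u + pi) pi"
    have cont': "continuous (at x) f" for x
      using cont by (simp add: continuous_on_eq_continuous_at)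
    have "((\<lambda>u. integral {c..u} f) has_vector_derivative f x) (at x)" if "c < x" for x
    proof -
      have "((\<lambda>u. integral {c..u} f) has_vector_derivative f x) (at x within {c..x + 1})"
        by (rule integral_has_vector_derivative) (use that in \<open>auto intro: continuous_on_subset[OF cont]\<close>)
      moreover have "at x within {c..x + 1} = at x"
        using that by (intro at_within_interior) auto
      ultimately show ?thesis by simp
    qed
    have shift: "integral {x + 2 * pi..y + 2 * pi} f = integral {x..y} f" for x y
      using integral_shift_real_ivl[of "x + 2 * pi" "2 * pi" "y + 2 * pi" f] by (simp add: per)
    show ?thesis
    proof (cases "u \<ge> 0")
      case True
      have "integral {- pi..u + pi} f = integral {- pi..u - pi} f + F u"
        unfolding F_def using True by (simp add: Henstock_Kurzweil_Integration.integral_combine int)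
      moreover have "integral {- pi..u + pi} f = F 0 + integral {pi..u + pi} f"
        unfolding F_def using True by (simp add: Henstock_Kurzweil_Integration.integral_combine int)
      moreover have "integral {pi..u + pi} f = integral {- pi..u - pi} f"
        using shift[of "- pi" "u - pi"] by (simp add: add.commute)
      ultimately show ?thesis by simp
    next
      case False
      have "integral {u - pi..pi} f = integral {u - pi..- pi} f + F 0"
        unfolding F_def using False by (simp add: Henstock_Kurzweil_Integration.integral_combine int)
      moreover have "integral {u - pi..pi} f = F u + integral {u + pi..pi} f"
        unfolding F_def using False by (simp add: Henstock_Kurzweil_Integration.integral_combine int)
      moreover have "integral {u + pi..pi} f = integral {u - pi..- pi} f"
        using shift[of "u - pi" "- pi"] by (simp add: add.commute)
      ultimately show ?thesis by simp
    qed
  qed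
  moreover have "integral {-pi..pi} (\<lambda>x. f (x + a)) = F a"
    using integral_shift_real_ivl[of "a - pi" a "a + pi" f] by (simp add: F_def)
  ultimately show ?thesis by (simp add: F_def)
qed

section \<open>Bias of the periodogram and of its smoothed version\<close>

lemma sum_rectangle_cis:
  "(\<Sum>s = - int h..int h. \<Sum>t = - int h..int h. cis (of_int s * y) * cis (of_int (s - t) * x)) =
     of_real (dirichlet h (x + y) * dirichlet h x)"
proof -
  have "cis (of_int s * y) * cis (of_int (s - t) * x) = cis (of_int s * (x + y)) * cis (of_int t * (- x))" for s t
    by (simp add: cis_mult algebra_simps)
  then have "(\<Sum>s = - int h..int h. \<Sum>t = - int h..int h. cis (of_int s * y) * cis (of_int (s - t) * x)) =
     (\<Sum>s = - int h..int h. cis (of_int s * (x + y))) * (\<Sum>t = - int h..int h. cis (of_int t * (- x)))"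
    by (simp only: sum_product)
  then show ?thesis by (simp only: sum_cis_eq_dirichlet dirichlet_minus of_real_mult)
qed

text \<open>Orthogonality of the exponentials keeps the terms s = t of
  \<open>sum_rectangle_cis\<close>. The value is the normalisation against which the bias is
  measured below.\<close>

lemma integral_dirichlet_product:
  "integral {-pi..pi} (\<lambda>x. complex_of_real (dirichlet h (x + y) * dirichlet h x)) = of_real (2 * pi * dirichlet h y)"
proof -
  have int: "(\<lambda>x. cis (of_int s * y) * cis (of_int (s - t) * x)) integrable_on {-pi..pi}" for s t :: int
    by (intro integrable_continuous_real continuous_intros)
  have "integral {-pi..pi} (\<lambda>x. complex_of_real (dirichlet h (x + y) * dirichlet h x)) =
     (\<Sum>s = - int h..int h. \<Sum>t = - int h..int h. integral {-pi..pi} (\<lambda>x. cis (of_int s * y) * cis (of_int (s - t) * x)))"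
    unfolding sum_rectangle_cis[symmetric]
    by (subst Henstock_Kurzweil_Integration.integral_sum;
        (intro finite_atLeastAtMost_int integrable_sum int sum.cong refl)?)
       (subst Henstock_Kurzweil_Integration.integral_sum; (intro finite_atLeastAtMost_int int refl)?)
  also have "\<dots> = (\<Sum>s = - int h..int h. \<Sum>t = - int h..int h. if t = s then cis (of_int s * y) * of_real (2 * pi) else 0)"
  proof (intro sum.cong refl)
    fix s t :: int
    show "integral {-pi..pi} (\<lambda>x. cis (of_int s * y) * cis (of_int (s - t) * x)) = (if t = s then cis (of_int s * y) * of_real (2 * pi) else 0)"
      using integral_cis_int[of "s - t"] by (simp add: integral_mult_right)
  qed
  also have "\<dots> = (\<Sum>s = - int h..int h. cis (of_int s * y)) * of_real (2 * pi)"
    by (simp add: sum_distrib_right)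
  finally show ?thesis by (simp add: sum_cis_eq_dirichlet)
qed

(* Lipschitz continuity absorbs one of the two Dirichlet kernels, as |x D(x)| is at most pi;
   the other kernel only contributes the Lebesgue constant. *)
lemma periodogram_bias:
  fixes f :: "real \<Rightarrow> complex"
  assumes per: "\<And>x. f (x + 2 * pi) = f x" and lip: "\<And>x y. cmod (f x - f y) \<le> B * \<bar>x - y\<bar>"
    and cont: "continuous_on UNIV f"
  shows "cmod ((\<Sum>s = - int h..int h. \<Sum>t = - int h..int h.
            cis (of_int s * y) * cis (- (of_int (s - t) * \<mu>)) * integral {-pi..pi} (\<lambda>l. cis (of_int (s - t) * l) * f l))
         - of_real (2 * pi * dirichlet h y) * f \<mu>)
       \<le> B * pi * integral {-pi..pi} (\<lambda>x. \<bar>dirichlet h x\<bar>)"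
proof -
  have cf: "continuous_on S g \<Longrightarrow> continuous_on S (\<lambda>x. f (g x))" for S and g :: "real \<Rightarrow> real"
    by (rule continuous_on_compose2[OF cont]) auto
  have perd: "dirichlet h (x + 2 * pi) = dirichlet h x" for x
    using dirichlet_periodic[of h x 1] by simp
  have int: "(\<lambda>l. cis (of_int s * y) * cis (- (of_int (s - t) * \<mu>)) * (cis (of_int (s - t) * l) * f l)) integrable_on {-pi..pi}" for s t :: int
    by (intro integrable_continuous_real continuous_intros cf)
  have "(\<Sum>s = - int h..int h. \<Sum>t = - int h..int h.
            cis (of_int s * y) * cis (- (of_int (s - t) * \<mu>)) * integral {-pi..pi} (\<lambda>l. cis (of_int (s - t) * l) * f l)) =
      (\<Sum>s = - int h..int h. \<Sum>t = - int h..int h.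
           integral {-pi..pi} (\<lambda>l. cis (of_int s * y) * cis (- (of_int (s - t) * \<mu>)) * (cis (of_int (s - t) * l) * f l)))"
    by (simp add: integral_mult_right)
  also have "\<dots> = integral {-pi..pi} (\<lambda>l. \<Sum>s = - int h..int h. \<Sum>t = - int h..int h. 
      cis (of_int s * y) * cis (- (of_int (s - t) * \<mu>)) * (cis (of_int (s - t) * l) * f l))"
    by (subst Henstock_Kurzweil_Integration.integral_sum;
        (intro finite_atLeastAtMost_int integrable_sum int sum.cong refl)?)
       (subst Henstock_Kurzweil_Integration.integral_sum; (intro finite_atLeastAtMost_int int refl)?)
  also have "\<dots> = integral {-pi..pi} (\<lambda>l. of_real (dirichlet h ((l - \<mu>) + y) * dirichlet h (l - \<mu>)) * f l)"
  proof (intro Henstock_Kurzweil_Integration.integral_cong)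
    fix l
    have "cis (of_int s * y) * cis (- (of_int (s - t) * \<mu>)) * (cis (of_int (s - t) * l) * f l) =
        cis (of_int s * y) * cis (of_int (s - t) * (l - \<mu>)) * f l" for s t
      by (simp add: cis_mult algebra_simps)
    then show "(\<Sum>s = - int h..int h. \<Sum>t = - int h..int h. 
      cis (of_int s * y) * cis (- (of_int (s - t) * \<mu>)) * (cis (of_int (s - t) * l) * f l)) =
      of_real (dirichlet h ((l - \<mu>) + y) * dirichlet h (l - \<mu>)) * f l"
      by (simp only: sum_rectangle_cis[symmetric] sum_distrib_right)
  qed
  also have "\<dots> = integral {-pi..pi} (\<lambda>x. of_real (dirichlet h (x + y) * dirichlet h x) * f (x + \<mu>))"
  proof -
    define g where "g l = of_real (dirichlet h ((l - \<mu>) + y) * dirichlet h (l - \<mu>)) * f l" for l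
    have "g (x + 2 * pi) = g x" for x
    proof -
      have "x + 2 * pi - \<mu> + y = x - \<mu> + y + 2 * pi" "x + 2 * pi - \<mu> = x - \<mu> + 2 * pi" by simp_all
      then show ?thesis unfolding g_def by (simp only: perd per)
    qed
    moreover have "continuous_on UNIV g" unfolding g_def by (intro continuous_intros cf)
    ultimately have "integral {-pi..pi} (\<lambda>x. g (x + \<mu>)) = integral {-pi..pi} g"
      by (rule integral_periodic_shift)
    then show ?thesis unfolding g_def by (simp only: add_diff_cancel_right')
  qed
  finally have 1: "(\<Sum>s = - int h..int h. \<Sum>t = - int h..int h.
            cis (of_int s * y) * cis (- (of_int (s - t) * \<mu>)) * integral {-pi..pi} (\<lambda>l. cis (of_int (s - t) * l) * f l)) =
     integral {-pi..pi} (\<lambda>x. of_real (dirichlet h (x + y) * dirichlet h x) * f (x + \<mu>))" .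
  \<comment> \<open>Since the kernel product integrates to 2 pi D(y), the value at \<mu> goes under
    the integral sign, and only the increment f(x + \<mu>) - f(\<mu>) has to be estimated.\<close>
  have "of_real (2 * pi * dirichlet h y) * f \<mu> = integral {-pi..pi} (\<lambda>x. of_real (dirichlet h (x + y) * dirichlet h x) * f \<mu>)"
    by (subst integral_dirichlet_product[symmetric]) (simp only: integral_mult_left)
  then have 2: "integral {-pi..pi} (\<lambda>x. of_real (dirichlet h (x + y) * dirichlet h x) * f (x + \<mu>)) - of_real (2 * pi * dirichlet h y) * f \<mu>
      = integral {-pi..pi} (\<lambda>x. of_real (dirichlet h (x + y) * dirichlet h x) * (f (x + \<mu>) - f \<mu>))"
    by (simp only: right_diff_distrib)
       (subst Henstock_Kurzweil_Integration.integral_diff; (intro integrable_continuous_real continuous_intros cf)?; simp)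
  have B: "0 \<le> B"
    using order_trans[OF norm_ge_zero lip[of 1 0]] by simp
  have "cmod (integral {-pi..pi} (\<lambda>x. of_real (dirichlet h (x + y) * dirichlet h x) * (f (x + \<mu>) - f \<mu>)))
     \<le> integral {-pi..pi} (\<lambda>x. B * pi * \<bar>dirichlet h (x + y)\<bar>)"
  proof (rule integral_norm_bound_integral)
    fix x assume x: "x \<in> {-pi..pi}"
    have "cmod (of_real (dirichlet h (x + y) * dirichlet h x) * (f (x + \<mu>) - f \<mu>)) \<le> 
       \<bar>dirichlet h (x + y)\<bar> * \<bar>dirichlet h x\<bar> * (B * \<bar>x\<bar>)"
      unfolding norm_mult norm_of_real abs_mult using lip[of "x + \<mu>" \<mu>] by (intro mult_left_mono) auto
    also have "\<dots> = B * (\<bar>x\<bar> * \<bar>dirichlet h x\<bar>) * \<bar>dirichlet h (x + y)\<bar>" by simp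
    also have "\<dots> \<le> B * pi * \<bar>dirichlet h (x + y)\<bar>"
      using x B by (intro mult_right_mono mult_left_mono abs_dirichlet_mult_le) auto
    finally show "cmod (of_real (dirichlet h (x + y) * dirichlet h x) * (f (x + \<mu>) - f \<mu>)) \<le> B * pi * \<bar>dirichlet h (x + y)\<bar>" .
  qed (intro integrable_continuous_real continuous_intros cf)+
  also have "\<dots> = B * pi * integral {-pi..pi} (\<lambda>x. \<bar>dirichlet h (x + y)\<bar>)"
    by (simp add: integral_mult_right)
  also have "integral {-pi..pi} (\<lambda>x. \<bar>dirichlet h (x + y)\<bar>) = integral {-pi..pi} (\<lambda>x. \<bar>dirichlet h x\<bar>)"
    by (rule integral_periodic_shift[where f = "\<lambda>x. \<bar>dirichlet h x\<bar>"]) (auto simp: perd intro!: continuous_intros)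
  finally show ?thesis unfolding 1 2 .
qed

text \<open>The bound of \<open>periodogram_bias\<close> is uniform in \<mu>, so averaging against a
  nonnegative weight of mass at most one does not worsen it. In particular no bandwidth enters the
  error.\<close>

lemma smoothed_periodogram_bias:
  fixes f :: "real \<Rightarrow> complex" and \<kappa> :: "real \<Rightarrow> real"
  assumes per: "\<And>x. f (x + 2 * pi) = f x" and lip: "\<And>x y. cmod (f x - f y) \<le> B * \<bar>x - y\<bar>"
    and cont: "continuous_on UNIV f"
    and \<kappa>: "continuous_on {-pi..pi} \<kappa>" "\<And>x. 0 \<le> \<kappa> x" "integral {-pi..pi} \<kappa> \<le> 1"
  shows "cmod ((\<Sum>s = - int h..int h. \<Sum>t = - int h..int h.
            cis (of_int s * y) * integral {-pi..pi} (\<lambda>l. cis (of_int (s - t) * l) * f l) *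
               integral {-pi..pi} (\<lambda>\<mu>. cis (- (of_int (s - t) * \<mu>)) * of_real (\<kappa> \<mu>)))
         - of_real (2 * pi * dirichlet h y) * integral {-pi..pi} (\<lambda>\<mu>. f \<mu> * of_real (\<kappa> \<mu>)))
       \<le> B * pi * integral {-pi..pi} (\<lambda>x. \<bar>dirichlet h x\<bar>)"
proof -
  define c where "c k = integral {-pi..pi} (\<lambda>l. cis (of_int k * l) * f l)" for k :: int
  define I where "I = integral {-pi..pi} (\<lambda>x. \<bar>dirichlet h x\<bar>)"
  define G where "G \<mu> = (\<Sum>s = - int h..int h. \<Sum>t = - int h..int h. cis (of_int s * y) * cis (- (of_int (s - t) * \<mu>)) * c (s - t))" for \<mu>
  have I: "0 \<le> I" unfolding I_def
    by (intro Henstock_Kurzweil_Integration.integral_nonneg integrable_continuous_real continuous_intros) auto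
  have B: "0 \<le> B"
    using order_trans[OF norm_ge_zero lip[of 1 0]] by simp
  have f: "continuous_on {-pi..pi} f" using cont by (rule continuous_on_subset) simp
  have int: "(\<lambda>\<mu>. cis (of_int s * y) * cis (- (of_int (s - t) * \<mu>)) * c (s - t) * of_real (\<kappa> \<mu>)) integrable_on {-pi..pi}" for s t :: int
    by (intro integrable_continuous_real continuous_intros \<kappa>)
  have "(\<Sum>s = - int h..int h. \<Sum>t = - int h..int h.
            cis (of_int s * y) * c (s - t) * integral {-pi..pi} (\<lambda>\<mu>. cis (- (of_int (s - t) * \<mu>)) * of_real (\<kappa> \<mu>))) =
     (\<Sum>s = - int h..int h. \<Sum>t = - int h..int h.
       integral {-pi..pi} (\<lambda>\<mu>. cis (of_int s * y) * cis (- (of_int (s - t) * \<mu>)) * c (s - t) * of_real (\<kappa> \<mu>)))"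
    by (simp add: integral_mult_right[symmetric] mult_ac)
  also have "\<dots> = integral {-pi..pi} (\<lambda>\<mu>. \<Sum>s = - int h..int h. \<Sum>t = - int h..int h.
       cis (of_int s * y) * cis (- (of_int (s - t) * \<mu>)) * c (s - t) * of_real (\<kappa> \<mu>))"
    by (subst Henstock_Kurzweil_Integration.integral_sum;
        (intro finite_atLeastAtMost_int integrable_sum int sum.cong refl)?)
       (subst Henstock_Kurzweil_Integration.integral_sum; (intro finite_atLeastAtMost_int int refl)?)
  also have "\<dots> = integral {-pi..pi} (\<lambda>\<mu>. G \<mu> * of_real (\<kappa> \<mu>))"
    by (simp only: G_def sum_distrib_right)
  finally have 1: "(\<Sum>s = - int h..int h. \<Sum>t = - int h..int h.
            cis (of_int s * y) * c (s - t) * integral {-pi..pi} (\<lambda>\<mu>. cis (- (of_int (s - t) * \<mu>)) * of_real (\<kappa> \<mu>))) =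
      integral {-pi..pi} (\<lambda>\<mu>. G \<mu> * of_real (\<kappa> \<mu>))" .
  have G: "continuous_on {-pi..pi} G" unfolding G_def by (intro continuous_intros)
  have 2: "integral {-pi..pi} (\<lambda>\<mu>. G \<mu> * of_real (\<kappa> \<mu>)) - of_real (2 * pi * dirichlet h y) * integral {-pi..pi} (\<lambda>\<mu>. f \<mu> * of_real (\<kappa> \<mu>)) =
     integral {-pi..pi} (\<lambda>\<mu>. (G \<mu> - of_real (2 * pi * dirichlet h y) * f \<mu>) * of_real (\<kappa> \<mu>))"
  proof -
    have "of_real (2 * pi * dirichlet h y) * integral {-pi..pi} (\<lambda>\<mu>. f \<mu> * of_real (\<kappa> \<mu>)) =
        integral {-pi..pi} (\<lambda>\<mu>. of_real (2 * pi * dirichlet h y) * f \<mu> * of_real (\<kappa> \<mu>))"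
      by (simp only: mult.assoc integral_mult_right)
    moreover have "integral {-pi..pi} (\<lambda>\<mu>. G \<mu> * of_real (\<kappa> \<mu>) - of_real (2 * pi * dirichlet h y) * f \<mu> * of_real (\<kappa> \<mu>)) =
       integral {-pi..pi} (\<lambda>\<mu>. G \<mu> * of_real (\<kappa> \<mu>)) - integral {-pi..pi} (\<lambda>\<mu>. of_real (2 * pi * dirichlet h y) * f \<mu> * of_real (\<kappa> \<mu>))"
      by (rule Henstock_Kurzweil_Integration.integral_diff) (intro integrable_continuous_real continuous_intros f G \<kappa>)+
    ultimately show ?thesis by (simp only: left_diff_distrib)
  qed
  have "cmod (integral {-pi..pi} (\<lambda>\<mu>. (G \<mu> - of_real (2 * pi * dirichlet h y) * f \<mu>) * of_real (\<kappa> \<mu>)))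
     \<le> integral {-pi..pi} (\<lambda>\<mu>. B * pi * I * \<kappa> \<mu>)"
  proof (rule integral_norm_bound_integral)
    fix \<mu>
    have "cmod (G \<mu> - of_real (2 * pi * dirichlet h y) * f \<mu>) \<le> B * pi * I"
      using periodogram_bias[OF per lip cont, where h = h and y = y and \<mu> = \<mu>] by (simp only: G_def c_def I_def)
    then show "cmod ((G \<mu> - of_real (2 * pi * dirichlet h y) * f \<mu>) * of_real (\<kappa> \<mu>)) \<le> B * pi * I * \<kappa> \<mu>"
      unfolding norm_mult norm_of_real using \<kappa>(2)[of \<mu>] by (simp add: mult_right_mono)
  qed (intro integrable_continuous_real continuous_intros f G \<kappa>)+
  also have "\<dots> = B * pi * I * integral {-pi..pi} \<kappa>"
    by (rule integral_mult_right)
  also have "\<dots> \<le> B * pi * I * 1"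
    using B I \<kappa>(3) by (intro mult_left_mono) auto
  finally show ?thesis unfolding 1[unfolded c_def] 2 I_def by simp
qed

section \<open>Shape of the Dirichlet kernel near its peak and away from it\<close>

lemma has_derivative_dirichlet:
  "(dirichlet h has_real_derivative (\<Sum>t = - int h..int h. - of_int t * sin (of_int t * x))) (at x)"
  unfolding dirichlet_def[abs_def] by (auto intro!: derivative_eq_intros sum.cong)

text \<open>Differentiating both sides of sin(x / 2) D(x) = sin(N x / 2), with N = 2 h + 1,
  expresses sin(x / 2) D'(x) by two terms of size at most N / 2 each.\<close>

lemma abs_dirichlet_derivative_le:
  "\<bar>\<Sum>t = - int h..int h. of_int t * sin (of_int t * x)\<bar> * \<bar>sin (x / 2)\<bar> \<le> 2 * real h + 1"
proof -
  define D where "D = (\<Sum>t = - int h..int h. - of_int t * sin (of_int t * x))"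
  define N where "N = 2 * real h + 1"
  have "((\<lambda>x. sin (x / 2) * dirichlet h x) has_real_derivative cos (x / 2) / 2 * dirichlet h x + D * sin (x / 2)) (at x)"
    unfolding D_def by (auto intro!: derivative_eq_intros has_derivative_dirichlet)
  moreover have "((\<lambda>x. sin (x / 2) * dirichlet h x) has_real_derivative cos (N * (x / 2)) * (N / 2)) (at x)"
    unfolding sin_mult_dirichlet N_def by (auto intro!: derivative_eq_intros)
  ultimately have "cos (x / 2) / 2 * dirichlet h x + D * sin (x / 2) = cos (N * (x / 2)) * (N / 2)"
    by (rule DERIV_unique)
  then have "\<bar>D * sin (x / 2)\<bar> = \<bar>cos (N * (x / 2)) * (N / 2) - cos (x / 2) / 2 * dirichlet h x\<bar>" by simp
  also have "\<dots> \<le> \<bar>cos (N * (x / 2)) * (N / 2)\<bar> + \<bar>cos (x / 2) / 2 * dirichlet h x\<bar>" by (rule abs_triangle_ineq4)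
  also have "\<dots> \<le> 1 * (N / 2) + 1 / 2 * N"
    unfolding abs_mult using abs_dirichlet_le[of h x]
    by (intro add_mono mult_mono) (auto simp: N_def)
  finally show ?thesis by (simp add: D_def N_def abs_mult sum_negf)
qed

lemma sum_squares_symmetric: "(\<Sum>t = - int h..int h. (of_int t)\<^sup>2 :: real) = real h * (real h + 1) * (2 * real h + 1) / 3"
proof (induction h)
  case (Suc h)
  have "{- int (Suc h)..int (Suc h)} = insert (- int (Suc h)) (insert (int (Suc h)) {- int h..int h})"
    by auto
  then show ?case using Suc by (simp add: power2_eq_square field_simps)
qed simp

text \<open>For N = 2 h + 1 and the normalised kernel G(u) = D(u / N) / N this is -G''(0), the
  curvature at the peak. It is the divisor in the linearised equation for the maximum.\<close>

definition second_moment :: "nat \<Rightarrow> real" where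
  "second_moment h = (\<Sum>t = - int h..int h. (of_int t / (2 * real h + 1))\<^sup>2) / (2 * real h + 1)"

text \<open>The value is h (h + 1) / (3 (2 h + 1)^2), which grows from 2/27 at h = 1 to the limit
  1/12; at h = 0 it vanishes.\<close>

lemma second_moment_bounds:
  assumes "h \<ge> 1"
  shows "1 / 20 \<le> second_moment h" "second_moment h \<le> 1 / 4"
proof -
  have "second_moment h = real h * (real h + 1) / (3 * (2 * real h + 1)\<^sup>2)"
  proof -
    define N where "N = 2 * real h + 1"
    have "0 < N" by (simp add: N_def)
    then show ?thesis
      unfolding second_moment_def power_divide sum_divide_distrib[symmetric] sum_squares_symmetric N_def[symmetric]
      by (simp add: power2_eq_square)
  qed
  moreover have "(2 * real h + 1)\<^sup>2 * 3 \<le> 20 * (real h * (real h + 1))"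
    using assms mult_mono[of 1 "real h" 1 "real h"] by (simp add: power2_eq_square algebra_simps)
  moreover have "4 * (real h * (real h + 1)) \<le> 3 * (2 * real h + 1)\<^sup>2"
    by (simp add: power2_eq_square algebra_simps)
  moreover have "0 < 3 * (2 * real h + 1)\<^sup>2" by simp
  ultimately show "1 / 20 \<le> second_moment h" "second_moment h \<le> 1 / 4"
    by (auto simp only: intro!: iffD2[OF pos_le_divide_eq] iffD2[OF pos_divide_le_eq[of "3 * (2 * real h + 1)\<^sup>2"]])
qed

lemma cos_ge_quadratic: "1 - x\<^sup>2 / 2 \<le> cos x" for x :: real
proof -
  have "cos x = 1 - 2 * (sin (x / 2))\<^sup>2" using cos_double_sin[of "x / 2"] by simp
  moreover have "(sin (x / 2))\<^sup>2 \<le> (x / 2)\<^sup>2"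
    using power_mono[OF abs_sin_x_le_abs_x[of "x / 2"], of 2] by (simp add: power_divide)
  ultimately show ?thesis by (simp add: power_divide)
qed

lemma cos_le_quadratic: 
  assumes "\<bar>x\<bar> \<le> pi"
  shows "cos x \<le> 1 - 2 * x\<^sup>2 / pi\<^sup>2"
proof -
  have "cos x = 1 - 2 * (sin (x / 2))\<^sup>2" using cos_double_sin[of "x / 2"] by simp
  moreover have "(\<bar>x\<bar> / pi)\<^sup>2 \<le> \<bar>sin (x / 2)\<bar>\<^sup>2"
    by (intro power_mono abs_sin_half_ge assms) simp
  ultimately show ?thesis by (simp add: power_divide)
qed

lemma abs_sin_minus_le_cube: "\<bar>sin x - x\<bar> \<le> \<bar>x\<bar> ^ 3 / 6" for x :: real
proof -
  have "\<bar>sin x - (\<Sum>m<3. sin_coeff m * x ^ m)\<bar> \<le> inverse (fact 3) * \<bar>x\<bar> ^ 3"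
    by (rule Maclaurin_sin_bound)
  then show ?thesis by (simp add: sin_coeff_def eval_nat_numeral)
qed

lemma frequency_le_half:
  assumes "t \<in> {- int h..int h}"
  shows "\<bar>of_int t / (2 * real h + 1)\<bar> \<le> 1 / 2"
proof -
  have "\<bar>t\<bar> \<le> int h" using assms by auto
  then have "\<bar>real_of_int t\<bar> \<le> real h" by linarith
  then show ?thesis by (simp add: divide_simps)
qed

text \<open>Every frequency satisfies |t / N| <= 1/2, so that 1 - cos(t x) <= (t x)^2 / 2 <= (N x)^2
  / 8 holds term by term.\<close>

lemma dirichlet_near_one:
  "\<bar>1 - dirichlet h x / (2 * real h + 1)\<bar> \<le> ((2 * real h + 1) * x)\<^sup>2 / 8"
proof -
  define N where "N = 2 * real h + 1"
  have N: "0 < N" by (simp add: N_def)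
  have "N - dirichlet h x = (\<Sum>t = - int h..int h. 1 - cos (of_int t * x))"
    by (simp add: dirichlet_def N_def sum_subtractf)
  also have "\<dots> \<le> (\<Sum>t = - int h..int h. (N * x)\<^sup>2 / 8)"
  proof (intro sum_mono)
    fix t assume t: "t \<in> {- int h..int h}"
    have "\<bar>of_int t * x\<bar> = \<bar>of_int t / N\<bar> * \<bar>N * x\<bar>" using N by (simp add: abs_mult)
    also have "\<dots> \<le> 1 / 2 * \<bar>N * x\<bar>"
      using frequency_le_half[OF t] by (intro mult_right_mono) (auto simp: N_def)
    finally have "\<bar>of_int t * x\<bar>\<^sup>2 \<le> (1 / 2 * \<bar>N * x\<bar>)\<^sup>2" by (intro power_mono) auto
    then have "(of_int t * x)\<^sup>2 \<le> (N * x)\<^sup>2 / 4" by (simp add: power_mult_distrib power_divide)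
    then show "1 - cos (of_int t * x) \<le> (N * x)\<^sup>2 / 8"
      using cos_ge_quadratic[of "of_int t * x"] by linarith
  qed
  also have "\<dots> = N * ((N * x)\<^sup>2 / 8)" by (simp add: N_def)
  finally have "N - dirichlet h x \<le> N * ((N * x)\<^sup>2 / 8)" .
  moreover have "0 \<le> N - dirichlet h x" using abs_dirichlet_le[of h x] by (simp add: N_def)
  ultimately show ?thesis using N unfolding N_def[symmetric] by (simp add: abs_if field_simps)
qed

text \<open>The sum on the left is the derivative at u of D(u / N) / N. Replacing the sine by its
  argument costs a cubic term with factor 1/6 (1/2)^2 = 1/24; keeping one square of the frequency
  makes the error proportional to \<open>second_moment h\<close>.\<close>

lemma dirichlet_derivative_near_zero:
  defines "N \<equiv> \<lambda>h. 2 * real h + 1"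
  shows "\<bar>(\<Sum>t = - int h..int h. - (of_int t / N h) * sin (of_int t / N h * u)) / N h + second_moment h * u\<bar>
     \<le> second_moment h * \<bar>u\<bar> ^ 3 / 24"
proof -
  let ?\<theta> = "\<lambda>t. of_int t / N h"
  have N: "0 < N h" by (simp add: N_def)
  have "(\<Sum>t = - int h..int h. - ?\<theta> t * sin (?\<theta> t * u)) + N h * second_moment h * u =
     (\<Sum>t = - int h..int h. - ?\<theta> t * (sin (?\<theta> t * u) - ?\<theta> t * u))"
  proof -
    have "N h * second_moment h * u = (\<Sum>t = - int h..int h. ?\<theta> t * (?\<theta> t * u))"
    proof -
      have "N h * second_moment h = (\<Sum>t = - int h..int h. (?\<theta> t)\<^sup>2)"
        using N by (simp add: second_moment_def N_def)
      then show ?thesis by (simp add: sum_distrib_right power2_eq_square mult.assoc)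
    qed
    then show ?thesis by (simp only: right_diff_distrib sum_subtractf) (simp add: sum_negf)
  qed
  also have "\<bar>\<dots>\<bar> \<le> (\<Sum>t = - int h..int h. (?\<theta> t)\<^sup>2 * (\<bar>u\<bar> ^ 3 / 24))"
  proof (intro order_trans[OF sum_abs] sum_mono)
    fix t assume t: "t \<in> {- int h..int h}"
    have le: "\<bar>?\<theta> t\<bar>\<^sup>2 \<le> (1 / 2)\<^sup>2"
      using frequency_le_half[OF t] by (intro power_mono) (auto simp: N_def)
    have "\<bar>- ?\<theta> t * (sin (?\<theta> t * u) - ?\<theta> t * u)\<bar> \<le> \<bar>?\<theta> t\<bar> * (\<bar>?\<theta> t * u\<bar> ^ 3 / 6)"
      unfolding abs_mult[of "- ?\<theta> t"] abs_minus by (intro mult_left_mono abs_sin_minus_le_cube) auto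
    also have "\<dots> = (?\<theta> t)\<^sup>2 * (\<bar>?\<theta> t\<bar>\<^sup>2 * (\<bar>u\<bar> ^ 3 / 6))"
    proof -
      have "a * ((a * b) ^ 3 / 6) = a\<^sup>2 * (a\<^sup>2 * (b ^ 3 / 6))" for a b :: real
        by (simp add: power2_eq_square power3_eq_cube)
      from this[of "\<bar>?\<theta> t\<bar>" "\<bar>u\<bar>"] show ?thesis by (simp only: abs_mult[of "?\<theta> t"] power2_abs)
    qed
    also have "\<dots> \<le> (?\<theta> t)\<^sup>2 * ((1 / 2)\<^sup>2 * (\<bar>u\<bar> ^ 3 / 6))"
      by (intro mult_left_mono mult_right_mono le) auto
    finally show "\<bar>- ?\<theta> t * (sin (?\<theta> t * u) - ?\<theta> t * u)\<bar> \<le> (?\<theta> t)\<^sup>2 * (\<bar>u\<bar> ^ 3 / 24)"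
      by (simp add: power_divide)
  qed
  also have "\<dots> = N h * (second_moment h * \<bar>u\<bar> ^ 3 / 24)"
  proof -
    have "N h * second_moment h = (\<Sum>t = - int h..int h. (?\<theta> t)\<^sup>2)"
      using N by (simp add: second_moment_def N_def)
    then show ?thesis unfolding sum_distrib_right[symmetric] by simp
  qed
  finally show ?thesis
    using N by (simp add: abs_if field_simps split: if_splits)
qed

text \<open>Beyond 2 pi / N the bound |x D(x)| <= pi already gives N / 2. Up to 2 pi / N the kernel
  is nonnegative and all arguments t x lie in [-pi, pi], where the cosine has a quadratic upper
  bound.\<close>

lemma dirichlet_away_from_zero:
  assumes h: "h \<ge> 1" and x: "1 / (2 * real h + 1) \<le> \<bar>x\<bar>" "\<bar>x\<bar> \<le> pi"
  shows "\<bar>dirichlet h x\<bar> \<le> (1 - 1 / 200) * (2 * real h + 1)"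
proof -
  define N where "N = 2 * real h + 1"
  have N: "3 \<le> N" using h by (simp add: N_def)
  show ?thesis
  proof (cases "\<bar>x\<bar> \<le> 2 * pi / N")
    case False
    have "\<bar>x\<bar> * \<bar>dirichlet h x\<bar> \<le> pi" using x by (intro abs_dirichlet_mult_le)
    moreover have "2 * pi / N * \<bar>dirichlet h x\<bar> \<le> \<bar>x\<bar> * \<bar>dirichlet h x\<bar>"
      using False by (intro mult_right_mono) auto
    ultimately have "2 * pi / N * \<bar>dirichlet h x\<bar> \<le> pi" by linarith
    then have "2 * \<bar>dirichlet h x\<bar> \<le> N" using N by (simp add: field_simps)
    then show ?thesis using N by (simp add: N_def[symmetric])
  next
    case True
    have "0 \<le> dirichlet h \<bar>x\<bar>"
    proof -
      have x0: "0 < \<bar>x\<bar>" using x(1) N by (auto simp: N_def[symmetric] intro: less_le_trans[of 0 "1 / N"])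
      have "0 \<le> sin (N * (\<bar>x\<bar> / 2))"
        using True N by (intro sin_ge_zero) (auto simp: field_simps)
      then have "0 \<le> sin (\<bar>x\<bar> / 2) * dirichlet h \<bar>x\<bar>" by (simp add: sin_mult_dirichlet N_def)
      moreover have "0 < sin (\<bar>x\<bar> / 2)" using x(2) x0 by (intro sin_gt_zero) auto
      ultimately show ?thesis by (simp add: zero_le_mult_iff)
    qed
    moreover have "dirichlet h \<bar>x\<bar> = dirichlet h x" by (cases "x \<ge> 0") (auto simp: dirichlet_minus)
    ultimately have nonneg: "0 \<le> dirichlet h x" by simp
    have "dirichlet h x \<le> (\<Sum>t = - int h..int h. 1 - 2 * (of_int t * x)\<^sup>2 / pi\<^sup>2)"
      unfolding dirichlet_def
    proof (intro sum_mono cos_le_quadratic)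
      fix t assume t: "t \<in> {- int h..int h}"
      have "\<bar>of_int t * x\<bar> = \<bar>of_int t / N\<bar> * (N * \<bar>x\<bar>)" using N by (simp add: abs_mult)
      also have "\<dots> \<le> 1 / 2 * (2 * pi)"
      proof (rule mult_mono)
        show "\<bar>of_int t / N\<bar> \<le> 1 / 2" using frequency_le_half[OF t] by (simp only: N_def)
        show "N * \<bar>x\<bar> \<le> 2 * pi" using True N by (simp add: field_simps)
      qed (use N in auto)
      finally show "\<bar>of_int t * x\<bar> \<le> pi" by simp
    qed
    also have "\<dots> = N - 2 * (x\<^sup>2 / pi\<^sup>2) * (\<Sum>t = - int h..int h. (of_int t)\<^sup>2)"
      by (simp add: sum_subtractf N_def power_mult_distrib sum_distrib_left sum_divide_distrib mult_ac)
    also have "(\<Sum>t = - int h..int h. (of_int t)\<^sup>2) = second_moment h * N ^ 3"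
      using N unfolding second_moment_def N_def[symmetric] power_divide sum_divide_distrib[symmetric]
      by (simp add: power2_eq_square power3_eq_cube)
    also have "N - 2 * (x\<^sup>2 / pi\<^sup>2) * (second_moment h * N ^ 3) = N - 2 * (N * \<bar>x\<bar>)\<^sup>2 / pi\<^sup>2 * second_moment h * N"
      by (simp add: power_mult_distrib power2_eq_square power3_eq_cube)
    \<comment> \<open>With N |x| >= 1 and pi < 4 the loss is at least 2/16 times 1/20, that is
      1/160, which leaves room for 1/200.\<close>
    also have "\<dots> \<le> N - 2 * 1\<^sup>2 / 4\<^sup>2 * (1 / 20) * N"
    proof -
      have "2 * 1\<^sup>2 / 4\<^sup>2 \<le> 2 * (N * \<bar>x\<bar>)\<^sup>2 / pi\<^sup>2"
      proof (intro frac_le mult_left_mono power_mono)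
        show "1 \<le> N * \<bar>x\<bar>" using x(1) N unfolding N_def[symmetric] by (simp add: field_simps)
      qed (use pi_less_4 in auto)
      then have "2 * 1\<^sup>2 / 4\<^sup>2 * (1 / 20) \<le> 2 * (N * \<bar>x\<bar>)\<^sup>2 / pi\<^sup>2 * second_moment h"
        by (intro mult_mono second_moment_bounds h) auto
      then show ?thesis using N by (intro diff_left_mono mult_right_mono) auto
    qed
    also have "\<dots> \<le> (1 - 1 / 200) * N" using N by (simp add: power2_eq_square)
    finally show ?thesis using nonneg by (simp add: N_def)
  qed
qed

section \<open>Square integrable random variables and the Cauchy-Schwarz inequality\<close>

lemma borel_measurable_cnj [measurable]:
  "f \<in> borel_measurable M \<Longrightarrow> (\<lambda>x. cnj (f x)) \<in> borel_measurable M"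
  by (rule measurable_compose[OF _ borel_measurable_continuous_onI]) (auto intro!: continuous_intros)

lemma integrable_mult_of_squares:
  fixes U V :: "'a \<Rightarrow> real"
  assumes [measurable]: "U \<in> borel_measurable M" "V \<in> borel_measurable M"
    and "integrable M (\<lambda>x. (U x)\<^sup>2)" "integrable M (\<lambda>x. (V x)\<^sup>2)"
  shows "integrable M (\<lambda>x. U x * V x)"
proof (rule Bochner_Integration.integrable_bound[where f = "\<lambda>x. ((U x)\<^sup>2 + (V x)\<^sup>2) / 2"])
  show "AE x in M. norm (U x * V x) \<le> norm (((U x)\<^sup>2 + (V x)\<^sup>2) / 2)"
    using abs_mult_le_squares by auto
qed (use assms in auto)

text \<open>Integrating 2 |u v| <= t u^2 + v^2 / t and choosing t = sqrt b / sqrt a gives the claim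
  when both second moments are positive; the degenerate cases need their own choice of t.\<close>

lemma cauchy_schwarz_integral:
  fixes U V :: "'a \<Rightarrow> real"
  assumes [measurable]: "U \<in> borel_measurable M" "V \<in> borel_measurable M"
    and sq: "integrable M (\<lambda>x. (U x)\<^sup>2)" "integrable M (\<lambda>x. (V x)\<^sup>2)"
  shows "(\<integral>x. \<bar>U x * V x\<bar> \<partial>M) \<le> sqrt (\<integral>x. (U x)\<^sup>2 \<partial>M) * sqrt (\<integral>x. (V x)\<^sup>2 \<partial>M)"
proof -
  define I where "I = (\<integral>x. \<bar>U x * V x\<bar> \<partial>M)"
  define a where "a = (\<integral>x. (U x)\<^sup>2 \<partial>M)"
  define b where "b = (\<integral>x. (V x)\<^sup>2 \<partial>M)"
  have ab: "0 \<le> a" "0 \<le> b" "0 \<le> I" by (auto simp: a_def b_def I_def)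
  have int: "integrable M (\<lambda>x. \<bar>U x * V x\<bar>)"
    using integrable_mult_of_squares[OF assms] by simp
  have key: "2 * I \<le> t * a + b / t" if t: "t > 0" for t
  proof -
    have "2 * \<bar>u * v\<bar> \<le> t * u\<^sup>2 + v\<^sup>2 / t" for u v :: real
    proof -
      have "2 * (t * \<bar>u\<bar>) * \<bar>v\<bar> \<le> (t * \<bar>u\<bar>)\<^sup>2 + \<bar>v\<bar>\<^sup>2" by (rule sum_squares_bound)
      then have "t * (2 * \<bar>u * v\<bar>) \<le> t * (t * u\<^sup>2 + v\<^sup>2 / t)"
        using t by (simp add: abs_mult power_mult_distrib power2_eq_square algebra_simps)
      then show ?thesis using t by simp
    qed
    then have "(\<integral>x. 2 * \<bar>U x * V x\<bar> \<partial>M) \<le> (\<integral>x. t * (U x)\<^sup>2 + (V x)\<^sup>2 / t \<partial>M)"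
      using int sq by (intro integral_mono) auto
    then show ?thesis using sq by (simp add: I_def a_def b_def)
  qed
  have "I \<le> sqrt a * sqrt b"
  proof (cases "a = 0 \<or> b = 0 \<or> I = 0")
    case False
    then have pos: "a > 0" "b > 0" using ab by auto
    have "sqrt b / sqrt a * a = sqrt a * sqrt b" "b / (sqrt b / sqrt a) = sqrt a * sqrt b"
      using pos by (simp_all add: field_simps)
    then show ?thesis using key[of "sqrt b / sqrt a"] pos by simp
  next
    case True
    have "I = 0" if "a = 0"
    proof (rule ccontr)
      assume "I \<noteq> 0"
      then have I: "I > 0" using ab by simp
      \<comment> \<open>With a = 0 any large t is allowed; t = (b + 1) / I makes the right-hand side
        smaller than I.\<close>
      have "2 * I \<le> b * I / (b + 1)" using key[of "(b + 1) / I"] I ab that by simp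
      also have "\<dots> \<le> I" using I ab by (simp add: field_simps)
      finally show False using I by simp
    qed
    moreover have "I = 0" if "a > 0" "b = 0"
    proof (rule ccontr)
      assume "I \<noteq> 0"
      then have I: "I > 0" using ab by simp
      then show False using key[of "I / a"] that by simp
    qed
    ultimately have "I = 0" using True ab by fastforce
    then show ?thesis using ab by simp
  qed
  then show ?thesis by (simp add: I_def a_def b_def)
qed

lemma
  fixes U V :: "'a \<Rightarrow> complex"
  assumes [measurable]: "U \<in> borel_measurable M" "V \<in> borel_measurable M"
    and sq: "integrable M (\<lambda>x. (cmod (U x))\<^sup>2)" "integrable M (\<lambda>x. (cmod (V x))\<^sup>2)"
  shows integrable_mult_cnj: "integrable M (\<lambda>x. U x * cnj (V x))"
    and cauchy_schwarz_integral_cnj: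
      "cmod (\<integral>x. U x * cnj (V x) \<partial>M) \<le> sqrt (\<integral>x. (cmod (U x))\<^sup>2 \<partial>M) * sqrt (\<integral>x. (cmod (V x))\<^sup>2 \<partial>M)"
proof -
  have "integrable M (\<lambda>x. cmod (U x) * cmod (V x))"
    using sq by (intro integrable_mult_of_squares) auto
  then show "integrable M (\<lambda>x. U x * cnj (V x))"
    by (rule Bochner_Integration.integrable_bound) (auto simp: norm_mult)
  have "cmod (\<integral>x. U x * cnj (V x) \<partial>M) \<le> (\<integral>x. cmod (U x * cnj (V x)) \<partial>M)"
    by (rule integral_norm_bound)
  also have "\<dots> = (\<integral>x. \<bar>cmod (U x) * cmod (V x)\<bar> \<partial>M)" by (simp add: norm_mult)
  also have "\<dots> \<le> sqrt (\<integral>x. (cmod (U x))\<^sup>2 \<partial>M) * sqrt (\<integral>x. (cmod (V x))\<^sup>2 \<partial>M)"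
    using sq by (intro cauchy_schwarz_integral) auto
  finally show "cmod (\<integral>x. U x * cnj (V x) \<partial>M) \<le> sqrt (\<integral>x. (cmod (U x))\<^sup>2 \<partial>M) * sqrt (\<integral>x. (cmod (V x))\<^sup>2 \<partial>M)" .
qed

section \<open>The covariance as a sum over the spectral lines\<close>

definition square_integrable :: "'a measure \<Rightarrow> ('a \<Rightarrow> complex) \<Rightarrow> bool" where
  "square_integrable M U \<longleftrightarrow> U \<in> borel_measurable M \<and> integrable M (\<lambda>x. (cmod (U x))\<^sup>2)"

lemma square_integrable_add:
  assumes "square_integrable M U" "square_integrable M V"
  shows "square_integrable M (\<lambda>x. U x + V x)"
proof -
  have [measurable]: "U \<in> borel_measurable M" "V \<in> borel_measurable M"
    using assms by (auto simp: square_integrable_def)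
  have "(cmod (u + v))\<^sup>2 \<le> 2 * ((cmod u)\<^sup>2 + (cmod v)\<^sup>2)" for u v
  proof -
    have "(cmod (u + v))\<^sup>2 \<le> (cmod u + cmod v)\<^sup>2" by (intro power_mono norm_triangle_ineq) simp
    then show ?thesis using zero_le_power2[of "cmod u - cmod v"] by (simp add: power2_eq_square algebra_simps)
  qed
  note le = this
  have "integrable M (\<lambda>x. (cmod (U x + V x))\<^sup>2)"
  proof (rule Bochner_Integration.integrable_bound)
    show "integrable M (\<lambda>x. 2 * ((cmod (U x))\<^sup>2 + (cmod (V x))\<^sup>2))"
      using assms by (simp add: square_integrable_def)
    show "AE x in M. norm ((cmod (U x + V x))\<^sup>2) \<le> norm (2 * ((cmod (U x))\<^sup>2 + (cmod (V x))\<^sup>2))"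
      using le by (intro AE_I2) simp
  qed measurable
  then show ?thesis by (simp add: square_integrable_def)
qed

lemma square_integrable_cmult:
  "square_integrable M U \<Longrightarrow> square_integrable M (\<lambda>x. c * U x)"
  by (auto simp: square_integrable_def norm_mult power_mult_distrib)

lemma square_integrable_diff:
  "square_integrable M U \<Longrightarrow> square_integrable M V \<Longrightarrow> square_integrable M (\<lambda>x. U x - V x)"
  using square_integrable_add[of M U "\<lambda>x. -1 * V x"] square_integrable_cmult[of M V "-1"] by simp

lemma square_integrable_sum:
  "(\<And>i. i \<in> I \<Longrightarrow> square_integrable M (U i)) \<Longrightarrow> square_integrable M (\<lambda>x. \<Sum>i\<in>I. U i x)"
  by (induction I rule: infinite_finite_induct)
     (auto intro: square_integrable_add simp: square_integrable_def[of M "\<lambda>_. 0"])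

lemma (in prob_space) square_integrable_const: "square_integrable M (\<lambda>_. c)"
  by (simp add: square_integrable_def)

lemma (in prob_space) square_integrable_imp_integrable:
  assumes "square_integrable M U"
  shows "integrable M U"
  using assms integrable_mult_cnj[of U M "\<lambda>_. 1"] by (simp add: square_integrable_def)

text \<open>\<open>spectral_cov\<close> centres Z, whereas the Riemann sums in
  \<open>mean_square_integral\<close> do not. As X has mean zero, centring those sums does not
  increase their mean square distance to X.\<close>

lemma (in prob_space) centering_reduces_variance:
  assumes U: "square_integrable M U"
  shows "(\<integral>x. (cmod (U x - (\<integral>x. U x \<partial>M)))\<^sup>2 \<partial>M) \<le> (\<integral>x. (cmod (U x))\<^sup>2 \<partial>M)"
proof -
  define m where "m = (\<integral>x. U x \<partial>M)"
  have int: "integrable M U" "integrable M (\<lambda>x. (cmod (U x))\<^sup>2)"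
    using square_integrable_imp_integrable[OF U] U by (simp_all add: square_integrable_def)
  have ri: "integrable M (\<lambda>x. Re (U x))" "integrable M (\<lambda>x. Im (U x))"
    "(\<integral>x. Re (U x) \<partial>M) = Re m" "(\<integral>x. Im (U x) \<partial>M) = Im m"
    using int(1) by (auto simp: m_def integral_Re integral_Im)
  have e: "(cmod (u - m))\<^sup>2 = (cmod u)\<^sup>2 - 2 * (Re u * Re m + Im u * Im m) + (cmod m)\<^sup>2" for u
    by (simp add: cmod_power2 power2_diff algebra_simps)
  have "(\<integral>x. (cmod (U x - m))\<^sup>2 \<partial>M) = (\<integral>x. (cmod (U x))\<^sup>2 - 2 * (Re (U x) * Re m + Im (U x) * Im m) + (cmod m)\<^sup>2 \<partial>M)"
    by (simp only: e)
  also have "\<dots> = (\<integral>x. (cmod (U x))\<^sup>2 \<partial>M) - 2 * ((\<integral>x. Re (U x) \<partial>M) * Re m + (\<integral>x. Im (U x) \<partial>M) * Im m) + (cmod m)\<^sup>2"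
    using int(2) ri(1,2) by (simp add: prob_space)
  also have "\<dots> = (\<integral>x. (cmod (U x))\<^sup>2 \<partial>M) - (cmod m)\<^sup>2"
    unfolding ri(3,4) cmod_power2 by (simp add: power2_eq_square)
  also have "\<dots> \<le> (\<integral>x. (cmod (U x))\<^sup>2 \<partial>M)" by simp
  finally show ?thesis by (simp add: m_def)
qed

section \<open>The uniform grid on the circle and Riemann sums along a spectral line\<close>

definition uniform_point :: "nat \<Rightarrow> nat \<Rightarrow> real" where
  "uniform_point N i = - pi + 2 * pi * real i / real N"

lemma uniform_point_mono: "i \<le> j \<Longrightarrow> uniform_point N i \<le> uniform_point N j"
  by (auto simp: uniform_point_def divide_right_mono)

lemma uniform_point_bounds: "N > 0 \<Longrightarrow> i \<le> N \<Longrightarrow> uniform_point N i \<in> {-pi..pi}"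
  using uniform_point_mono[of 0 i N] uniform_point_mono[of i N N] by (simp add: uniform_point_def)

lemma circle_partition_uniform: "N > 0 \<Longrightarrow> circle_partition N (uniform_point N)"
  using uniform_point_mono[of i "Suc i" N for i] by (auto simp: circle_partition_def uniform_point_def)

lemma uniform_point_Suc: "N > 0 \<Longrightarrow> uniform_point N (Suc i) - uniform_point N i = 2 * pi / real N"
  by (simp add: uniform_point_def field_simps)

text \<open>The cells are open on the left and closed on the right, hence a ceiling minus one where
  a floor would fit the opposite convention. The point -pi lies in no cell.\<close>

definition uniform_index :: "nat \<Rightarrow> real \<Rightarrow> nat" where
  "uniform_index N x = nat (\<lceil>(x + pi) * real N / (2 * pi)\<rceil> - 1)"

lemma uniform_index_eq:
  assumes N: "N > 0" and x: "- pi < x" "x \<le> pi"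
  shows "uniform_index N x < N"
    and "x \<in> {uniform_point N i<..uniform_point N (Suc i)} \<longleftrightarrow> i = uniform_index N x"
proof -
  define y where "y = (x + pi) * real N / (2 * pi)"
  have "0 < (x + pi) * real N" using x N by (intro mult_pos_pos) auto
  then have y: "0 < y" "y \<le> N" using x N by (auto simp: y_def field_simps)
  then have c: "0 < \<lceil>y\<rceil>" "\<lceil>y\<rceil> \<le> int N" by (auto simp: ceiling_le_iff)
  then show "uniform_index N x < N"
    by (simp add: uniform_index_def flip: y_def) linarith
  have xy: "x = - pi + 2 * pi * y / N" using N by (simp add: y_def)
  have "x \<in> {uniform_point N i<..uniform_point N (Suc i)} \<longleftrightarrow> real i < y \<and> y \<le> real (Suc i)"
    using N unfolding uniform_point_def greaterThanAtMost_iff xy by (simp add: divide_le_cancel divide_less_cancel)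
  also have "\<dots> \<longleftrightarrow> \<lceil>y\<rceil> = int i + 1"
    by (auto simp: ceiling_eq_iff add.commute)
  also have "\<dots> \<longleftrightarrow> i = uniform_index N x"
    using c by (auto simp: uniform_index_def simp flip: y_def)
  finally show "x \<in> {uniform_point N i<..uniform_point N (Suc i)} \<longleftrightarrow> i = uniform_index N x" .
qed

lemma wrap_bounds: "- pi < wrap z" "wrap z \<le> pi"
proof -
  define k where "k = \<lceil>(z - pi) / (2 * pi)\<rceil>"
  have "of_int k - 1 < (z - pi) / (2 * pi)" "(z - pi) / (2 * pi) \<le> of_int k"
    unfolding k_def by linarith+
  then have "(of_int k - 1) * (2 * pi) < z - pi" "z - pi \<le> of_int k * (2 * pi)"
    by (simp_all add: pos_less_divide_eq pos_divide_le_eq)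
  moreover have "wrap z = z - 2 * pi * of_int k" by (simp add: wrap_def k_def)
  ultimately show "- pi < wrap z" "wrap z \<le> pi" by (simp_all add: algebra_simps)
qed

lemma cis_int_periodic: "cis (of_int k * (x + 2 * pi * of_int j)) = cis (of_int k * x)"
proof -
  have "of_int k * (x + 2 * pi * of_int j) = of_int k * x + 2 * pi * of_int (k * j)" by (simp add: algebra_simps)
  moreover have "cis (2 * pi * of_int (k * j)) = 1" by (rule cis_multiple_2pi) simp
  ultimately show ?thesis by (simp add: cis_mult[symmetric] del: of_int_mult)
qed

lemma cis_int_wrap: "cis (of_int k * wrap z) = cis (of_int k * z)"
  using cis_int_periodic[of k z "- \<lceil>(z - pi) / (2 * pi)\<rceil>"] by (simp add: wrap_def)

lemma borel_measurable_wrap [measurable]: "wrap \<in> borel_measurable borel"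
  unfolding wrap_def[abs_def] by measurable

lemma norm_cis_diff_le: "cmod (cis x - cis y) \<le> \<bar>x - y\<bar>"
proof -
  have "cmod (cis x - cis y) = cmod (cis y * (cis (x - y) - 1))"
    by (simp add: cis_mult right_diff_distrib)
  also have "\<dots> = cmod (cis (x - y) - 1)" by (simp add: norm_mult)
  also have "\<dots> = sqrt ((cos (x - y) - 1)\<^sup>2 + (sin (x - y))\<^sup>2)" by (simp add: cmod_def)
  also have "(cos (x - y) - 1)\<^sup>2 + (sin (x - y))\<^sup>2 = (2 * sin ((x - y) / 2))\<^sup>2"
  proof -
    have "(cos (x - y) - 1)\<^sup>2 + (sin (x - y))\<^sup>2 = ((sin (x - y))\<^sup>2 + (cos (x - y))\<^sup>2) + 1 - 2 * cos (x - y)"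
      by (simp add: power2_diff)
    also have "\<dots> = 2 - 2 * cos (x - y)" by (simp only: sin_cos_squared_add)
    also have "2 - 2 * cos (x - y) = 4 * (sin ((x - y) / 2))\<^sup>2"
    proof -
      have "cos (2 * ((x - y) / 2)) = 1 - 2 * (sin ((x - y) / 2))\<^sup>2" by (rule cos_double_sin)
      moreover have "2 * ((x - y) / 2) = x - y" by simp
      ultimately show ?thesis by (simp only:) simp
    qed
    finally show ?thesis by (simp add: power_mult_distrib)
  qed
  also have "sqrt \<dots> = 2 * \<bar>sin ((x - y) / 2)\<bar>" by (simp only: real_sqrt_abs abs_mult abs_numeral)
  also have "\<dots> \<le> \<bar>x - y\<bar>" using abs_sin_x_le_abs_x[of "(x - y) / 2"] by simp
  finally show ?thesis .
qed

(* The Riemann sums of the integrand against the mass which a line carries in each cell of the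
   uniform grid; a point of the line lies in exactly one cell. *)
lemma line_riemann_sum:
  fixes f :: "real \<Rightarrow> complex"
  assumes cont: "continuous_on {-pi..pi} f" and N: "N > 0"
  defines "p \<equiv> uniform_point N"
  shows "cmod ((\<Sum>i<N. \<Sum>j<N. cis (of_int k * p i) * cnj (cis (of_int m * p j)) *
            integral {\<mu> \<in> {p j<..p (Suc j)}. wrap (\<mu> + b) \<in> {p i<..p (Suc i)}} f)
          - cis (of_int k * b) * line_coeff (\<lambda>_. f) b (k - m))
         \<le> (\<bar>of_int k\<bar> + \<bar>of_int m\<bar>) * (2 * pi / N) * integral {-pi..pi} (\<lambda>x. cmod (f x))"
proof -
  define R where "R i j = {\<mu> \<in> {p j<..p (Suc j)}. wrap (\<mu> + b) \<in> {p i<..p (Suc i)}}" for i j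
  define c where "c i j = cis (of_int k * p i) * cnj (cis (of_int m * p j))" for i j
  define g where "g \<mu> = cis (of_int k * (\<mu> + b)) * cis (- (of_int m * \<mu>))" for \<mu>
  have R_sub: "R i j \<subseteq> {-pi..pi}" if "j < N" for i j
    using uniform_point_bounds[OF N, of j] uniform_point_bounds[OF N, of "Suc j"] that by (auto simp: R_def p_def)
  have R_meas: "R i j \<in> sets lborel" for i j
    unfolding R_def by measurable
  have intf: "set_integrable lborel {-pi..pi} f"
    by (rule borel_integrable_atLeastAtMost'[OF cont])
  have intR: "set_integrable lborel (R i j) f" if "j < N" for i j
    using set_integrable_subset[OF intf] R_sub[OF that] R_meas by blast
  have Rf: "integral (R i j) f = integral {-pi..pi} (\<lambda>x. if x \<in> R i j then f x else 0)"
    and Rint: "(\<lambda>x. if x \<in> R i j then f x else 0) integrable_on {-pi..pi}" if "j < N" for i j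
  proof -
    have *: "R i j \<inter> {-pi..pi} = R i j" using R_sub[OF that] by auto
    show "integral (R i j) f = integral {-pi..pi} (\<lambda>x. if x \<in> R i j then f x else 0)"
      using integral_restrict_Int[of "{-pi..pi}" "R i j" f] by (simp add: * Int_commute)
    show "(\<lambda>x. if x \<in> R i j then f x else 0) integrable_on {-pi..pi}"
      using integrable_restrict_Int[of "R i j" f "{-pi..pi}"] set_borel_integral_eq_integral(1)[OF intR[OF that, of i]]
      by (simp add: * Int_commute)
  qed
  have intg: "(\<lambda>x. g x * f x) integrable_on {-pi..pi}"
    unfolding g_def by (intro integrable_continuous_real continuous_intros cont)
  have "cis (of_int k * b) * line_coeff (\<lambda>_. f) b (k - m) = integral {-pi..pi} (\<lambda>x. g x * f x)"
  proof -
    have "g x * f x = cis (of_int k * b) * (cis (of_int (k - m) * x) * f x)" for x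
      unfolding g_def by (simp add: cis_mult mult.assoc[symmetric] del: cis_cnj) (simp add: algebra_simps)
    then show ?thesis by (simp only: line_coeff_def integral_mult_right)
  qed
  moreover have "(\<Sum>i<N. \<Sum>j<N. c i j * integral (R i j) f) =
      integral {-pi..pi} (\<lambda>x. \<Sum>i<N. \<Sum>j<N. c i j * (if x \<in> R i j then f x else 0))"
  proof -
    have *: "(\<lambda>x. c i j * (if x \<in> R i j then f x else 0)) integrable_on {-pi..pi}" if "j < N" for i j
      using Rint[OF that, of i] by (rule integrable_on_mult_right)
    have "integral {-pi..pi} (\<lambda>x. \<Sum>i<N. \<Sum>j<N. c i j * (if x \<in> R i j then f x else 0)) =
       (\<Sum>i<N. integral {-pi..pi} (\<lambda>x. \<Sum>j<N. c i j * (if x \<in> R i j then f x else 0)))"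
      by (rule Henstock_Kurzweil_Integration.integral_sum) (auto intro!: integrable_sum *)
    also have "\<dots> = (\<Sum>i<N. \<Sum>j<N. integral {-pi..pi} (\<lambda>x. c i j * (if x \<in> R i j then f x else 0)))"
      by (intro sum.cong refl Henstock_Kurzweil_Integration.integral_sum) (auto intro!: *)
    also have "\<dots> = (\<Sum>i<N. \<Sum>j<N. c i j * integral (R i j) f)"
      by (intro sum.cong refl) (simp only: integral_mult_right Rf lessThan_iff)
    finally show ?thesis ..
  qed
  moreover have Sint: "(\<lambda>x. \<Sum>i<N. \<Sum>j<N. c i j * (if x \<in> R i j then f x else 0)) integrable_on {-pi..pi}"
    by (intro integrable_sum integrable_on_mult_right Rint) auto
  ultimately have eq: "(\<Sum>i<N. \<Sum>j<N. c i j * integral (R i j) f) - cis (of_int k * b) * line_coeff (\<lambda>_. f) b (k - m) =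
      integral {-pi..pi} (\<lambda>x. (\<Sum>i<N. \<Sum>j<N. c i j * (if x \<in> R i j then f x else 0)) - g x * f x)"
    using intg by (simp add: Henstock_Kurzweil_Integration.integral_diff)
  define K where "K = (\<bar>of_int k\<bar> + \<bar>of_int m\<bar>) * (2 * pi / N)"
  \<comment> \<open>The endpoint -pi is missed by every cell, so there the whole integrand is
    allowed as error; a single point does not change the integral.\<close>
  have "cmod (integral {-pi..pi} (\<lambda>x. (\<Sum>i<N. \<Sum>j<N. c i j * (if x \<in> R i j then f x else 0)) - g x * f x))
     \<le> integral {-pi..pi} (\<lambda>x. if x = -pi then cmod (g x * f x) else K * cmod (f x))"
  proof (rule integral_norm_bound_integral)
    show "(\<lambda>x. if x = -pi then cmod (g x * f x) else K * cmod (f x)) integrable_on {-pi..pi}"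
      by (rule integrable_spike_finite[where S = "{-pi}" and f = "\<lambda>x. K * cmod (f x)"])
         (auto intro!: integrable_continuous_real continuous_intros cont)
    fix x assume x: "x \<in> {-pi..pi}"
    show "cmod ((\<Sum>i<N. \<Sum>j<N. c i j * (if x \<in> R i j then f x else 0)) - g x * f x) \<le> (if x = -pi then cmod (g x * f x) else K * cmod (f x))"
    proof (cases "x = -pi")
      case True
      have "x \<notin> R i j" if "j < N" for i j
        using uniform_point_bounds[OF N, of j] that True by (auto simp: R_def p_def)
      then have "(\<Sum>i<N. \<Sum>j<N. c i j * (if x \<in> R i j then f x else 0)) = 0"
        by (intro sum.neutral ballI) auto
      then show ?thesis using True by simp
    next
      case False
      define j0 where "j0 = uniform_index N x"
      define i0 where "i0 = uniform_index N (wrap (x + b))"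
      have j0: "j0 < N" "x \<in> {p j<..p (Suc j)} \<longleftrightarrow> j = j0" for j
        unfolding j0_def p_def using uniform_index_eq[OF N, of x] x False by auto
      have i0: "i0 < N" "wrap (x + b) \<in> {p i<..p (Suc i)} \<longleftrightarrow> i = i0" for i
        unfolding i0_def p_def using uniform_index_eq[OF N wrap_bounds] by blast+
      have xR: "x \<in> R i j \<longleftrightarrow> i = i0 \<and> j = j0" for i j
        using i0(2) j0(2) by (auto simp: R_def)
      have "(\<Sum>i<N. \<Sum>j<N. c i j * (if x \<in> R i j then f x else 0)) = (\<Sum>i<N. \<Sum>j<N. if j = j0 then (if i = i0 then c i j * f x else 0) else 0)"
        by (intro sum.cong refl) (simp add: xR)
      also have "\<dots> = c i0 j0 * f x" using i0(1) j0(1) by simp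
      finally have "cmod ((\<Sum>i<N. \<Sum>j<N. c i j * (if x \<in> R i j then f x else 0)) - g x * f x) = cmod (c i0 j0 - g x) * cmod (f x)"
        by (simp add: left_diff_distrib[symmetric] norm_mult)
      \<comment> \<open>Each of the two phases is evaluated at the left end of its cell and thus
        moved by at most one mesh width.\<close>
      also have "cmod (c i0 j0 - g x) \<le> K"
      proof -
        have xb: "x \<in> {p j0<..p (Suc j0)}" "wrap (x + b) \<in> {p i0<..p (Suc i0)}" using i0(2) j0(2) by blast+
        have d: "\<bar>p i0 - wrap (x + b)\<bar> \<le> 2 * pi / N" "\<bar>p j0 - x\<bar> \<le> 2 * pi / N"
          using xb uniform_point_Suc[OF N, of i0] uniform_point_Suc[OF N, of j0] by (auto simp: p_def)
        have "cmod (c i0 j0 - g x) = cmod ((cis (of_int k * p i0) - cis (of_int k * wrap (x + b))) * cis (- (of_int m * p j0))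
            + cis (of_int k * wrap (x + b)) * (cis (- (of_int m * p j0)) - cis (- (of_int m * x))))"
          by (simp add: c_def g_def cis_int_wrap cis_cnj algebra_simps)
        also have "\<dots> \<le> cmod (cis (of_int k * p i0) - cis (of_int k * wrap (x + b))) + cmod (cis (- (of_int m * p j0)) - cis (- (of_int m * x)))"
          by (rule order_trans[OF norm_triangle_ineq]) (simp add: norm_mult)
        also have "\<dots> \<le> \<bar>of_int k * p i0 - of_int k * wrap (x + b)\<bar> + \<bar>- (of_int m * p j0) - - (of_int m * x)\<bar>"
          by (intro add_mono norm_cis_diff_le)
        also have "\<dots> = \<bar>of_int k\<bar> * \<bar>p i0 - wrap (x + b)\<bar> + \<bar>of_int m\<bar> * \<bar>p j0 - x\<bar>"
        proof -
          have "of_int k * p i0 - of_int k * wrap (x + b) = of_int k * (p i0 - wrap (x + b))"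
            "- (of_int m * p j0) - - (of_int m * x) = of_int m * (- (p j0 - x))" by (simp_all add: algebra_simps)
          then show ?thesis by (simp only: abs_mult abs_minus)
        qed
        also have "\<dots> \<le> K" unfolding K_def distrib_right by (intro add_mono mult_left_mono d) auto
        finally show ?thesis .
      qed
      finally show ?thesis using False by (simp add: mult_right_mono)
    qed
  qed (intro Henstock_Kurzweil_Integration.integrable_diff Sint intg)
  also have "\<dots> = integral {-pi..pi} (\<lambda>x. K * cmod (f x))"
    by (rule integral_spike[where S = "{-pi}"]) auto
  also have "\<dots> = K * integral {-pi..pi} (\<lambda>x. cmod (f x))"
    by (rule integral_mult_right)
  finally show ?thesis unfolding eq[symmetric, unfolded c_def R_def] c_def R_def K_def by (simp only: eq[unfolded c_def R_def])
qed

text \<open>By bilinearity, products of increments of the centred Z turn into rectangle masses of F,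
  the quantities about which \<open>spectral_lines\<close> gives information.\<close>

lemma (in prob_space) integral_increment_product:
  assumes Z: "\<And>l. l \<in> {-pi..pi} \<Longrightarrow> square_integrable M (Z l)"
    and l: "l1 \<in> {-pi..pi}" "l2 \<in> {-pi..pi}" "m1 \<in> {-pi..pi}" "m2 \<in> {-pi..pi}"
  defines "Zc \<equiv> \<lambda>l \<omega>. Z l \<omega> - (\<integral>\<omega>'. Z l \<omega>' \<partial>M)"
  shows "(\<integral>\<omega>. (Zc l2 \<omega> - Zc l1 \<omega>) * cnj (Zc m2 \<omega> - Zc m1 \<omega>) \<partial>M) = rect_incr (spectral_cov M Z) l1 l2 m1 m2"
proof -
  have Zc: "square_integrable M (Zc l)" if "l \<in> {-pi..pi}" for l
    unfolding Zc_def by (intro square_integrable_diff Z that square_integrable_const)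
  have int: "integrable M (\<lambda>\<omega>. Zc l \<omega> * cnj (Zc m \<omega>))" if "l \<in> {-pi..pi}" "m \<in> {-pi..pi}" for l m
    using Zc[OF that(1)] Zc[OF that(2)] by (intro integrable_mult_cnj) (auto simp: square_integrable_def)
  have "(\<integral>\<omega>. (Zc l2 \<omega> - Zc l1 \<omega>) * cnj (Zc m2 \<omega> - Zc m1 \<omega>) \<partial>M) =
    (\<integral>\<omega>. Zc l2 \<omega> * cnj (Zc m2 \<omega>) - Zc l1 \<omega> * cnj (Zc m2 \<omega>) - Zc l2 \<omega> * cnj (Zc m1 \<omega>) + Zc l1 \<omega> * cnj (Zc m1 \<omega>) \<partial>M)"
    by (simp add: algebra_simps)
  also have "\<dots> = spectral_cov M Z l2 m2 - spectral_cov M Z l1 m2 - spectral_cov M Z l2 m1 + spectral_cov M Z l1 m1"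
    using int l by (simp add: spectral_cov_def Zc_def)
  finally show ?thesis by (simp add: rect_incr_def)
qed

text \<open>X k and X m are approximated in mean square by Riemann sums over the same grid. The
  covariance of these sums is a sum of rectangle masses, which is distributed over the lines and is
  itself a Riemann sum of the claimed integrals.\<close>

lemma (in prob_space) covariance_representation:
  assumes harm: "harmonizable_via M X Z"
    and X: "\<And>k. square_integrable M (\<lambda>\<omega>. complex_of_real (X k \<omega>))"
    and mean: "\<And>k. (\<integral>\<omega>. X k \<omega> \<partial>M) = 0"
    and L: "finite L" and lines: "spectral_lines (spectral_cov M Z) L f"
    and cont: "\<And>b. b \<in> L \<Longrightarrow> continuous_on {-pi..pi} (f b)"
  shows "complex_of_real (covariance_fun M X k m) = (\<Sum>b\<in>L. cis (of_int k * b) * line_coeff f b (k - m))"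
proof -
  define S where "S k N \<omega> = (\<Sum>i<N. cis (of_int k * uniform_point N i) * (Z (uniform_point N (Suc i)) \<omega> - Z (uniform_point N i) \<omega>))"
    for k :: int and N \<omega>
  define Sc where "Sc k N \<omega> = S k N \<omega> - (\<integral>\<omega>'. S k N \<omega>' \<partial>M)" for k N \<omega>
  define Zc where "Zc l \<omega> = Z l \<omega> - (\<integral>\<omega>'. Z l \<omega>' \<partial>M)" for l \<omega>
  define Y where "Y k \<omega> = complex_of_real (X k \<omega>)" for k \<omega>
  have Y: "square_integrable M (Y k)" for k unfolding Y_def by (rule X)
  have Z: "square_integrable M (Z l)" if "l \<in> {-pi..pi}" for l
    using harm that by (auto simp: harmonizable_via_def square_integrable_def)
  have up: "uniform_point N i \<in> {-pi..pi}" "uniform_point N (Suc i) \<in> {-pi..pi}" if "i < N" for N i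
    using uniform_point_bounds[of N i] uniform_point_bounds[of N "Suc i"] that by auto
  have Zint: "integrable M (Z l)" if "l \<in> {-pi..pi}" for l
    using Z[OF that] by (rule square_integrable_imp_integrable)
  have S: "square_integrable M (S k N)" for k N
    unfolding S_def by (intro square_integrable_sum square_integrable_cmult square_integrable_diff Z up) auto
  have Sc: "square_integrable M (Sc k N)" for k N
    unfolding Sc_def by (intro square_integrable_diff S square_integrable_const)
  have Sc_eq: "Sc k N \<omega> = (\<Sum>i<N. cis (of_int k * uniform_point N i) * (Zc (uniform_point N (Suc i)) \<omega> - Zc (uniform_point N i) \<omega>))" for k N \<omega>
  proof -
    have "(\<integral>\<omega>'. S k N \<omega>' \<partial>M) = (\<Sum>i<N. cis (of_int k * uniform_point N i) * ((\<integral>\<omega>'. Z (uniform_point N (Suc i)) \<omega>' \<partial>M) - (\<integral>\<omega>'. Z (uniform_point N i) \<omega>' \<partial>M)))"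
      unfolding S_def
    proof (subst Bochner_Integration.integral_sum)
      fix i assume "i \<in> {..<N}"
      then show "integrable M (\<lambda>\<omega>. cis (of_int k * uniform_point N i) * (Z (uniform_point N (Suc i)) \<omega> - Z (uniform_point N i) \<omega>))"
        using up by (intro integrable_mult_right Bochner_Integration.integrable_diff Zint) auto
    qed (intro sum.cong refl, subst integral_mult_right_zero, subst Bochner_Integration.integral_diff, use up Zint in auto)
    then show ?thesis unfolding Sc_def S_def Zc_def by (simp add: sum_subtractf[symmetric] right_diff_distrib[symmetric] algebra_simps)
  qed
  have approx: "\<exists>N0. \<forall>N\<ge>N0. N > 0 \<longrightarrow> (\<integral>\<omega>. (cmod (Y k \<omega> - Sc k N \<omega>))\<^sup>2 \<partial>M) < e" if e: "e > 0" for e k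
  proof -
    have "mean_square_integral M Z (\<lambda>l. cis (of_int k * l)) (Y k)"
      using harm unfolding harmonizable_via_def Y_def[abs_def] by blast
    then obtain d where d: "d > 0" and *: "\<And>N p \<xi>. circle_partition N p \<and> (\<forall>i<N. p (Suc i) - p i < d \<and> \<xi> i \<in> {p i..p (Suc i)}) \<Longrightarrow>
        (\<integral>\<omega>. (cmod (Y k \<omega> - (\<Sum>i<N. cis (of_int k * \<xi> i) * (Z (p (Suc i)) \<omega> - Z (p i) \<omega>))))\<^sup>2 \<partial>M) < e"
      unfolding mean_square_integral_def using e by meson
    show ?thesis
    proof (intro exI allI impI)
      fix N :: nat assume N: "nat \<lceil>2 * pi / d\<rceil> + 1 \<le> N" "N > 0"
      have "2 * pi / d < N" using N(1) by linarith
      then have "2 * pi / N < d" using d N by (simp add: field_simps)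
      then have "(\<integral>\<omega>. (cmod (Y k \<omega> - S k N \<omega>))\<^sup>2 \<partial>M) < e"
        unfolding S_def using N(2) uniform_point_mono[of _ "Suc _" N]
        by (intro *) (auto simp: circle_partition_uniform uniform_point_Suc)
      moreover have "(\<integral>\<omega>. (cmod (Y k \<omega> - Sc k N \<omega>))\<^sup>2 \<partial>M) \<le> (\<integral>\<omega>. (cmod (Y k \<omega> - S k N \<omega>))\<^sup>2 \<partial>M)"
      proof -
        have "(\<integral>\<omega>. Y k \<omega> \<partial>M) = 0" by (simp add: Y_def mean)
        then have "(\<integral>\<omega>. Y k \<omega> - S k N \<omega> \<partial>M) = - (\<integral>\<omega>. S k N \<omega> \<partial>M)"
          using square_integrable_imp_integrable[OF Y] square_integrable_imp_integrable[OF S] by simp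
        then show ?thesis
          using centering_reduces_variance[OF square_integrable_diff[OF Y S], of k k N] by (simp add: Sc_def algebra_simps)
      qed
      ultimately show "(\<integral>\<omega>. (cmod (Y k \<omega> - Sc k N \<omega>))\<^sup>2 \<partial>M) < e" by simp
    qed
  qed
  define r where "r = complex_of_real (covariance_fun M X k m)"
  define T where "T = (\<Sum>b\<in>L. cis (of_int k * b) * line_coeff f b (k - m))"
  define D where "D = (\<Sum>b\<in>L. (\<bar>of_int k\<bar> + \<bar>of_int m\<bar>) * (2 * pi) * integral {-pi..pi} (\<lambda>x. cmod (f b x)))"
  have D: "0 \<le> D" unfolding D_def
    by (intro sum_nonneg mult_nonneg_nonneg Henstock_Kurzweil_Integration.integral_nonneg integrable_continuous_real continuous_intros cont) auto
  have int: "integrable M (\<lambda>\<omega>. U \<omega> * cnj (V \<omega>))" if "square_integrable M U" "square_integrable M V" for U V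
    using that by (intro integrable_mult_cnj) (auto simp: square_integrable_def)
  have cs: "cmod (\<integral>\<omega>. U \<omega> * cnj (V \<omega>) \<partial>M) \<le> sqrt (\<integral>\<omega>. (cmod (U \<omega>))\<^sup>2 \<partial>M) * sqrt (\<integral>\<omega>. (cmod (V \<omega>))\<^sup>2 \<partial>M)"
    if "square_integrable M U" "square_integrable M V" for U V
    using that by (intro cauchy_schwarz_integral_cnj) (auto simp: square_integrable_def)
  define a where "a k = sqrt (\<integral>\<omega>. (cmod (Y k \<omega>))\<^sup>2 \<partial>M)" for k
  have a: "0 \<le> a k" for k by (simp add: a_def)
  have step: "cmod (r - T) \<le> e * (a m + a k + 2)" if e: "0 < e" "e \<le> 1" for e
  proof -
    obtain N1 where N1: "\<And>N. N \<ge> N1 \<Longrightarrow> N > 0 \<Longrightarrow> (\<integral>\<omega>. (cmod (Y k \<omega> - Sc k N \<omega>))\<^sup>2 \<partial>M) < e\<^sup>2"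
      using approx[of "e\<^sup>2" k] e by auto
    obtain N2 where N2: "\<And>N. N \<ge> N2 \<Longrightarrow> N > 0 \<Longrightarrow> (\<integral>\<omega>. (cmod (Y m \<omega> - Sc m N \<omega>))\<^sup>2 \<partial>M) < e\<^sup>2"
      using approx[of "e\<^sup>2" m] e by auto
    \<comment> \<open>One grid serves both approximations and also makes the Riemann error D / N
      along the lines at most e.\<close>
    define N where "N = Max {N1, N2, 1, nat \<lceil>D / e\<rceil>}"
    have N: "N \<ge> N1" "N \<ge> N2" "N > 0" "N \<ge> nat \<lceil>D / e\<rceil>"
      unfolding N_def by (auto simp: le_max_iff_disj less_max_iff_disj)
    have "D / e \<le> N" using N(4) by linarith
    then have DN: "D / N \<le> e" using e N(3) by (simp add: field_simps)
    define A where "A \<omega> = Y k \<omega> - Sc k N \<omega>" for \<omega>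
    define B where "B \<omega> = Y m \<omega> - Sc m N \<omega>" for \<omega>
    have A: "square_integrable M A" and B: "square_integrable M B"
      unfolding A_def B_def by (intro square_integrable_diff Y Sc)+
    have Ae: "sqrt (\<integral>\<omega>. (cmod (A \<omega>))\<^sup>2 \<partial>M) \<le> e" and Be: "sqrt (\<integral>\<omega>. (cmod (B \<omega>))\<^sup>2 \<partial>M) \<le> e"
      using real_sqrt_le_mono[OF less_imp_le[OF N1[OF N(1,3)]]] real_sqrt_le_mono[OF less_imp_le[OF N2[OF N(2,3)]]] e
      by (simp_all add: A_def B_def)
    have "r = (\<integral>\<omega>. Y k \<omega> * cnj (Y m \<omega>) \<partial>M)"
      unfolding r_def covariance_fun_def Y_def by (simp flip: integral_complex_of_real)
    \<comment> \<open>The product of the approximations is expanded so that every error term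
      contains A or B, each with L2 norm at most e, and otherwise only Y, whose norm does not depend
      on N.\<close>
    also have "\<dots> = (\<integral>\<omega>. Sc k N \<omega> * cnj (Sc m N \<omega>) + (A \<omega> * cnj (Y m \<omega>) + Y k \<omega> * cnj (B \<omega>) - A \<omega> * cnj (B \<omega>)) \<partial>M)"
      by (simp add: A_def B_def algebra_simps)
    also have "\<dots> = (\<integral>\<omega>. Sc k N \<omega> * cnj (Sc m N \<omega>) \<partial>M) + ((\<integral>\<omega>. A \<omega> * cnj (Y m \<omega>) \<partial>M) + (\<integral>\<omega>. Y k \<omega> * cnj (B \<omega>) \<partial>M) - (\<integral>\<omega>. A \<omega> * cnj (B \<omega>) \<partial>M))"
      using int[OF Sc Sc] int[OF A Y] int[OF Y B] int[OF A B] by simp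
    finally have "r - (\<integral>\<omega>. Sc k N \<omega> * cnj (Sc m N \<omega>) \<partial>M) = (\<integral>\<omega>. A \<omega> * cnj (Y m \<omega>) \<partial>M) + (\<integral>\<omega>. Y k \<omega> * cnj (B \<omega>) \<partial>M) - (\<integral>\<omega>. A \<omega> * cnj (B \<omega>) \<partial>M)"
      by simp
    also have "cmod \<dots> \<le> cmod (\<integral>\<omega>. A \<omega> * cnj (Y m \<omega>) \<partial>M) + cmod (\<integral>\<omega>. Y k \<omega> * cnj (B \<omega>) \<partial>M) + cmod (\<integral>\<omega>. A \<omega> * cnj (B \<omega>) \<partial>M)"
      by (intro order_trans[OF norm_triangle_ineq4] add_right_mono norm_triangle_ineq)
    also have "\<dots> \<le> e * a m + a k * e + e * e"
      using e a Ae Be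
      by (intro add_mono order_trans[OF cs[OF A Y]] order_trans[OF cs[OF Y B]] order_trans[OF cs[OF A B]])
         (auto simp: a_def intro!: mult_mono)
    also have "e * e \<le> e * 1" using e by (intro mult_left_mono) auto
    finally have 1: "cmod (r - (\<integral>\<omega>. Sc k N \<omega> * cnj (Sc m N \<omega>) \<partial>M)) \<le> e * (a m + a k + 1)"
      by (simp add: algebra_simps)
    let ?c = "\<lambda>i j. cis (of_int k * uniform_point N i) * cnj (cis (of_int m * uniform_point N j))"
    let ?I = "\<lambda>b i j. integral {\<mu> \<in> {uniform_point N j<..uniform_point N (Suc j)}. wrap (\<mu> + b) \<in> {uniform_point N i<..uniform_point N (Suc i)}} (f b)"
    have "(\<integral>\<omega>. Sc k N \<omega> * cnj (Sc m N \<omega>) \<partial>M) =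
        (\<integral>\<omega>. (\<Sum>i<N. \<Sum>j<N. ?c i j * ((Zc (uniform_point N (Suc i)) \<omega> - Zc (uniform_point N i) \<omega>) * cnj (Zc (uniform_point N (Suc j)) \<omega> - Zc (uniform_point N j) \<omega>))) \<partial>M)"
      unfolding Sc_eq cnj_sum sum_product by (simp only: complex_cnj_mult mult_ac)
    also have "\<dots> = (\<Sum>i<N. \<Sum>j<N. ?c i j * (\<integral>\<omega>. (Zc (uniform_point N (Suc i)) \<omega> - Zc (uniform_point N i) \<omega>) * cnj (Zc (uniform_point N (Suc j)) \<omega> - Zc (uniform_point N j) \<omega>) \<partial>M))"
    proof -
      have *: "integrable M (\<lambda>\<omega>. ?c i j * ((Zc (uniform_point N (Suc i)) \<omega> - Zc (uniform_point N i) \<omega>) * cnj (Zc (uniform_point N (Suc j)) \<omega> - Zc (uniform_point N j) \<omega>)))" if "i < N" "j < N" for i j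
        unfolding Zc_def by (intro integrable_mult_right int square_integrable_diff square_integrable_const Z up that)
      have "(\<integral>\<omega>. (\<Sum>i<N. \<Sum>j<N. ?c i j * ((Zc (uniform_point N (Suc i)) \<omega> - Zc (uniform_point N i) \<omega>) * cnj (Zc (uniform_point N (Suc j)) \<omega> - Zc (uniform_point N j) \<omega>))) \<partial>M) =
        (\<Sum>i<N. \<integral>\<omega>. (\<Sum>j<N. ?c i j * ((Zc (uniform_point N (Suc i)) \<omega> - Zc (uniform_point N i) \<omega>) * cnj (Zc (uniform_point N (Suc j)) \<omega> - Zc (uniform_point N j) \<omega>))) \<partial>M)"
        by (rule Bochner_Integration.integral_sum) (intro Bochner_Integration.integrable_sum *; simp)
      also have "\<dots> = (\<Sum>i<N. \<Sum>j<N. \<integral>\<omega>. ?c i j * ((Zc (uniform_point N (Suc i)) \<omega> - Zc (uniform_point N i) \<omega>) * cnj (Zc (uniform_point N (Suc j)) \<omega> - Zc (uniform_point N j) \<omega>)) \<partial>M)"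
        by (intro sum.cong refl Bochner_Integration.integral_sum *) auto
      finally show ?thesis by (simp only: integral_mult_right_zero)
    qed
    also have "\<dots> = (\<Sum>i<N. \<Sum>j<N. ?c i j * (\<Sum>b\<in>L. ?I b i j))"
    proof (intro sum.cong refl arg_cong2[where f = "(*)"])
      fix i j assume "i \<in> {..<N}" "j \<in> {..<N}"
      then have ij: "i < N" "j < N" by auto
      have "(\<integral>\<omega>. (Zc (uniform_point N (Suc i)) \<omega> - Zc (uniform_point N i) \<omega>) * cnj (Zc (uniform_point N (Suc j)) \<omega> - Zc (uniform_point N j) \<omega>) \<partial>M) =
        rect_incr (spectral_cov M Z) (uniform_point N i) (uniform_point N (Suc i)) (uniform_point N j) (uniform_point N (Suc j))"
        unfolding Zc_def by (rule integral_increment_product) (use up ij Z in auto)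
      also have "\<dots> = (\<Sum>b\<in>L. ?I b i j)"
      proof -
        have *: "\<And>l1 l2 m1 m2. -pi \<le> l1 \<and> l1 \<le> l2 \<and> l2 \<le> pi \<and> -pi \<le> m1 \<and> m1 \<le> m2 \<and> m2 \<le> pi \<Longrightarrow>
          rect_incr (spectral_cov M Z) l1 l2 m1 m2 =
          (\<Sum>b\<in>L. integral {\<mu> \<in> {m1<..m2}. wrap (\<mu> + b) \<in> {l1<..l2}} (f b))"
          using lines unfolding spectral_lines_def by blast
        show ?thesis by (rule *) (use up[OF ij(1)] up[OF ij(2)] uniform_point_mono[of i "Suc i" N] uniform_point_mono[of j "Suc j" N] in auto)
      qed
      finally show "(\<integral>\<omega>. (Zc (uniform_point N (Suc i)) \<omega> - Zc (uniform_point N i) \<omega>) * cnj (Zc (uniform_point N (Suc j)) \<omega> - Zc (uniform_point N j) \<omega>) \<partial>M) = (\<Sum>b\<in>L. ?I b i j)" .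
    qed
    also have "\<dots> = (\<Sum>b\<in>L. \<Sum>i<N. \<Sum>j<N. ?c i j * ?I b i j)"
      by (simp only: sum_distrib_left sum.swap[of _ _ L])
    finally have "cmod ((\<integral>\<omega>. Sc k N \<omega> * cnj (Sc m N \<omega>) \<partial>M) - T) =
        cmod (\<Sum>b\<in>L. (\<Sum>i<N. \<Sum>j<N. ?c i j * ?I b i j) - cis (of_int k * b) * line_coeff (\<lambda>_. f b) b (k - m))"
      by (simp only: T_def sum_subtractf line_coeff_def)
    also have "\<dots> \<le> (\<Sum>b\<in>L. (\<bar>of_int k\<bar> + \<bar>of_int m\<bar>) * (2 * pi / N) * integral {-pi..pi} (\<lambda>x. cmod (f b x)))"
      by (intro sum_norm_le line_riemann_sum cont N(3))
    also have "\<dots> = D / N" by (simp add: D_def sum_divide_distrib)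
    finally have "cmod ((\<integral>\<omega>. Sc k N \<omega> * cnj (Sc m N \<omega>) \<partial>M) - T) \<le> e" using DN by simp
    with 1 have "cmod (r - T) \<le> e * (a m + a k + 1) + e"
      by (rule norm_diff_triangle_le)
    then show ?thesis by (simp add: algebra_simps)
  qed
  have "cmod (r - T) \<le> 0 + \<eta>" if \<eta>: "\<eta> > 0" for \<eta>
  proof -
    define C where "C = a m + a k + 2"
    have C: "C > 0" using a[of m] a[of k] by (simp add: C_def)
    have "cmod (r - T) \<le> min 1 (\<eta> / C) * C"
      unfolding C_def using \<eta> C by (intro step) (auto simp: C_def)
    also have "\<dots> \<le> \<eta> / C * C" using C by (intro mult_right_mono) auto
    finally show ?thesis using C by simp
  qed
  then have "cmod (r - T) \<le> 0" by (rule field_le_epsilon)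
  then show ?thesis by (simp add: r_def T_def)
qed

section \<open>Fluctuations of random trigonometric sums\<close>

text \<open>Expanding the exponentials separates u from the data: only the sums of \<theta>^k x
  enter, and one bound for all of them serves every |u| <= 1. This permits a u that depends on the
  data. The tail is at most |u|^j \<rho> e, and e <= 3.\<close>

lemma frequency_series_bound:
  fixes x :: "'i \<Rightarrow> complex" and \<theta> :: "'i \<Rightarrow> real"
  assumes I: "finite I" and \<rho>: "\<And>k. cmod (\<Sum>i\<in>I. of_real (\<theta> i) ^ k * x i) \<le> \<rho>" and u: "\<bar>u\<bar> \<le> 1"
  shows "cmod ((\<Sum>i\<in>I. x i * cis (- (\<theta> i * u))) -
      (\<Sum>k<j. (- \<i> * of_real u) ^ k / fact k * (\<Sum>i\<in>I. of_real (\<theta> i) ^ k * x i))) \<le> 3 * \<bar>u\<bar> ^ j * \<rho>"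
proof -
  define c where "c k = (- \<i> * of_real u) ^ k / fact k * (\<Sum>i\<in>I. of_real (\<theta> i) ^ k * x i)" for k
  have \<rho>0: "0 \<le> \<rho>" using order_trans[OF norm_ge_zero \<rho>[of 0]] .
  have "(\<lambda>k. x i * ((- \<i> * of_real (\<theta> i * u)) ^ k /\<^sub>R fact k)) sums (x i * cis (- (\<theta> i * u)))" for i
  proof -
    have "cis (- (\<theta> i * u)) = exp (- \<i> * of_real (\<theta> i * u))" by (simp add: cis_conv_exp)
    then show ?thesis using exp_converges[of "- \<i> * of_real (\<theta> i * u)"] by (simp only: sums_mult)
  qed
  then have "(\<lambda>k. \<Sum>i\<in>I. x i * ((- \<i> * of_real (\<theta> i * u)) ^ k /\<^sub>R fact k)) sums (\<Sum>i\<in>I. x i * cis (- (\<theta> i * u)))"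
    by (rule sums_sum)
  moreover have "(\<Sum>i\<in>I. x i * ((- \<i> * of_real (\<theta> i * u)) ^ k /\<^sub>R fact k)) = c k" for k
    unfolding c_def sum_distrib_left
  proof (intro sum.cong refl)
    fix i
    have "- \<i> * complex_of_real (\<theta> i * u) = of_real (\<theta> i) * (- \<i> * of_real u)" by simp
    then show "x i * ((- \<i> * of_real (\<theta> i * u)) ^ k /\<^sub>R fact k) = (- \<i> * of_real u) ^ k / fact k * (of_real (\<theta> i) ^ k * x i)"
      by (simp only: power_mult_distrib scaleR_conv_of_real) (simp add: divide_inverse mult_ac)
  qed
  ultimately have s: "c sums (\<Sum>i\<in>I. x i * cis (- (\<theta> i * u)))" by simp
  then have s': "(\<lambda>k. c (k + j)) sums ((\<Sum>i\<in>I. x i * cis (- (\<theta> i * u))) - (\<Sum>k<j. c k))"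
    by (simp add: sums_iff_shift)
  have e: "(\<lambda>k. \<bar>u\<bar> ^ j * \<rho> * (1 ^ k /\<^sub>R fact k)) sums (\<bar>u\<bar> ^ j * \<rho> * exp 1)"
    by (intro sums_mult exp_converges)
  have "cmod (c (k + j)) \<le> \<bar>u\<bar> ^ j * \<rho> * (1 ^ k /\<^sub>R fact k)" for k
  proof -
    have "cmod (c (k + j)) = \<bar>u\<bar> ^ (k + j) / fact (k + j) * cmod (\<Sum>i\<in>I. of_real (\<theta> i) ^ (k + j) * x i)"
      by (simp add: c_def norm_mult norm_divide norm_power)
    also have "\<dots> \<le> \<bar>u\<bar> ^ j / fact k * \<rho>"
    proof (intro mult_mono frac_le \<rho>)
      show "\<bar>u\<bar> ^ (k + j) \<le> \<bar>u\<bar> ^ j" using u by (intro power_decreasing) auto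
      show "fact k \<le> (fact (k + j) :: real)" by (intro fact_mono) auto
    qed auto
    finally show ?thesis by (simp add: divide_inverse mult_ac)
  qed
  then have "cmod (\<Sum>k. c (k + j)) \<le> (\<Sum>k. \<bar>u\<bar> ^ j * \<rho> * (1 ^ k /\<^sub>R fact k))"
    using e by (intro norm_suminf_le) (auto simp: sums_iff)
  also have "\<dots> = \<bar>u\<bar> ^ j * \<rho> * exp 1" using e by (rule sums_unique[symmetric])
  also have "\<dots> \<le> \<bar>u\<bar> ^ j * \<rho> * 3" using \<rho>0 exp_le by (intro mult_left_mono) auto
  finally show ?thesis using s' by (simp add: sums_iff c_def mult_ac)
qed

text \<open>The dominating variable is the l^q norm of the sequence of coefficients. Frequencies of
  size at most 1/2 make it finite pointwise, and the geometric decay of the moments gives the factor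
  2.\<close>

lemma (in prob_space) random_frequency_series:
  fixes x :: "'i \<Rightarrow> 'a \<Rightarrow> complex" and \<theta> :: "'i \<Rightarrow> real" and I :: "'i set"
  defines "a \<equiv> \<lambda>k \<omega>. \<Sum>i\<in>I. of_real (\<theta> i) ^ k * x i \<omega>"
  assumes I: "finite I" and \<theta>: "\<And>i. i \<in> I \<Longrightarrow> \<bar>\<theta> i\<bar> \<le> 1 / 2"
    and x[measurable]: "\<And>i. x i \<in> borel_measurable M" and q: "q > 0"
    and int: "\<And>k. integrable M (\<lambda>\<omega>. cmod (a k \<omega>) ^ q)"
    and bound: "\<And>k. (\<integral>\<omega>. cmod (a k \<omega>) ^ q \<partial>M) \<le> B * (1 / 2) ^ k"
  obtains \<rho> where "\<rho> \<in> borel_measurable M" "\<And>\<omega>. 0 \<le> \<rho> \<omega>" "integrable M (\<lambda>\<omega>. \<rho> \<omega> ^ q)"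
    "(\<integral>\<omega>. \<rho> \<omega> ^ q \<partial>M) \<le> 2 * B" "\<And>k \<omega>. cmod (a k \<omega>) \<le> \<rho> \<omega>"
proof -
  have [measurable]: "a k \<in> borel_measurable M" for k unfolding a_def by measurable
  have sum: "summable (\<lambda>k. cmod (a k \<omega>) ^ q)" for \<omega>
  proof -
    define S where "S = (\<Sum>i\<in>I. cmod (x i \<omega>))"
    have S: "0 \<le> S" by (auto simp: S_def intro: sum_nonneg)
    have "cmod (a k \<omega>) \<le> (1 / 2) ^ k * S" for k
      unfolding a_def S_def sum_distrib_left
      by (intro sum_norm_le) (auto simp: norm_mult norm_power intro!: mult_right_mono power_mono \<theta>)
    then have "cmod (a k \<omega>) ^ q \<le> ((1 / 2) ^ k * S) ^ q" for k
      by (intro power_mono) auto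
    then have "norm (cmod (a k \<omega>) ^ q) \<le> S ^ q * ((1 / 2) ^ q) ^ k" for k
      by (simp add: power_mult_distrib power_mult[symmetric] mult_ac power_divide)
    moreover have "summable (\<lambda>k. S ^ q * ((1 / 2) ^ q) ^ k :: real)"
    proof (intro summable_mult summable_geometric)
      have "(1 / 2 :: real) ^ q \<le> (1 / 2) ^ 1" using q by (intro power_decreasing) auto
      then show "norm ((1 / 2 :: real) ^ q) < 1" by simp
    qed
    ultimately show ?thesis by (rule summable_comparison_test'[of "\<lambda>k. S ^ q * ((1 / 2) ^ q) ^ k" 0, rotated])
  qed
  have ig: "summable (\<lambda>k. \<integral>\<omega>. norm (cmod (a k \<omega>) ^ q) \<partial>M)"
  proof (rule summable_comparison_test'[of "\<lambda>k. B * (1 / 2) ^ k" 0])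
    show "summable (\<lambda>k. B * (1 / 2) ^ k :: real)" by (intro summable_mult summable_geometric) simp
    fix k :: nat show "norm (\<integral>\<omega>. norm (cmod (a k \<omega>) ^ q) \<partial>M) \<le> B * (1 / 2) ^ k"
      using bound[of k] by simp
  qed
  define R where "R \<omega> = (\<Sum>k. cmod (a k \<omega>) ^ q)" for \<omega>
  define \<rho> where "\<rho> \<omega> = root q (R \<omega>)" for \<omega>
  have R0: "0 \<le> R \<omega>" for \<omega> unfolding R_def by (intro suminf_nonneg sum) auto
  have [measurable]: "R \<in> borel_measurable M" unfolding R_def by measurable
  have \<rho>q: "\<rho> \<omega> ^ q = R \<omega>" for \<omega> using R0 q by (simp add: \<rho>_def)
  show thesis
  proof (rule that)
    show "\<rho> \<in> borel_measurable M" unfolding \<rho>_def by measurable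
    show "0 \<le> \<rho> \<omega>" for \<omega> using R0 by (simp add: \<rho>_def real_root_ge_zero)
    show "integrable M (\<lambda>\<omega>. \<rho> \<omega> ^ q)"
      unfolding \<rho>q unfolding R_def using sum ig int by (intro integrable_suminf) auto
    have "(\<integral>\<omega>. \<rho> \<omega> ^ q \<partial>M) = (\<Sum>k. \<integral>\<omega>. cmod (a k \<omega>) ^ q \<partial>M)"
      unfolding \<rho>q unfolding R_def using sum ig int by (intro integral_suminf) auto
    also have "\<dots> \<le> (\<Sum>k. B * (1 / 2) ^ k)"
      using ig by (intro suminf_le bound summable_mult summable_geometric) auto
    also have "\<dots> = 2 * B" by (subst suminf_mult) (auto simp: suminf_geometric)
    finally show "(\<integral>\<omega>. \<rho> \<omega> ^ q \<partial>M) \<le> 2 * B" .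
    show "cmod (a k \<omega>) \<le> \<rho> \<omega>" for k \<omega>
    proof -
      have "cmod (a k \<omega>) ^ q = sum (\<lambda>k. cmod (a k \<omega>) ^ q) {k}" by simp
      also have "\<dots> \<le> R \<omega>" unfolding R_def by (intro sum_le_suminf sum) auto
      finally have "root q (cmod (a k \<omega>) ^ q) \<le> root q (R \<omega>)" using q by (intro real_root_le_mono) auto
      then show ?thesis using q by (simp add: \<rho>_def real_root_power_cancel)
    qed
  qed
qed

section \<open>The centred line statistic and its uniform bound\<close>

context gaussian_summable
begin

definition fluctuation :: "nat \<Rightarrow> real \<Rightarrow> 'a \<Rightarrow> complex" where
  "fluctuation h w \<omega> = (\<Sum>t = - int h..int h. cis (- (of_int t * w)) / of_real (2 * real h + 1) * of_real ((X t \<omega>)\<^sup>2 - cov t t))"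

lemma measurable_fluctuation [measurable]: "fluctuation h w \<in> borel_measurable M"
  unfolding fluctuation_def by measurable

text \<open>There are N = 2 h + 1 coefficients of modulus 1 / N, so that the quantity \<alpha>^2
  \<open>card T\<close> in the moment bound equals 1 / N.\<close>

lemma fluctuation_moment:
  assumes "p > 0"
  shows "integrable M (\<lambda>\<omega>. cmod (fluctuation h w \<omega>) ^ (2 * p))"
    "expectation (\<lambda>\<omega>. cmod (fluctuation h w \<omega>) ^ (2 * p)) \<le> 2 ^ Suc p * moment_bound p / (2 * real h + 1) ^ p"
proof -
  have c: "cmod (cis (- (of_int t * w)) / of_real (2 * real h + 1)) \<le> 1 / (2 * real h + 1)" for t :: int
    unfolding norm_divide norm_cis norm_of_real by simp
  show "integrable M (\<lambda>\<omega>. cmod (fluctuation h w \<omega>) ^ (2 * p))"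
    unfolding fluctuation_def by (rule quadratic_moment_complex(1)[OF _ assms c]) simp
  have "expectation (\<lambda>\<omega>. cmod (fluctuation h w \<omega>) ^ (2 * p)) \<le>
     2 ^ Suc p * moment_bound p * ((1 / (2 * real h + 1))\<^sup>2 * card {- int h..int h}) ^ p"
    unfolding fluctuation_def by (rule quadratic_moment_complex(2)[OF _ assms c]) simp
  also have "(1 / (2 * real h + 1))\<^sup>2 * card {- int h..int h} = 1 / (2 * real h + 1)"
    by (simp add: power2_eq_square)
  finally show "expectation (\<lambda>\<omega>. cmod (fluctuation h w \<omega>) ^ (2 * p)) \<le> 2 ^ Suc p * moment_bound p / (2 * real h + 1) ^ p"
    by (simp add: power_divide)
qed

lemma moment_bound_nonneg: "0 \<le> moment_bound p"
  by (simp add: moment_bound_def)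

text \<open>The factor |t| <= N from differentiating a phase is compensated by the normalisation 1 /
  N. Cancellation between the summands is given up.\<close>

lemma fluctuation_lipschitz:
  "cmod (fluctuation h v \<omega> - fluctuation h w \<omega>) \<le> \<bar>v - w\<bar> * (\<Sum>t = - int h..int h. \<bar>(X t \<omega>)\<^sup>2 - cov t t\<bar>)"
proof -
  have "cmod (fluctuation h v \<omega> - fluctuation h w \<omega>) \<le> (\<Sum>t = - int h..int h. \<bar>v - w\<bar> * \<bar>(X t \<omega>)\<^sup>2 - cov t t\<bar>)"
    unfolding fluctuation_def sum_subtractf[symmetric]
  proof (intro sum_norm_le)
    fix t assume t: "t \<in> {- int h..int h}"
    then have "\<bar>t\<bar> \<le> int h" by auto
    then have th: "\<bar>real_of_int t\<bar> \<le> 2 * real h + 1" by linarith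
    have "cis (- (of_int t * v)) / of_real (2 * real h + 1) * of_real ((X t \<omega>)\<^sup>2 - cov t t) - cis (- (of_int t * w)) / of_real (2 * real h + 1) * of_real ((X t \<omega>)\<^sup>2 - cov t t)
      = (cis (- (of_int t * v)) - cis (- (of_int t * w))) / of_real (2 * real h + 1) * of_real ((X t \<omega>)\<^sup>2 - cov t t)"
      by (simp only: diff_divide_distrib left_diff_distrib)
    also have "cmod \<dots> = cmod (cis (- (of_int t * v)) - cis (- (of_int t * w))) / (2 * real h + 1) * \<bar>(X t \<omega>)\<^sup>2 - cov t t\<bar>"
      unfolding norm_mult norm_divide norm_of_real by simp
    also have "\<dots> \<le> \<bar>v - w\<bar> * \<bar>(X t \<omega>)\<^sup>2 - cov t t\<bar>"
    proof (rule mult_right_mono)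
      have "cmod (cis (- (of_int t * v)) - cis (- (of_int t * w))) \<le> \<bar>- (of_int t * v) - - (of_int t * w)\<bar>"
        by (rule norm_cis_diff_le)
      also have "\<dots> = \<bar>of_int t\<bar> * \<bar>v - w\<bar>"
        by (simp add: abs_mult[symmetric] algebra_simps abs_minus_commute)
      also have "\<dots> \<le> (2 * real h + 1) * \<bar>v - w\<bar>" using th by (intro mult_right_mono) auto
      finally show "cmod (cis (- (of_int t * v)) - cis (- (of_int t * w))) / (2 * real h + 1) \<le> \<bar>v - w\<bar>"
        by (simp add: divide_le_eq mult.commute)
    qed simp
    finally show "cmod (cis (- (of_int t * v)) / of_real (2 * real h + 1) * of_real ((X t \<omega>)\<^sup>2 - cov t t) - cis (- (of_int t * w)) / of_real (2 * real h + 1) * of_real ((X t \<omega>)\<^sup>2 - cov t t))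
       \<le> \<bar>v - w\<bar> * \<bar>(X t \<omega>)\<^sup>2 - cov t t\<bar>" .
  qed
  then show ?thesis by (simp add: sum_distrib_left)
qed

lemma fluctuation_periodic: "fluctuation h (w + 2 * pi * of_int j) \<omega> = fluctuation h w \<omega>"
proof -
  have "cis (- (of_int t * (w + 2 * pi * of_int j))) = cis (- (of_int t * w))" for t
    using cis_int_periodic[of "- t" w j] by simp
  then show ?thesis by (simp add: fluctuation_def)
qed

text \<open>Controls the random Lipschitz constant of the fluctuation. Without cancellation it is of
  order N, still far below the N^2 that the net can afford.\<close>

lemma absolute_fluctuation_moment:
  assumes "p > 0"
  shows "integrable M (\<lambda>\<omega>. (\<Sum>t = - int h..int h. \<bar>(X t \<omega>)\<^sup>2 - cov t t\<bar>) ^ (2 * p))"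
    and "expectation (\<lambda>\<omega>. (\<Sum>t = - int h..int h. \<bar>(X t \<omega>)\<^sup>2 - cov t t\<bar>) ^ (2 * p)) \<le> moment_bound p * (2 * real h + 1) ^ (2 * p)"
proof -
  define N where "N = 2 * real h + 1"
  have N: "0 < N" and cN: "real (card {- int h..int h}) = N" by (simp_all add: N_def)
  have mom: "all_moments M (\<lambda>\<omega>. (X t \<omega>)\<^sup>2 - cov t t)" for t
    by (intro all_moments_intros all_moments_const all_moments_X)
  have le: "(\<Sum>t = - int h..int h. \<bar>(X t \<omega>)\<^sup>2 - cov t t\<bar>) ^ (2 * p) \<le> N ^ (2 * p - 1) * (\<Sum>t = - int h..int h. ((X t \<omega>)\<^sup>2 - cov t t) ^ (2 * p))" for \<omega>
    using power_sum_le[of "{- int h..int h}" "\<lambda>t. \<bar>(X t \<omega>)\<^sup>2 - cov t t\<bar>" "2 * p"] assms unfolding cN by (simp add: power_even_abs)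
  have int: "integrable M (\<lambda>\<omega>. N ^ (2 * p - 1) * (\<Sum>t = - int h..int h. ((X t \<omega>)\<^sup>2 - cov t t) ^ (2 * p)))"
    by (intro all_moments_integrable all_moments_intros all_moments_const all_moments_X)
  show i: "integrable M (\<lambda>\<omega>. (\<Sum>t = - int h..int h. \<bar>(X t \<omega>)\<^sup>2 - cov t t\<bar>) ^ (2 * p))"
    by (rule Bochner_Integration.integrable_bound[OF int]) (auto intro!: AE_I2 order_trans[OF le] order_trans[OF _ abs_ge_self])
  have "expectation (\<lambda>\<omega>. (\<Sum>t = - int h..int h. \<bar>(X t \<omega>)\<^sup>2 - cov t t\<bar>) ^ (2 * p)) \<le>
     expectation (\<lambda>\<omega>. N ^ (2 * p - 1) * (\<Sum>t = - int h..int h. ((X t \<omega>)\<^sup>2 - cov t t) ^ (2 * p)))"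
    by (rule integral_mono[OF i int le])
  also have "\<dots> = N ^ (2 * p - 1) * (\<Sum>t = - int h..int h. expectation (\<lambda>\<omega>. ((X t \<omega>)\<^sup>2 - cov t t) ^ (2 * p)))"
    by (subst integral_mult_right_zero, subst Bochner_Integration.integral_sum)
       (intro all_moments_integrable all_moments_intros all_moments_const all_moments_X refl)+
  also have "\<dots> \<le> N ^ (2 * p - 1) * (\<Sum>t = - int h..int h. moment_bound p)"
  proof (intro mult_left_mono sum_mono)
    fix t
    show "expectation (\<lambda>\<omega>. ((X t \<omega>)\<^sup>2 - cov t t) ^ (2 * p)) \<le> moment_bound p"
      using quadratic_moment[of "{t}" p "\<lambda>_. 1" 1] assms by simp
  qed (use N in auto)
  also have "\<dots> = N ^ (2 * p - 1) * (N * moment_bound p)" by (simp only: sum_constant cN)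
  also have "\<dots> = moment_bound p * N ^ (2 * p)"
    using assms by (cases p) simp_all
  finally show "expectation (\<lambda>\<omega>. (\<Sum>t = - int h..int h. \<bar>(X t \<omega>)\<^sup>2 - cov t t\<bar>) ^ (2 * p)) \<le> moment_bound p * (2 * real h + 1) ^ (2 * p)"
    by (simp add: N_def)
qed

lemma markov_power:
  assumes "integrable M (\<lambda>\<omega>. U \<omega> ^ p)" and [measurable]: "U \<in> borel_measurable M" and "\<And>\<omega>. 0 \<le> U \<omega>" "c > 0"
    and "expectation (\<lambda>\<omega>. U \<omega> ^ p) \<le> B"
  shows "prob {\<omega> \<in> space M. U \<omega> > c} \<le> B / c ^ p"
proof -
  have "prob {\<omega> \<in> space M. U \<omega> > c} \<le> prob {\<omega> \<in> space M. U \<omega> ^ p \<ge> c ^ p}"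
    using assms(4) by (intro finite_measure_mono) (auto intro!: power_mono)
  also have "\<dots> \<le> expectation (\<lambda>\<omega>. U \<omega> ^ p) / c ^ p"
    using assms by (intro integral_Markov_inequality_measure[where A = "{}"]) auto
  also have "\<dots> \<le> B / c ^ p" using assms by (intro divide_right_mono) auto
  finally show ?thesis .
qed

(* A net of N^2 points suffices, by periodicity and the crude Lipschitz bound. *)
lemma uniform_fluctuation_bound:
  assumes \<kappa>: "\<kappa> > 0"
  obtains C where "C \<ge> 0" "\<And>h. \<exists>G\<in>events. prob (space M - G) \<le> C / (2 * real h + 1) ^ 6 \<and>
     (\<forall>\<omega>\<in>G. \<forall>w. cmod (fluctuation h w \<omega>) \<le> \<kappa>)"
proof -
  \<comment> \<open>Moments of order 16, that is p = 8, give N^(-8) at each point; the N^2 points of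
    the net reduce this to N^(-6).\<close>
  define C1 where "C1 = 2 ^ 9 * moment_bound 8 / (\<kappa> / 2) ^ 16"
  define C2 where "C2 = moment_bound 8 / (\<kappa> / (4 * pi)) ^ 16"
  have C0: "0 \<le> C1" "0 \<le> C2" using \<kappa> moment_bound_nonneg[of 8] by (auto simp: C1_def C2_def)
  show thesis
  proof (rule that[of "C1 + C2"])
    show "0 \<le> C1 + C2" using C0 by simp
    fix h
    define N where "N = 2 * real h + 1"
    define K where "K = (2 * h + 1)\<^sup>2"
    have N: "1 \<le> N" and K: "real K = N\<^sup>2" "K > 0" by (simp_all add: N_def K_def)
    define v where "v j = 2 * pi * real j / N\<^sup>2" for j :: nat
    define U where "U \<omega> = (\<Sum>t = - int h..int h. \<bar>(X t \<omega>)\<^sup>2 - cov t t\<bar>)" for \<omega>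
    have [measurable]: "U \<in> borel_measurable M" unfolding U_def by measurable
    \<comment> \<open>The net has spacing 2 pi / N^2, so the bound \<kappa> N^2 / (4 pi) on the
      Lipschitz constant allows a change of at most \<kappa> / 2 between net points.\<close>
    define G where "G = {\<omega> \<in> space M. (\<forall>j<K. cmod (fluctuation h (v j) \<omega>) \<le> \<kappa> / 2) \<and> U \<omega> \<le> \<kappa> * N\<^sup>2 / (4 * pi)}"
    have [measurable]: "G \<in> events" unfolding G_def by measurable
    have "prob (space M - G) \<le> prob ((\<Union>j<K. {\<omega> \<in> space M. cmod (fluctuation h (v j) \<omega>) > \<kappa> / 2}) \<union> {\<omega> \<in> space M. U \<omega> > \<kappa> * N\<^sup>2 / (4 * pi)})"
      by (intro finite_measure_mono) (auto simp: G_def not_le)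
    also have "\<dots> \<le> prob (\<Union>j<K. {\<omega> \<in> space M. cmod (fluctuation h (v j) \<omega>) > \<kappa> / 2}) + prob {\<omega> \<in> space M. U \<omega> > \<kappa> * N\<^sup>2 / (4 * pi)}"
      by (intro measure_Un_le) auto
    also have "prob (\<Union>j<K. {\<omega> \<in> space M. cmod (fluctuation h (v j) \<omega>) > \<kappa> / 2}) \<le> (\<Sum>j<K. prob {\<omega> \<in> space M. cmod (fluctuation h (v j) \<omega>) > \<kappa> / 2})"
      by (intro measure_UNION_le) auto
    also have "\<dots> \<le> (\<Sum>j<K. (2 ^ Suc 8 * moment_bound 8 / N ^ 8) / (\<kappa> / 2) ^ (2 * 8))"
      using \<kappa> fluctuation_moment[of 8 h] by (intro sum_mono markov_power) (auto simp: N_def)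
    also have "\<dots> = C1 / N ^ 6"
    proof -
      have "N\<^sup>2 * (x / N ^ 8 / y) = x / y / N ^ 6" for x y
      proof -
        have *: "N ^ 8 = N\<^sup>2 * N ^ 6" by (simp flip: power_add)
        have "a * (x / (a * b) / y) = x / y / b" if "a \<noteq> 0" for a b :: real using that by simp
        moreover have "N\<^sup>2 \<noteq> 0" using N by simp
        ultimately show ?thesis unfolding * by blast
      qed
      moreover have "2 * 8 = (16 :: nat)" "Suc 8 = 9" by simp_all
      ultimately show ?thesis unfolding C1_def sum_constant card_lessThan K by metis
    qed
    also have "prob {\<omega> \<in> space M. U \<omega> > \<kappa> * N\<^sup>2 / (4 * pi)} \<le> moment_bound 8 * N ^ (2 * 8) / (\<kappa> * N\<^sup>2 / (4 * pi)) ^ (2 * 8)"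
      using \<kappa> absolute_fluctuation_moment[of 8 h] N by (intro markov_power) (auto simp: N_def U_def sum_nonneg)
    also have "\<dots> = C2 / N ^ 16"
    proof -
      have "(\<kappa> * N\<^sup>2 / (4 * pi)) ^ (2 * 8) = (\<kappa> / (4 * pi)) ^ 16 * (N ^ 16 * N ^ 16)"
        by (simp add: power_mult_distrib power_divide flip: power_add power_mult)
      moreover have "x * a / (y * (a * a)) = x / y / a" if "a \<noteq> 0" for x y a :: real using that by simp
      moreover have "N ^ 16 \<noteq> 0" "2 * 8 = (16 :: nat)" using N by simp_all
      ultimately show ?thesis unfolding C2_def by metis
    qed
    also have "\<dots> \<le> C2 / N ^ 6" using N C0 by (intro divide_left_mono power_increasing) auto
    finally have P: "prob (space M - G) \<le> (C1 + C2) / N ^ 6" by (simp add: add_divide_distrib)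
    have "cmod (fluctuation h w \<omega>) \<le> \<kappa>" if \<omega>: "\<omega> \<in> G" for \<omega> w
    proof -
      \<comment> \<open>The index of the grid point just below w on the whole line; periodicity
        moves it to one of the K points of the net.\<close>
      define i where "i = \<lfloor>w * N\<^sup>2 / (2 * pi)\<rfloor>"
      define j where "j = nat (i mod int K)"
      have jK: "j < K" using K by (simp add: j_def nat_less_iff)
      have i_eq: "i = int j + int K * (i div int K)" using K by (simp add: j_def)
      define z where "z = 2 * pi * of_int i / N\<^sup>2"
      have "z = v j + 2 * pi * of_int (i div int K)"
      proof -
        have "real_of_int i = real j + N\<^sup>2 * of_int (i div int K)"
          using arg_cong[OF i_eq, of real_of_int] by (simp add: K)
        then show ?thesis using N by (simp add: z_def v_def field_simps)
      qed
      then have 1: "cmod (fluctuation h z \<omega>) \<le> \<kappa> / 2"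
        using \<omega> jK by (simp add: fluctuation_periodic G_def)
      have "of_int i \<le> w * N\<^sup>2 / (2 * pi)" "w * N\<^sup>2 / (2 * pi) \<le> of_int i + 1"
        unfolding i_def by linarith+
      then have "z \<le> w" "w \<le> z + 2 * pi / N\<^sup>2" using N by (simp_all add: z_def field_simps)
      then have "\<bar>w - z\<bar> \<le> 2 * pi / N\<^sup>2" by simp
      then have "\<bar>w - z\<bar> * U \<omega> \<le> 2 * pi / N\<^sup>2 * (\<kappa> * N\<^sup>2 / (4 * pi))"
        using \<omega> by (intro mult_mono) (auto simp: G_def U_def sum_nonneg)
      also have "\<dots> = \<kappa> / 2" using N by (simp add: field_simps)
      finally have "cmod (fluctuation h w \<omega> - fluctuation h z \<omega>) \<le> \<kappa> / 2"
        using fluctuation_lipschitz[of h w \<omega> z] by (simp add: U_def)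
      then show ?thesis using 1 norm_triangle_sub[of "fluctuation h w \<omega>" "fluctuation h z \<omega>"] by linarith
    qed
    then show "\<exists>G\<in>events. prob (space M - G) \<le> (C1 + C2) / (2 * real h + 1) ^ 6 \<and> (\<forall>\<omega>\<in>G. \<forall>w. cmod (fluctuation h w \<omega>) \<le> \<kappa>)"
      using P by (intro bexI[of _ G]) (auto simp: N_def)
  qed
qed

section \<open>Second moments of bilinear forms\<close>

lemma sum_cov_le:
  assumes "finite T"
  shows "(\<Sum>s\<in>T. \<Sum>t\<in>T. \<bar>cov s t\<bar>) \<le> card T * \<Lambda>"
  using sum_mono[of T "\<lambda>s. \<Sum>t\<in>T. \<bar>cov s t\<bar>" "\<lambda>_. \<Lambda>"] cov_row_sum[OF assms] by simp

text \<open>Each of the two pairings between a pair of products factorises into two sums of |cov|,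
  and these are at most \<open>card T\<close> times \<Lambda>. With coefficients of order 1 / N on N
  indices the bound is of order one.\<close>

lemma bilinear_moment_real:
  fixes c :: "int \<times> int \<Rightarrow> real"
  assumes T: "finite T" and c: "\<And>i. i \<in> T \<times> T \<Longrightarrow> \<bar>c i\<bar> \<le> \<beta>"
  shows "expectation (\<lambda>\<omega>. (\<Sum>i\<in>T \<times> T. c i * (X (fst i) \<omega> * X (snd i) \<omega> - cov (fst i) (snd i)))\<^sup>2) \<le> 2 * \<beta>\<^sup>2 * (card T * \<Lambda>)\<^sup>2"
proof -
  let ?Y = "\<lambda>i \<omega>. X (fst i) \<omega> * X (snd i) \<omega> - cov (fst i) (snd i)"
  have int: "integrable M (\<lambda>\<omega>. c i * c j * (?Y i \<omega> * ?Y j \<omega>))" for i j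
    by (intro all_moments_integrable all_moments_intros all_moments_const all_moments_X)
  define A where "A = (\<Sum>s\<in>T. \<Sum>t\<in>T. \<bar>cov s t\<bar>)"
  have "expectation (\<lambda>\<omega>. (\<Sum>i\<in>T \<times> T. c i * ?Y i \<omega>)\<^sup>2) = expectation (\<lambda>\<omega>. \<Sum>i\<in>T \<times> T. \<Sum>j\<in>T \<times> T. c i * c j * (?Y i \<omega> * ?Y j \<omega>))"
    by (simp only: power2_eq_square sum_product mult_ac)
  also have "\<dots> = (\<Sum>i\<in>T \<times> T. \<Sum>j\<in>T \<times> T. c i * c j * expectation (\<lambda>\<omega>. ?Y i \<omega> * ?Y j \<omega>))"
  proof -
    have "expectation (\<lambda>\<omega>. \<Sum>i\<in>T \<times> T. \<Sum>j\<in>T \<times> T. c i * c j * (?Y i \<omega> * ?Y j \<omega>)) = (\<Sum>i\<in>T \<times> T. expectation (\<lambda>\<omega>. \<Sum>j\<in>T \<times> T. c i * c j * (?Y i \<omega> * ?Y j \<omega>)))"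
      by (rule Bochner_Integration.integral_sum) (intro Bochner_Integration.integrable_sum int)
    also have "\<dots> = (\<Sum>i\<in>T \<times> T. \<Sum>j\<in>T \<times> T. expectation (\<lambda>\<omega>. c i * c j * (?Y i \<omega> * ?Y j \<omega>)))"
      by (intro sum.cong refl Bochner_Integration.integral_sum int)
    finally show ?thesis by (simp only: integral_mult_right_zero)
  qed
  also have "\<dots> = (\<Sum>i\<in>T \<times> T. \<Sum>j\<in>T \<times> T. c i * c j * (cov (fst i) (fst j) * cov (snd i) (snd j) + cov (fst i) (snd j) * cov (snd i) (fst j)))"
    by (simp only: covariance_products)
  also have "\<dots> \<le> (\<Sum>i\<in>T \<times> T. \<Sum>j\<in>T \<times> T. \<beta> * \<beta> * (\<bar>cov (fst i) (fst j)\<bar> * \<bar>cov (snd i) (snd j)\<bar> + \<bar>cov (fst i) (snd j)\<bar> * \<bar>cov (snd i) (fst j)\<bar>))"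
  proof (intro sum_mono)
    fix i j assume ij: "i \<in> T \<times> T" "j \<in> T \<times> T"
    have "c i * c j * (cov (fst i) (fst j) * cov (snd i) (snd j) + cov (fst i) (snd j) * cov (snd i) (fst j)) \<le>
      \<bar>c i\<bar> * \<bar>c j\<bar> * \<bar>cov (fst i) (fst j) * cov (snd i) (snd j) + cov (fst i) (snd j) * cov (snd i) (fst j)\<bar>"
      by (simp flip: abs_mult)
    also have "\<dots> \<le> \<beta> * \<beta> * (\<bar>cov (fst i) (fst j)\<bar> * \<bar>cov (snd i) (snd j)\<bar> + \<bar>cov (fst i) (snd j)\<bar> * \<bar>cov (snd i) (fst j)\<bar>)"
      using c[OF ij(1)] c[OF ij(2)]
      by (intro mult_mono) (auto simp flip: abs_mult intro!: abs_triangle_ineq)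
    finally show "c i * c j * (cov (fst i) (fst j) * cov (snd i) (snd j) + cov (fst i) (snd j) * cov (snd i) (fst j)) \<le> \<beta> * \<beta> * (\<bar>cov (fst i) (fst j)\<bar> * \<bar>cov (snd i) (snd j)\<bar> + \<bar>cov (fst i) (snd j)\<bar> * \<bar>cov (snd i) (fst j)\<bar>)" .
  qed
  also have "\<dots> = \<beta> * \<beta> * (A * A + A * A)"
  proof -
    have 1: "(\<Sum>i\<in>T \<times> T. \<Sum>j\<in>T \<times> T. \<bar>cov (fst i) (fst j)\<bar> * \<bar>cov (snd i) (snd j)\<bar>) = A * A"
    proof -
      have "A * A = (\<Sum>s\<in>T. \<Sum>t\<in>T. (\<Sum>s'\<in>T. \<bar>cov s s'\<bar>) * (\<Sum>t'\<in>T. \<bar>cov t t'\<bar>))"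
        unfolding A_def sum_product ..
      also have "\<dots> = (\<Sum>s\<in>T. \<Sum>t\<in>T. \<Sum>s'\<in>T. \<Sum>t'\<in>T. \<bar>cov s s'\<bar> * \<bar>cov t t'\<bar>)"
        by (simp only: sum_product)
      finally show ?thesis by (simp add: sum.cartesian_product')
    qed
    have 2: "(\<Sum>i\<in>T \<times> T. \<Sum>j\<in>T \<times> T. \<bar>cov (fst i) (snd j)\<bar> * \<bar>cov (snd i) (fst j)\<bar>) = A * A"
    proof -
      have "A * A = (\<Sum>s\<in>T. \<Sum>t\<in>T. (\<Sum>s'\<in>T. \<bar>cov t s'\<bar>) * (\<Sum>t'\<in>T. \<bar>cov s t'\<bar>))"
        unfolding A_def sum_product by (subst sum.swap) (simp only: mult.commute)
      also have "\<dots> = (\<Sum>s\<in>T. \<Sum>t\<in>T. \<Sum>s'\<in>T. \<Sum>t'\<in>T. \<bar>cov t s'\<bar> * \<bar>cov s t'\<bar>)"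
        by (simp only: sum_product)
      finally show ?thesis by (simp add: sum.cartesian_product' mult.commute)
    qed
    show ?thesis unfolding sum_distrib_left[symmetric] sum.distrib 1 2 ..
  qed
  also have "\<dots> = 2 * \<beta>\<^sup>2 * A\<^sup>2" by (simp add: power2_eq_square)
  also have "\<dots> \<le> 2 * \<beta>\<^sup>2 * (card T * \<Lambda>)\<^sup>2"
    using sum_cov_le[OF T] by (intro mult_left_mono power_mono) (auto simp: A_def intro!: sum_nonneg)
  finally show ?thesis .
qed

lemma bilinear_moment:
  fixes c :: "int \<times> int \<Rightarrow> complex"
  assumes T: "finite T" and c: "\<And>i. i \<in> T \<times> T \<Longrightarrow> cmod (c i) \<le> \<beta>"
  shows "integrable M (\<lambda>\<omega>. (cmod (\<Sum>i\<in>T \<times> T. c i * of_real (X (fst i) \<omega> * X (snd i) \<omega> - cov (fst i) (snd i))))\<^sup>2)"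
    and "expectation (\<lambda>\<omega>. (cmod (\<Sum>i\<in>T \<times> T. c i * of_real (X (fst i) \<omega> * X (snd i) \<omega> - cov (fst i) (snd i))))\<^sup>2)
       \<le> 4 * \<beta>\<^sup>2 * (card T * \<Lambda>)\<^sup>2"
proof -
  define Q where "Q d \<omega> = (\<Sum>i\<in>T \<times> T. d i * (X (fst i) \<omega> * X (snd i) \<omega> - cov (fst i) (snd i)))" for d :: "int \<times> int \<Rightarrow> real" and \<omega>
  have eq: "(cmod (\<Sum>i\<in>T \<times> T. c i * of_real (X (fst i) \<omega> * X (snd i) \<omega> - cov (fst i) (snd i))))\<^sup>2 =
      (Q (\<lambda>i. Re (c i)) \<omega>)\<^sup>2 + (Q (\<lambda>i. Im (c i)) \<omega>)\<^sup>2" for \<omega>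
    by (simp add: cmod_power2 Q_def)
  have int: "integrable M (\<lambda>\<omega>. (Q d \<omega>)\<^sup>2)" for d
    unfolding Q_def by (intro all_moments_integrable all_moments_intros all_moments_const all_moments_X)
  show "integrable M (\<lambda>\<omega>. (cmod (\<Sum>i\<in>T \<times> T. c i * of_real (X (fst i) \<omega> * X (snd i) \<omega> - cov (fst i) (snd i))))\<^sup>2)"
    unfolding eq using int by simp
  have "expectation (\<lambda>\<omega>. (Q (\<lambda>i. Re (c i)) \<omega>)\<^sup>2) \<le> 2 * \<beta>\<^sup>2 * (card T * \<Lambda>)\<^sup>2" "expectation (\<lambda>\<omega>. (Q (\<lambda>i. Im (c i)) \<omega>)\<^sup>2) \<le> 2 * \<beta>\<^sup>2 * (card T * \<Lambda>)\<^sup>2"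
    unfolding Q_def using c by (auto intro!: bilinear_moment_real T intro: order_trans[OF abs_Re_le_cmod] order_trans[OF abs_Im_le_cmod])
  then show "expectation (\<lambda>\<omega>. (cmod (\<Sum>i\<in>T \<times> T. c i * of_real (X (fst i) \<omega> * X (snd i) \<omega> - cov (fst i) (snd i))))\<^sup>2)
       \<le> 4 * \<beta>\<^sup>2 * (card T * \<Lambda>)\<^sup>2"
    unfolding eq using int by simp
qed

text \<open>Because the first form is diagonal, both pairings coincide and tie the two indices of
  the second form to the same t. The sum collapses to squares of single row sums, so that \<alpha>
  and \<beta> of order 1 / N give O(1 / N), a factor N^(-1/2) better than Cauchy-Schwarz with the
  bounds above.\<close>

lemma bilinear_quadratic_covariance:
  fixes c :: "int \<times> int \<Rightarrow> complex" and a :: "int \<Rightarrow> real"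
  assumes T: "finite T" and c: "\<And>i. i \<in> T \<times> T \<Longrightarrow> cmod (c i) \<le> \<beta>" and a: "\<And>t. t \<in> T \<Longrightarrow> \<bar>a t\<bar> \<le> \<alpha>"
  shows "cmod (\<integral>\<omega>. of_real (\<Sum>t\<in>T. a t * ((X t \<omega>)\<^sup>2 - cov t t)) *
       (\<Sum>i\<in>T \<times> T. c i * of_real (X (fst i) \<omega> * X (snd i) \<omega> - cov (fst i) (snd i))) \<partial>M) \<le> 2 * \<alpha> * \<beta> * card T * \<Lambda>\<^sup>2"
proof -
  let ?Y = "\<lambda>i \<omega>. X (fst i) \<omega> * X (snd i) \<omega> - cov (fst i) (snd i)"
  have int: "integrable M (\<lambda>\<omega>. ((X t \<omega>)\<^sup>2 - cov t t) * ?Y i \<omega>)" for t i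
    by (intro all_moments_integrable all_moments_intros all_moments_const all_moments_X)
  have int': "integrable M (\<lambda>\<omega>. of_real (a t) * c i * of_real (((X t \<omega>)\<^sup>2 - cov t t) * ?Y i \<omega>))" for t i
    using int[of t i] by (intro integrable_mult_right integrable_of_real)
  have ev: "expectation (\<lambda>\<omega>. ((X t \<omega>)\<^sup>2 - cov t t) * ?Y i \<omega>) = 2 * cov t (fst i) * cov t (snd i)" for t i
    using covariance_products[of t t "fst i" "snd i"] by (simp add: power2_eq_square)
  have "(\<integral>\<omega>. of_real (\<Sum>t\<in>T. a t * ((X t \<omega>)\<^sup>2 - cov t t)) * (\<Sum>i\<in>T \<times> T. c i * of_real (?Y i \<omega>)) \<partial>M) =
     (\<integral>\<omega>. (\<Sum>t\<in>T. \<Sum>i\<in>T \<times> T. of_real (a t) * c i * of_real (((X t \<omega>)\<^sup>2 - cov t t) * ?Y i \<omega>)) \<partial>M)"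
    by (simp only: of_real_sum sum_product of_real_mult mult_ac)
  also have "\<dots> = (\<Sum>t\<in>T. \<Sum>i\<in>T \<times> T. of_real (a t) * c i * of_real (2 * cov t (fst i) * cov t (snd i)))"
  proof -
    have "(\<integral>\<omega>. (\<Sum>t\<in>T. \<Sum>i\<in>T \<times> T. of_real (a t) * c i * of_real (((X t \<omega>)\<^sup>2 - cov t t) * ?Y i \<omega>)) \<partial>M) =
      (\<Sum>t\<in>T. \<integral>\<omega>. (\<Sum>i\<in>T \<times> T. of_real (a t) * c i * of_real (((X t \<omega>)\<^sup>2 - cov t t) * ?Y i \<omega>)) \<partial>M)"
      by (rule Bochner_Integration.integral_sum) (intro Bochner_Integration.integrable_sum int')
    also have "\<dots> = (\<Sum>t\<in>T. \<Sum>i\<in>T \<times> T. \<integral>\<omega>. of_real (a t) * c i * of_real (((X t \<omega>)\<^sup>2 - cov t t) * ?Y i \<omega>) \<partial>M)"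
      by (intro sum.cong refl Bochner_Integration.integral_sum int')
    finally show ?thesis by (simp only: integral_mult_right_zero integral_complex_of_real ev)
  qed
  also have "cmod \<dots> \<le> (\<Sum>t\<in>T. \<Sum>i\<in>T \<times> T. \<alpha> * \<beta> * (2 * \<bar>cov t (fst i)\<bar> * \<bar>cov t (snd i)\<bar>))"
  proof (intro order_trans[OF norm_sum] sum_mono)
    fix t i assume ti: "t \<in> T" "i \<in> T \<times> T"
    have "cmod (of_real (a t) * c i * of_real (2 * cov t (fst i) * cov t (snd i))) = \<bar>a t\<bar> * cmod (c i) * (2 * \<bar>cov t (fst i)\<bar> * \<bar>cov t (snd i)\<bar>)"
      unfolding norm_mult norm_of_real abs_mult by simp
    also have "\<dots> \<le> \<alpha> * \<beta> * (2 * \<bar>cov t (fst i)\<bar> * \<bar>cov t (snd i)\<bar>)"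
      using a[OF ti(1)] c[OF ti(2)] by (intro mult_right_mono mult_mono) auto
    finally show "cmod (of_real (a t) * c i * of_real (2 * cov t (fst i) * cov t (snd i))) \<le> \<alpha> * \<beta> * (2 * \<bar>cov t (fst i)\<bar> * \<bar>cov t (snd i)\<bar>)" .
  qed
  also have "\<dots> = 2 * \<alpha> * \<beta> * (\<Sum>t\<in>T. (\<Sum>s\<in>T. \<bar>cov t s\<bar>) * (\<Sum>s\<in>T. \<bar>cov t s\<bar>))"
    by (simp only: sum_product sum.cartesian_product') (simp add: sum_distrib_left mult_ac)
  also have "\<dots> \<le> 2 * \<alpha> * \<beta> * (\<Sum>t\<in>T. \<Lambda> * \<Lambda>)"
  proof (cases "T = {}")
    case False
    then obtain t where t: "t \<in> T" by auto
    have "0 \<le> \<alpha>" "0 \<le> \<beta>" using order_trans[OF abs_ge_zero a[OF t]] order_trans[OF norm_ge_zero c[of "(t, t)"]] t by auto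
    then show ?thesis
      by (intro mult_left_mono sum_mono mult_mono cov_row_sum T Lambda_nonneg sum_nonneg) auto
  qed simp
  also have "\<dots> = 2 * \<alpha> * \<beta> * card T * \<Lambda>\<^sup>2" by (simp add: power2_eq_square)
  finally show ?thesis .
qed

end

section \<open>Maxima of the line statistic\<close>

lemma wrap_add_multiple:
  assumes "- pi < x" "x \<le> pi"
  shows "wrap (x + 2 * pi * of_int k) = x"
proof -
  have "\<lceil>(x + 2 * pi * of_int k - pi) / (2 * pi)\<rceil> = k"
  proof (rule ceiling_unique)
    show "of_int k - 1 < (x + 2 * pi * of_int k - pi) / (2 * pi)" "(x + 2 * pi * of_int k - pi) / (2 * pi) \<le> of_int k"
      using assms by (simp_all add: field_simps)
  qed
  then show ?thesis by (simp add: wrap_def)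
qed

lemma multiple_of_two_pi_zero:
  assumes "x + 2 * pi * of_int k \<in> {-pi..pi}" "\<bar>x\<bar> < pi"
  shows "k = 0"
proof -
  have "- pi \<le> x + 2 * pi * of_int k" "x + 2 * pi * of_int k \<le> pi" "- pi < x" "x < pi" using assms by auto
  then have "- 2 * pi < 2 * pi * of_int k" "2 * pi * of_int k < 2 * pi" by linarith+
  then have "2 * pi * (- 1) < 2 * pi * real_of_int k" "2 * pi * real_of_int k < 2 * pi * 1" by simp_all
  then have "- 1 < real_of_int k" "real_of_int k < 1" by (simp_all only: mult_less_cancel_left_pos[of "2 * pi"] pi_gt_zero zero_less_mult_iff zero_less_numeral simp_thms)
  then show ?thesis by linarith
qed

text \<open>A maximiser within \<epsilon> of b is retained: by \<epsilon> + l <= r its block and all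
  competitors within l stay in the range where m is the largest value. Hence the location chosen
  closest to b is also within \<epsilon> of b. It lies within 2 \<epsilon> <= l of a maximiser and
  was itself retained, so it has the maximal value as well.\<close>

lemma selected_location:
  fixes X :: "int \<Rightarrow> 'a \<Rightarrow> real" and c :: "nat \<Rightarrow> real" and n :: nat and \<omega> :: 'a
  defines "st \<equiv> line_statistic X n \<omega>" and "l \<equiv> c n / real n"
  assumes per: "\<And>x k. st (x + 2 * pi * of_int k) = st x" and even: "\<And>x. st (- x) = st x"
    and cont: "continuous_on UNIV st"
    and b: "- pi < b" "b \<le> pi" and \<epsilon>: "0 < \<epsilon>" "\<epsilon> < r" "r < pi" "2 * \<epsilon> \<le> l" "\<epsilon> + l \<le> r"
    and b\<epsilon>: "b \<noteq> pi \<Longrightarrow> \<bar>b\<bar> < pi - \<epsilon>"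
    and away: "\<And>x. \<epsilon> < \<bar>x\<bar> \<Longrightarrow> \<bar>x\<bar> \<le> r \<Longrightarrow> st (b + x) < st b"
    and thr: "\<delta> + (ln (real n) / real n) powr (1 / 4) < st b"
    and w: "w \<in> {-pi..pi}"
    and sel: "retained_maxima X c \<delta> n \<omega> \<noteq> {} \<Longrightarrow> is_arg_min (\<lambda>v. \<bar>ydiff b v\<bar>) (\<lambda>v. v \<in> retained_maxima X c \<delta> n \<omega>) w"
  obtains x k where "\<bar>x\<bar> \<le> \<epsilon>" "w = b + x + 2 * pi * of_int k" "\<And>x'. \<bar>x'\<bar> \<le> r \<Longrightarrow> st (b + x') \<le> st (b + x)"
proof -
  have l: "l > 0" using \<epsilon> by simp
  have "continuous_on {-\<epsilon>..\<epsilon>} (\<lambda>x. st (b + x))"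
    by (rule continuous_on_compose2[OF cont]) (auto intro!: continuous_intros)
  moreover have "{-\<epsilon>..\<epsilon>} \<noteq> {}" using \<epsilon>(1) by simp
  ultimately obtain x0 where "x0 \<in> {-\<epsilon>..\<epsilon>}" "\<forall>x\<in>{-\<epsilon>..\<epsilon>}. st (b + x) \<le> st (b + x0)"
    using continuous_attains_sup[of "{-\<epsilon>..\<epsilon>}" "\<lambda>x. st (b + x)"] by blast
  then have x0: "\<bar>x0\<bar> \<le> \<epsilon>" "\<And>x. \<bar>x\<bar> \<le> \<epsilon> \<Longrightarrow> st (b + x) \<le> st (b + x0)"
    by (simp_all add: abs_le_iff)
  define m where "m = st (b + x0)"
  have mb: "st b \<le> m" using x0(2)[of 0] \<epsilon> by (simp add: m_def)
  have maxm: "st (b + x) \<le> m" if "\<bar>x\<bar> \<le> r" for x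
    using x0(2)[of x] away[of x] mb that by (cases "\<bar>x\<bar> \<le> \<epsilon>") (auto simp: m_def)
  have near: "st v \<le> m" if "v = b + x + 2 * pi * of_int k" "\<bar>x\<bar> \<le> r" for v x k
    using maxm[OF that(2)] by (simp add: that(1) per)
  have inB: "v \<in> block_maxima X c \<delta> n \<omega>" and inR: "v \<in> retained_maxima X c \<delta> n \<omega>"
    if v: "v \<in> {-pi..pi}" "st v = m" "v = b + x + 2 * pi * of_int k" "\<bar>x\<bar> \<le> \<epsilon>" for v x k
  proof -
    have le: "st u \<le> m" if "\<bar>u - v\<bar> \<le> l" for u
    proof (rule near[of u "x + (u - v)" k])
      show "u = b + (x + (u - v)) + 2 * pi * of_int k" using v(3) by simp
      show "\<bar>x + (u - v)\<bar> \<le> r" using v(4) that \<epsilon>(5) by linarith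
    qed
    \<comment> \<open>A point on a common boundary is assigned to the block on its left; at v = -pi
      the index -1 is truncated to 0, which is the right block.\<close>
    define j where "j = nat (\<lceil>(v + pi) / l\<rceil> - 1)"
    define B where "B = {-pi + real j * l..min pi (-pi + (real j + 1) * l)}"
    have "-pi + real j * l < pi \<and> -pi + real j * l \<le> v \<and> v \<le> -pi + (real j + 1) * l"
    proof (cases "v = -pi")
      case True
      then show ?thesis using l by (simp add: j_def)
    next
      case False
      then have "0 < (v + pi) / l" using v l by simp
      then have "0 < \<lceil>(v + pi) / l\<rceil>" by simp
      then have "real j = of_int \<lceil>(v + pi) / l\<rceil> - 1" by (simp add: j_def)
      then have "real j < (v + pi) / l" "(v + pi) / l \<le> real j + 1" by linarith+
      then have "real j * l < v + pi" "v + pi \<le> (real j + 1) * l" using l by (simp_all add: field_simps)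
      then show ?thesis using v by auto
    qed
    then have B: "B \<in> blocks c n" "v \<in> B"
      using v(1) by (auto simp: blocks_def B_def l_def[symmetric])
    have "\<bar>u - v\<bar> \<le> l" if "u \<in> B" for u
      using that B(2) l by (auto simp: B_def algebra_simps)
    then have "is_arg_max st (\<lambda>u. u \<in> B) v"
      using B(2) le v(2) by (auto simp: is_arg_max_def not_less)
    then show vB: "v \<in> block_maxima X c \<delta> n \<omega>"
      using B(1) thr mb v(2) unfolding block_maxima_def st_def by auto
    show "v \<in> retained_maxima X c \<delta> n \<omega>"
      using vB le v(2) unfolding retained_maxima_def st_def l_def by auto
  qed
  define w0 where "w0 = wrap (b + x0)"
  obtain k0 where w0: "w0 = b + x0 + 2 * pi * of_int k0"
  proof
    show "w0 = b + x0 + 2 * pi * of_int (- \<lceil>(b + x0 - pi) / (2 * pi)\<rceil>)"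
      by (simp add: w0_def wrap_def)
  qed
  have w0m: "st w0 = m" by (simp add: w0 per m_def)
  have w0b: "w0 \<in> {-pi..pi}" using wrap_bounds[of "b + x0"] by (auto simp: w0_def)
  have w0R: "w0 \<in> retained_maxima X c \<delta> n \<omega>" by (rule inR[OF w0b w0m w0 x0(1)])
  then have arg: "is_arg_min (\<lambda>v. \<bar>ydiff b v\<bar>) (\<lambda>v. v \<in> retained_maxima X c \<delta> n \<omega>) w"
    using sel by blast
  have wR: "w \<in> retained_maxima X c \<delta> n \<omega>" using arg by (simp add: is_arg_min_def)
  have "ydiff b w0 = - x0"
    using wrap_add_multiple[of "- x0" "- k0"] x0(1) \<epsilon> by (simp add: ydiff_def w0)
  moreover have "\<bar>ydiff b w\<bar> \<le> \<bar>ydiff b w0\<bar>"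
    using arg w0R by (auto simp: is_arg_min_def not_less)
  ultimately have yw: "\<bar>ydiff b w\<bar> \<le> \<epsilon>" using x0(1) by simp
  define x where "x = - ydiff b w"
  have x: "\<bar>x\<bar> \<le> \<epsilon>" using yw by (simp add: x_def)
  obtain k where wk: "w = b + x + 2 * pi * of_int k"
  proof
    show "w = b + x + 2 * pi * of_int (- \<lceil>(b - w - pi) / (2 * pi)\<rceil>)"
      by (simp add: x_def ydiff_def wrap_def)
  qed
  \<comment> \<open>The rule that discards the smaller of two nearby maxima is used here: surviving
    next to v means being at least as large as v.\<close>
  have close: "st w = m" if "v \<in> block_maxima X c \<delta> n \<omega>" "st v = m" "\<bar>v - w\<bar> \<le> l" for v
  proof -
    have "st v \<le> st w" using wR that unfolding retained_maxima_def st_def l_def by auto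
    moreover have "st w \<le> m" using near[OF wk] x \<epsilon> by simp
    ultimately show ?thesis using that by simp
  qed
  have wm: "st w = m"
  proof (cases "k = k0")
    case True
    then have "\<bar>w0 - w\<bar> \<le> l" using wk w0 x x0(1) \<epsilon> by simp
    then show ?thesis using close[OF inB[OF w0b w0m w0 x0(1)] w0m] by simp
  next
    case False
    have bpi: "b = pi"
    proof (rule ccontr)
      assume "b \<noteq> pi"
      then have "\<bar>b + x\<bar> < pi" "\<bar>b + x0\<bar> < pi" using b\<epsilon> x x0(1) by auto
      then have "k = 0" "k0 = 0"
        using multiple_of_two_pi_zero[of "b + x" k] multiple_of_two_pi_zero[of "b + x0" k0] w w0b wk w0 by auto
      then show False using False by simp
    qed
    have pm: "j = 0 \<or> j = - 1" if "pi + z + 2 * pi * of_int j \<in> {-pi..pi}" "\<bar>z\<bar> \<le> \<epsilon>" for j :: int and z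
    proof -
      have "- pi \<le> pi + z + 2 * pi * of_int j" "pi + z + 2 * pi * of_int j \<le> pi" "- pi < z" "z < pi"
        using that \<epsilon> by auto
      then have "2 * pi * (- 3 / 2) < 2 * pi * real_of_int j" "2 * pi * real_of_int j < 2 * pi * (1 / 2)" by linarith+
      then have "- 3 / 2 < real_of_int j" "real_of_int j < 1 / 2"
        by (simp_all only: mult_less_cancel_left_pos[of "2 * pi"] pi_gt_zero zero_less_mult_iff zero_less_numeral simp_thms)
      then show ?thesis by linarith
    qed
    have k: "k = 0 \<or> k = - 1" "k0 = 0 \<or> k0 = - 1"
      using pm[of x k] pm[of x0 k0] w w0b x x0(1) by (simp_all add: wk w0 bpi)
    \<comment> \<open>For b = pi the points near b lie at both ends of [-pi, pi], but
      \<open>retained_maxima\<close> measures ordinary distance. When w and w0 sit at opposite ends,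
      evenness of the statistic makes -w0 a maximiser at the end where w is.\<close>
    define v where "v = - w0"
    have v: "v = b + (- x0) + 2 * pi * of_int (- 1 - k0)" by (simp add: v_def w0 bpi algebra_simps)
    have vb: "v \<in> {-pi..pi}" using w0b by (auto simp: v_def)
    have vm: "st v = m" by (simp add: v_def even w0m)
    have "k = - 1 - k0" using k False by auto
    then have "\<bar>v - w\<bar> \<le> l" using x x0(1) \<epsilon> by (simp add: v wk)
    then show ?thesis using close[OF inB[OF vb vm v]] vm x0(1) by simp
  qed
  show thesis
  proof (rule that[OF x wk])
    fix x' assume "\<bar>x'\<bar> \<le> r"
    then have "st (b + x') \<le> m" by (rule maxm)
    then show "st (b + x') \<le> st (b + x)" using wm by (simp add: wk per)
  qed
qed

text \<open>The squared modulus is differentiable even where the modulus is not, and half its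
  derivative is the real part in question.\<close>

lemma critical_point_of_modulus:
  fixes x :: "'i \<Rightarrow> complex" and \<theta> :: "'i \<Rightarrow> real" and I :: "'i set" and d :: real
  defines "\<phi> \<equiv> \<lambda>u. \<Sum>i\<in>I. x i * cis (- (\<theta> i * u))"
    and "\<phi>' \<equiv> \<lambda>u. \<Sum>i\<in>I. - \<i> * of_real (\<theta> i) * (x i * cis (- (\<theta> i * u)))"
  assumes d0: "0 < d" and max: "\<And>v. \<bar>u - v\<bar> < d \<Longrightarrow> cmod (\<phi> v) \<le> cmod (\<phi> u)"
  shows "Re (cnj (\<phi> u) * \<phi>' u) = 0"
proof -
  have "(\<phi> has_vector_derivative \<phi>' u) (at u)"
    unfolding \<phi>_def \<phi>'_def
  proof (intro has_vector_derivative_sum)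
    fix i
    have "((\<lambda>u. cis (- (\<theta> i * u))) has_vector_derivative - \<i> * of_real (\<theta> i) * cis (- (\<theta> i * u))) (at u)"
      unfolding has_vector_derivative_def
      by (auto intro!: derivative_eq_intros simp: fun_eq_iff scaleR_conv_of_real)
    from has_vector_derivative_mult_right[OF this, of "x i"]
    show "((\<lambda>u. x i * cis (- (\<theta> i * u))) has_vector_derivative - \<i> * of_real (\<theta> i) * (x i * cis (- (\<theta> i * u)))) (at u)"
      by (simp add: mult_ac)
  qed
  then have d: "((\<lambda>u. Re (\<phi> u)) has_real_derivative Re (\<phi>' u)) (at u)" "((\<lambda>u. Im (\<phi> u)) has_real_derivative Im (\<phi>' u)) (at u)"
    unfolding has_real_derivative_iff_has_vector_derivative
    by (auto intro: bounded_linear.has_vector_derivative[OF bounded_linear_Re] bounded_linear.has_vector_derivative[OF bounded_linear_Im])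
  have "((\<lambda>u. (Re (\<phi> u))\<^sup>2 + (Im (\<phi> u))\<^sup>2) has_real_derivative 2 * (Re (\<phi> u) * Re (\<phi>' u) + Im (\<phi> u) * Im (\<phi>' u))) (at u)"
    using DERIV_add[OF DERIV_power[OF d(1), of 2] DERIV_power[OF d(2), of 2]] by (simp add: algebra_simps)
  moreover have "\<forall>v. \<bar>u - v\<bar> < d \<longrightarrow> (Re (\<phi> v))\<^sup>2 + (Im (\<phi> v))\<^sup>2 \<le> (Re (\<phi> u))\<^sup>2 + (Im (\<phi> u))\<^sup>2"
    unfolding cmod_power2[symmetric] using max by (auto intro!: power_mono)
  ultimately have "2 * (Re (\<phi> u) * Re (\<phi>' u) + Im (\<phi> u) * Im (\<phi>' u)) = 0"
    using d0 by (intro DERIV_local_max) auto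
  then show ?thesis by simp
qed

(* Here S = \<sigma> G + P is the statistic near a line, G the normalised Dirichlet kernel and P the
   perturbation; the leading term of the location u of the maximum is linear in P'(0). *)
lemma critical_expansion:
  fixes \<sigma> P P' P0 :: complex
  assumes crit: "Re (cnj (\<sigma> * of_real G + P) * (\<sigma> * of_real G' + P')) = 0"
    and \<sigma>: "\<sigma> \<noteq> 0" and u: "\<bar>u\<bar> \<le> 1" and G: "\<bar>1 - G\<bar> \<le> u\<^sup>2 / 8"
    and G': "\<bar>G' + g * u\<bar> \<le> g * \<bar>u\<bar> ^ 3 / 24" and g: "1 / 20 \<le> g" "g \<le> 1 / 4"
    and P: "cmod P \<le> cmod \<sigma> / 4" "cmod P \<le> e" "cmod P' \<le> e" "cmod (P' - P0) \<le> e * \<bar>u\<bar> + \<tau>" and \<tau>: "0 \<le> \<tau>"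
  shows "\<bar>u\<bar> \<le> 53 * e / cmod \<sigma>"
    and "\<bar>u - Re (cnj \<sigma> * P0) / ((cmod \<sigma>)\<^sup>2 * g)\<bar> \<le> 20 / (cmod \<sigma>)\<^sup>2 * (5000 * e\<^sup>2 + cmod \<sigma> * \<tau>)"
proof -
  define s where "s = cmod \<sigma>"
  have s: "s > 0" using \<sigma> by (simp add: s_def)
  have e: "0 \<le> e" using order_trans[OF norm_ge_zero P(2)] .
  have u2: "u\<^sup>2 \<le> \<bar>u\<bar>"
  proof -
    have "\<bar>u\<bar> * \<bar>u\<bar> \<le> 1 * \<bar>u\<bar>" using u by (intro mult_right_mono) auto
    then show ?thesis by (simp add: power2_eq_square)
  qed
  have u3: "\<bar>u\<bar> ^ 3 \<le> u\<^sup>2"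
  proof -
    have "\<bar>u\<bar> ^ 3 = \<bar>u\<bar> * \<bar>u\<bar>\<^sup>2" by (simp add: power3_eq_cube power2_eq_square)
    also have "\<dots> \<le> 1 * \<bar>u\<bar>\<^sup>2" using u by (intro mult_right_mono) auto
    finally show ?thesis by simp
  qed
  have G78: "7 / 8 \<le> G" "\<bar>G\<bar> \<le> 9 / 8"
    using G u2 u by linarith+
  have dG': "\<bar>G' + g * u\<bar> \<le> g * \<bar>u\<bar> / 24"
  proof -
    have "g * \<bar>u\<bar> ^ 3 \<le> g * \<bar>u\<bar>" using g u2 u3 by (intro mult_left_mono) auto
    then show ?thesis using G' by linarith
  qed
  have gu: "\<bar>g * u\<bar> = g * \<bar>u\<bar>" using g by (simp add: abs_mult)
  have gu20: "\<bar>u\<bar> / 20 \<le> g * \<bar>u\<bar>" "g * \<bar>u\<bar> \<le> \<bar>u\<bar> / 4"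
    using mult_right_mono[OF g(1), of "\<bar>u\<bar>"] mult_right_mono[OF g(2), of "\<bar>u\<bar>"] by auto
  have G'lo: "\<bar>u\<bar> / 24 \<le> \<bar>G'\<bar>" using dG' gu gu20 by linarith
  have G'hi: "\<bar>G'\<bar> \<le> \<bar>u\<bar>" using dG' gu gu20 by linarith
  define r1 where "r1 = Re (cnj \<sigma> * P')"
  define r2 where "r2 = Re (cnj P * \<sigma>)"
  define r3 where "r3 = Re (cnj P * P')"
  define r0 where "r0 = Re (cnj \<sigma> * P0)"
  have r1: "\<bar>r1\<bar> \<le> s * e"
    unfolding r1_def s_def using P(3) by (intro order_trans[OF abs_Re_le_cmod]) (simp add: norm_mult mult_left_mono)
  have r2: "\<bar>r2\<bar> \<le> cmod P * s"
    unfolding r2_def s_def by (intro order_trans[OF abs_Re_le_cmod]) (simp add: norm_mult)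
  have r3: "\<bar>r3\<bar> \<le> cmod P * e"
    unfolding r3_def using P(3) by (intro order_trans[OF abs_Re_le_cmod]) (simp add: norm_mult mult_left_mono)
  have r10: "\<bar>r1 - r0\<bar> \<le> s * (e * \<bar>u\<bar> + \<tau>)"
  proof -
    have "r1 - r0 = Re (cnj \<sigma> * (P' - P0))" by (simp add: r1_def r0_def right_diff_distrib)
    then show ?thesis
      using P(4) by (simp only:) (intro order_trans[OF abs_Re_le_cmod], simp add: norm_mult mult_left_mono s_def)
  qed
  have eq: "s\<^sup>2 * G * G' + G * r1 + G' * r2 + r3 = 0"
  proof -
    have "s\<^sup>2 = Re \<sigma> * Re \<sigma> + Im \<sigma> * Im \<sigma>" unfolding s_def cmod_power2 by (simp add: power2_eq_square)
    then show ?thesis using crit unfolding r1_def r2_def r3_def by (simp add: algebra_simps)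
  qed
  have "s\<^sup>2 * (7 / 8) * \<bar>G'\<bar> \<le> s\<^sup>2 * G * \<bar>G'\<bar>"
    using G78 by (intro mult_right_mono mult_left_mono) auto
  also have "s\<^sup>2 * G * \<bar>G'\<bar> = \<bar>s\<^sup>2 * G * G'\<bar>" using G78 by (simp add: abs_mult)
  also have "s\<^sup>2 * G * G' = - (G * r1) - G' * r2 - r3" using eq by simp
  also have "\<bar>- (G * r1) - G' * r2 - r3\<bar> \<le> \<bar>G\<bar> * \<bar>r1\<bar> + \<bar>G'\<bar> * \<bar>r2\<bar> + \<bar>r3\<bar>"
    unfolding abs_mult[symmetric] by linarith
  also have "\<dots> \<le> 9 / 8 * (s * e) + \<bar>G'\<bar> * (s / 4 * s) + s / 4 * e"
    using G78 r1 r2 r3 P(1) e s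
    by (intro add_mono mult_mono order_trans[OF r2] order_trans[OF r3] mult_left_mono) (auto simp: s_def mult_right_mono)
  finally have "s\<^sup>2 * (5 / 8) * \<bar>G'\<bar> \<le> 11 / 8 * (s * e)" by (simp add: power2_eq_square algebra_simps)
  then have "s * (s * (5 / 8) * \<bar>G'\<bar>) \<le> s * (11 / 8 * e)" by (simp add: power2_eq_square algebra_simps)
  then have "s * (5 / 8) * \<bar>G'\<bar> \<le> 11 / 8 * e" using s by (simp only: mult_le_cancel_left_pos)
  moreover have "s * (\<bar>u\<bar> / 24) \<le> s * \<bar>G'\<bar>" using s G'lo by (intro mult_left_mono) auto
  \<comment> \<open>The critical equation has given (7/8 - 1/4) s |G'| <= (9/8 + 1/4) e, that is s
    |G'| <= (11/5) e. With |u| <= 24 |G'| the constant is 24 * 11/5 < 53.\<close>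
  ultimately have su: "s * \<bar>u\<bar> \<le> 53 * e" using e by (simp add: algebra_simps)
  then show "\<bar>u\<bar> \<le> 53 * e / cmod \<sigma>" using s by (simp add: s_def field_simps)
  define A where "A = s * \<bar>u\<bar>"
  have A: "0 \<le> A" "A \<le> 53 * e" using s su by (auto simp: A_def)
  have b1: "s\<^sup>2 * \<bar>G' + g * u\<bar> \<le> A\<^sup>2 / 96"
  proof -
    have "g * \<bar>u\<bar> ^ 3 \<le> 1 / 4 * u\<^sup>2" using g u3 by (intro mult_mono) auto
    then have "\<bar>G' + g * u\<bar> \<le> u\<^sup>2 / 96" using G' by linarith
    then have "s\<^sup>2 * \<bar>G' + g * u\<bar> \<le> s\<^sup>2 * (u\<^sup>2 / 96)" by (intro mult_left_mono) auto
    then show ?thesis by (simp add: A_def power_mult_distrib)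
  qed
  have G1: "\<bar>G - 1\<bar> \<le> \<bar>u\<bar> / 8" using G u2 by linarith
  have b2: "s\<^sup>2 * \<bar>G' * (G - 1)\<bar> \<le> A\<^sup>2 / 8"
  proof -
    have "\<bar>G' * (G - 1)\<bar> \<le> \<bar>u\<bar> * (\<bar>u\<bar> / 8)" unfolding abs_mult using G'hi G1 by (intro mult_mono) auto
    then have "s\<^sup>2 * \<bar>G' * (G - 1)\<bar> \<le> s\<^sup>2 * (\<bar>u\<bar> * (\<bar>u\<bar> / 8))" by (intro mult_left_mono) auto
    then show ?thesis by (simp add: A_def power2_eq_square mult_ac)
  qed
  have b3: "\<bar>(G - 1) * r1\<bar> \<le> A * e / 8"
  proof -
    have "\<bar>(G - 1) * r1\<bar> \<le> \<bar>u\<bar> / 8 * (s * e)" unfolding abs_mult using G1 r1 by (intro mult_mono) auto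
    then show ?thesis by (simp add: A_def mult_ac)
  qed
  have b4: "\<bar>r1 - r0\<bar> \<le> A * e + s * \<tau>" using r10 by (simp add: A_def algebra_simps)
  have b5: "\<bar>G' * r2\<bar> \<le> A * e"
  proof -
    have "\<bar>G' * r2\<bar> \<le> \<bar>u\<bar> * (e * s)" unfolding abs_mult
      using G'hi order_trans[OF r2 mult_right_mono[OF P(2)]] s by (intro mult_mono) auto
    then show ?thesis by (simp add: A_def mult_ac)
  qed
  have b6: "\<bar>r3\<bar> \<le> e * e" using order_trans[OF r3 mult_right_mono[OF P(2) e]] .
  have "s\<^sup>2 * g * u - r0 = s\<^sup>2 * (G' + g * u) + s\<^sup>2 * (G' * (G - 1)) + (G - 1) * r1 + (r1 - r0) + G' * r2 + r3"
    using eq by (simp add: algebra_simps)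
  also have "\<bar>\<dots>\<bar> \<le> s\<^sup>2 * \<bar>G' + g * u\<bar> + s\<^sup>2 * \<bar>G' * (G - 1)\<bar> + \<bar>(G - 1) * r1\<bar> + \<bar>r1 - r0\<bar> + \<bar>G' * r2\<bar> + \<bar>r3\<bar>"
    by (intro order_trans[OF abs_triangle_ineq] add_mono order_refl) (simp_all add: abs_mult)
  also have "\<dots> \<le> A\<^sup>2 / 96 + A\<^sup>2 / 8 + A * e / 8 + (A * e + s * \<tau>) + A * e + e * e"
    by (intro add_mono b1 b2 b3 b4 b5 b6)
  \<comment> \<open>Inserting A <= 53 e makes all products multiples of e^2; they add up to less
    than 500 e^2, so 5000 is a generous choice.\<close>
  also have "\<dots> \<le> 5000 * e\<^sup>2 + s * \<tau>"
  proof -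
    have "A\<^sup>2 \<le> (53 * e)\<^sup>2" using A by (intro power_mono) auto
    then have "A\<^sup>2 \<le> 2809 * e\<^sup>2" by (simp add: power_mult_distrib)
    moreover have "A * e \<le> 53 * e\<^sup>2" using mult_right_mono[OF A(2) e] by (simp add: power2_eq_square)
    moreover have "e * e = e\<^sup>2" by (simp add: power2_eq_square)
    ultimately show ?thesis using zero_le_power2[of e] by linarith
  qed
  finally have fin: "\<bar>s\<^sup>2 * g * u - r0\<bar> \<le> 5000 * e\<^sup>2 + s * \<tau>" .
  have sg: "s\<^sup>2 * g > 0" using s g by simp
  have "\<bar>u - r0 / (s\<^sup>2 * g)\<bar> = \<bar>s\<^sup>2 * g * u - r0\<bar> / (s\<^sup>2 * g)"
  proof -
    have "u - r0 / (s\<^sup>2 * g) = (s\<^sup>2 * g * u - r0) / (s\<^sup>2 * g)" using s g by (simp add: field_simps)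
    then show ?thesis using sg by simp
  qed
  also have "\<dots> \<le> (5000 * e\<^sup>2 + s * \<tau>) / (s\<^sup>2 * (1 / 20))"
    using fin s g by (intro frac_le mult_left_mono) auto
  finally show "\<bar>u - Re (cnj \<sigma> * P0) / ((cmod \<sigma>)\<^sup>2 * g)\<bar> \<le> 20 / (cmod \<sigma>)\<^sup>2 * (5000 * e\<^sup>2 + cmod \<sigma> * \<tau>)"
    by (simp add: s_def r0_def mult_ac)
qed

section \<open>The statistics as bilinear forms in the data\<close>

lemma even_index: 
  assumes "n = 2 * h"
  shows "int (n div 2) = int h" "real n + 1 = 2 * real h + 1"
  using assms by auto

definition kernel_coeff :: "(real \<Rightarrow> real) \<Rightarrow> int \<Rightarrow> complex" where
  "kernel_coeff g k = integral {-pi..pi} (\<lambda>\<mu>. cis (- (of_int k * \<mu>)) * of_real (g \<mu>))"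

text \<open>Serves both statistics: g = 1 gives the line statistic before taking the modulus, and g
  the shifted kernel gives the spectral estimate.\<close>

lemma weighted_periodogram:
  fixes X :: "int \<Rightarrow> 'a \<Rightarrow> real"
  assumes n: "n = 2 * h" and g: "continuous_on {-pi..pi} g"
  shows "integral {-pi..pi} (\<lambda>\<mu>. bi_periodogram X n (\<mu> + w) \<mu> \<omega> * of_real (g \<mu>)) =
    (\<Sum>i\<in>{- int h..int h} \<times> {- int h..int h}. of_real (1 / (2 * pi * (2 * real h + 1))) * cis (- (of_int (fst i) * w)) *
       kernel_coeff g (fst i - snd i) * of_real (X (fst i) \<omega> * X (snd i) \<omega>))"
proof -
  let ?T = "{- int h..int h}"
  define c where "c = complex_of_real (1 / (2 * pi * (2 * real h + 1)))"
  have "bi_periodogram X n (\<mu> + w) \<mu> \<omega> * of_real (g \<mu>) =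
     (\<Sum>i\<in>?T \<times> ?T. c * cis (- (of_int (fst i) * w)) * of_real (X (fst i) \<omega> * X (snd i) \<omega>) * (cis (- (of_int (fst i - snd i) * \<mu>)) * of_real (g \<mu>)))" for \<mu>
  proof -
    have "bi_periodogram X n (\<mu> + w) \<mu> \<omega> * of_real (g \<mu>) =
      (\<Sum>s\<in>?T. of_real (X s \<omega>) * cis (- (of_int s * (\<mu> + w)))) * (\<Sum>t\<in>?T. of_real (X t \<omega>) * cis (of_int t * \<mu>)) * c * of_real (g \<mu>)"
    proof -
      have "cnj (finite_fourier X n \<mu> \<omega>) = (\<Sum>t\<in>?T. of_real (X t \<omega>) * cis (of_int t * \<mu>))"
        unfolding finite_fourier_def even_index(1)[OF n] by (simp add: cis_cnj)
      moreover have "finite_fourier X n (\<mu> + w) \<omega> = (\<Sum>s\<in>?T. of_real (X s \<omega>) * cis (- (of_int s * (\<mu> + w))))"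
        unfolding finite_fourier_def even_index(1)[OF n] ..
      moreover have "z / of_real (2 * pi * (real n + 1)) = z * c" for z
        unfolding c_def even_index(2)[OF n] by simp
      ultimately show ?thesis unfolding bi_periodogram_def by simp
    qed
    also have "\<dots> = (\<Sum>s\<in>?T. \<Sum>t\<in>?T. of_real (X s \<omega>) * cis (- (of_int s * (\<mu> + w))) * (of_real (X t \<omega>) * cis (of_int t * \<mu>)) * (c * of_real (g \<mu>)))"
      by (simp only: sum_product) (simp only: sum_distrib_right mult.assoc)
    also have "\<dots> = (\<Sum>s\<in>?T. \<Sum>t\<in>?T. c * cis (- (of_int s * w)) * of_real (X s \<omega> * X t \<omega>) * (cis (- (of_int (s - t) * \<mu>)) * of_real (g \<mu>)))"
    proof (intro sum.cong refl)
      fix s t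
      have "cis (- (of_int s * (\<mu> + w))) * cis (of_int t * \<mu>) = cis (- (of_int s * w)) * cis (- (of_int (s - t) * \<mu>))"
        by (simp add: cis_mult algebra_simps)
      moreover have "of_real x * p * (of_real y * q) * (c * z) = c * (p * q) * of_real (x * y) * z" for x y p q z
        by (simp add: mult_ac)
      ultimately show "of_real (X s \<omega>) * cis (- (of_int s * (\<mu> + w))) * (of_real (X t \<omega>) * cis (of_int t * \<mu>)) * (c * of_real (g \<mu>)) =
        c * cis (- (of_int s * w)) * of_real (X s \<omega> * X t \<omega>) * (cis (- (of_int (s - t) * \<mu>)) * of_real (g \<mu>))"
        by (simp only:) (simp only: mult_ac)
    qed
    finally show ?thesis by (simp add: sum.cartesian_product')
  qed
  then have "integral {-pi..pi} (\<lambda>\<mu>. bi_periodogram X n (\<mu> + w) \<mu> \<omega> * of_real (g \<mu>)) =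
     integral {-pi..pi} (\<lambda>\<mu>. \<Sum>i\<in>?T \<times> ?T. c * cis (- (of_int (fst i) * w)) * of_real (X (fst i) \<omega> * X (snd i) \<omega>) * (cis (- (of_int (fst i - snd i) * \<mu>)) * of_real (g \<mu>)))"
    by (simp only:)
  also have "\<dots> = (\<Sum>i\<in>?T \<times> ?T. integral {-pi..pi} (\<lambda>\<mu>. c * cis (- (of_int (fst i) * w)) * of_real (X (fst i) \<omega> * X (snd i) \<omega>) * (cis (- (of_int (fst i - snd i) * \<mu>)) * of_real (g \<mu>))))"
    by (intro Henstock_Kurzweil_Integration.integral_sum integrable_continuous_real continuous_intros g) auto
  also have "\<dots> = (\<Sum>i\<in>?T \<times> ?T. c * cis (- (of_int (fst i) * w)) * kernel_coeff g (fst i - snd i) * of_real (X (fst i) \<omega> * X (snd i) \<omega>))"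
    unfolding integral_mult_right kernel_coeff_def by (intro sum.cong refl) (simp only: mult_ac)
  finally show ?thesis by (simp only: c_def)
qed

lemma kernel_coeff_one: "kernel_coeff (\<lambda>_. 1) k = (if k = 0 then of_real (2 * pi) else 0)"
  using integral_cis_int[of "- k"] by (simp add: kernel_coeff_def)

lemma norm_kernel_coeff_le:
  assumes "continuous_on {-pi..pi} g" "\<And>x. 0 \<le> g x" "integral {-pi..pi} g \<le> 1"
  shows "cmod (kernel_coeff g k) \<le> 1"
proof -
  have "cmod (kernel_coeff g k) \<le> integral {-pi..pi} g"
    unfolding kernel_coeff_def using assms
    by (intro integral_norm_bound_integral integrable_continuous_real continuous_intros) (auto simp: norm_mult)
  then show ?thesis using assms(3) by simp
qed

text \<open>For g = 1 orthogonality leaves only the diagonal s = t, so squares remain. The sequence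
  v is a parameter because the same transform is applied to the variances \<open>cov t t\<close> to
  obtain the mean.\<close>

definition square_transform :: "(int \<Rightarrow> real) \<Rightarrow> nat \<Rightarrow> real \<Rightarrow> complex" where
  "square_transform v h w = (\<Sum>t = - int h..int h. cis (- (of_int t * w)) / of_real (2 * real h + 1) * of_real (v t))"

lemma line_statistic_eq:
  assumes n: "n = 2 * h"
  shows "line_statistic X n \<omega> w = cmod (square_transform (\<lambda>t. (X t \<omega>)\<^sup>2) h w)"
proof -
  let ?T = "{- int h..int h}"
  define N where "N = 2 * real h + 1"
  have N: "N > 0" by (simp add: N_def)
  have "integral {-pi..pi} (\<lambda>\<mu>. bi_periodogram X n (\<mu> + w) \<mu> \<omega>) = 
    (\<Sum>i\<in>?T \<times> ?T. of_real (1 / (2 * pi * N)) * cis (- (of_int (fst i) * w)) *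
       kernel_coeff (\<lambda>_. 1) (fst i - snd i) * of_real (X (fst i) \<omega> * X (snd i) \<omega>))"
    using weighted_periodogram[OF n, of "\<lambda>_. 1" X w \<omega>] by (simp add: N_def)
  also have "\<dots> = (\<Sum>s\<in>?T. \<Sum>t\<in>?T. if t = s then cis (- (of_int s * w)) / of_real N * of_real ((X s \<omega>)\<^sup>2) else 0)"
    unfolding sum.cartesian_product' using N by (intro sum.cong refl) (auto simp: kernel_coeff_one power2_eq_square)
  also have "\<dots> = square_transform (\<lambda>t. (X t \<omega>)\<^sup>2) h w"
    by (simp add: square_transform_def N_def)
  finally show ?thesis by (simp add: line_statistic_def)
qed

lemma square_transform_periodic: "square_transform v h (w + 2 * pi * of_int k) = square_transform v h w"
proof -
  have "cis (- (of_int t * (w + 2 * pi * of_int k))) = cis (- (of_int t * w))" for t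
    using cis_int_periodic[of "- t" w k] by simp
  then show ?thesis by (simp add: square_transform_def)
qed

lemma square_transform_minus: "square_transform v h (- w) = cnj (square_transform v h w)"
  by (simp add: square_transform_def cis_cnj)

lemma continuous_on_square_transform: "continuous_on A (square_transform v h)"
  unfolding square_transform_def[abs_def] divide_inverse by (intro continuous_intros)

text \<open>The cosine part is odd in t and cancels; what is left is minus the derivative of the
  Dirichlet kernel at y.\<close>

lemma sum_odd_cis: "(\<Sum>t = - int h..int h. - \<i> * of_int t * cis (of_int t * y)) = of_real (\<Sum>t = - int h..int h. of_int t * sin (of_int t * y))"
proof -
  have "(\<Sum>t = - int h..int h. of_int t * cos (of_int t * y)) = (0::real)"
    by (rule sum_symmetric_odd) auto
  then have 0: "(\<Sum>t = - int h..int h. - \<i> * of_real (of_int t * cos (of_int t * y))) = 0"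
    unfolding sum_distrib_left[symmetric] of_real_sum[symmetric] by simp
  have "- \<i> * of_int t * cis (of_int t * y) = of_real (of_int t * sin (of_int t * y)) + - \<i> * of_real (of_int t * cos (of_int t * y))" for t
    by (simp add: complex_eq_iff)
  then have "(\<Sum>t = - int h..int h. - \<i> * of_int t * cis (of_int t * y)) =
    (\<Sum>t = - int h..int h. of_real (of_int t * sin (of_int t * y))) + (\<Sum>t = - int h..int h. - \<i> * of_real (of_int t * cos (of_int t * y)))"
    by (simp only: sum.distrib)
  then show ?thesis by (simp only: 0 of_real_sum add_0_right)
qed

text \<open>Collects what the asymptotic analysis takes from Assumptions 1 and 2. The spectral
  process Z no longer occurs, and the constant B is common to all lines, which finiteness of L
  permits.\<close>

locale line_model = gaussian_summable +
  fixes L :: "real set" and f :: "real \<Rightarrow> real \<Rightarrow> complex" and B :: real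
  assumes finite_L: "finite L" and L_range: "L \<subseteq> {-pi<..pi}"
    and cov_lines: "complex_of_real (cov k m) = (\<Sum>b\<in>L. cis (of_int k * b) * line_coeff f b (k - m))"
    and periodic: "b \<in> L \<Longrightarrow> f b (x + 2 * pi) = f b x"
    and lipschitz: "b \<in> L \<Longrightarrow> cmod (f b x - f b y) \<le> B * \<bar>x - y\<bar>"
    and continuous: "b \<in> L \<Longrightarrow> continuous_on UNIV (f b)"
begin

abbreviation mass :: "real \<Rightarrow> complex" where
  "mass b \<equiv> line_coeff f b 0"

lemma cov_diag: "complex_of_real (cov t t) = (\<Sum>b\<in>L. cis (of_int t * b) * mass b)"
  by (simp add: cov_lines)

lemma mean_square_transform:
  "square_transform (\<lambda>t. cov t t) h w = (\<Sum>b\<in>L. mass b * of_real (dirichlet h (b - w) / (2 * real h + 1)))"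
proof -
  have "cis (- (of_int t * w)) / of_real (2 * real h + 1) * of_real (cov t t) =
      (\<Sum>b\<in>L. mass b / of_real (2 * real h + 1) * cis (of_int t * (b - w)))" for t
    unfolding cov_diag sum_distrib_left
  proof (intro sum.cong refl)
    fix b
    have *: "cis (of_int t * (b - w)) = cis (- (of_int t * w)) * cis (of_int t * b)"
      by (simp add: cis_mult algebra_simps)
    show "cis (- (of_int t * w)) / of_real (2 * real h + 1) * (cis (of_int t * b) * mass b) =
        mass b / of_real (2 * real h + 1) * cis (of_int t * (b - w))"
      unfolding * by simp
  qed
  then have "square_transform (\<lambda>t. cov t t) h w = (\<Sum>b\<in>L. mass b / of_real (2 * real h + 1) * (\<Sum>t = - int h..int h. cis (of_int t * (b - w))))"
    unfolding square_transform_def by (simp only: sum_distrib_left) (rule sum.swap)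
  then show ?thesis unfolding sum_cis_eq_dirichlet by simp
qed

lemma square_transform_split:
  "square_transform (\<lambda>t. (X t \<omega>)\<^sup>2) h w = square_transform (\<lambda>t. cov t t) h w + fluctuation h w \<omega>"
  unfolding square_transform_def fluctuation_def sum.distrib[symmetric]
  by (intro sum.cong refl) (simp only: distrib_left[symmetric] of_real_add[symmetric], simp)

text \<open>The phase at b is included, so that the fluctuation at b + u / N has these coefficients
  on the exponentials exp(-i u t / N) and can be expanded in the local variable u.\<close>

definition fluctuation_coeff :: "nat \<Rightarrow> real \<Rightarrow> int \<Rightarrow> 'a \<Rightarrow> complex" where
  "fluctuation_coeff h b t \<omega> = cis (- (of_int t * b)) / of_real (2 * real h + 1) * of_real ((X t \<omega>)\<^sup>2 - cov t t)"

text \<open>The solution u of the critical equation linearised at b: the inner sum is the derivative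
  at u = 0 of the fluctuation at b + u / N, and the denominator is the squared mass times the
  curvature of the normalised kernel.\<close>

definition location_linear :: "nat \<Rightarrow> real \<Rightarrow> 'a \<Rightarrow> real" where
  "location_linear h b \<omega> = Re (cnj (mass b) * (\<Sum>t = - int h..int h. - \<i> * of_real (of_int t / (2 * real h + 1)) * fluctuation_coeff h b t \<omega>))
     / ((cmod (mass b))\<^sup>2 * second_moment h)"

(* The parameter k is the number of turns by which w and b + u / (2h+1) differ. *)
lemma location:
  fixes h n :: nat and b r s0 \<kappa> \<delta> w :: real and c :: "nat \<Rightarrow> real"
  defines "N \<equiv> 2 * real h + 1" and "Q \<equiv> (\<Sum>b'\<in>L - {b}. cmod (mass b')) / s0"
  assumes n: "n = 2 * h" and h: "h \<ge> 1" and b: "b \<in> L" and \<sigma>: "mass b \<noteq> 0"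
    and r: "0 < r" "r < pi" and s0: "0 < s0" and sep: "\<And>b' x. b' \<in> L - {b} \<Longrightarrow> \<bar>x\<bar> \<le> r \<Longrightarrow> s0 \<le> \<bar>sin ((b' - b - x) / 2)\<bar>"
    and N1: "2 * (Q / N) + 2 * \<kappa> < cmod (mass b) / 200"
    and thr: "\<delta> + (ln (real n) / real n) powr (1 / 4) < cmod (mass b) - Q / N - \<kappa>"
    and cn: "2 / N \<le> c n / real n" "1 / N + c n / real n \<le> r" and bN: "b \<noteq> pi \<Longrightarrow> \<bar>b\<bar> < pi - 1 / N"
    and good: "\<And>v. cmod (fluctuation h v \<omega>) \<le> \<kappa>"
    and w: "w \<in> {-pi..pi}"
    and sel: "retained_maxima X c \<delta> n \<omega> \<noteq> {} \<Longrightarrow> is_arg_min (\<lambda>v. \<bar>ydiff b v\<bar>) (\<lambda>v. v \<in> retained_maxima X c \<delta> n \<omega>) w"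
  obtains u k where "\<bar>u\<bar> \<le> 1" "w = b + u / N + 2 * pi * of_int k"
    "\<And>\<rho>. (\<And>j. cmod (\<Sum>t = - int h..int h. of_real (of_int t / N) ^ j * fluctuation_coeff h b t \<omega>) \<le> \<rho>) \<Longrightarrow>
       \<bar>u\<bar> \<le> 53 * (3 * \<rho> + Q / N) / cmod (mass b) \<and>
       \<bar>u - location_linear h b \<omega>\<bar> \<le> 20 / (cmod (mass b))\<^sup>2 * (5000 * (3 * \<rho> + Q / N)\<^sup>2 + cmod (mass b) * (Q / N))"
proof -
  define \<sigma> where "\<sigma> = mass b"
  have N: "3 \<le> N" using h by (simp add: N_def)
  have Q0: "0 \<le> Q" using s0 by (auto simp: Q_def intro!: divide_nonneg_pos sum_nonneg)
  have QN: "0 \<le> Q / N" using Q0 N by simp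
  have \<kappa>0: "0 \<le> \<kappa>" using order_trans[OF norm_ge_zero good[of 0]] .
  define S where "S = square_transform (\<lambda>t. (X t \<omega>)\<^sup>2) h"
  \<comment> \<open>The leakage of the other lines. Within distance r of b they stay separated from
    b + x by \<open>sep\<close>, so their kernels are bounded by 1 / s0 and the normalised total is
    at most Q / N.\<close>
  define q where "q x = (\<Sum>b'\<in>L - {b}. mass b' * of_real (dirichlet h (b' - b - x) / N))" for x
  have S: "S (b + x) = \<sigma> * of_real (dirichlet h x / N) + (q x + fluctuation h (b + x) \<omega>)" for x
  proof -
    have "(\<Sum>b'\<in>L. mass b' * of_real (dirichlet h (b' - (b + x)) / N)) = mass b * of_real (dirichlet h (b - (b + x)) / N)
        + (\<Sum>b'\<in>L - {b}. mass b' * of_real (dirichlet h (b' - (b + x)) / N))"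
      by (rule sum.remove[OF finite_L b])
    then show ?thesis
      by (simp add: S_def square_transform_split mean_square_transform \<sigma>_def q_def N_def[symmetric] dirichlet_minus diff_diff_eq)
  qed
  have q: "cmod (q x) \<le> Q / N" if "\<bar>x\<bar> \<le> r" for x
  proof -
    have "cmod (q x) \<le> (\<Sum>b'\<in>L - {b}. cmod (mass b') * (1 / s0 / N))"
      unfolding q_def
    proof (intro sum_norm_le)
      fix b' assume b': "b' \<in> L - {b}"
      have "\<bar>dirichlet h (b' - b - x)\<bar> * s0 \<le> \<bar>dirichlet h (b' - b - x)\<bar> * \<bar>sin ((b' - b - x) / 2)\<bar>"
        using sep[OF b' that] by (intro mult_left_mono) auto
      also have "\<dots> \<le> 1" by (rule abs_dirichlet_mult_sin_le)
      finally have "\<bar>dirichlet h (b' - b - x)\<bar> \<le> 1 / s0" using s0 by (simp add: field_simps)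
      then have "\<bar>dirichlet h (b' - b - x)\<bar> / N \<le> 1 / s0 / N" using N by (intro divide_right_mono) auto
      then show "cmod (mass b' * of_real (dirichlet h (b' - b - x) / N)) \<le> cmod (mass b') * (1 / s0 / N)"
        unfolding norm_mult norm_of_real abs_divide using N by (intro mult_left_mono) auto
    qed
    also have "\<dots> = Q / N" by (simp add: Q_def sum_divide_distrib)
    finally show ?thesis .
  qed
  have P: "cmod (q x + fluctuation h (b + x) \<omega>) \<le> Q / N + \<kappa>" if "\<bar>x\<bar> \<le> r" for x
    using norm_triangle_ineq[of "q x" "fluctuation h (b + x) \<omega>"] q[OF that] good[of "b + x"] by linarith
  have st: "line_statistic X n \<omega> = (\<lambda>w. cmod (S w))"
    by (rule ext) (simp add: line_statistic_eq[OF n] S_def)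
  have Sb: "cmod \<sigma> - Q / N - \<kappa> \<le> cmod (S b)"
  proof -
    have "S b = \<sigma> + (q 0 + fluctuation h b \<omega>)" using S[of 0] N by (simp add: dirichlet_0 N_def)
    then show ?thesis using norm_diff_ineq[of \<sigma> "q 0 + fluctuation h b \<omega>"] P[of 0] r by simp
  qed
  \<comment> \<open>Outside the 1 / N neighbourhood the main lobe has lost at least 1/200 of its
    height, more than twice the perturbation Q / N + \<kappa>; this confines the maximum to |u| <=
    1.\<close>
  have away: "cmod (S (b + x)) < cmod (S b)" if "1 / N < \<bar>x\<bar>" "\<bar>x\<bar> \<le> r" for x
  proof -
    have "\<bar>dirichlet h x\<bar> / N \<le> 1 - 1 / 200"
    proof -
      have "\<bar>dirichlet h x\<bar> \<le> (1 - 1 / 200) * N"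
        unfolding N_def by (rule dirichlet_away_from_zero[OF h]) (use that r in \<open>auto simp only: N_def\<close>)
      then show ?thesis using N by (simp add: pos_divide_le_eq)
    qed
    then have "cmod (\<sigma> * of_real (dirichlet h x / N)) \<le> cmod \<sigma> * (1 - 1 / 200)"
      unfolding norm_mult norm_of_real abs_divide using N by (intro mult_left_mono) auto
    then have "cmod (S (b + x)) \<le> cmod \<sigma> * (1 - 1 / 200) + (Q / N + \<kappa>)"
      unfolding S using norm_triangle_ineq[of "\<sigma> * of_real (dirichlet h x / N)" "q x + fluctuation h (b + x) \<omega>"] P[OF that(2)] by linarith
    also have "cmod \<sigma> * (1 - 1 / 200) = cmod \<sigma> - cmod \<sigma> / 200" by (simp add: right_diff_distrib)
    also have "cmod \<sigma> - cmod \<sigma> / 200 + (Q / N + \<kappa>) < cmod \<sigma> - Q / N - \<kappa>" using N1 unfolding \<sigma>_def by linarith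
    finally show ?thesis using Sb by simp
  qed
  obtain x k where x: "\<bar>x\<bar> \<le> 1 / N" "w = b + x + 2 * pi * of_int k"
    and xmax: "\<And>x'. \<bar>x'\<bar> \<le> r \<Longrightarrow> cmod (S (b + x')) \<le> cmod (S (b + x))"
  proof (rule selected_location[where X = X and n = n and \<omega> = \<omega> and c = c and b = b and \<epsilon> = "1 / N" and r = r and \<delta> = \<delta> and w = w])
    show "line_statistic X n \<omega> (x + 2 * pi * of_int k) = line_statistic X n \<omega> x" for x k
      by (simp add: st S_def square_transform_periodic)
    show "line_statistic X n \<omega> (- x) = line_statistic X n \<omega> x" for x
      by (simp add: st S_def square_transform_minus)
    show "continuous_on UNIV (line_statistic X n \<omega>)"
      unfolding st S_def by (intro continuous_intros continuous_on_square_transform)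
    show "- pi < b" "b \<le> pi" using b L_range by auto
    show "0 < 1 / N" using N by simp
    have "0 < 2 / N" using N by simp
    then show "1 / N < r" using cn by linarith
    show "2 * (1 / N) \<le> c n / real n" using cn by simp
    show "\<delta> + (ln (real n) / real n) powr (1 / 4) < line_statistic X n \<omega> b"
      using thr Sb by (simp add: st \<sigma>_def)
    show "line_statistic X n \<omega> (b + x) < line_statistic X n \<omega> b" if "1 / N < \<bar>x\<bar>" "\<bar>x\<bar> \<le> r" for x
      using away[OF that] by (simp add: st)
  qed (use r cn bN w sel in \<open>auto simp: st\<close>)
  define u where "u = N * x"
  have u: "\<bar>u\<bar> \<le> 1" using x(1) N by (simp add: u_def abs_mult field_simps)
  have xu: "x = u / N" using N by (simp add: u_def)
  have rN: "1 / N < r" 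
  proof -
    have "0 < 2 / N" using N by simp
    then show ?thesis using cn by linarith
  qed
  let ?T = "{- int h..int h}" and ?\<theta> = "\<lambda>t. of_int t / N :: real"
  define z where "z t = cis (- (of_int t * b)) / of_real N * of_real ((X t \<omega>)\<^sup>2)" for t
  define zf where "zf t = fluctuation_coeff h b t \<omega>" for t
  have cis_eq: "cis (- (of_int t * b)) * cis (- (?\<theta> t * v)) = cis (- (of_int t * (b + v / N)))" for t v
    by (simp add: cis_mult algebra_simps)
  have Sz: "S (b + v / N) = (\<Sum>t\<in>?T. z t * cis (- (?\<theta> t * v)))" for v
    unfolding S_def square_transform_def z_def cis_eq[symmetric] N_def[symmetric]
    by (intro sum.cong refl) (simp add: mult_ac)
  have fz: "fluctuation h (b + v / N) \<omega> = (\<Sum>t\<in>?T. zf t * cis (- (?\<theta> t * v)))" for v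
    unfolding fluctuation_def zf_def fluctuation_coeff_def cis_eq[symmetric] N_def[symmetric]
    by (intro sum.cong refl) (simp add: mult_ac)
  define S' where "S' = (\<Sum>t\<in>?T. - \<i> * of_real (?\<theta> t) * (z t * cis (- (?\<theta> t * u))))"
  define F' where "F' = (\<Sum>t\<in>?T. - \<i> * of_real (?\<theta> t) * (zf t * cis (- (?\<theta> t * u))))"
  have crit: "Re (cnj (S (b + u / N)) * S') = 0"
    unfolding Sz S'_def
  \<comment> \<open>In the variable u the maximality reaches to N r, and |u| <= 1 leaves a margin of
    N r - 1 on either side.\<close>
  proof (rule critical_point_of_modulus[where d = "N * r - 1"])
    show "0 < N * r - 1" using rN N by (simp add: field_simps)
    fix v assume "\<bar>u - v\<bar> < N * r - 1"
    then have "\<bar>v\<bar> \<le> N * r" using u by linarith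
    then have "\<bar>v / N\<bar> \<le> r" using N by (simp add: abs_divide pos_divide_le_eq mult.commute)
    from xmax[OF this] show "cmod (\<Sum>t\<in>?T. z t * cis (- (?\<theta> t * v))) \<le> cmod (\<Sum>t\<in>?T. z t * cis (- (?\<theta> t * u)))"
      by (simp only: Sz xu)
  qed
  \<comment> \<open>Signed so that \<open>d (- (u / N))\<close> is the derivative in u of
    \<open>dirichlet h (u / N) / N\<close>.\<close>
  define d where "d y = (\<Sum>t\<in>?T. of_int t * sin (of_int t * y)) / N / N" for y :: real
  define q' where "q' = (\<Sum>b'\<in>L - {b}. mass b' * of_real (d (b' - b - u / N)))"
  have S'_eq: "S' = \<sigma> * of_real (d (- (u / N))) + (q' + F')"
  proof -
    have "- \<i> * of_real (?\<theta> t) * (z t * cis (- (?\<theta> t * u))) =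
        (\<Sum>b'\<in>L. mass b' / of_real N / of_real N * (- \<i> * of_int t * cis (of_int t * (b' - b - u / N)))) +
         - \<i> * of_real (?\<theta> t) * (zf t * cis (- (?\<theta> t * u)))" for t
    proof -
      have "z t = cis (- (of_int t * b)) / of_real N * of_real (cov t t) + zf t"
        unfolding z_def zf_def fluctuation_coeff_def N_def[symmetric]
        by (simp only: distrib_left[symmetric] of_real_add[symmetric]) simp
      then have "z t * cis (- (?\<theta> t * u)) = (\<Sum>b'\<in>L. mass b' / of_real N * cis (of_int t * (b' - b - u / N))) + zf t * cis (- (?\<theta> t * u))"
      proof -
        assume zt: "z t = cis (- (of_int t * b)) / of_real N * of_real (cov t t) + zf t"
        have "cis (- (of_int t * b)) / of_real N * of_real (cov t t) * cis (- (?\<theta> t * u)) = (\<Sum>b'\<in>L. mass b' / of_real N * cis (of_int t * (b' - b - u / N)))"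
        proof -
          have cc: "cis (- (of_int t * b)) * cis (- (?\<theta> t * u)) * cis (of_int t * b') = cis (of_int t * (b' - b - u / N))" for b'
            by (simp add: cis_mult algebra_simps)
          have *: "mass b' / of_real N * cis (of_int t * (b' - b - u / N)) = cis (- (of_int t * b)) / of_real N * (cis (of_int t * b') * mass b') * cis (- (?\<theta> t * u))" for b'
            unfolding cc[symmetric] by (simp add: mult_ac)
          show ?thesis unfolding * cov_diag sum_distrib_left sum_distrib_right ..
        qed
        then show ?thesis by (simp add: zt distrib_right)
      qed
      then show ?thesis by (simp add: distrib_left sum_distrib_left mult_ac)
    qed
    then have "S' = (\<Sum>t\<in>?T. \<Sum>b'\<in>L. mass b' / of_real N / of_real N * (- \<i> * of_int t * cis (of_int t * (b' - b - u / N)))) + F'"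
      unfolding S'_def F'_def by (simp only: sum.distrib)
    also have "(\<Sum>t\<in>?T. \<Sum>b'\<in>L. mass b' / of_real N / of_real N * (- \<i> * of_int t * cis (of_int t * (b' - b - u / N)))) =
       (\<Sum>b'\<in>L. mass b' * of_real (d (b' - b - u / N)))"
      by (subst sum.swap, unfold sum_distrib_left[symmetric] sum_odd_cis) (simp add: d_def divide_inverse mult_ac)
    also have "\<dots> = \<sigma> * of_real (d (- (u / N))) + q'"
      unfolding q'_def \<sigma>_def by (subst sum.remove[OF finite_L b]) simp
    finally show ?thesis by simp
  qed
  have q': "cmod q' \<le> Q / N"
  proof -
    have "cmod q' \<le> (\<Sum>b'\<in>L - {b}. cmod (mass b') * (1 / s0 / N))"
      unfolding q'_def
    proof (intro sum_norm_le)
      fix b' assume b': "b' \<in> L - {b}"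
      let ?y = "b' - b - u / N"
      have "\<bar>u / N\<bar> \<le> r" using x(1) rN by (simp add: xu)
      from sep[OF b' this] have "\<bar>\<Sum>t\<in>?T. of_int t * sin (of_int t * ?y)\<bar> * s0 \<le> \<bar>\<Sum>t\<in>?T. of_int t * sin (of_int t * ?y)\<bar> * \<bar>sin (?y / 2)\<bar>"
        by (intro mult_left_mono) auto
      also have "\<dots> \<le> N" unfolding N_def by (rule abs_dirichlet_derivative_le)
      finally have "\<bar>\<Sum>t\<in>?T. of_int t * sin (of_int t * ?y)\<bar> / N \<le> 1 / s0" using s0 N by (simp add: field_simps)
      moreover have "\<bar>N\<bar> = N" using N by simp
      ultimately have "\<bar>d ?y\<bar> \<le> 1 / s0 / N" unfolding d_def abs_divide using N by (simp only:) (intro divide_right_mono; simp)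
      then show "cmod (mass b' * of_real (d ?y)) \<le> cmod (mass b') * (1 / s0 / N)"
        unfolding norm_mult norm_of_real by (intro mult_left_mono) auto
    qed
    also have "\<dots> = Q / N" by (simp add: Q_def sum_divide_distrib)
    finally show ?thesis .
  qed
  show thesis
  proof (rule that[OF u])
    show "w = b + u / N + 2 * pi * of_int k" using x(2) xu by simp
    fix \<rho> assume \<rho>: "\<And>j. cmod (\<Sum>t\<in>?T. of_real (?\<theta> t) ^ j * fluctuation_coeff h b t \<omega>) \<le> \<rho>"
    have \<rho>0: "0 \<le> \<rho>" using order_trans[OF norm_ge_zero \<rho>[of 0]] .
    define P0 where "P0 = (\<Sum>t\<in>?T. - \<i> * of_real (?\<theta> t) * zf t)"
    have F: "cmod (fluctuation h (b + u / N) \<omega>) \<le> 3 * \<rho>"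
      using frequency_series_bound[of ?T ?\<theta> zf \<rho> u 0] \<rho> u by (simp add: fz zf_def)
    \<comment> \<open>Differentiation in u multiplies each coefficient by -i t / N, which only
      shifts the power by one; the same \<rho> therefore bounds the series of the
      derivative.\<close>
    have coeff: "cmod (\<Sum>t\<in>?T. of_real (?\<theta> t) ^ j * (- \<i> * of_real (?\<theta> t) * zf t)) \<le> \<rho>" for j
    proof -
      have "(\<Sum>t\<in>?T. of_real (?\<theta> t) ^ j * (- \<i> * of_real (?\<theta> t) * zf t)) = - \<i> * (\<Sum>t\<in>?T. of_real (?\<theta> t) ^ Suc j * zf t)"
        unfolding sum_distrib_left by (intro sum.cong refl) (simp add: mult_ac)
      then show ?thesis using \<rho>[of "Suc j"] by (simp add: norm_mult zf_def del: power_Suc)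
    qed
    have F'_eq: "F' = (\<Sum>t\<in>?T. (- \<i> * of_real (?\<theta> t) * zf t) * cis (- (?\<theta> t * u)))"
      unfolding F'_def by (simp only: mult.assoc)
    have F'1: "cmod F' \<le> 3 * \<rho>"
      using frequency_series_bound[of ?T ?\<theta> "\<lambda>t. - \<i> * of_real (?\<theta> t) * zf t" \<rho> u 0, OF _ coeff u] by (simp add: F'_eq)
    have F'2: "cmod (F' - P0) \<le> 3 * \<bar>u\<bar> * \<rho>"
      using frequency_series_bound[of ?T ?\<theta> "\<lambda>t. - \<i> * of_real (?\<theta> t) * zf t" \<rho> u 1, OF _ coeff u] by (simp add: F'_eq P0_def)
    define e where "e = 3 * \<rho> + Q / N"
    have ub: "\<bar>u / N\<bar> \<le> r" using x(1) rN by (simp add: xu)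
    let ?G = "dirichlet h (u / N) / N" and ?G' = "d (- (u / N))" and ?P = "q (u / N) + fluctuation h (b + u / N) \<omega>"
    have pc: "Re (cnj (\<sigma> * of_real ?G + ?P) * (\<sigma> * of_real ?G' + (q' + F'))) = 0"
      using crit by (simp only: S S'_eq)
    have pG: "\<bar>1 - ?G\<bar> \<le> u\<^sup>2 / 8"
      using dirichlet_near_one[of h "u / N"] N by (simp add: N_def[symmetric])
    have pG': "\<bar>?G' + second_moment h * u\<bar> \<le> second_moment h * \<bar>u\<bar> ^ 3 / 24"
    proof -
      have "?G' = (\<Sum>t\<in>?T. - (of_int t / N) * sin (of_int t / N * u)) / N"
        unfolding d_def sum_divide_distrib by (intro sum.cong refl) simp
      then show ?thesis using dirichlet_derivative_near_zero[of h u] by (simp only: N_def)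
    qed
    have p1: "cmod ?P \<le> cmod \<sigma> / 4" using P[OF ub] N1 QN \<kappa>0 unfolding \<sigma>_def by linarith
    have p2: "cmod ?P \<le> e" using norm_triangle_ineq[of "q (u / N)" "fluctuation h (b + u / N) \<omega>"] q[OF ub] F unfolding e_def by linarith
    have p3: "cmod (q' + F') \<le> e" using norm_triangle_ineq[of q' F'] q' F'1 unfolding e_def by linarith
    have p4: "cmod (q' + F' - P0) \<le> e * \<bar>u\<bar> + Q / N"
    proof -
      have "cmod (q' + F' - P0) \<le> cmod q' + cmod (F' - P0)"
        using norm_triangle_ineq[of q' "F' - P0"] by (simp add: algebra_simps)
      also have "\<dots> \<le> Q / N + 3 * \<rho> * \<bar>u\<bar>" using q' F'2 by (simp add: mult_ac)
      also have "3 * \<rho> * \<bar>u\<bar> \<le> e * \<bar>u\<bar>" using QN by (intro mult_right_mono) (auto simp: e_def)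
      finally show ?thesis by simp
    qed
    have \<sigma>0: "\<sigma> \<noteq> 0" using \<sigma> by (simp add: \<sigma>_def)
    note C = critical_expansion[OF pc \<sigma>0 u pG pG' second_moment_bounds[OF h] p1 p2 p3 p4 QN]
    show "\<bar>u\<bar> \<le> 53 * (3 * \<rho> + Q / N) / cmod (mass b) \<and>
       \<bar>u - location_linear h b \<omega>\<bar> \<le> 20 / (cmod (mass b))\<^sup>2 * (5000 * (3 * \<rho> + Q / N)\<^sup>2 + cmod (mass b) * (Q / N))"
      using C unfolding e_def \<sigma>_def location_linear_def P0_def zf_def N_def by blast
  qed
qed

end

lemma power2_sum_le: "(x + y)\<^sup>2 \<le> 2 * (x\<^sup>2 + y\<^sup>2)" for x y :: real
  using zero_le_power2[of "x - y"] by (simp add: power2_eq_square algebra_simps)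

text \<open>Distinct points of (-pi, pi] differ by less than 2 pi, so the half-angle sines do not
  vanish and finiteness of L gives a positive minimum m. A shift by |x| <= m changes such a sine by
  at most m / 2.\<close>

lemma angular_separation:
  fixes L :: "real set"
  assumes L: "finite L" "L \<subseteq> {-pi<..pi}" and b: "b \<in> L"
  obtains r s0 where "0 < r" "r < pi" "0 < s0"
    "\<And>b' x. b' \<in> L - {b} \<Longrightarrow> \<bar>x\<bar> \<le> r \<Longrightarrow> s0 \<le> \<bar>sin ((b' - b - x) / 2)\<bar>"
proof -
  define m where "m = Min (insert 1 ((\<lambda>b'. \<bar>sin ((b' - b) / 2)\<bar>) ` (L - {b})))"
  have fin: "finite (insert 1 ((\<lambda>b'. \<bar>sin ((b' - b) / 2)\<bar>) ` (L - {b})))" using L by simp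
  have "0 < \<bar>sin ((b' - b) / 2)\<bar>" if "b' \<in> L - {b}" for b'
  proof -
    have "b' \<in> {-pi<..pi}" "b \<in> {-pi<..pi}" using that b L by auto
    then have "b' \<noteq> b" "\<bar>b' - b\<bar> < 2 * pi" using that by (auto simp: abs_less_iff)
    then have "0 < sin \<bar>(b' - b) / 2\<bar>" by (intro sin_gt_zero) auto
    moreover have "0 < sin \<bar>x\<bar> \<Longrightarrow> 0 < \<bar>sin x\<bar>" for x :: real by (cases "x \<ge> 0") auto
    ultimately show ?thesis by blast
  qed
  then have m: "0 < m" unfolding m_def by (subst Min_gr_iff[OF fin]) auto
  have m1: "m \<le> 1" unfolding m_def by (rule Min_le[OF fin]) simp
  show thesis
  proof (rule that[of m "m / 2"])
    show "0 < m" "0 < m / 2" using m by auto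
    show "m < pi" using m1 pi_gt3 by linarith
    fix b' x assume b': "b' \<in> L - {b}" and x: "\<bar>x\<bar> \<le> m"
    have "m \<le> \<bar>sin ((b' - b) / 2)\<bar>" unfolding m_def using b' by (intro Min_le[OF fin]) auto
    moreover have "\<bar>sin ((b' - b) / 2) - sin ((b' - b - x) / 2)\<bar> \<le> \<bar>(b' - b) / 2 - (b' - b - x) / 2\<bar>"
    proof -
      have "\<bar>sin y - sin z\<bar> \<le> \<bar>y - z\<bar>" for y z :: real
        using order_trans[OF abs_Im_le_cmod norm_cis_diff_le, of y z] by simp
      then show ?thesis .
    qed
    moreover have "\<bar>(b' - b) / 2 - (b' - b - x) / 2\<bar> \<le> m / 2" using x by (simp add: diff_divide_distrib[symmetric])
    ultimately show "m / 2 \<le> \<bar>sin ((b' - b - x) / 2)\<bar>" by linarith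
  qed
qed

section \<open>The estimated frequency on an event of high probability\<close>

context line_model
begin

text \<open>Each power of t / N gains a factor 1/2, as required by
  \<open>random_frequency_series\<close>. Fourth moments are taken because the square of the
  dominating variable is later multiplied by a variable controlled in L2.\<close>

lemma fluctuation_series_moment:
  assumes h: "N = 2 * real h + 1"
  shows "integrable M (\<lambda>\<omega>. cmod (\<Sum>t = - int h..int h. of_real (of_int t / N) ^ j * fluctuation_coeff h b t \<omega>) ^ 4)"
    and "expectation (\<lambda>\<omega>. cmod (\<Sum>t = - int h..int h. of_real (of_int t / N) ^ j * fluctuation_coeff h b t \<omega>) ^ 4)
      \<le> 8 * moment_bound 2 / N\<^sup>2 * (1 / 2) ^ j"
proof -
  have N: "0 < N" by (simp add: h)
  define z where "z t = of_real (of_int t / N) ^ j * (cis (- (of_int t * b)) / of_real (2 * real h + 1))" for t :: int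
  have eq: "(\<Sum>t = - int h..int h. of_real (of_int t / N) ^ j * fluctuation_coeff h b t \<omega>) =
     (\<Sum>t = - int h..int h. z t * of_real ((X t \<omega>)\<^sup>2 - cov t t))" for \<omega>
    by (simp add: z_def fluctuation_coeff_def mult.assoc)
  have z: "cmod (z t) \<le> (1 / 2) ^ j / N" if "t \<in> {- int h..int h}" for t
  proof -
    have "cmod (z t) = \<bar>of_int t / N\<bar> ^ j * (1 / N)"
      unfolding z_def norm_mult norm_power norm_divide norm_cis norm_of_real using N by (simp add: h)
    also have "\<dots> \<le> (1 / 2) ^ j * (1 / N)"
      using frequency_le_half[OF that] N by (intro mult_right_mono power_mono) (auto simp: h)
    finally show ?thesis by simp
  qed
  show "integrable M (\<lambda>\<omega>. cmod (\<Sum>t = - int h..int h. of_real (of_int t / N) ^ j * fluctuation_coeff h b t \<omega>) ^ 4)"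
    unfolding eq using quadratic_moment_complex(1)[of "{- int h..int h}" 2 z "(1 / 2) ^ j / N"] z by simp
  have "expectation (\<lambda>\<omega>. cmod (\<Sum>t = - int h..int h. z t * of_real ((X t \<omega>)\<^sup>2 - cov t t)) ^ (2 * 2))
     \<le> 2 ^ Suc 2 * moment_bound 2 * (((1 / 2) ^ j / N)\<^sup>2 * card {- int h..int h}) ^ 2"
    by (rule quadratic_moment_complex(2)) (use z in auto)
  also have "((1 / 2) ^ j / N)\<^sup>2 * card {- int h..int h} = ((1 / 2) ^ j)\<^sup>2 / N"
    using N by (simp add: power_divide power2_eq_square h)
  also have "2 ^ Suc 2 * moment_bound 2 * (((1 / 2) ^ j)\<^sup>2 / N) ^ 2 \<le> 8 * moment_bound 2 / N\<^sup>2 * (1 / 2) ^ j"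
  proof -
    have "(((1 / 2) ^ j)\<^sup>2)\<^sup>2 \<le> ((1 / 2 :: real) ^ j) ^ 1"
      unfolding power_mult[symmetric] by (intro power_decreasing) auto
    then have "8 * moment_bound 2 / N\<^sup>2 * (((1 / 2) ^ j)\<^sup>2)\<^sup>2 \<le> 8 * moment_bound 2 / N\<^sup>2 * (1 / 2) ^ j"
      using moment_bound_nonneg by (intro mult_left_mono) auto
    moreover have "2 ^ Suc 2 * moment_bound 2 * (x / N) ^ 2 = 8 * moment_bound 2 / N\<^sup>2 * x\<^sup>2" for x
      by (simp add: power_divide)
    ultimately show ?thesis by (simp only:)
  qed
  finally show "expectation (\<lambda>\<omega>. cmod (\<Sum>t = - int h..int h. of_real (of_int t / N) ^ j * fluctuation_coeff h b t \<omega>) ^ 4)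
      \<le> 8 * moment_bound 2 / N\<^sup>2 * (1 / 2) ^ j"
    unfolding eq by simp
qed

lemma measurable_fluctuation_coeff [measurable]: "fluctuation_coeff h b t \<in> borel_measurable M"
  unfolding fluctuation_coeff_def by measurable

text \<open>Turns the deterministic statement \<open>location\<close> into one about a good event
  and one dominating variable \<rho>. The last clause keeps the other lines from contributing more
  than O(1 / N) to the mean of the estimate at the selected frequency.\<close>

lemma location_eventually:
  fixes c :: "nat \<Rightarrow> real" and w :: "nat \<Rightarrow> 'a \<Rightarrow> real"
  assumes b: "b \<in> L" and \<delta>: "0 < \<delta>" "\<delta> < cmod (mass b)"
    and c: "filterlim c at_top sequentially" "c \<in> o(\<lambda>n. real n)"
    and w: "line_estimate M X c \<delta> b w"
  obtains C h0 where "0 \<le> C"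
    "\<And>h N. h0 \<le> h \<Longrightarrow> N = 2 * real h + 1 \<Longrightarrow> \<exists>G\<in>events. \<exists>\<rho>. prob (space M - G) \<le> C / N ^ 6 \<and>
       \<rho> \<in> borel_measurable M \<and> (\<forall>\<omega>. 0 \<le> \<rho> \<omega>) \<and> integrable M (\<lambda>\<omega>. \<rho> \<omega> ^ 4) \<and> expectation (\<lambda>\<omega>. \<rho> \<omega> ^ 4) \<le> C / N\<^sup>2 \<and>
       (\<forall>\<omega>\<in>G. \<exists>u k. \<bar>u\<bar> \<le> 1 \<and> w (2 * h) \<omega> = b + u / N + 2 * pi * of_int k \<and> \<bar>u\<bar> \<le> C * (\<rho> \<omega> + 1 / N) \<and>
          \<bar>u - location_linear h b \<omega>\<bar> \<le> C * ((\<rho> \<omega>)\<^sup>2 + 1 / N) \<and>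
          (\<forall>b'\<in>L - {b}. \<bar>dirichlet h (b' - w (2 * h) \<omega>)\<bar> \<le> C))"
proof -
  define s where "s = cmod (mass b)"
  have s: "0 < s" "\<delta> < s" using \<delta> by (auto simp: s_def)
  obtain r s0 where r: "0 < r" "r < pi" and s0: "0 < s0"
    and sep: "\<And>b' x. b' \<in> L - {b} \<Longrightarrow> \<bar>x\<bar> \<le> r \<Longrightarrow> s0 \<le> \<bar>sin ((b' - b - x) / 2)\<bar>"
    using angular_separation[OF finite_L L_range b] by blast
  define Q where "Q = (\<Sum>b'\<in>L - {b}. cmod (mass b')) / s0"
  have Q: "0 \<le> Q" using s0 by (auto simp: Q_def intro!: divide_nonneg_pos sum_nonneg)
  \<comment> \<open>With Q / N below the same two bounds, 2 Q / N + 2 \<kappa> stays below 4 s /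
    1000 < s / 200; and threshold term, Q / N and \<kappa> together use at most three quarters of
    the gap s - \<delta>.\<close>
  define \<kappa> where "\<kappa> = min (s / 1000) ((s - \<delta>) / 4)"
  have \<kappa>: "0 < \<kappa>" "\<kappa> \<le> s / 1000" "\<kappa> \<le> (s - \<delta>) / 4" using s unfolding \<kappa>_def by (simp_all only: min_less_iff_conj min.cobounded1 min.cobounded2) simp
  obtain C0 where C0: "0 \<le> C0" "\<And>h. \<exists>G\<in>events. prob (space M - G) \<le> C0 / (2 * real h + 1) ^ 6 \<and>
     (\<forall>\<omega>\<in>G. \<forall>w. cmod (fluctuation h w \<omega>) \<le> \<kappa>)"
    using uniform_fluctuation_bound[OF \<kappa>(1)] by blast
  define C1 where "C1 = 53 * (3 + Q) / s"
  define C2 where "C2 = 20 / s\<^sup>2 * (5000 * (2 * (3 + Q)\<^sup>2) + s * Q)"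
  define C where "C = C0 + 16 * moment_bound 2 + C1 + C2 + 1 / s0"
  have Cs: "0 \<le> C1" "0 \<le> C2" "0 \<le> 1 / s0" "0 \<le> 16 * moment_bound 2"
    using Q s s0 moment_bound_nonneg by (auto simp: C1_def C2_def)
  have "((\<lambda>n. c n / real n) \<longlongrightarrow> 0) sequentially"
    using c(2) by (rule smalloD_tendsto)
  then have ev1: "eventually (\<lambda>n. c n / real n < r / 2) sequentially"
    using r by (intro order_tendstoD(2)[of _ 0]) auto
  have ev2: "eventually (\<lambda>n. 2 \<le> c n) sequentially"
    using c(1) by (auto simp: filterlim_at_top)
  have "((\<lambda>n. (ln (real n) / real n) powr (1 / 4)) \<longlongrightarrow> 0) sequentially" by real_asymp
  then have ev3: "eventually (\<lambda>n. (ln (real n) / real n) powr (1 / 4) < (s - \<delta>) / 4) sequentially"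
    using s by (intro order_tendstoD(2)[of _ 0]) auto
  have t1: "((\<lambda>n. 1 / (real n + 1)) \<longlongrightarrow> 0) sequentially" by real_asymp
  have t2: "((\<lambda>n. Q / (real n + 1)) \<longlongrightarrow> 0) sequentially" by real_asymp
  have ev4: "eventually (\<lambda>n. 1 / (real n + 1) < r / 2) sequentially"
    using r t1 by (intro order_tendstoD(2)[of _ 0]) auto
  have ev5: "eventually (\<lambda>n. b \<noteq> pi \<longrightarrow> 1 / (real n + 1) < pi - \<bar>b\<bar>) sequentially"
  proof (cases "b = pi")
    case False
    then have "0 < pi - \<bar>b\<bar>" using b L_range by fastforce
    then have "eventually (\<lambda>n. 1 / (real n + 1) < pi - \<bar>b\<bar>) sequentially"
      using t1 by (intro order_tendstoD(2)[of _ 0]) auto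
    then show ?thesis by eventually_elim auto
  qed simp
  have ev6: "eventually (\<lambda>n. Q / (real n + 1) < min (s / 1000) ((s - \<delta>) / 4)) sequentially"
    using s t2 by (intro order_tendstoD(2)[of _ 0]) auto
  have "eventually (\<lambda>n. c n / real n < r / 2 \<and> 2 \<le> c n \<and> (ln (real n) / real n) powr (1 / 4) < (s - \<delta>) / 4 \<and>
     1 / (real n + 1) < r / 2 \<and> (b \<noteq> pi \<longrightarrow> 1 / (real n + 1) < pi - \<bar>b\<bar>) \<and> Q / (real n + 1) < min (s / 1000) ((s - \<delta>) / 4)) sequentially"
    using ev1 ev2 ev3 ev4 ev5 ev6 by eventually_elim auto
  then obtain n0 where n0: "\<And>n. n0 \<le> n \<Longrightarrow> c n / real n < r / 2 \<and> 2 \<le> c n \<and> (ln (real n) / real n) powr (1 / 4) < (s - \<delta>) / 4 \<and>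
     1 / (real n + 1) < r / 2 \<and> (b \<noteq> pi \<longrightarrow> 1 / (real n + 1) < pi - \<bar>b\<bar>) \<and> Q / (real n + 1) < min (s / 1000) ((s - \<delta>) / 4)"
    by (auto simp: eventually_sequentially)
  show thesis
  proof (rule that[of C "n0 + 1"])
    show "0 \<le> C" using C0(1) Cs by (simp add: C_def)
    fix h and N :: real assume h: "n0 + 1 \<le> h" and N_eq: "N = 2 * real h + 1"
    define n where "n = 2 * h"
    have n: "n0 \<le> n" "n = 2 * h" "1 \<le> h" "real n + 1 = N" "0 < n" "even n" using h by (auto simp: n_def N_eq)
    have N: "3 \<le> N" using n by (simp add: N_eq)
    note e = n0[OF n(1), unfolded n(4) min_less_iff_conj]
    from e have e': "(ln (real n) / real n) powr (1 / 4) < (s - \<delta>) / 4" "Q / N < (s - \<delta>) / 4" "Q / N < s / 1000" by blast+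
    obtain G where G: "G \<in> events" "prob (space M - G) \<le> C0 / N ^ 6" "\<And>\<omega> v. \<omega> \<in> G \<Longrightarrow> cmod (fluctuation h v \<omega>) \<le> \<kappa>"
      using C0(2)[of h] unfolding N_eq by blast
    have B: "8 * moment_bound 2 / N\<^sup>2 * (1 / 2) ^ j = (8 * moment_bound 2 / N\<^sup>2) * (1 / 2) ^ j" for j by simp
    obtain \<rho> where \<rho>: "\<rho> \<in> borel_measurable M" "\<And>\<omega>. 0 \<le> \<rho> \<omega>" "integrable M (\<lambda>\<omega>. \<rho> \<omega> ^ 4)"
      "expectation (\<lambda>\<omega>. \<rho> \<omega> ^ 4) \<le> 2 * (8 * moment_bound 2 / N\<^sup>2)"
      "\<And>j \<omega>. cmod (\<Sum>t = - int h..int h. of_real (of_int t / N) ^ j * fluctuation_coeff h b t \<omega>) \<le> \<rho> \<omega>"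
    proof (rule random_frequency_series[of "{- int h..int h}" "\<lambda>t. of_int t / N" "fluctuation_coeff h b" 4 "8 * moment_bound 2 / N\<^sup>2"])
      show "\<bar>of_int t / N\<bar> \<le> 1 / 2" if "t \<in> {- int h..int h}" for t
        using frequency_le_half[OF that] by (simp add: N_eq)
    qed (use fluctuation_series_moment[OF N_eq] in auto)
    have le: "x / N ^ k \<le> C / N ^ k" if "x \<le> C" for x k using that N by (intro divide_right_mono) auto
    have loc: "\<exists>u k. \<bar>u\<bar> \<le> 1 \<and> w (2 * h) \<omega> = b + u / N + 2 * pi * of_int k \<and> \<bar>u\<bar> \<le> C * (\<rho> \<omega> + 1 / N) \<and>
          \<bar>u - location_linear h b \<omega>\<bar> \<le> C * ((\<rho> \<omega>)\<^sup>2 + 1 / N) \<and>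
          (\<forall>b'\<in>L - {b}. \<bar>dirichlet h (b' - w (2 * h) \<omega>)\<bar> \<le> C)" if \<omega>: "\<omega> \<in> G" for \<omega>
    proof -
      have \<omega>': "\<omega> \<in> space M" using \<omega> G(1) sets.sets_into_space by blast
      have wn: "w n \<omega> \<in> {-pi..pi}" "retained_maxima X c \<delta> n \<omega> \<noteq> {} \<Longrightarrow>
              is_arg_min (\<lambda>v. \<bar>ydiff b v\<bar>) (\<lambda>v. v \<in> retained_maxima X c \<delta> n \<omega>) (w n \<omega>)"
        using w n(5,6) \<omega>' unfolding line_estimate_def by blast+
      obtain u k where u: "\<bar>u\<bar> \<le> 1" "w n \<omega> = b + u / N + 2 * pi * of_int k"
        "\<bar>u\<bar> \<le> 53 * (3 * \<rho> \<omega> + Q / N) / s \<and> \<bar>u - location_linear h b \<omega>\<bar> \<le> 20 / s\<^sup>2 * (5000 * (3 * \<rho> \<omega> + Q / N)\<^sup>2 + s * (Q / N))"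
      proof (rule location[OF n(2,3) b _ r s0 sep, where \<omega> = \<omega> and w = "w n \<omega>" and \<kappa> = \<kappa> and \<delta> = \<delta> and c = c, folded N_eq, folded Q_def, folded s_def])
        show "mass b \<noteq> 0" using s by (auto simp: s_def)
        show "2 * (Q / N) + 2 * \<kappa> < s / 200" using e' \<kappa> s by linarith
        have "p < (s - \<delta>) / 4 \<Longrightarrow> q < (s - \<delta>) / 4 \<Longrightarrow> \<delta> + p < s - q - \<kappa>" for p q
          using \<kappa>(3) s(2) by (simp add: field_simps)
        from this[OF e'(1,2)] show "\<delta> + (ln (real n) / real n) powr (1 / 4) < s - Q / N - \<kappa>" .
        show "2 / N \<le> c n / real n" using e n(4,5) by (intro frac_le) auto
        show "1 / N + c n / real n \<le> r" using e by linarith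
        show "\<bar>b\<bar> < pi - 1 / N" if "b \<noteq> pi" using e that by linarith
        show "cmod (fluctuation h v \<omega>) \<le> \<kappa>" for v by (rule G(3)[OF \<omega>])
        fix u k assume a: "\<bar>u\<bar> \<le> 1" "w n \<omega> = b + u / N + 2 * pi * of_int k"
          "\<And>\<rho>. (\<And>j. cmod (\<Sum>t = - int h..int h. of_real (of_int t / N) ^ j * fluctuation_coeff h b t \<omega>) \<le> \<rho>) \<Longrightarrow>
            \<bar>u\<bar> \<le> 53 * (3 * \<rho> + Q / N) / s \<and> \<bar>u - location_linear h b \<omega>\<bar> \<le> 20 / s\<^sup>2 * (5000 * (3 * \<rho> + Q / N)\<^sup>2 + s * (Q / N))"
        show thesis using that[OF a(1,2) a(3)[OF \<rho>(5)]] .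
      qed (use wn in auto)
      let ?\<rho> = "\<rho> \<omega>"
      have \<rho>0: "0 \<le> ?\<rho>" by (rule \<rho>(2))
      have N1: "0 \<le> 1 / N" "1 / N \<le> 1" using N by auto
      have m: "3 * ?\<rho> + Q / N \<le> (3 + Q) * (?\<rho> + 1 / N)" "0 \<le> 3 * ?\<rho> + Q / N"
        using \<rho>0 Q N1 mult_nonneg_nonneg[OF Q \<rho>0] by (auto simp: algebra_simps)
      have "\<bar>u\<bar> \<le> 53 * ((3 + Q) * (?\<rho> + 1 / N)) / s"
        using u(3) m s by (elim conjE) (erule order_trans, intro divide_right_mono mult_left_mono, auto)
      then have 1: "\<bar>u\<bar> \<le> C1 * (?\<rho> + 1 / N)" unfolding C1_def by (simp only: times_divide_eq_left mult.assoc)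
      have sq: "(3 * ?\<rho> + Q / N)\<^sup>2 \<le> 2 * (3 + Q)\<^sup>2 * (?\<rho>\<^sup>2 + 1 / N)"
      proof -
        have "(3 * ?\<rho> + Q / N)\<^sup>2 \<le> ((3 + Q) * (?\<rho> + 1 / N))\<^sup>2" using m by (intro power_mono) auto
        also have "\<dots> = (3 + Q)\<^sup>2 * (?\<rho> + 1 / N)\<^sup>2" by (rule power_mult_distrib)
        also have "\<dots> \<le> (3 + Q)\<^sup>2 * (2 * (?\<rho>\<^sup>2 + 1 / N))"
        proof (intro mult_left_mono)
          have "(1 / N)\<^sup>2 \<le> 1 / N" using mult_left_mono[OF N1(2) N1(1)] by (simp add: power2_eq_square)
          then have "2 * (?\<rho>\<^sup>2 + (1 / N)\<^sup>2) \<le> 2 * (?\<rho>\<^sup>2 + 1 / N)" by (intro mult_left_mono add_left_mono) auto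
          with power2_sum_le show "(?\<rho> + 1 / N)\<^sup>2 \<le> 2 * (?\<rho>\<^sup>2 + 1 / N)" by (rule order_trans)
        qed simp
        finally show ?thesis by (simp only: mult_ac)
      qed
      have "5000 * (3 * ?\<rho> + Q / N)\<^sup>2 + s * (Q / N) \<le> (5000 * (2 * (3 + Q)\<^sup>2) + s * Q) * (?\<rho>\<^sup>2 + 1 / N)"
      proof -
        have "s * Q * (1 / N) \<le> s * Q * (?\<rho>\<^sup>2 + 1 / N)" using s Q by (intro mult_left_mono) auto
        then show ?thesis using sq unfolding distrib_right[of "5000 * (2 * (3 + Q)\<^sup>2)"] by simp
      qed
      then have "20 / s\<^sup>2 * (5000 * (3 * ?\<rho> + Q / N)\<^sup>2 + s * (Q / N)) \<le> 20 / s\<^sup>2 * ((5000 * (2 * (3 + Q)\<^sup>2) + s * Q) * (?\<rho>\<^sup>2 + 1 / N))"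
        by (intro mult_left_mono) auto
      then have 2: "\<bar>u - location_linear h b \<omega>\<bar> \<le> C2 * (?\<rho>\<^sup>2 + 1 / N)"
        using u(3) by (simp only: C2_def mult.assoc) linarith
      have C12: "C1 \<le> C" "C2 \<le> C" "1 / s0 \<le> C" using Cs C0(1) by (auto simp: C_def)
      have "C1 * (?\<rho> + 1 / N) \<le> C * (?\<rho> + 1 / N)" "C2 * (?\<rho>\<^sup>2 + 1 / N) \<le> C * (?\<rho>\<^sup>2 + 1 / N)"
        using C12 \<rho>0 N1 by (intro mult_right_mono; simp)+
      moreover have "\<bar>dirichlet h (b' - w n \<omega>)\<bar> \<le> C" if b': "b' \<in> L - {b}" for b'
      proof -
        have "\<bar>u / N\<bar> \<le> 1 / N" using u(1) N by (simp add: abs_divide divide_right_mono)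
        then have "\<bar>u / N\<bar> \<le> r" using e by linarith
        note sep[OF b' this]
        then have "\<bar>dirichlet h (b' - b - u / N)\<bar> * s0 \<le> \<bar>dirichlet h (b' - b - u / N)\<bar> * \<bar>sin ((b' - b - u / N) / 2)\<bar>"
          by (intro mult_left_mono) auto
        also have "\<dots> \<le> 1" by (rule abs_dirichlet_mult_sin_le)
        finally have "\<bar>dirichlet h (b' - b - u / N)\<bar> \<le> 1 / s0" using s0 by (simp add: field_simps)
        moreover have "dirichlet h (b' - w n \<omega>) = dirichlet h (b' - b - u / N)"
          using dirichlet_periodic[of h "b' - b - u / N" "- k"] u(2) by (simp add: algebra_simps)
        ultimately show ?thesis using C12 by simp
      qed
      ultimately show ?thesis using u(1,2) 1 2 unfolding n_def by (intro exI[of _ u] exI[of _ k]) auto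
    qed
    show "\<exists>G\<in>events. \<exists>\<rho>. prob (space M - G) \<le> C / N ^ 6 \<and>
       \<rho> \<in> borel_measurable M \<and> (\<forall>\<omega>. 0 \<le> \<rho> \<omega>) \<and> integrable M (\<lambda>\<omega>. \<rho> \<omega> ^ 4) \<and> expectation (\<lambda>\<omega>. \<rho> \<omega> ^ 4) \<le> C / N\<^sup>2 \<and>
       (\<forall>\<omega>\<in>G. \<exists>u k. \<bar>u\<bar> \<le> 1 \<and> w (2 * h) \<omega> = b + u / N + 2 * pi * of_int k \<and> \<bar>u\<bar> \<le> C * (\<rho> \<omega> + 1 / N) \<and>
          \<bar>u - location_linear h b \<omega>\<bar> \<le> C * ((\<rho> \<omega>)\<^sup>2 + 1 / N) \<and>
          (\<forall>b'\<in>L - {b}. \<bar>dirichlet h (b' - w (2 * h) \<omega>)\<bar> \<le> C))"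
      using G(1,2) \<rho> loc le[of C0 6] le[of "16 * moment_bound 2" 2] Cs C0(1)
      by (intro bexI[of _ G] exI[of _ \<rho>] conjI ballI) (auto simp: C_def)
  qed
qed

end

lemma borel_measurable_cis [measurable]:
  "f \<in> borel_measurable M \<Longrightarrow> (\<lambda>x. cis (f x)) \<in> borel_measurable M"
  by (rule measurable_compose[OF _ borel_measurable_continuous_onI]) (auto intro!: continuous_intros)

section \<open>Expansion of the kernel estimate\<close>

lemma sinc_near_one: "\<bar>sinc x - 1\<bar> \<le> x\<^sup>2 / 6" for x :: real
proof (cases "x = 0")
  case False
  have "\<bar>sinc x - 1\<bar> = \<bar>sin x - x\<bar> / \<bar>x\<bar>"
    using False by (simp add: abs_divide[symmetric] diff_divide_distrib)
  also have "\<dots> \<le> (\<bar>x\<bar> ^ 3 / 6) / \<bar>x\<bar>" by (intro divide_right_mono abs_sin_minus_le_cube) simp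
  also have "\<dots> = \<bar>x\<bar>\<^sup>2 / 6" using False by (simp add: power3_eq_cube power2_eq_square)
  finally show ?thesis by simp
qed simp

lemma abs_sinc_le_one: "\<bar>sinc x\<bar> \<le> 1" for x :: real
  using abs_sin_x_le_abs_x[of x] by (simp add: divide_le_eq_1)

context line_model
begin

text \<open>Linear in the matrix y: products of the data give the estimate, \<open>cov\<close> gives
  its mean as a function of the frequency, and the difference gives the centred part. A random
  frequency is inserted only after this splitting.\<close>

definition bilinear_estimate :: "(real \<Rightarrow> real) \<Rightarrow> nat \<Rightarrow> real \<Rightarrow> (int \<Rightarrow> int \<Rightarrow> real) \<Rightarrow> complex" where
  "bilinear_estimate g h v y = (\<Sum>i\<in>{- int h..int h} \<times> {- int h..int h}.
     of_real (1 / (2 * pi * (2 * real h + 1))) * cis (- (of_int (fst i) * v)) * kernel_coeff g (fst i - snd i) * of_real (y (fst i) (snd i)))"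

definition smoothed_density :: "(real \<Rightarrow> real) \<Rightarrow> real \<Rightarrow> complex" where
  "smoothed_density g b = integral {-pi..pi} (\<lambda>\<mu>. f b \<mu> * of_real (g \<mu>))"

text \<open>A pathwise bound for everything that has to be controlled off the good event. The
  summand 1 lets lower powers be bounded by higher ones.\<close>

definition energy :: "nat \<Rightarrow> 'a \<Rightarrow> real" where
  "energy h \<omega> = 1 + \<Lambda> + (\<Sum>t = - int h..int h. (X t \<omega>)\<^sup>2)"

lemma energy_ge_one: "1 \<le> energy h \<omega>"
  using Lambda_nonneg by (auto simp: energy_def intro!: add_nonneg_nonneg sum_nonneg)

lemma all_moments_energy: "all_moments M (energy h)"
  unfolding energy_def by (intro all_moments_intros all_moments_const all_moments_X)

lemma energy_moment:
  obtains K where "0 \<le> K" "\<And>h. expectation (\<lambda>\<omega>. energy h \<omega> ^ 4) \<le> K * (2 * real h + 1) ^ 4"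
proof -
  define K where "K = 16 * ((1 + \<Lambda>) ^ 4 + fact (2 * 4) / (2 ^ 4 * fact 4) * \<Lambda> ^ 4)"
  have K: "0 \<le> K" using Lambda_nonneg by (simp add: K_def)
  show thesis
  proof (rule that[OF K])
    fix h
    define N where "N = 2 * real h + 1"
    have N: "1 \<le> N" by (simp add: N_def)
    define V where "V \<omega> = (\<Sum>t = - int h..int h. (X t \<omega>)\<^sup>2)" for \<omega>
    have V: "all_moments M V" unfolding V_def by (intro all_moments_intros all_moments_const all_moments_X)
    have V0: "0 \<le> V \<omega>" for \<omega> by (auto simp: V_def intro: sum_nonneg)
    have le: "energy h \<omega> ^ 4 \<le> 16 * ((1 + \<Lambda>) ^ 4 + V \<omega> ^ 4)" for \<omega>
    proof -
      have "energy h \<omega> ^ 4 \<le> (2 * max (1 + \<Lambda>) (V \<omega>)) ^ 4"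
        using Lambda_nonneg V0[of \<omega>] by (intro power_mono) (auto simp: energy_def V_def[symmetric] max_def)
      also have "\<dots> \<le> 16 * ((1 + \<Lambda>) ^ 4 + V \<omega> ^ 4)"
        using Lambda_nonneg V0[of \<omega>] by (auto simp: power_mult_distrib max_def)
      finally show ?thesis .
    qed
    have "expectation (\<lambda>\<omega>. energy h \<omega> ^ 4) \<le> expectation (\<lambda>\<omega>. 16 * ((1 + \<Lambda>) ^ 4 + V \<omega> ^ 4))"
      by (intro integral_mono le all_moments_integrable all_moments_intros all_moments_const all_moments_energy V)
    also have "\<dots> = 16 * ((1 + \<Lambda>) ^ 4 + expectation (\<lambda>\<omega>. V \<omega> ^ 4))"
      using all_moments_integrable[OF all_moments_power[OF V, of 4]] by (simp add: prob_space)
    also have "\<dots> \<le> 16 * ((1 + \<Lambda>) ^ 4 * N ^ 4 + fact (2 * 4) / (2 ^ 4 * fact 4) * \<Lambda> ^ 4 * N ^ 4)"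
    proof (intro mult_left_mono add_mono)
      have "(1 + \<Lambda>) ^ 4 * 1 \<le> (1 + \<Lambda>) ^ 4 * N ^ 4" using N Lambda_nonneg by (intro mult_left_mono one_le_power) auto
      then show "(1 + \<Lambda>) ^ 4 \<le> (1 + \<Lambda>) ^ 4 * N ^ 4" by simp
      show "expectation (\<lambda>\<omega>. V \<omega> ^ 4) \<le> fact (2 * 4) / (2 ^ 4 * fact 4) * \<Lambda> ^ 4 * N ^ 4"
        using weighted_square_moment[of "{- int h..int h}" 4 "\<lambda>_. 1" 1] by (simp add: V_def N_def add.commute)
    qed simp
    also have "\<dots> = K * N ^ 4" by (simp add: K_def algebra_simps)
    finally show "expectation (\<lambda>\<omega>. energy h \<omega> ^ 4) \<le> K * (2 * real h + 1) ^ 4" by (simp add: N_def)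
  qed
qed

text \<open>Products are bounded by half the sum of squares; each square then occurs N times with
  weight 1 / N, and the covariance part contributes at most \<Lambda>.\<close>

lemma bilinear_energy_bound:
  fixes d :: "int \<times> int \<Rightarrow> complex"
  assumes d: "\<And>i. i \<in> {- int h..int h} \<times> {- int h..int h} \<Longrightarrow> cmod (d i) \<le> 1 / (2 * real h + 1)"
    and y: "\<And>s t. \<bar>y s t\<bar> \<le> \<bar>X s \<omega> * X t \<omega>\<bar> + \<bar>cov s t\<bar>"
  shows "cmod (\<Sum>i\<in>{- int h..int h} \<times> {- int h..int h}. d i * of_real (y (fst i) (snd i))) \<le> energy h \<omega>"
proof -
  let ?T = "{- int h..int h}"
  define N where "N = 2 * real h + 1"
  have N: "0 < N" and cN: "real (card ?T) = N" by (simp_all add: N_def)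
  have "cmod (\<Sum>i\<in>?T \<times> ?T. d i * of_real (y (fst i) (snd i))) \<le>
     (\<Sum>i\<in>?T \<times> ?T. 1 / N * (((X (fst i) \<omega>)\<^sup>2 + (X (snd i) \<omega>)\<^sup>2) / 2 + \<bar>cov (fst i) (snd i)\<bar>))"
  proof (intro order_trans[OF norm_sum] sum_mono)
    fix i assume i: "i \<in> ?T \<times> ?T"
    have "\<bar>y (fst i) (snd i)\<bar> \<le> ((X (fst i) \<omega>)\<^sup>2 + (X (snd i) \<omega>)\<^sup>2) / 2 + \<bar>cov (fst i) (snd i)\<bar>"
      by (rule order_trans[OF y add_right_mono[OF abs_mult_le_squares]])
    then show "cmod (d i * of_real (y (fst i) (snd i))) \<le> 1 / N * (((X (fst i) \<omega>)\<^sup>2 + (X (snd i) \<omega>)\<^sup>2) / 2 + \<bar>cov (fst i) (snd i)\<bar>)"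
      unfolding norm_mult norm_of_real using d[OF i] N by (intro mult_mono) (auto simp: N_def)
  qed
  also have "\<dots> = 1 / N * ((\<Sum>s\<in>?T. \<Sum>t\<in>?T. (X s \<omega>)\<^sup>2 / 2) + (\<Sum>s\<in>?T. \<Sum>t\<in>?T. (X t \<omega>)\<^sup>2 / 2) + (\<Sum>s\<in>?T. \<Sum>t\<in>?T. \<bar>cov s t\<bar>))"
    by (simp only: sum.cartesian_product' sum_distrib_left[symmetric] sum.distrib add_divide_distrib fst_conv snd_conv)
  also have "(\<Sum>s\<in>?T. \<Sum>t\<in>?T. (X s \<omega>)\<^sup>2 / 2) + (\<Sum>s\<in>?T. \<Sum>t\<in>?T. (X t \<omega>)\<^sup>2 / 2) = N * (\<Sum>t\<in>?T. (X t \<omega>)\<^sup>2)"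
    unfolding sum_constant cN by (simp only: sum_distrib_left[symmetric] sum_divide_distrib[symmetric])
  also have "1 / N * (N * (\<Sum>t\<in>?T. (X t \<omega>)\<^sup>2) + (\<Sum>s\<in>?T. \<Sum>t\<in>?T. \<bar>cov s t\<bar>)) \<le> 1 / N * (N * (\<Sum>t\<in>?T. (X t \<omega>)\<^sup>2) + N * \<Lambda>)"
    using sum_cov_le[of ?T] N unfolding cN by (intro mult_left_mono add_left_mono) auto
  also have "\<dots> = (\<Sum>t\<in>?T. (X t \<omega>)\<^sup>2) + \<Lambda>" using N by (simp add: distrib_left)
  finally show ?thesis by (simp add: energy_def)
qed

text \<open>Each line is treated by \<open>smoothed_periodogram_bias\<close> with y = b - v. The
  bound is uniform in v, so v may afterwards be replaced by the random frequency.\<close>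

lemma smoothed_mean:
  assumes g: "continuous_on {-pi..pi} g" "\<And>x. 0 \<le> g x" "integral {-pi..pi} g \<le> 1" and N: "N = 2 * real h + 1"
  shows "cmod (bilinear_estimate g h v cov - (\<Sum>b\<in>L. of_real (dirichlet h (b - v) / N) * smoothed_density g b))
     \<le> card L * B / N * integral {-pi..pi} (\<lambda>x. \<bar>dirichlet h x\<bar>)"
proof -
  let ?T = "{- int h..int h}"
  have Np: "0 < N" by (simp add: N)
  define c where "c = complex_of_real (1 / (2 * pi * N))"
  define E where "E b = (\<Sum>s\<in>?T. \<Sum>t\<in>?T. cis (of_int s * (b - v)) * line_coeff f b (s - t) * kernel_coeff g (s - t))" for b
  define I where "I = integral {-pi..pi} (\<lambda>x. \<bar>dirichlet h x\<bar>)"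
  have I: "0 \<le> I" unfolding I_def
    by (intro Henstock_Kurzweil_Integration.integral_nonneg integrable_continuous_real continuous_intros) auto
  have "bilinear_estimate g h v cov = (\<Sum>s\<in>?T. \<Sum>t\<in>?T. \<Sum>b\<in>L. c * (cis (of_int s * (b - v)) * line_coeff f b (s - t) * kernel_coeff g (s - t)))"
    unfolding bilinear_estimate_def sum.cartesian_product' fst_conv snd_conv cov_lines c_def[symmetric, unfolded N]
  proof (intro sum.cong refl)
    fix s t
    have cc: "cis (of_int s * (b - v)) = cis (- (of_int s * v)) * cis (of_int s * b)" for b
      by (simp add: cis_mult algebra_simps)
    show "c * cis (- (of_int s * v)) * kernel_coeff g (s - t) * (\<Sum>b\<in>L. cis (of_int s * b) * line_coeff f b (s - t)) =
       (\<Sum>b\<in>L. c * (cis (of_int s * (b - v)) * line_coeff f b (s - t) * kernel_coeff g (s - t)))"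
      unfolding sum_distrib_left cc by (intro sum.cong refl) (simp only: mult_ac)
  qed
  also have "\<dots> = (\<Sum>b\<in>L. c * E b)"
    unfolding E_def by (simp only: sum_distrib_left sum.swap[of _ _ L])
  finally have "cmod (bilinear_estimate g h v cov - (\<Sum>b\<in>L. of_real (dirichlet h (b - v) / N) * smoothed_density g b)) =
     cmod (\<Sum>b\<in>L. c * E b - of_real (dirichlet h (b - v) / N) * smoothed_density g b)"
    by (simp only: sum_subtractf)
  also have "\<dots> \<le> (\<Sum>b\<in>L. B / N * I)"
  proof (intro sum_norm_le)
    fix b assume b: "b \<in> L"
    have B: "0 \<le> B" using order_trans[OF norm_ge_zero lipschitz[OF b, of 1 0]] by simp
    have "c * E b - of_real (dirichlet h (b - v) / N) * smoothed_density g b =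
       c * (E b - of_real (2 * pi * dirichlet h (b - v)) * smoothed_density g b)"
    proof -
      have "of_real (dirichlet h (b - v) / N) = c * of_real (2 * pi * dirichlet h (b - v))"
        unfolding c_def of_real_mult[symmetric] using Np by simp
      then show ?thesis by (simp only: right_diff_distrib mult.assoc)
    qed
    also have "cmod \<dots> = 1 / (2 * pi * N) * cmod (E b - of_real (2 * pi * dirichlet h (b - v)) * smoothed_density g b)"
      unfolding norm_mult c_def norm_of_real using Np by simp
    also have "\<dots> \<le> 1 / (2 * pi * N) * (B * pi * I)"
    proof (intro mult_left_mono)
      show "cmod (E b - of_real (2 * pi * dirichlet h (b - v)) * smoothed_density g b) \<le> B * pi * I"
        using smoothed_periodogram_bias[OF periodic[OF b] lipschitz[OF b] continuous[OF b] g, where h = h and y = "b - v"]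
        by (simp only: E_def line_coeff_def kernel_coeff_def smoothed_density_def I_def)
    qed (use Np in auto)
    also have "\<dots> \<le> B / N * I" using Np B I by (simp add: field_simps)
    finally show "cmod (c * E b - of_real (dirichlet h (b - v) / N) * smoothed_density g b) \<le> B / N * I" .
  qed
  finally show ?thesis by (simp add: I_def)
qed

lemma density_bound:
  obtains F where "0 \<le> F" "\<And>b x. b \<in> L \<Longrightarrow> x \<in> {-pi..pi} \<Longrightarrow> cmod (f b x) \<le> F"
proof -
  have "\<exists>F. \<forall>x\<in>{-pi..pi}. cmod (f b x) \<le> F" if "b \<in> L" for b
  proof -
    have "compact (f b ` {-pi..pi})"
      by (rule compact_continuous_image[OF continuous_on_subset[OF continuous[OF that]]]) auto
    then have "bounded (f b ` {-pi..pi})" by (rule compact_imp_bounded)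
    then show ?thesis unfolding bounded_iff by blast
  qed
  then have "\<forall>b\<in>L. \<exists>F. \<forall>x\<in>{-pi..pi}. cmod (f b x) \<le> F" by blast
  from bchoice[OF this] obtain F where "\<forall>b\<in>L. \<forall>x\<in>{-pi..pi}. cmod (f b x) \<le> F b" by blast
  then have F: "\<And>b x. b \<in> L \<Longrightarrow> x \<in> {-pi..pi} \<Longrightarrow> cmod (f b x) \<le> F b" by blast
  show thesis
  proof (rule that[of "\<Sum>b\<in>L. \<bar>F b\<bar>"])
    fix b x assume bx: "b \<in> L" "x \<in> {-pi..pi}"
    have "cmod (f b x) \<le> \<bar>F b\<bar>" using F[OF bx] by linarith
    also have "\<dots> \<le> (\<Sum>b\<in>L. \<bar>F b\<bar>)" using bx finite_L by (intro member_le_sum) auto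
    finally show "cmod (f b x) \<le> (\<Sum>b\<in>L. \<bar>F b\<bar>)" .
  qed (auto intro: sum_nonneg)
qed

lemma norm_smoothed_density_le:
  assumes g: "continuous_on {-pi..pi} g" "\<And>x. 0 \<le> g x" "integral {-pi..pi} g \<le> 1" and b: "b \<in> L"
    and F: "0 \<le> F" "\<And>x. x \<in> {-pi..pi} \<Longrightarrow> cmod (f b x) \<le> F"
  shows "cmod (smoothed_density g b) \<le> F"
proof -
  have c: "continuous_on {-pi..pi} (f b)" using continuous[OF b] by (rule continuous_on_subset) simp
  have "cmod (smoothed_density g b) \<le> integral {-pi..pi} (\<lambda>x. F * g x)"
    unfolding smoothed_density_def using F g
    by (intro integral_norm_bound_integral integrable_continuous_real continuous_intros c g) (auto simp: norm_mult mult_right_mono)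
  also have "\<dots> = F * integral {-pi..pi} g" by (rule integral_mult_right)
  also have "\<dots> \<le> F * 1" using F g by (intro mult_left_mono) auto
  finally show ?thesis by simp
qed

text \<open>Exhibits the linear part of the location as a diagonal quadratic form with coefficients
  O(1 / N), the shape required by \<open>bilinear_quadratic_covariance\<close>. Frequencies at most
  1/2 and curvature at least 1/20 give the 10.\<close>

lemma location_linear_coefficients:
  assumes h: "1 \<le> h" and \<sigma>: "mass b \<noteq> 0"
  obtains a where "\<And>\<omega>. location_linear h b \<omega> = (\<Sum>t = - int h..int h. a t * ((X t \<omega>)\<^sup>2 - cov t t))"
    "\<And>t. t \<in> {- int h..int h} \<Longrightarrow> \<bar>a t\<bar> \<le> 10 / (cmod (mass b) * (2 * real h + 1))"
proof -
  define N where "N = 2 * real h + 1"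
  define s where "s = cmod (mass b)"
  have N: "0 < N" and s: "0 < s" using \<sigma> by (auto simp: N_def s_def)
  define z where "z t = cnj (mass b) * (- \<i> * of_real (of_int t / N) * (cis (- (of_int t * b)) / of_real N))" for t :: int
  define a where "a t = Re (z t) / (s\<^sup>2 * second_moment h)" for t
  show thesis
  proof (rule that[of a])
    fix \<omega>
    have "cnj (mass b) * (\<Sum>t = - int h..int h. - \<i> * of_real (of_int t / N) * fluctuation_coeff h b t \<omega>) =
       (\<Sum>t = - int h..int h. z t * of_real ((X t \<omega>)\<^sup>2 - cov t t))"
      unfolding sum_distrib_left fluctuation_coeff_def z_def N_def by (simp only: mult.assoc)
    then have "Re (cnj (mass b) * (\<Sum>t = - int h..int h. - \<i> * of_real (of_int t / N) * fluctuation_coeff h b t \<omega>)) =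
       (\<Sum>t = - int h..int h. Re (z t) * ((X t \<omega>)\<^sup>2 - cov t t))"
      by (simp only: Re_sum) simp
    then show "location_linear h b \<omega> = (\<Sum>t = - int h..int h. a t * ((X t \<omega>)\<^sup>2 - cov t t))"
      unfolding location_linear_def N_def[symmetric] s_def[symmetric] a_def by (simp add: sum_divide_distrib)
  next
    fix t assume t: "t \<in> {- int h..int h}"
    have "\<bar>Re (z t)\<bar> \<le> cmod (z t)" by (rule abs_Re_le_cmod)
    also have "\<dots> = s * (\<bar>of_int t / N\<bar> * (1 / N))"
      unfolding z_def norm_mult norm_divide norm_cis norm_of_real s_def using N by simp
    also have "\<dots> \<le> s * (1 / 2 * (1 / N))"
      using frequency_le_half[OF t] N s by (intro mult_left_mono mult_right_mono) (auto simp: N_def)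
    finally have "\<bar>Re (z t)\<bar> \<le> s / (2 * N)" by simp
    then have "\<bar>Re (z t)\<bar> / (s\<^sup>2 * second_moment h) \<le> (s / (2 * N)) / (s\<^sup>2 * (1 / 20))"
      using second_moment_bounds[OF h] s by (intro frac_le mult_left_mono) auto
    also have "\<dots> = 10 / (s * N)" using s N by (simp add: power2_eq_square)
    finally show "\<bar>a t\<bar> \<le> 10 / (cmod (mass b) * (2 * real h + 1))"
      using second_moment_bounds[OF h] s by (simp add: a_def abs_divide abs_mult s_def N_def)
  qed
qed

lemma measurable_location_linear [measurable]: "location_linear h b \<in> borel_measurable M"
  unfolding location_linear_def by measurable

text \<open>The difference of the two integrands is split into terms whose means are computed and a
  remainder bounded pointwise by an integrable variable. The constant does not depend on g, hence
  not on the bandwidth.\<close>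

lemma estimate_expansion:
  fixes c :: "nat \<Rightarrow> real" and w :: "nat \<Rightarrow> 'a \<Rightarrow> real"
  assumes b: "b \<in> L" and \<delta>: "0 < \<delta>" "\<delta> < cmod (mass b)"
    and c: "filterlim c at_top sequentially" "c \<in> o(\<lambda>n. real n)"
    and w: "line_estimate M X c \<delta> b w"
  obtains C h0 where "0 \<le> C"
    "\<And>h N g. h0 \<le> h \<Longrightarrow> N = 2 * real h + 1 \<Longrightarrow> continuous_on {-pi..pi} g \<Longrightarrow> (\<And>x. 0 \<le> g x) \<Longrightarrow> integral {-pi..pi} g \<le> 1 \<Longrightarrow>
       cmod ((\<integral>\<omega>. bilinear_estimate g h (w (2 * h) \<omega>) (\<lambda>s t. X s \<omega> * X t \<omega>) \<partial>M) -
         (\<integral>\<omega>. of_real (sinc (N / 2 * ydiff b (w (2 * h) \<omega>))) * smoothed_density g b \<partial>M))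
        \<le> C * (1 + integral {-pi..pi} (\<lambda>x. \<bar>dirichlet h x\<bar>)) / N"
    "\<And>h N. h0 \<le> h \<Longrightarrow> N = 2 * real h + 1 \<Longrightarrow>
       integrable M (\<lambda>\<omega>. sinc (N / 2 * ydiff b (w (2 * h) \<omega>))) \<and>
       expectation (\<lambda>\<omega>. \<bar>sinc (N / 2 * ydiff b (w (2 * h) \<omega>)) - 1\<bar>) \<le> C / N"
proof -
  define s where "s = cmod (mass b)"
  have s: "0 < s" and \<sigma>0: "mass b \<noteq> 0" using \<delta> by (auto simp: s_def)
  obtain C h1 where C: "0 \<le> C" and loc: "\<And>h N. h1 \<le> h \<Longrightarrow> N = 2 * real h + 1 \<Longrightarrow> \<exists>G\<in>events. \<exists>\<rho>. prob (space M - G) \<le> C / N ^ 6 \<and>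
       \<rho> \<in> borel_measurable M \<and> (\<forall>\<omega>. 0 \<le> \<rho> \<omega>) \<and> integrable M (\<lambda>\<omega>. \<rho> \<omega> ^ 4) \<and> expectation (\<lambda>\<omega>. \<rho> \<omega> ^ 4) \<le> C / N\<^sup>2 \<and>
       (\<forall>\<omega>\<in>G. \<exists>u k. \<bar>u\<bar> \<le> 1 \<and> w (2 * h) \<omega> = b + u / N + 2 * pi * of_int k \<and> \<bar>u\<bar> \<le> C * (\<rho> \<omega> + 1 / N) \<and>
          \<bar>u - location_linear h b \<omega>\<bar> \<le> C * ((\<rho> \<omega>)\<^sup>2 + 1 / N) \<and>
          (\<forall>b'\<in>L - {b}. \<bar>dirichlet h (b' - w (2 * h) \<omega>)\<bar> \<le> C))"
    using location_eventually[OF b \<delta> c w] by blast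
  obtain F where F: "0 \<le> F" "\<And>b x. b \<in> L \<Longrightarrow> x \<in> {-pi..pi} \<Longrightarrow> cmod (f b x) \<le> F"
    using density_bound by blast
  obtain KU where KU: "0 \<le> KU" "\<And>h. expectation (\<lambda>\<omega>. energy h \<omega> ^ 4) \<le> KU * (2 * real h + 1) ^ 4"
    using energy_moment by blast
  have B: "0 \<le> B" using order_trans[OF norm_ge_zero lipschitz[OF b, of 1 0]] by simp
  define K1 where "K1 = 6 * C\<^sup>2 + C + F * C\<^sup>2 + card L * F * C + card L * B"
  define K2 where "K2 = 2 + F + 10 / s"
  define K where "K = 2 * K1 + K2"
  have K: "0 \<le> K1" "0 \<le> K2" "0 \<le> K" using C F(1) B s by (auto simp: K1_def K2_def K_def)
  define CE where "CE = 20 * \<Lambda>\<^sup>2 / s + K * (1 + 8 * \<Lambda>\<^sup>2 + C + KU + C + 1)"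
  define CS where "CS = C\<^sup>2 * (2 + C) + 2 * C"
  have CC: "0 \<le> CE" "0 \<le> CS" using K C KU(1) s by (auto simp: CE_def CS_def)
  have core: "cmod ((\<integral>\<omega>. bilinear_estimate g h (w (2 * h) \<omega>) (\<lambda>s t. X s \<omega> * X t \<omega>) \<partial>M) -
         (\<integral>\<omega>. of_real (sinc (N / 2 * ydiff b (w (2 * h) \<omega>))) * smoothed_density g b \<partial>M))
        \<le> CE * (1 + integral {-pi..pi} (\<lambda>x. \<bar>dirichlet h x\<bar>)) / N" (is ?A1)
     and sincs: "integrable M (\<lambda>\<omega>. sinc (N / 2 * ydiff b (w (2 * h) \<omega>)))" (is ?A2)
       "expectation (\<lambda>\<omega>. \<bar>sinc (N / 2 * ydiff b (w (2 * h) \<omega>)) - 1\<bar>) \<le> CS / N" (is ?A3)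
    if h: "h1 + 1 \<le> h" and N_eq: "N = 2 * real h + 1"
      and g: "continuous_on {-pi..pi} g" "\<And>x. 0 \<le> g x" "integral {-pi..pi} g \<le> 1" for h N g
  proof -
    let ?T = "{- int h..int h}" and ?\<theta> = "\<lambda>i :: int \<times> int. of_int (fst i) / N :: real"
    define I where "I = integral {-pi..pi} (\<lambda>x. \<bar>dirichlet h x\<bar>)"
    have I: "0 \<le> I" unfolding I_def
      by (intro Henstock_Kurzweil_Integration.integral_nonneg integrable_continuous_real continuous_intros) auto
    have h1: "1 \<le> h" "h1 \<le> h" using h by auto
    have N: "1 \<le> N" by (simp add: N_eq)
    have [measurable]: "w (2 * h) \<in> borel_measurable M"
      using w h1 unfolding line_estimate_def by simp
    have [measurable]: "(\<lambda>\<omega>. sinc (N / 2 * ydiff b (w (2 * h) \<omega>))) \<in> borel_measurable M"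
      unfolding ydiff_def by measurable
    obtain G \<rho> where G[measurable]: "G \<in> events" and PG: "prob (space M - G) \<le> C / N ^ 6"
      and \<rho>[measurable]: "\<rho> \<in> borel_measurable M" and \<rho>0: "\<And>\<omega>. 0 \<le> \<rho> \<omega>"
      and \<rho>int: "integrable M (\<lambda>\<omega>. \<rho> \<omega> ^ 4)" "expectation (\<lambda>\<omega>. \<rho> \<omega> ^ 4) \<le> C / N\<^sup>2"
      and good: "\<And>\<omega>. \<omega> \<in> G \<Longrightarrow> \<exists>u k. \<bar>u\<bar> \<le> 1 \<and> w (2 * h) \<omega> = b + u / N + 2 * pi * of_int k \<and> \<bar>u\<bar> \<le> C * (\<rho> \<omega> + 1 / N) \<and>
          \<bar>u - location_linear h b \<omega>\<bar> \<le> C * ((\<rho> \<omega>)\<^sup>2 + 1 / N) \<and>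
          (\<forall>b'\<in>L - {b}. \<bar>dirichlet h (b' - w (2 * h) \<omega>)\<bar> \<le> C)"
      using loc[OF h1(2) N_eq] by blast
    define Y where "Y \<omega> = sinc (N / 2 * ydiff b (w (2 * h) \<omega>))" for \<omega>
    have Y1: "\<bar>Y \<omega>\<bar> \<le> 1" for \<omega> unfolding Y_def by (rule abs_sinc_le_one)
    have [measurable]: "Y \<in> borel_measurable M" unfolding Y_def by measurable
    have Yint: "integrable M Y" by (rule integrable_const_bound[where B = 1]) (use Y1 in auto)
    define \<tau> where "\<tau> \<omega> = (\<rho> \<omega>)\<^sup>2 + 1 / N" for \<omega>
    define bad where "bad \<omega> = indicat_real (space M - G) \<omega>" for \<omega>
    have badint: "integrable M bad" "expectation bad \<le> C / N ^ 6"
      unfolding bad_def using PG by (auto intro!: integrable_real_indicator simp: emeasure_eq_measure)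
    have u2: "u\<^sup>2 \<le> 2 * C\<^sup>2 * \<tau> \<omega>" if "\<bar>u\<bar> \<le> C * (\<rho> \<omega> + 1 / N)" for u \<omega>
    proof -
      have "\<bar>u\<bar>\<^sup>2 \<le> (C * (\<rho> \<omega> + 1 / N))\<^sup>2" using that by (intro power_mono) auto
      also have "\<dots> = C\<^sup>2 * (\<rho> \<omega> + 1 / N)\<^sup>2" by (rule power_mult_distrib)
      also have "\<dots> \<le> C\<^sup>2 * (2 * ((\<rho> \<omega>)\<^sup>2 + (1 / N)\<^sup>2))" by (intro mult_left_mono power2_sum_le) simp
      also have "\<dots> \<le> C\<^sup>2 * (2 * ((\<rho> \<omega>)\<^sup>2 + 1 / N))"
      proof (intro mult_left_mono add_left_mono)
        have "1 / N * (1 / N) \<le> 1 / N * 1" using N by (intro mult_left_mono) auto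
        then show "(1 / N)\<^sup>2 \<le> 1 / N" by (simp add: power2_eq_square)
      qed auto
      finally show ?thesis by (simp only: \<tau>_def mult_ac power2_abs)
    qed
    have sinc_good: "\<bar>Y \<omega> - 1\<bar> \<le> u\<^sup>2 / 24" if "\<bar>u\<bar> \<le> 1" "w (2 * h) \<omega> = b + u / N + 2 * pi * of_int k" for u k \<omega>
    proof -
      have "\<bar>u / N\<bar> \<le> 1"
        using that(1) N by (simp add: abs_divide divide_le_eq_1)
      then have "- pi < - (u / N)" "- (u / N) \<le> pi" using pi_gt3 by linarith+
      from wrap_add_multiple[OF this, of "- k"] have "ydiff b (w (2 * h) \<omega>) = - (u / N)"
        by (simp add: ydiff_def that(2))
      then have "N / 2 * ydiff b (w (2 * h) \<omega>) = - (u / 2)" using N by simp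
      then have "Y \<omega> = sinc (- (u / 2))" unfolding Y_def by (simp only:)
      moreover have "(- (u / 2))\<^sup>2 / 6 = u\<^sup>2 / 24" by (simp add: power_divide)
      ultimately show ?thesis using sinc_near_one[of "- (u / 2)"] by (simp only:)
    qed
    define \<rho>4 where "\<rho>4 \<omega> = \<rho> \<omega> ^ 4" for \<omega>
    \<comment> \<open>The weights 1 / N and N balance: for x in L2 the first term has mean O(1 / N),
      and so has the second because the fourth moment of \<rho> is O(N^(-2)).\<close>
    have r4: "(\<rho> \<omega>)\<^sup>2 * x \<le> (x\<^sup>2 / N + N * \<rho>4 \<omega>) / 2" for \<omega> x
    proof -
      have "0 \<le> (x - N * (\<rho> \<omega>)\<^sup>2)\<^sup>2 / N" using N by simp
      also have "\<dots> = x\<^sup>2 / N - 2 * ((\<rho> \<omega>)\<^sup>2 * x) + N * \<rho>4 \<omega>"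
        using N by (simp add: power2_diff \<rho>4_def field_simps power2_eq_square) (simp add: eval_nat_numeral algebra_simps)
      finally have "0 \<le> x\<^sup>2 / N - 2 * ((\<rho> \<omega>)\<^sup>2 * x) + N * \<rho>4 \<omega>" .
      moreover have "0 \<le> p - 2 * q + r \<Longrightarrow> q \<le> (p + r) / 2" for p q r :: real by simp
      ultimately show ?thesis by blast
    qed
    show ?A2 using Yint unfolding Y_def[abs_def] .
    show ?A3
    proof -
      have pw: "\<bar>Y \<omega> - 1\<bar> \<le> C\<^sup>2 * (2 * (1 / N) + N * \<rho>4 \<omega>) + 2 * bad \<omega>" if \<omega>: "\<omega> \<in> space M" for \<omega>
      proof (cases "\<omega> \<in> G")
        case True
        obtain u k where u: "\<bar>u\<bar> \<le> 1" "w (2 * h) \<omega> = b + u / N + 2 * pi * of_int k" "\<bar>u\<bar> \<le> C * (\<rho> \<omega> + 1 / N)"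
          using good[OF True] by blast
        have "\<bar>Y \<omega> - 1\<bar> \<le> u\<^sup>2 / 24" by (rule sinc_good[OF u(1,2)])
        also have "\<dots> \<le> C\<^sup>2 * \<tau> \<omega>"
        proof -
          have "0 \<le> C\<^sup>2 * \<tau> \<omega>" using N by (simp add: \<tau>_def)
          moreover have "p \<le> 2 * q \<Longrightarrow> 0 \<le> q \<Longrightarrow> p / 24 \<le> q" for p q :: real by simp
          ultimately show ?thesis using u2[OF u(3)] unfolding mult.assoc by blast
        qed
        also have "\<dots> \<le> C\<^sup>2 * (2 * (1 / N) + N * \<rho>4 \<omega>)"
        proof (intro mult_left_mono)
          define y where "y = 1 / N"
          define z where "z = N * \<rho>4 \<omega>"
          have yz: "0 \<le> y" "0 \<le> z" using N \<rho>0 by (auto simp: y_def z_def \<rho>4_def)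
          have "(\<rho> \<omega>)\<^sup>2 \<le> (y + z) / 2" using r4[of \<omega> 1] by (simp add: y_def z_def)
          then show "\<tau> \<omega> \<le> 2 * (1 / N) + N * \<rho>4 \<omega>" unfolding \<tau>_def y_def[symmetric] z_def[symmetric] using yz by argo
        qed simp
        finally show ?thesis using True by (simp add: bad_def)
      next
        case False
        have "0 \<le> C\<^sup>2 * (2 * (1 / N) + N * \<rho>4 \<omega>)" using N by (intro mult_nonneg_nonneg add_nonneg_nonneg) (auto simp: \<rho>4_def)
        moreover have "\<bar>Y \<omega> - 1\<bar> \<le> 2" using Y1[of \<omega>] by linarith
        ultimately show ?thesis using False \<omega> by (simp add: bad_def)
      qed
      have "expectation (\<lambda>\<omega>. \<bar>Y \<omega> - 1\<bar>) \<le> expectation (\<lambda>\<omega>. C\<^sup>2 * (2 * (1 / N) + N * \<rho>4 \<omega>) + 2 * bad \<omega>)"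
        using Yint \<rho>int(1) badint(1) pw by (intro integral_mono) (auto simp: \<rho>4_def)
      also have "\<dots> = C\<^sup>2 * (2 * (1 / N) + N * expectation \<rho>4) + 2 * expectation bad"
        using \<rho>int(1) badint(1) by (simp add: \<rho>4_def[abs_def] prob_space)
      also have "\<dots> \<le> C\<^sup>2 * (2 * (1 / N) + N * (C / N\<^sup>2)) + 2 * (C / N)"
      proof (intro add_mono mult_left_mono order_refl)
        show "expectation \<rho>4 \<le> C / N\<^sup>2" using \<rho>int(2) by (simp add: \<rho>4_def[abs_def])
        have "C / N ^ 6 \<le> C / N ^ 1" using C N by (intro divide_left_mono power_increasing) auto
        then show "expectation bad \<le> C / N" using badint(2) by simp
      qed (use N in auto)
      also have "\<dots> = CS / N" using N by (simp add: CS_def field_simps power2_eq_square)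
      finally show ?thesis unfolding Y_def .
    qed
    show ?A1
    proof -
      define J where "J = smoothed_density g b"
      have J: "cmod (smoothed_density g b') \<le> F" if "b' \<in> L" for b'
        by (rule norm_smoothed_density_le[OF g that F(1) F(2)[OF that]])
      define est where "est \<omega> = bilinear_estimate g h (w (2 * h) \<omega>) (\<lambda>s t. X s \<omega> * X t \<omega>)" for \<omega>
      define cf where "cf v i = of_real (1 / (2 * pi * N)) * cis (- (of_int (fst i) * v)) * kernel_coeff g (fst i - snd i)" for v and i :: "int \<times> int"
      have cf: "cmod (cf v i) \<le> 1 / N" for v i
      proof -
        have "cmod (cf v i) = 1 / (2 * pi * N) * cmod (kernel_coeff g (fst i - snd i))"
          unfolding cf_def norm_mult norm_cis norm_of_real using N by simp
        also have "\<dots> \<le> 1 / (2 * pi * N) * 1"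
          using norm_kernel_coeff_le[OF g] N by (intro mult_left_mono) auto
        also have "\<dots> \<le> 1 / N" using N pi_gt3 by (simp add: field_simps)
        finally show ?thesis .
      qed
      have bil: "bilinear_estimate g h v y = (\<Sum>i\<in>?T \<times> ?T. cf v i * of_real (y (fst i) (snd i)))" for v y
        by (simp only: bilinear_estimate_def cf_def N_eq)
      define x where "x i \<omega> = cf b i * of_real (X (fst i) \<omega> * X (snd i) \<omega> - cov (fst i) (snd i))" for i \<omega>
      have [measurable]: "x i \<in> borel_measurable M" for i unfolding x_def by measurable
      define a where "a k \<omega> = (\<Sum>i\<in>?T \<times> ?T. of_real (?\<theta> i) ^ k * x i \<omega>)" for k \<omega>
      have \<theta>: "\<bar>?\<theta> i\<bar> \<le> 1 / 2" if "i \<in> ?T \<times> ?T" for i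
        using frequency_le_half[of "fst i" h] that unfolding N_eq by (metis mem_Times_iff)
      have co: "cmod (of_real (?\<theta> i) ^ k * cf b i) \<le> (1 / 2) ^ k / N" if "i \<in> ?T \<times> ?T" for i k
      proof -
        have "cmod (of_real (?\<theta> i) ^ k * cf b i) \<le> (1 / 2) ^ k * (1 / N)"
          unfolding norm_mult norm_power norm_of_real using \<theta>[OF that] cf by (intro mult_mono power_mono) auto
        then show ?thesis by simp
      qed
      have a_eq: "a k \<omega> = (\<Sum>i\<in>?T \<times> ?T. (of_real (?\<theta> i) ^ k * cf b i) * of_real (X (fst i) \<omega> * X (snd i) \<omega> - cov (fst i) (snd i)))" for k \<omega>
        by (simp only: a_def x_def mult.assoc)
      have [measurable]: "a k \<in> borel_measurable M" for k unfolding a_def by measurable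
      have cardT: "real (card ?T) = N" by (simp add: N_eq)
      \<comment> \<open>Dominates all Taylor coefficients of the centred estimate. Its second moment
        is only bounded, in contrast to the decaying moments of \<rho>.\<close>
      obtain W where W[measurable]: "W \<in> borel_measurable M" and W0: "\<And>\<omega>. 0 \<le> W \<omega>" and Wint: "integrable M (\<lambda>\<omega>. (W \<omega>)\<^sup>2)"
        "expectation (\<lambda>\<omega>. (W \<omega>)\<^sup>2) \<le> 2 * (4 * \<Lambda>\<^sup>2)" and aW: "\<And>k \<omega>. cmod (a k \<omega>) \<le> W \<omega>"
      proof (rule random_frequency_series[of "?T \<times> ?T" ?\<theta> x 2 "4 * \<Lambda>\<^sup>2", folded a_def])
        show "finite (?T \<times> ?T)" by simp
        fix k
        show "integrable M (\<lambda>\<omega>. (cmod (a k \<omega>))\<^sup>2)"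
          unfolding a_eq by (rule bilinear_moment(1)[OF _ co]) auto
        have "expectation (\<lambda>\<omega>. (cmod (a k \<omega>))\<^sup>2) \<le> 4 * ((1 / 2) ^ k / N)\<^sup>2 * (card ?T * \<Lambda>)\<^sup>2"
          unfolding a_eq by (rule bilinear_moment(2)[OF _ co]) auto
        also have "\<dots> = 4 * \<Lambda>\<^sup>2 * ((1 / 2) ^ k)\<^sup>2"
          unfolding cardT using N by (simp add: power_mult_distrib power_divide)
        also have "\<dots> \<le> 4 * \<Lambda>\<^sup>2 * (1 / 2) ^ k"
        proof (intro mult_left_mono)
          have "((1 / 2 :: real) ^ k)\<^sup>2 \<le> ((1 / 2) ^ k) ^ 1" by (intro power_decreasing) (auto intro: power_le_one)
          then show "((1 / 2 :: real) ^ k)\<^sup>2 \<le> (1 / 2) ^ k" by simp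
        qed auto
        finally show "expectation (\<lambda>\<omega>. (cmod (a k \<omega>))\<^sup>2) \<le> 4 * \<Lambda>\<^sup>2 * (1 / 2) ^ k" .
      qed (use \<theta> in auto)
      define l where "l = location_linear h b"
      have [measurable]: "l \<in> borel_measurable M" unfolding l_def by measurable
      obtain al where al: "\<And>\<omega>. l \<omega> = (\<Sum>t\<in>?T. al t * ((X t \<omega>)\<^sup>2 - cov t t))"
        "\<And>t. t \<in> ?T \<Longrightarrow> \<bar>al t\<bar> \<le> 10 / (s * N)"
        using location_linear_coefficients[OF h1(1) \<sigma>0] unfolding l_def s_def N_eq by blast
      let ?U = "energy h"
      have U1: "1 \<le> ?U \<omega>" for \<omega> by (rule energy_ge_one)
      have [measurable]: "?U \<in> borel_measurable M" by (rule all_moments_measurable[OF all_moments_energy])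
      have Uint: "integrable M (\<lambda>\<omega>. ?U \<omega> ^ k)" for k
        by (intro all_moments_integrable all_moments_intros all_moments_energy)
      have estU: "cmod (est \<omega>) \<le> ?U \<omega>" for \<omega>
        unfolding est_def bil by (rule bilinear_energy_bound) (use cf in \<open>auto simp: N_eq\<close>)
      have aU: "cmod (a k \<omega>) \<le> ?U \<omega>" for k \<omega>
        unfolding a_eq
      proof (rule bilinear_energy_bound)
        show "cmod (of_real (?\<theta> i) ^ k * cf b i) \<le> 1 / (2 * real h + 1)" if "i \<in> ?T \<times> ?T" for i
        proof -
          have "(1 / 2) ^ k / N \<le> 1 / N" using N by (intro divide_right_mono power_le_one) auto
          then show ?thesis using co[OF that, of k] by (simp only: N_eq)
        qed
      qed (rule abs_triangle_ineq4)
      have lU: "\<bar>l \<omega>\<bar> \<le> 10 / s * ?U \<omega>" for \<omega>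
      proof -
        have "\<bar>l \<omega>\<bar> \<le> (\<Sum>t\<in>?T. 10 / (s * N) * ((X t \<omega>)\<^sup>2 + \<Lambda>))"
          unfolding al(1)
        proof (intro order_trans[OF sum_abs] sum_mono)
          fix t assume t: "t \<in> ?T"
          have "\<bar>(X t \<omega>)\<^sup>2 - cov t t\<bar> \<le> (X t \<omega>)\<^sup>2 + \<Lambda>"
            using abs_triangle_ineq4[of "(X t \<omega>)\<^sup>2" "cov t t"] cov_le[of t t] by simp
          then show "\<bar>al t * ((X t \<omega>)\<^sup>2 - cov t t)\<bar> \<le> 10 / (s * N) * ((X t \<omega>)\<^sup>2 + \<Lambda>)"
            unfolding abs_mult using al(2)[OF t] s N by (intro mult_mono) auto
        qed
        also have "\<dots> = 10 / (s * N) * ((\<Sum>t\<in>?T. (X t \<omega>)\<^sup>2) + N * \<Lambda>)"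
          unfolding sum_distrib_left[symmetric] sum.distrib sum_constant cardT ..
        also have "\<dots> \<le> 10 / (s * N) * (N * ?U \<omega>)"
        proof (intro mult_left_mono)
          have "1 * (\<Sum>t\<in>?T. (X t \<omega>)\<^sup>2) \<le> N * (\<Sum>t\<in>?T. (X t \<omega>)\<^sup>2)"
            using N by (intro mult_right_mono sum_nonneg) auto
          then show "(\<Sum>t\<in>?T. (X t \<omega>)\<^sup>2) + N * \<Lambda> \<le> N * ?U \<omega>"
            using N by (simp add: energy_def distrib_left)
        qed (use s N in auto)
        finally show ?thesis using N by simp
      qed
      \<comment> \<open>\<open>a k\<close> is, up to a power of \<open>- \<i>\<close>, the k-th derivative at u = 0 of the centred estimate at the
        frequency b + u / N, and \<open>l\<close> is the linear part of u; the remainder \<open>D\<close> is O(log N / N) in mean.\<close>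
      define D where "D \<omega> = est \<omega> - of_real (Y \<omega>) * J - a 0 \<omega> + \<i> * (of_real (l \<omega>) * a 1 \<omega>)" for \<omega>
      define R where "R \<omega> = 1 / N + (W \<omega>)\<^sup>2 / N + N * \<rho>4 \<omega>" for \<omega>
      \<comment> \<open>Off the good event D is at most a multiple of U^2 <= U^4 / N^5 + N^5, where
        U is the energy. As E U^4 = O(N^4) and the event has probability O(N^(-6)), both parts of
        the second summand have mean O(1 / N).\<close>
      define Z where "Z \<omega> = K * (R \<omega> + (?U \<omega> ^ 4 / N ^ 5 + N ^ 5 * bad \<omega>) + I / N)" for \<omega>
      have R0: "0 \<le> R \<omega>" for \<omega> using N by (auto simp: R_def \<rho>4_def intro!: add_nonneg_nonneg)
      have IN: "0 \<le> I / N" using I N by simp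
      have \<tau>W: "\<tau> \<omega> * (1 + W \<omega>) \<le> 2 * R \<omega>" for \<omega>
      proof -
        define y where "y = 1 / N"
        define z where "z = N * \<rho>4 \<omega>"
        define v where "v = (W \<omega>)\<^sup>2 / N"
        have yzv: "0 \<le> y" "0 \<le> z" "0 \<le> v" using N by (auto simp: y_def z_def v_def \<rho>4_def)
        have "(\<rho> \<omega>)\<^sup>2 \<le> (y + z) / 2" using r4[of \<omega> 1] by (simp add: y_def z_def)
        moreover have "(\<rho> \<omega>)\<^sup>2 * W \<omega> \<le> (v + z) / 2" using r4[of \<omega> "W \<omega>"] by (simp add: v_def z_def)
        moreover have "y * W \<omega> \<le> (y + v) / 2"
        proof -
          have "W \<omega> \<le> (1 + (W \<omega>)\<^sup>2) / 2" using sum_squares_bound[of 1 "W \<omega>"] by simp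
          then have "y * W \<omega> \<le> y * ((1 + (W \<omega>)\<^sup>2) / 2)" using yzv by (intro mult_left_mono) auto
          also have "\<dots> = (y + v) / 2" by (simp add: y_def v_def add_divide_distrib)
          finally show ?thesis .
        qed
        moreover have "\<tau> \<omega> * (1 + W \<omega>) = (\<rho> \<omega>)\<^sup>2 + (\<rho> \<omega>)\<^sup>2 * W \<omega> + y + y * W \<omega>"
          by (simp add: \<tau>_def y_def algebra_simps)
        ultimately show ?thesis using yzv unfolding R_def y_def[symmetric] z_def[symmetric] v_def[symmetric] by argo
      qed
      have pw: "cmod (D \<omega>) \<le> Z \<omega>" if \<omega>: "\<omega> \<in> space M" for \<omega>
      proof (cases "\<omega> \<in> G")
        case True
        obtain u k where u: "\<bar>u\<bar> \<le> 1" "w (2 * h) \<omega> = b + u / N + 2 * pi * of_int k" "\<bar>u\<bar> \<le> C * (\<rho> \<omega> + 1 / N)"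
          "\<bar>u - l \<omega>\<bar> \<le> C * \<tau> \<omega>" and far: "\<And>b'. b' \<in> L - {b} \<Longrightarrow> \<bar>dirichlet h (b' - w (2 * h) \<omega>)\<bar> \<le> C"
          using good[OF True] unfolding l_def \<tau>_def by blast
        define v where "v = w (2 * h) \<omega>"
        define t where "t = \<tau> \<omega> * (1 + W \<omega>)"
        have tau0: "0 \<le> \<tau> \<omega>" "1 / N \<le> \<tau> \<omega>" using N by (auto simp: \<tau>_def)
        have t: "\<tau> \<omega> \<le> t" "\<tau> \<omega> * W \<omega> \<le> t" "1 / N \<le> t" "0 \<le> t"
        proof -
          have "0 \<le> \<tau> \<omega> * W \<omega>" using tau0 W0[of \<omega>] by simp
          then show "\<tau> \<omega> \<le> t" "\<tau> \<omega> * W \<omega> \<le> t" "1 / N \<le> t" "0 \<le> t" using tau0 by (auto simp: t_def distrib_left)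
        qed
        define e where "e = bilinear_estimate g h v cov"
        define Gs where "Gs = (\<Sum>i\<in>?T \<times> ?T. x i \<omega> * cis (- (?\<theta> i * u)))"
        \<comment> \<open>The integer number of turns disappears from the phases. The randomness of
          the frequency now enters through u in the centred part and through v in the mean part
          e.\<close>
        have est_eq: "est \<omega> = Gs + e"
        proof -
          have "cf v i = cf b i * cis (- (?\<theta> i * u))" for i
          proof -
            have "cis (- (of_int (fst i) * v)) = cis (of_int (- fst i) * ((b + u / N) + 2 * pi * of_int k))" by (simp add: v_def u(2))
            also have "\<dots> = cis (of_int (- fst i) * (b + u / N))" by (rule cis_int_periodic)
            also have "\<dots> = cis (- (of_int (fst i) * b)) * cis (- (?\<theta> i * u))" by (simp add: cis_mult algebra_simps)
            finally show ?thesis by (simp only: cf_def) (simp only: mult_ac)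
          qed
          then have "cf v i * of_real (X (fst i) \<omega> * X (snd i) \<omega>) = x i \<omega> * cis (- (?\<theta> i * u)) + cf v i * of_real (cov (fst i) (snd i))" for i
            unfolding x_def by (simp add: algebra_simps)
          then show ?thesis unfolding est_def bil Gs_def e_def v_def[symmetric] by (simp only: sum.distrib)
        qed
        have uu: "u\<^sup>2 \<le> 2 * C\<^sup>2 * \<tau> \<omega>" by (rule u2[OF u(3)])
        \<comment> \<open>Taylor expansion to first order: the remainder carries u^2, which is of
          order \<tau>, times the dominating variable W.\<close>
        have d1: "cmod (Gs - (a 0 \<omega> - \<i> * of_real u * a 1 \<omega>)) \<le> 6 * C\<^sup>2 * t"
        proof -
          have "cmod (Gs - (\<Sum>k<2. (- \<i> * of_real u) ^ k / fact k * a k \<omega>)) \<le> 3 * \<bar>u\<bar>\<^sup>2 * W \<omega>"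
            unfolding Gs_def a_def by (rule frequency_series_bound) (use aW u(1) in \<open>auto simp: a_def\<close>)
          also have "\<dots> \<le> 3 * (2 * C\<^sup>2 * \<tau> \<omega>) * W \<omega>" using uu W0 by (intro mult_right_mono mult_left_mono) auto
          also have "\<dots> = 6 * C\<^sup>2 * (\<tau> \<omega> * W \<omega>)" by simp
          also have "\<dots> \<le> 6 * C\<^sup>2 * t" using t by (intro mult_left_mono) auto
          finally show ?thesis by (simp add: eval_nat_numeral)
        qed
        \<comment> \<open>Three errors: the bias with its Lebesgue constant, the deviation of the
          normalised kernel of line b from 1, quadratic in u, and the bounded kernels of the other
          lines divided by N.\<close>
        have d2: "cmod (e - J) \<le> card L * B * (I / N) + C\<^sup>2 / 4 * F * t + card L * F * C * t"
        proof -
          have s1: "cmod (e - (\<Sum>b\<in>L. of_real (dirichlet h (b - v) / N) * smoothed_density g b)) \<le> card L * B * (I / N)"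
            using smoothed_mean[OF g N_eq, of v] by (simp add: e_def I_def)
          have "(\<Sum>b\<in>L. of_real (dirichlet h (b - v) / N) * smoothed_density g b) - J =
            of_real (dirichlet h (b - v) / N - 1) * J + (\<Sum>b'\<in>L - {b}. of_real (dirichlet h (b' - v) / N) * smoothed_density g b')"
            by (subst sum.remove[OF finite_L b]) (simp add: J_def algebra_simps)
          also have "cmod \<dots> \<le> C\<^sup>2 / 4 * t * F + (\<Sum>b'\<in>L - {b}. C * t * F)"
          proof (intro order_trans[OF norm_triangle_ineq] add_mono sum_norm_le)
            have "dirichlet h (b - v) = dirichlet h (u / N)"
            proof -
              have "b - v = - (u / N) + 2 * pi * of_int (- k)" unfolding v_def u(2) by simp
              then show ?thesis by (simp only: dirichlet_periodic dirichlet_minus)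
            qed
            then have "\<bar>dirichlet h (b - v) / N - 1\<bar> \<le> u\<^sup>2 / 8"
              using dirichlet_near_one[of h "u / N"] N by (simp add: N_eq[symmetric] abs_minus_commute)
            also have "\<dots> \<le> C\<^sup>2 / 4 * t" using uu mult_left_mono[OF t(1), of "C\<^sup>2"] by simp
            finally show "cmod (of_real (dirichlet h (b - v) / N - 1) * J) \<le> C\<^sup>2 / 4 * t * F"
              unfolding norm_mult norm_of_real J_def using J[OF b] t by (intro mult_mono) auto
          next
            fix b' assume b': "b' \<in> L - {b}"
            have "\<bar>dirichlet h (b' - v) / N\<bar> = \<bar>dirichlet h (b' - v)\<bar> * (1 / N)" using N by (simp add: abs_divide)
            also have "\<dots> \<le> C * t" using far[OF b'] t C N by (intro mult_mono) (auto simp: v_def)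
            finally show "cmod (of_real (dirichlet h (b' - v) / N) * smoothed_density g b') \<le> C * t * F"
              unfolding norm_mult norm_of_real using J b' t C by (intro mult_mono) auto
          qed
          also have "(\<Sum>b'\<in>L - {b}. C * t * F) \<le> card L * F * C * t"
          proof -
            have "real (card (L - {b})) \<le> real (card L)" using finite_L by (simp add: card_Diff_subset card_mono)
            then have "real (card (L - {b})) * (C * t * F) \<le> real (card L) * (C * t * F)"
              using C t F(1) by (intro mult_right_mono) auto
            then show ?thesis by (simp add: mult_ac)
          qed
          finally have s2: "cmod ((\<Sum>b\<in>L. of_real (dirichlet h (b - v) / N) * smoothed_density g b) - J) \<le> C\<^sup>2 / 4 * F * t + card L * F * C * t"
            by (simp add: mult_ac)
          show ?thesis using norm_diff_triangle_le[OF s1 s2] by (simp only: add.assoc)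
        qed
        have d3: "cmod (of_real (1 - Y \<omega>) * J) \<le> C\<^sup>2 / 12 * F * t"
        proof -
          have "\<bar>1 - Y \<omega>\<bar> \<le> u\<^sup>2 / 24" using sinc_good[OF u(1,2)] by (simp add: abs_minus_commute)
          also have "\<dots> \<le> C\<^sup>2 / 12 * t" using uu mult_left_mono[OF t(1), of "C\<^sup>2"] by simp
          finally have "cmod (of_real (1 - Y \<omega>) * J) \<le> C\<^sup>2 / 12 * t * F"
            unfolding norm_mult norm_of_real J_def using J[OF b] t by (intro mult_mono) auto
          then show ?thesis by (simp add: mult_ac)
        qed
        have d4: "cmod (\<i> * of_real (l \<omega> - u) * a 1 \<omega>) \<le> C * t"
        proof -
          have "cmod (\<i> * of_real (l \<omega> - u) * a 1 \<omega>) = \<bar>u - l \<omega>\<bar> * cmod (a 1 \<omega>)"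
            unfolding norm_mult norm_of_real by (simp add: abs_minus_commute)
          also have "\<dots> \<le> C * \<tau> \<omega> * W \<omega>" using u(4) aW C tau0 by (intro mult_mono) auto
          also have "\<dots> \<le> C * t" using t C unfolding mult.assoc by (intro mult_left_mono) auto
          finally show ?thesis .
        qed
        \<comment> \<open>The four brackets are the Taylor remainder, the error of the mean part,
          the distance of the sinc factor from 1, and the error of replacing u by its linear
          part.\<close>
        have "D \<omega> = (Gs - (a 0 \<omega> - \<i> * of_real u * a 1 \<omega>)) + (e - J) + of_real (1 - Y \<omega>) * J + \<i> * of_real (l \<omega> - u) * a 1 \<omega>"
          by (simp add: D_def est_eq algebra_simps)
        also have "cmod \<dots> \<le> 6 * C\<^sup>2 * t + (card L * B * (I / N) + C\<^sup>2 / 4 * F * t + card L * F * C * t) + C\<^sup>2 / 12 * F * t + C * t"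
          by (intro order_trans[OF norm_triangle_ineq] add_mono d1 d2 d3 d4)
        also have "\<dots> \<le> K1 * t + K1 * (I / N)"
        proof -
          have p: "0 \<le> F * C\<^sup>2 * t" "0 \<le> card L * B * t" using F(1) B t by simp_all
          have "card L * B * (I / N) \<le> K1 * (I / N)"
            using C F(1) IN by (intro mult_right_mono) (simp_all add: K1_def)
          moreover have "6 * C\<^sup>2 * t + C\<^sup>2 / 4 * F * t + card L * F * C * t + C\<^sup>2 / 12 * F * t + C * t \<le> K1 * t"
            using p by (simp add: K1_def algebra_simps)
          ultimately show ?thesis by linarith
        qed
        also have "\<dots> \<le> K1 * (2 * R \<omega>) + K1 * (I / N)"
          using K \<tau>W[of \<omega>] by (intro add_right_mono mult_left_mono) (auto simp: t_def)
        also have "\<dots> \<le> K * R \<omega> + K * (I / N)"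
        proof (intro add_mono)
          show "K1 * (2 * R \<omega>) \<le> K * R \<omega>" using K R0[of \<omega>] mult_nonneg_nonneg[OF K(2) R0[of \<omega>]] by (simp add: K_def algebra_simps)
          show "K1 * (I / N) \<le> K * (I / N)" using K IN by (intro mult_right_mono) (auto simp: K_def)
        qed
        also have "\<dots> \<le> Z \<omega>"
        proof -
          have "0 \<le> K * (?U \<omega> ^ 4 / N ^ 5 + N ^ 5 * bad \<omega>)" using K N by (intro mult_nonneg_nonneg add_nonneg_nonneg) (auto simp: bad_def)
          then show ?thesis by (simp add: Z_def distrib_left)
        qed
        finally show ?thesis .
      next
        case False
        then have bad1: "bad \<omega> = 1" using \<omega> by (simp add: bad_def)
        define U where "U = ?U \<omega>"
        have U: "1 \<le> U" using U1 by (simp add: U_def)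
        have UU: "U \<le> U\<^sup>2" "1 \<le> U\<^sup>2" using U mult_mono[of 1 U 1 U] mult_left_mono[of 1 U U] by (auto simp: power2_eq_square)
        have "cmod (D \<omega>) \<le> cmod (est \<omega>) + cmod (of_real (Y \<omega>) * J) + cmod (a 0 \<omega>) + cmod (\<i> * (of_real (l \<omega>) * a 1 \<omega>))"
          unfolding D_def by (intro order_trans[OF norm_triangle_ineq] order_trans[OF norm_triangle_ineq4] add_right_mono order_refl)
        also have "\<dots> \<le> U + 1 * F + U + 10 / s * U * U"
        proof (intro add_mono)
          show "cmod (of_real (Y \<omega>) * J) \<le> 1 * F"
            unfolding norm_mult norm_of_real J_def using J[OF b] Y1[of \<omega>] by (intro mult_mono) auto
          show "cmod (\<i> * (of_real (l \<omega>) * a 1 \<omega>)) \<le> 10 / s * U * U"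
          proof -
            have "\<bar>l \<omega>\<bar> * cmod (a 1 \<omega>) \<le> (10 / s * U) * U"
              using lU[of \<omega>] aU[of 1 \<omega>] U s by (intro mult_mono) (auto simp: U_def)
            then show ?thesis unfolding norm_mult norm_of_real norm_ii mult_1_left .
          qed
        qed (use estU aU in \<open>auto simp: U_def\<close>)
        also have "\<dots> \<le> K2 * U\<^sup>2"
        proof -
          have "F * 1 \<le> F * U\<^sup>2" using UU F(1) by (intro mult_left_mono) auto
          then show ?thesis using UU by (simp add: K2_def distrib_right power2_eq_square)
        qed
        also have "\<dots> \<le> K2 * (U ^ 4 / N ^ 5 + N ^ 5)"
        proof (intro mult_left_mono K)
          have "0 < N ^ 5" using N by simp
          have "0 \<le> (U\<^sup>2 - N ^ 5)\<^sup>2 / N ^ 5" using N by simp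
          also have "\<dots> = U ^ 4 / N ^ 5 - 2 * U\<^sup>2 + N ^ 5"
          proof -
            have "(p\<^sup>2 - q)\<^sup>2 / q = p ^ 4 / q - 2 * p\<^sup>2 + q" if "0 < q" for p q :: real
            proof -
              have e: "(p\<^sup>2 - q)\<^sup>2 = p ^ 4 - 2 * p\<^sup>2 * q + q * q"
                by (simp add: power2_eq_square eval_nat_numeral algebra_simps)
              show ?thesis unfolding e using that by (simp add: add_divide_distrib diff_divide_distrib)
            qed
            from this[OF \<open>0 < N ^ 5\<close>] show ?thesis .
          qed
          finally have "0 \<le> U ^ 4 / N ^ 5 - 2 * U\<^sup>2 + N ^ 5" .
          moreover have "0 \<le> p - 2 * q + r \<Longrightarrow> 0 \<le> q \<Longrightarrow> q \<le> p + r" for p q r :: real by simp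
          ultimately show "U\<^sup>2 \<le> U ^ 4 / N ^ 5 + N ^ 5" using zero_le_power2 by blast
        qed
        also have "\<dots> \<le> K * (U ^ 4 / N ^ 5 + N ^ 5)"
          using K N U by (intro mult_right_mono add_nonneg_nonneg) (auto simp: K_def)
        also have "\<dots> \<le> Z \<omega>"
        proof -
          have "Z \<omega> = K * R \<omega> + K * (U ^ 4 / N ^ 5 + N ^ 5) + K * (I / N)"
            unfolding Z_def bad1 U_def[symmetric] by (simp only: mult_1_right distrib_left[of K] add.assoc)
          moreover have "0 \<le> p \<Longrightarrow> 0 \<le> r \<Longrightarrow> q \<le> p + q + r" for p q r :: real by simp
          ultimately show ?thesis using mult_nonneg_nonneg[OF K(3) R0] mult_nonneg_nonneg[OF K(3) IN] by (simp only:)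
        qed
        finally show ?thesis .
      qed
      have [measurable]: "est \<in> borel_measurable M" unfolding est_def bil cf_def by measurable
      have [measurable]: "D \<in> borel_measurable M" unfolding D_def by measurable
      have estint: "integrable M est"
        by (rule Bochner_Integration.integrable_bound[OF Uint[of 1]]) (use estU in \<open>auto intro!: AE_I2 order_trans[OF _ abs_ge_self]\<close>)
      have aint: "integrable M (a k)" for k
        by (rule Bochner_Integration.integrable_bound[OF Uint[of 1]]) (use aU in \<open>auto intro!: AE_I2 order_trans[OF _ abs_ge_self]\<close>)
      have laint: "integrable M (\<lambda>\<omega>. of_real (l \<omega>) * a 1 \<omega>)"
      proof (rule Bochner_Integration.integrable_bound[where f = "\<lambda>\<omega>. 10 / s * ?U \<omega> ^ 2"])
        show "AE \<omega> in M. norm (of_real (l \<omega>) * a 1 \<omega>) \<le> norm (10 / s * (?U \<omega>)\<^sup>2)"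
        proof (intro AE_I2)
          fix \<omega>
          have "cmod (of_real (l \<omega>) * a 1 \<omega>) \<le> (10 / s * ?U \<omega>) * ?U \<omega>"
            unfolding norm_mult norm_of_real using lU[of \<omega>] aU[of 1 \<omega>] U1[of \<omega>] s by (intro mult_mono) auto
          then show "norm (of_real (l \<omega>) * a 1 \<omega>) \<le> norm (10 / s * (?U \<omega>)\<^sup>2)"
            using s by (simp add: power2_eq_square)
        qed
      qed (use Uint in auto)
      have YJint: "integrable M (\<lambda>\<omega>. of_real (Y \<omega>) * J)" using Yint by (intro integrable_mult_left integrable_of_real)
      have Zint: "integrable M Z"
        unfolding Z_def R_def using Wint(1) \<rho>int(1) Uint[of 4] badint(1) by (auto simp: \<rho>4_def)
      have Dint: "integrable M D"
        unfolding D_def using estint YJint aint laint by auto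
      have EZ: "expectation Z \<le> K * (1 + 8 * \<Lambda>\<^sup>2 + C + KU + C + I) / N"
      proof -
        have "expectation Z = K * (1 / N + expectation (\<lambda>\<omega>. (W \<omega>)\<^sup>2) / N + N * expectation (\<lambda>\<omega>. \<rho> \<omega> ^ 4)
            + (expectation (\<lambda>\<omega>. ?U \<omega> ^ 4) / N ^ 5 + N ^ 5 * expectation bad) + I / N)"
          unfolding Z_def R_def using Wint(1) \<rho>int(1) Uint[of 4] badint(1) by (simp add: \<rho>4_def prob_space)
        also have "\<dots> \<le> K * (1 / N + 2 * (4 * \<Lambda>\<^sup>2) / N + N * (C / N\<^sup>2) + (KU * N ^ 4 / N ^ 5 + N ^ 5 * (C / N ^ 6)) + I / N)"
          using K(3) N Wint(2) \<rho>int(2) KU(2)[of h] badint(2)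
          by (intro mult_left_mono add_mono divide_right_mono order_refl) (auto simp: N_eq)
        also have "\<dots> = K * (1 + 8 * \<Lambda>\<^sup>2 + C + KU + C + I) / N"
        proof -
          have "N * (C / N\<^sup>2) = C / N" "KU * N ^ 4 / N ^ 5 = KU / N" "N ^ 5 * (C / N ^ 6) = C / N"
            using N by (simp_all add: eval_nat_numeral)
          then have "1 / N + 2 * (4 * \<Lambda>\<^sup>2) / N + N * (C / N\<^sup>2) + (KU * N ^ 4 / N ^ 5 + N ^ 5 * (C / N ^ 6)) + I / N =
              1 / N + 2 * (4 * \<Lambda>\<^sup>2) / N + C / N + (KU / N + C / N) + I / N"
            by (simp only:)
          also have "\<dots> = (1 + 8 * \<Lambda>\<^sup>2 + C + KU + C + I) / N" by (simp add: add_divide_distrib)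
          finally show ?thesis by (simp only: times_divide_eq_right)
        qed
        finally show ?thesis .
      qed
      have ED: "cmod (\<integral>\<omega>. D \<omega> \<partial>M) \<le> K * (1 + 8 * \<Lambda>\<^sup>2 + C + KU + C + I) / N"
      proof -
        have "cmod (\<integral>\<omega>. D \<omega> \<partial>M) \<le> (\<integral>\<omega>. cmod (D \<omega>) \<partial>M)" by (rule integral_norm_bound)
        also have "\<dots> \<le> expectation Z" using Dint Zint pw by (intro integral_mono) auto
        finally show ?thesis using EZ by simp
      qed
      \<comment> \<open>Here the frequency is the fixed b, so the centred form has mean
        zero.\<close>
      have Ea0: "(\<integral>\<omega>. a 0 \<omega> \<partial>M) = 0"
      proof -
        have XX: "integrable M (\<lambda>\<omega>. X s \<omega> * X t \<omega> - cov s t)" "expectation (\<lambda>\<omega>. X s \<omega> * X t \<omega> - cov s t) = 0" for s t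
        proof -
          have i: "integrable M (\<lambda>\<omega>. X s \<omega> * X t \<omega>)" by (intro all_moments_integrable all_moments_intros all_moments_X)
          then show "integrable M (\<lambda>\<omega>. X s \<omega> * X t \<omega> - cov s t)" by simp
          show "expectation (\<lambda>\<omega>. X s \<omega> * X t \<omega> - cov s t) = 0" using i by (simp add: covariance_eq prob_space)
        qed
        have "(\<integral>\<omega>. a 0 \<omega> \<partial>M) = (\<Sum>i\<in>?T \<times> ?T. \<integral>\<omega>. cf b i * of_real (X (fst i) \<omega> * X (snd i) \<omega> - cov (fst i) (snd i)) \<partial>M)"
          unfolding a_def x_def power_0 mult_1_left
          by (intro Bochner_Integration.integral_sum integrable_mult_right integrable_of_real XX)
        then show ?thesis by (simp only: integral_mult_right_zero integral_complex_of_real XX(2)) simp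
      qed
      \<comment> \<open>The only place where a product of order N^(-1/2) must be integrated without
        absolute values: the covariance of the diagonal and the bilinear form is O(1 / N).\<close>
      have Ela: "cmod (\<integral>\<omega>. of_real (l \<omega>) * a 1 \<omega> \<partial>M) \<le> 20 * \<Lambda>\<^sup>2 / s / N"
      proof -
        have "cmod (\<integral>\<omega>. of_real (l \<omega>) * a 1 \<omega> \<partial>M) \<le> 2 * (10 / (s * N)) * ((1 / 2) ^ 1 / N) * card ?T * \<Lambda>\<^sup>2"
          unfolding al(1) a_eq by (rule bilinear_quadratic_covariance) (use co[of _ 1] al(2) in auto)
        also have "\<dots> = 10 * \<Lambda>\<^sup>2 / s / N" unfolding cardT using N s by simp
        also have "\<dots> \<le> 20 * \<Lambda>\<^sup>2 / s / N" using N s by (intro divide_right_mono) auto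
        finally show ?thesis .
      qed
      have "(\<integral>\<omega>. D \<omega> \<partial>M) = (\<integral>\<omega>. est \<omega> \<partial>M) - (\<integral>\<omega>. of_real (Y \<omega>) * J \<partial>M) - (\<integral>\<omega>. a 0 \<omega> \<partial>M) + \<i> * (\<integral>\<omega>. of_real (l \<omega>) * a 1 \<omega> \<partial>M)"
        unfolding D_def using estint YJint aint[of 0] laint by simp
      then have "(\<integral>\<omega>. est \<omega> \<partial>M) - (\<integral>\<omega>. of_real (Y \<omega>) * J \<partial>M) = (\<integral>\<omega>. D \<omega> \<partial>M) - \<i> * (\<integral>\<omega>. of_real (l \<omega>) * a 1 \<omega> \<partial>M)"
        by (simp add: Ea0)
      also have "cmod \<dots> \<le> cmod (\<integral>\<omega>. D \<omega> \<partial>M) + cmod (\<i> * (\<integral>\<omega>. of_real (l \<omega>) * a 1 \<omega> \<partial>M))" by (rule norm_triangle_ineq4)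
      also have "\<dots> \<le> K * (1 + 8 * \<Lambda>\<^sup>2 + C + KU + C + I) / N + 20 * \<Lambda>\<^sup>2 / s / N"
        using ED Ela by (intro add_mono) (auto simp: norm_mult)
      also have "\<dots> = (K * (1 + 8 * \<Lambda>\<^sup>2 + C + KU + C + I) + 20 * \<Lambda>\<^sup>2 / s) / N" by (simp add: add_divide_distrib)
      also have "\<dots> \<le> CE * (1 + I) / N"
      proof (intro divide_right_mono)
        define q where "q = 1 + 8 * \<Lambda>\<^sup>2 + C + KU + C"
        define m where "m = 20 * \<Lambda>\<^sup>2 / s"
        have q: "0 \<le> q" "0 \<le> m" using C KU(1) s by (auto simp: q_def m_def)
        have "0 \<le> m * I" "0 \<le> K * q * I" "0 \<le> K" using q K I by auto
        then have "K * (q + I) + m \<le> (m + K * (q + 1)) * (1 + I)" by (simp add: algebra_simps)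
        then show "K * (1 + 8 * \<Lambda>\<^sup>2 + C + KU + C + I) + 20 * \<Lambda>\<^sup>2 / s \<le> CE * (1 + I)"
          by (simp only: CE_def q_def m_def)
      qed (use N in auto)
      finally show ?thesis by (simp only: est_def Y_def J_def I_def)
    qed
  qed
  show thesis
  proof (rule that[of "max CE CS" "h1 + 1"])
    show "0 \<le> max CE CS" using CC by simp
    fix h N and g :: "real \<Rightarrow> real"
    assume a: "h1 + 1 \<le> h" "N = 2 * real h + 1" "continuous_on {-pi..pi} g" "\<And>x. 0 \<le> g x" "integral {-pi..pi} g \<le> 1"
    define I where "I = integral {-pi..pi} (\<lambda>x. \<bar>dirichlet h x\<bar>)"
    have I: "0 \<le> I" unfolding I_def
      by (intro Henstock_Kurzweil_Integration.integral_nonneg integrable_continuous_real continuous_intros) auto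
    have "CE * (1 + I) / N \<le> max CE CS * (1 + I) / N"
      using I a(2) by (intro divide_right_mono mult_right_mono) auto
    moreover have "cmod ((\<integral>\<omega>. bilinear_estimate g h (w (2 * h) \<omega>) (\<lambda>s t. X s \<omega> * X t \<omega>) \<partial>M) -
         (\<integral>\<omega>. of_real (sinc (N / 2 * ydiff b (w (2 * h) \<omega>))) * smoothed_density g b \<partial>M))
        \<le> CE * (1 + integral {-pi..pi} (\<lambda>x. \<bar>dirichlet h x\<bar>)) / N"
      by (rule core[OF a(1-3)]) (rule a)+
    ultimately show "cmod ((\<integral>\<omega>. bilinear_estimate g h (w (2 * h) \<omega>) (\<lambda>s t. X s \<omega> * X t \<omega>) \<partial>M) -
         (\<integral>\<omega>. of_real (sinc (N / 2 * ydiff b (w (2 * h) \<omega>))) * smoothed_density g b \<partial>M))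
        \<le> max CE CS * (1 + integral {-pi..pi} (\<lambda>x. \<bar>dirichlet h x\<bar>)) / N"
      unfolding I_def by (rule order_trans[rotated])
  next
    fix h N
    assume a: "h1 + 1 \<le> h" "N = 2 * real h + 1"
    have "CS / N \<le> max CE CS / N" using a(2) by (intro divide_right_mono) auto
    then show "integrable M (\<lambda>\<omega>. sinc (N / 2 * ydiff b (w (2 * h) \<omega>))) \<and>
       expectation (\<lambda>\<omega>. \<bar>sinc (N / 2 * ydiff b (w (2 * h) \<omega>)) - 1\<bar>) \<le> max CE CS / N"
      \<comment> \<open>The claims about the sinc factor do not mention g; the zero function meets
        the conditions on g.\<close>
      using sincs[OF a, of "\<lambda>_. 0"] by auto
  qed
qed

end

section \<open>Smoothing by the weight function\<close>

lemma periodic_int_multiple: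
  fixes f :: "real \<Rightarrow> 'b"
  assumes "\<And>x. f (x + 2 * pi) = f x"
  shows "f (x + 2 * pi * of_int k) = f x"
proof (induction k arbitrary: x rule: int_induct[where k = 0])
  case (step1 i)
  have "f (x + 2 * pi * of_int (i + 1)) = f ((x + 2 * pi * of_int i) + 2 * pi)" by (simp add: algebra_simps)
  then show ?case using step1(2) by (simp only: assms)
next
  case (step2 i)
  have "f (x + 2 * pi * of_int (i - 1)) = f ((x + 2 * pi * of_int (i - 1)) + 2 * pi)" by (simp only: assms)
  also have "\<dots> = f (x + 2 * pi * of_int i)" by (simp add: algebra_simps)
  finally show ?case using step2(2) by simp
qed simp

text \<open>The derivative inherits the period, so its continuity bounds it on the whole line and
  the mean value inequality applies globally.\<close>

lemma periodic_C1_lipschitz: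
  fixes f :: "real \<Rightarrow> complex"
  assumes per: "\<And>x. f (x + 2 * pi) = f x" and C1: "f C1_differentiable_on UNIV"
  obtains B where "\<And>x y. cmod (f x - f y) \<le> B * \<bar>x - y\<bar>"
proof -
  obtain D where D: "\<And>x. (f has_vector_derivative D x) (at x)" and cont: "continuous_on UNIV D"
    using C1 unfolding C1_differentiable_on_def by auto
  have Dper: "D (x + 2 * pi) = D x" for x
  proof -
    have "((\<lambda>y. y + 2 * pi) has_real_derivative 1) (at x)" by (auto intro!: derivative_eq_intros)
    then have "((f \<circ> (\<lambda>y. y + 2 * pi)) has_vector_derivative 1 *\<^sub>R D (x + 2 * pi)) (at x)"
      by (intro vector_diff_chain_at D) (simp add: has_real_derivative_iff_has_vector_derivative)
    then have "(f has_vector_derivative D (x + 2 * pi)) (at x)" by (simp add: o_def per)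
    then show ?thesis using D vector_derivative_unique_at by blast
  qed
  have "compact (D ` {-pi..pi})" by (rule compact_continuous_image[OF continuous_on_subset[OF cont]]) auto
  then have "bounded (D ` {-pi..pi})" by (rule compact_imp_bounded)
  then obtain B where B: "\<And>x. x \<in> {-pi..pi} \<Longrightarrow> cmod (D x) \<le> B" unfolding bounded_iff by blast
  have DB: "cmod (D x) \<le> B" for x
  proof -
    have "D (wrap x) = D x"
      using periodic_int_multiple[of D "wrap x" "\<lceil>(x - pi) / (2 * pi)\<rceil>", OF Dper] by (simp add: wrap_def)
    then show ?thesis using B[of "wrap x"] wrap_bounds[of x] by simp
  qed
  show thesis
  proof (rule that)
    fix x y
    have "norm (f x - f y) \<le> B * norm (x - y)"
    proof (rule differentiable_bound[where S = UNIV])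
      show "(f has_derivative (\<lambda>h. h *\<^sub>R D z)) (at z within UNIV)" for z
        using D[of z] by (simp add: has_vector_derivative_def)
      show "onorm (\<lambda>h. h *\<^sub>R D z) \<le> B" for z
      proof (rule onorm_le)
        show "norm (h *\<^sub>R D z) \<le> B * norm h" for h :: real
          using mult_right_mono[OF DB[of z], of "\<bar>h\<bar>"] by (simp add: mult.commute)
      qed
    qed auto
    then show "cmod (f x - f y) \<le> B * \<bar>x - y\<bar>" by simp
  qed
qed

lemma scaled_kernel_substitution:
  fixes \<phi> :: "real \<Rightarrow> complex"
  assumes \<phi>: "continuous_on UNIV \<phi>" and K: "continuous_on UNIV K" and b: "0 < bw n" and R: "0 < R"
  shows "integral {\<eta> - R * bw n..\<eta> + R * bw n} (\<lambda>\<mu>. \<phi> \<mu> * of_real (scaled_kernel K bw n (\<mu> - \<eta>))) =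
     integral {-R..R} (\<lambda>x. \<phi> (\<eta> + bw n * x) * of_real (K x))"
proof -
  let ?b = "bw n"
  define F where "F \<mu> = \<phi> \<mu> * of_real (scaled_kernel K bw n (\<mu> - \<eta>))" for \<mu>
  have cF: "continuous_on A F" for A
    unfolding F_def scaled_kernel_def
    by (intro continuous_intros continuous_on_compose2[OF K] continuous_on_subset[OF \<phi>]) auto
  have "(F has_integral integral {\<eta> - R * ?b..\<eta> + R * ?b} F) (cbox (\<eta> - R * ?b) (\<eta> + R * ?b))"
    using integrable_continuous_real[OF cF] by (simp add: integrable_integral)
  from has_integral_affinity[OF this, of ?b \<eta>]
  have "((\<lambda>x. F (?b * x + \<eta>)) has_integral (1 / ?b) *\<^sub>R integral {\<eta> - R * ?b..\<eta> + R * ?b} F)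
      ((\<lambda>x. (1 / ?b) * x + - ((1 / ?b) * \<eta>)) ` {\<eta> - R * ?b..\<eta> + R * ?b})"
    using b by simp
  also have "(\<lambda>x. (1 / ?b) * x + - ((1 / ?b) * \<eta>)) ` {\<eta> - R * ?b..\<eta> + R * ?b} = {-R..R}"
    using b R by (subst image_affinity_atLeastAtMost) (auto simp: field_simps)
  finally have "((\<lambda>x. of_real ?b * F (?b * x + \<eta>)) has_integral of_real ?b * ((1 / ?b) *\<^sub>R integral {\<eta> - R * ?b..\<eta> + R * ?b} F)) {-R..R}"
    by (rule has_integral_mult_right)
  moreover have "of_real ?b * F (?b * x + \<eta>) = \<phi> (\<eta> + ?b * x) * of_real (K x)" for x
  proof -
    have "scaled_kernel K bw n (?b * x) = inverse ?b * K x" using b by (simp add: scaled_kernel_def mult.assoc[symmetric])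
    then have "of_real ?b * F (?b * x + \<eta>) = \<phi> (\<eta> + ?b * x) * of_real (?b * (inverse ?b * K x))"
      by (simp add: F_def add.commute mult_ac)
    then show ?thesis using b by (simp add: mult.assoc[symmetric])
  qed
  moreover have "of_real ?b * ((1 / ?b) *\<^sub>R integral {\<eta> - R * ?b..\<eta> + R * ?b} F) = integral {\<eta> - R * ?b..\<eta> + R * ?b} F"
    using b by (simp add: scaleR_conv_of_real)
  moreover have "(\<lambda>\<mu>. \<phi> \<mu> * of_real (scaled_kernel K bw n (\<mu> - \<eta>))) = F" by (simp add: F_def fun_eq_iff)
  ultimately show ?thesis by (simp only: integral_unique)
qed

lemma weight_function_support:
  assumes "weight_function K"
  obtains R where "0 < R" "\<And>x. R < \<bar>x\<bar> \<Longrightarrow> K x = 0" "(K has_integral 1) {-R..R}"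
proof -
  obtain R where R: "\<And>x. R < \<bar>x\<bar> \<Longrightarrow> K x = 0" and K: "(K has_integral 1) UNIV"
    using assms unfolding weight_function_def by blast
  show thesis
  proof (rule that[of "max R 1"])
    have "(\<lambda>x. if x \<in> {- max R 1..max R 1} then K x else 0) = K"
      using R by (auto simp: fun_eq_iff)
    then show "(K has_integral 1) {- max R 1..max R 1}"
      using has_integral_restrict_UNIV[of "{- max R 1..max R 1}" K 1] K by simp
  qed (use R in auto)
qed

text \<open>The total mass is one on the line; on [-pi, pi] it may be smaller, since for \<eta> near
  an endpoint or a large bandwidth part of the support falls outside.\<close>

lemma scaled_kernel_mass:
  assumes K: "weight_function K" and b: "0 < bw n"
  shows "continuous_on A (\<lambda>\<mu>. scaled_kernel K bw n (\<mu> - \<eta>))" "0 \<le> scaled_kernel K bw n (\<mu> - \<eta>)"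
    "integral {-pi..pi} (\<lambda>\<mu>. scaled_kernel K bw n (\<mu> - \<eta>)) \<le> 1"
proof -
  have Kc: "continuous_on UNIV K" and K0: "\<And>x. 0 \<le> K x" using K by (auto simp: weight_function_def)
  obtain R where R: "0 < R" "\<And>x. R < \<bar>x\<bar> \<Longrightarrow> K x = 0" "(K has_integral 1) {-R..R}"
    using weight_function_support[OF K] by blast
  let ?g = "\<lambda>\<mu>. scaled_kernel K bw n (\<mu> - \<eta>)" and ?S = "{\<eta> - R * bw n..\<eta> + R * bw n}"
  show c: "continuous_on A ?g" for A
    unfolding scaled_kernel_def by (intro continuous_intros continuous_on_compose2[OF Kc]) auto
  show nonneg: "0 \<le> scaled_kernel K bw n (\<mu> - \<eta>)" for \<mu>
    using K0 b by (simp add: scaled_kernel_def)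
  have out: "?g \<mu> = 0" if "\<mu> \<notin> ?S" for \<mu>
  proof -
    have "R * bw n < \<bar>\<mu> - \<eta>\<bar>" using that by auto
    then have "R < \<bar>inverse (bw n) * (\<mu> - \<eta>)\<bar>" using b by (simp add: abs_mult field_simps)
    then show ?thesis by (simp add: scaled_kernel_def R(2))
  qed
  have "integral ?S ?g = 1"
  proof -
    have "integral ?S (\<lambda>\<mu>. complex_of_real (?g \<mu>)) = integral {-R..R} (\<lambda>x. complex_of_real (K x))"
      using scaled_kernel_substitution[where \<phi> = "\<lambda>_. 1" and K = K and bw = bw and n = n and R = R and \<eta> = \<eta>] Kc b R(1) by simp
    also have "\<dots> = of_real 1" by (rule integral_unique[OF has_integral_of_real[OF R(3)]])
    finally have "integral ?S (\<lambda>\<mu>. complex_of_real (?g \<mu>)) = of_real 1" .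
    moreover have "integral ?S (\<lambda>\<mu>. complex_of_real (?g \<mu>)) = of_real (integral ?S ?g)"
      by (rule integral_unique[OF has_integral_of_real[OF integrable_integral[OF integrable_continuous_real[OF c]]]])
    ultimately show ?thesis by (simp only: of_real_eq_iff)
  qed
  then have "(?g has_integral 1) ?S"
    using integrable_integral[OF integrable_continuous_real[OF c], of "\<eta> - R * bw n" "\<eta> + R * bw n"] by simp
  then have U: "(?g has_integral 1) UNIV"
    by (rule has_integral_on_superset) (use out in auto)
  have "integral {-pi..pi} ?g \<le> integral UNIV ?g"
    using U nonneg by (intro integral_subset_le integrable_continuous_real c) (auto simp: integrable_on_def)
  then show "integral {-pi..pi} ?g \<le> 1" using U by (simp add: integral_unique)
qed

text \<open>Differentiability of D at \<eta> makes the first-order Taylor remainder of f quadratic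
  there, and the linear term integrates to zero by symmetry of K. As \<eta> is interior, the support
  of the shifted kernel eventually lies inside [-pi, pi].\<close>

lemma kernel_smoothing_error:
  fixes f :: "real \<Rightarrow> complex"
  assumes K: "weight_function K" and bw: "bandwidth_sequence bw" and \<eta>: "\<eta> \<in> {-pi<..<pi}"
    and cont: "continuous_on UNIV f" and D: "\<And>x. (f has_vector_derivative D x) (at x)"
    and D2: "(D has_vector_derivative f2) (at \<eta>)"
  obtains C where "0 \<le> C" "eventually (\<lambda>n. cmod (integral {-pi..pi} (\<lambda>\<mu>. f \<mu> * of_real (scaled_kernel K bw n (\<mu> - \<eta>))) - f \<eta>) \<le> C * (bw n)\<^sup>2) sequentially"
proof -
  have Kc: "continuous_on UNIV K" and K0: "\<And>x. 0 \<le> K x" and Ks: "\<And>x. K (- x) = K x" using K by (auto simp: weight_function_def)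
  obtain R where R: "0 < R" "\<And>x. R < \<bar>x\<bar> \<Longrightarrow> K x = 0" "(K has_integral 1) {-R..R}"
    using weight_function_support[OF K] by blast
  \<comment> \<open>The derivative of D at \<eta> with tolerance 1: near \<eta> the increment of D
    is f2 times y up to an error of at most |y|.\<close>
  define M where "M = cmod f2 + 1"
  have M: "0 \<le> M" by (simp add: M_def)
  obtain d where d: "0 < d" "\<And>y. \<bar>y\<bar> < d \<Longrightarrow> cmod (D (\<eta> + y) - D \<eta>) \<le> M * \<bar>y\<bar>"
  proof -
    have "\<exists>d>0. \<forall>y. norm (y - \<eta>) < d \<longrightarrow> norm (D y - D \<eta> - (y - \<eta>) *\<^sub>R f2) \<le> 1 * norm (y - \<eta>)"
      using D2 unfolding has_vector_derivative_def has_derivative_at_alt by (metis zero_less_one)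
    then obtain d where d: "d > 0" "\<And>y. norm (y - \<eta>) < d \<Longrightarrow> norm (D y - D \<eta> - (y - \<eta>) *\<^sub>R f2) \<le> norm (y - \<eta>)" by auto
    show thesis
    proof (rule that[OF d(1)])
      fix y assume y: "\<bar>y\<bar> < d"
      have "cmod (D (\<eta> + y) - D \<eta>) \<le> cmod (y *\<^sub>R f2) + cmod (D (\<eta> + y) - D \<eta> - y *\<^sub>R f2)" by (rule norm_triangle_sub)
      also have "\<dots> \<le> \<bar>y\<bar> * cmod f2 + \<bar>y\<bar>" using d(2)[of "\<eta> + y"] y by (intro add_mono) auto
      finally show "cmod (D (\<eta> + y) - D \<eta>) \<le> M * \<bar>y\<bar>" by (simp add: M_def algebra_simps)
    qed
  qed
  have taylor: "cmod (f (\<eta> + y) - f \<eta> - y *\<^sub>R D \<eta>) \<le> M * y\<^sup>2" if y: "\<bar>y\<bar> < d" for y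
  proof -
    define H where "H z = f (\<eta> + z) - z *\<^sub>R D \<eta>" for z
    have "norm (H y - H 0) \<le> M * \<bar>y\<bar> * norm (y - 0)"
    proof (rule differentiable_bound[where S = "{-\<bar>y\<bar>..\<bar>y\<bar>}"])
      fix z assume z: "z \<in> {-\<bar>y\<bar>..\<bar>y\<bar>}"
      have "((\<lambda>z. \<eta> + z) has_vector_derivative 1) (at z)"
        by (auto intro!: derivative_eq_intros)
      from vector_diff_chain_at[OF this D[of "\<eta> + z"]]
      have "((\<lambda>z. f (\<eta> + z)) has_vector_derivative D (\<eta> + z)) (at z)" by (simp add: o_def)
      moreover have "((\<lambda>z. z *\<^sub>R D \<eta>) has_vector_derivative D \<eta>) (at z)"
        by (auto intro!: derivative_eq_intros simp: has_vector_derivative_def)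
      ultimately have "(H has_vector_derivative D (\<eta> + z) - D \<eta>) (at z)"
        unfolding H_def by (rule has_vector_derivative_diff)
      then show "(H has_derivative (\<lambda>h. h *\<^sub>R (D (\<eta> + z) - D \<eta>))) (at z within {-\<bar>y\<bar>..\<bar>y\<bar>})"
        unfolding has_vector_derivative_def by (rule has_derivative_at_withinI)
      have "cmod (D (\<eta> + z) - D \<eta>) \<le> M * \<bar>z\<bar>" using z y by (intro d) auto
      also have "\<dots> \<le> M * \<bar>y\<bar>" using z M by (intro mult_left_mono) auto
      finally have Dz: "cmod (D (\<eta> + z) - D \<eta>) \<le> M * \<bar>y\<bar>" .
      show "onorm (\<lambda>h. h *\<^sub>R (D (\<eta> + z) - D \<eta>)) \<le> M * \<bar>y\<bar>"
      proof (rule onorm_le)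
        show "norm (h *\<^sub>R (D (\<eta> + z) - D \<eta>)) \<le> M * \<bar>y\<bar> * norm h" for h :: real
          using mult_right_mono[OF Dz, of "\<bar>h\<bar>"] by (simp add: mult.commute)
      qed
    qed auto
    then show ?thesis by (simp add: H_def power2_eq_square algebra_simps)
  qed
  have "integral {-R..R} (\<lambda>x. complex_of_real (K x)) = of_real 1"
    by (rule integral_unique[OF has_integral_of_real[OF R(3)]])
  then have iK: "integral {-R..R} (\<lambda>x. complex_of_real (K x)) = 1" by simp
  \<comment> \<open>Reflection shows that the first moment equals its own negative, K being
    even.\<close>
  have ixK: "integral {-R..R} (\<lambda>x. complex_of_real (x * K x)) = 0"
  proof -
    have "integral {-R..R} (\<lambda>x. complex_of_real (x * K x)) = integral {-R..R} (\<lambda>x. complex_of_real (- x * K (- x)))"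
      using Henstock_Kurzweil_Integration.integral_reflect_real[of R "-R" "\<lambda>x. complex_of_real (x * K x)"] by simp
    also have "\<dots> = - integral {-R..R} (\<lambda>x. complex_of_real (x * K x))" by (simp add: Ks)
    finally show ?thesis by simp
  qed
  show thesis
  proof (rule that[of "M * R\<^sup>2"])
    have b0: "((\<lambda>n. R * bw n) \<longlongrightarrow> 0) sequentially"
      using bw tendsto_mult_right_zero unfolding bandwidth_sequence_def by blast
    have "0 < min d (pi - \<bar>\<eta>\<bar>)" using d(1) \<eta> by auto
    then have "eventually (\<lambda>n. R * bw n < min d (pi - \<bar>\<eta>\<bar>)) sequentially"
      using b0 by (intro order_tendstoD(2)[of _ 0]) auto
    then show "eventually (\<lambda>n. cmod (integral {-pi..pi} (\<lambda>\<mu>. f \<mu> * of_real (scaled_kernel K bw n (\<mu> - \<eta>))) - f \<eta>) \<le> M * R\<^sup>2 * (bw n)\<^sup>2) sequentially"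
    proof eventually_elim
      case (elim n)
      have b: "0 < bw n" using bw by (simp add: bandwidth_sequence_def)
      have small: "R * bw n < d" "R * bw n < pi - \<bar>\<eta>\<bar>" using elim by auto
      let ?F = "\<lambda>\<mu>. f \<mu> * of_real (scaled_kernel K bw n (\<mu> - \<eta>))" and ?S = "{\<eta> - R * bw n..\<eta> + R * bw n}"
      have out: "?F \<mu> = 0" if "\<mu> \<notin> ?S" for \<mu>
      proof -
        have "R * bw n < \<bar>\<mu> - \<eta>\<bar>" using that by auto
        then have "R < \<bar>inverse (bw n) * (\<mu> - \<eta>)\<bar>" using b by (simp add: abs_mult field_simps)
        then show ?thesis by (simp add: scaled_kernel_def R(2))
      qed
      have "continuous_on ?S ?F"
        using scaled_kernel_mass(1)[of K bw n, OF K b] by (intro continuous_intros continuous_on_subset[OF cont]) auto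
      then have "(?F has_integral integral ?S ?F) ?S" by (intro integrable_integral integrable_continuous_real)
      then have "(?F has_integral integral ?S ?F) {-pi..pi}"
        by (rule has_integral_on_superset) (use out small in auto)
      then have "integral {-pi..pi} ?F = integral ?S ?F" by (rule integral_unique)
      also have "\<dots> = integral {-R..R} (\<lambda>x. f (\<eta> + bw n * x) * of_real (K x))"
        by (rule scaled_kernel_substitution[where bw = bw and n = n and K = K and \<phi> = f]) fact+
      finally have J: "integral {-pi..pi} ?F = integral {-R..R} (\<lambda>x. f (\<eta> + bw n * x) * of_real (K x))" .
      have cfb: "continuous_on {-R..R} (\<lambda>x. f (\<eta> + bw n * x))"
        by (rule continuous_on_compose2[OF cont]) (auto intro!: continuous_intros)
      have cK: "continuous_on {-R..R} K" using Kc by (rule continuous_on_subset) simp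
      have i1: "(\<lambda>x. f (\<eta> + bw n * x) * complex_of_real (K x)) integrable_on {-R..R}"
        "(\<lambda>x. f \<eta> * complex_of_real (K x)) integrable_on {-R..R}"
        "(\<lambda>x. of_real (bw n) * D \<eta> * complex_of_real (x * K x)) integrable_on {-R..R}"
        by (intro integrable_continuous_real continuous_intros cfb cK)+
      have "f \<eta> = integral {-R..R} (\<lambda>x. f \<eta> * complex_of_real (K x)) + integral {-R..R} (\<lambda>x. of_real (bw n) * D \<eta> * complex_of_real (x * K x))"
        unfolding integral_mult_right iK ixK by simp
      then have "integral {-pi..pi} ?F - f \<eta> = integral {-R..R} (\<lambda>x. f (\<eta> + bw n * x) * complex_of_real (K x) -
          (f \<eta> * complex_of_real (K x) + of_real (bw n) * D \<eta> * complex_of_real (x * K x)))"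
        unfolding J using i1
        by (simp only: Henstock_Kurzweil_Integration.integral_diff Henstock_Kurzweil_Integration.integral_add integrable_add)
      also have "cmod \<dots> \<le> integral {-R..R} (\<lambda>x. M * R\<^sup>2 * (bw n)\<^sup>2 * K x)"
      proof (rule integral_norm_bound_integral)
        show "(\<lambda>x. f (\<eta> + bw n * x) * complex_of_real (K x) - (f \<eta> * complex_of_real (K x) + of_real (bw n) * D \<eta> * complex_of_real (x * K x))) integrable_on {-R..R}"
          using i1 by (intro Henstock_Kurzweil_Integration.integrable_diff Henstock_Kurzweil_Integration.integrable_add)
        show "(\<lambda>x. M * R\<^sup>2 * (bw n)\<^sup>2 * K x) integrable_on {-R..R}" by (intro integrable_continuous_real continuous_intros cK)
        fix x assume x: "x \<in> {-R..R}"
        have bx: "\<bar>bw n * x\<bar> \<le> R * bw n" using x b by (simp add: abs_mult abs_le_iff mult.commute)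
        have "f (\<eta> + bw n * x) * complex_of_real (K x) - (f \<eta> * complex_of_real (K x) + of_real (bw n) * D \<eta> * complex_of_real (x * K x))
          = (f (\<eta> + bw n * x) - f \<eta> - (bw n * x) *\<^sub>R D \<eta>) * of_real (K x)"
          by (simp add: scaleR_conv_of_real algebra_simps)
        also have "cmod \<dots> \<le> M * (bw n * x)\<^sup>2 * K x"
          unfolding norm_mult norm_of_real using bx small K0[of x] by (intro mult_mono taylor) (auto intro: mult_nonneg_nonneg M)
        also have "(bw n * x)\<^sup>2 \<le> (R * bw n)\<^sup>2" using power_mono[OF bx, of 2] by simp
        then have "M * (bw n * x)\<^sup>2 * K x \<le> M * (R * bw n)\<^sup>2 * K x" using M K0 by (intro mult_right_mono mult_left_mono) auto
        finally show "cmod (f (\<eta> + bw n * x) * complex_of_real (K x) - (f \<eta> * complex_of_real (K x) + of_real (bw n) * D \<eta> * complex_of_real (x * K x))) \<le> M * R\<^sup>2 * (bw n)\<^sup>2 * K x"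
          by (simp add: power_mult_distrib mult_ac)
      qed
      also have "\<dots> = M * R\<^sup>2 * (bw n)\<^sup>2 * integral {-R..R} K" by (rule integral_mult_right)
      finally show ?case using R(3) by (simp add: integral_unique)
    qed
  qed (use M in auto)
qed

text \<open>By the representation over the lines, |cov t s| is at most \<open>card L\<close> times
  C(t - s), so every row sum is bounded by the total sum of C. Summing the Lipschitz constants over
  the finite L makes them uniform.\<close>

lemma line_model_assumptions:
  assumes "prob_space M" "assumption1 M X Z L f" "assumption2 L f"
  obtains \<Lambda> B where "line_model M X \<Lambda> L f B"
proof -
  interpret prob_space M by fact
  have a1: "gaussian_sequence M X" "\<And>k. (\<integral>\<omega>. X k \<omega> \<partial>M) = 0" "harmonizable_via M X Z" "finite L"
    "spectral_lines (spectral_cov M Z) L f" "\<And>b x. b \<in> L \<Longrightarrow> f b (x + 2 * pi) = f b x" "\<And>b. b \<in> L \<Longrightarrow> f b C1_differentiable_on UNIV"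
    using assms(2) unfolding assumption1_def by blast+
  interpret gaussian_family M X by unfold_locales fact+
  have cont: "continuous_on A (f b)" if "b \<in> L" for b A
    using C1_differentiable_imp_continuous_on[OF a1(7)[OF that]] by (rule continuous_on_subset) simp
  obtain C where C: "\<And>j. 0 \<le> C j" "\<And>b j. b \<in> L \<Longrightarrow> cmod (line_coeff f b j) \<le> C j" "C summable_on UNIV"
    using assms(3) unfolding assumption2_def by blast
  have sq: "square_integrable M (\<lambda>\<omega>. complex_of_real (X k \<omega>))" for k
    using all_moments_integrable[OF all_moments_power[OF all_moments_X[of k], of 2]]
    unfolding square_integrable_def by (simp add: norm_of_real)
  have rep: "complex_of_real (cov k m) = (\<Sum>b\<in>L. cis (of_int k * b) * line_coeff f b (k - m))" for k m
    by (rule covariance_representation[OF a1(3) sq a1(2,4,5) cont])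
  define \<Lambda> where "\<Lambda> = card L * infsum C UNIV"
  have row: "(\<Sum>s\<in>S. \<bar>cov t s\<bar>) \<le> \<Lambda>" if S: "finite S" for S t
  proof -
    have "\<bar>cov t s\<bar> \<le> card L * C (t - s)" for s
    proof -
      have "\<bar>cov t s\<bar> = cmod (complex_of_real (cov t s))" by simp
      also have "\<dots> \<le> (\<Sum>b\<in>L. C (t - s))"
        unfolding rep using C(2) by (intro sum_norm_le) (simp add: norm_mult)
      finally show ?thesis by simp
    qed
    then have "(\<Sum>s\<in>S. \<bar>cov t s\<bar>) \<le> (\<Sum>s\<in>S. card L * C (t - s))" by (rule sum_mono)
    also have "\<dots> = card L * (\<Sum>j\<in>(\<lambda>s. t - s) ` S. C j)"
      by (subst sum.reindex) (auto simp: sum_distrib_left inj_on_def)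
    also have "\<dots> \<le> \<Lambda>"
      unfolding \<Lambda>_def using S C by (intro mult_left_mono finite_sum_le_infsum) auto
    finally show ?thesis .
  qed
  have "\<forall>b\<in>L. \<exists>B. \<forall>x y. cmod (f b x - f b y) \<le> B * \<bar>x - y\<bar>"
    using periodic_C1_lipschitz[OF a1(6) a1(7)] by metis
  from bchoice[OF this] obtain B where B: "\<And>b x y. b \<in> L \<Longrightarrow> cmod (f b x - f b y) \<le> B b * \<bar>x - y\<bar>" by blast
  have lip: "cmod (f b x - f b y) \<le> (\<Sum>b\<in>L. \<bar>B b\<bar>) * \<bar>x - y\<bar>" if b: "b \<in> L" for b x y
  proof -
    have "B b \<le> \<bar>B b\<bar>" by simp
    also have "\<dots> \<le> (\<Sum>b\<in>L. \<bar>B b\<bar>)" using b a1(4) by (intro member_le_sum) auto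
    finally show ?thesis using B[OF b, of x y] by (meson abs_ge_zero mult_right_mono order_trans)
  qed
  have "L \<subseteq> {-pi<..pi}" using a1(5) by (simp add: spectral_lines_def)
  then have "line_model M X \<Lambda> L f (\<Sum>b\<in>L. \<bar>B b\<bar>)"
    by unfold_locales (use row rep a1(4,6) lip cont in auto)
  then show thesis by (rule that)
qed

lemma eventually_even_at_top: "eventually P even_at_top \<longleftrightarrow> eventually (\<lambda>n. even n \<longrightarrow> P n) sequentially"
  unfolding even_at_top_def by (simp add: eventually_inf_principal)

theorem theorem5:
  fixes M :: "'a measure"
    and X :: "int \<Rightarrow> 'a \<Rightarrow> real"
    and Z :: "real \<Rightarrow> 'a \<Rightarrow> complex"
    and L :: "real set"
    and f :: "real \<Rightarrow> real \<Rightarrow> complex"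
    and K :: "real \<Rightarrow> real"
    and bw c :: "nat \<Rightarrow> real"
    and w :: "nat \<Rightarrow> 'a \<Rightarrow> real"
    and \<delta> b \<eta> :: real
  assumes "prob_space M"
    and "assumption1 M X Z L f"
    and "assumption2 L f"
    and "assumption3 L f"
    and "weight_function K"
    and "bandwidth_sequence bw"
    and "filterlim c at_top sequentially"
    and "c \<in> o(\<lambda>n. real n)"
    and "\<delta> > 0"
    and "b \<in> L"
    and "cmod (integral {-pi..pi} (f b)) > \<delta>"
    and "line_estimate M X c \<delta> b w"
    and "\<eta> \<in> {-pi..pi}"
  shows "(\<lambda>n. cmod ((\<integral>\<omega>. kernel_estimate X K bw n (w n \<omega>) \<eta> \<omega> \<partial>M) - main_term M K bw f b w \<eta> n))
           \<in> O[even_at_top](\<lambda>n. ln (real n) / real n)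
         \<and> (\<forall>f2. \<eta> \<in> {-pi<..<pi} \<and>
              ((\<lambda>\<mu>. vector_derivative (f b) (at \<mu>)) has_vector_derivative f2) (at \<eta>) \<longrightarrow>
              (\<lambda>n. cmod (main_term M K bw f b w \<eta> n -
                     (f b \<eta> + of_real ((bw n)\<^sup>2 / 2) * f2 * of_real (integral UNIV (\<lambda>x. x\<^sup>2 * K x)))))
              \<in> O[even_at_top](\<lambda>n. (bw n)\<^sup>2 + real n powr (-1/2) * sqrt (ln (real n)) + 1 / (real n * bw n)))"
proof -
  interpret prob_space M by fact
  obtain \<Lambda> B where "line_model M X \<Lambda> L f B"
    using line_model_assumptions assms(1-3) by blast
  then interpret line_model M X \<Lambda> L f B .
  have mass: "mass b = integral {-pi..pi} (f b)" by (simp add: line_coeff_def)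
  obtain C h0 where C: "0 \<le> C"
    and est: "\<And>h N g. h0 \<le> h \<Longrightarrow> N = 2 * real h + 1 \<Longrightarrow> continuous_on {-pi..pi} g \<Longrightarrow> (\<And>x. 0 \<le> g x) \<Longrightarrow> integral {-pi..pi} g \<le> 1 \<Longrightarrow>
       cmod ((\<integral>\<omega>. bilinear_estimate g h (w (2 * h) \<omega>) (\<lambda>s t. X s \<omega> * X t \<omega>) \<partial>M) -
         (\<integral>\<omega>. of_real (sinc (N / 2 * ydiff b (w (2 * h) \<omega>))) * smoothed_density g b \<partial>M))
        \<le> C * (1 + integral {-pi..pi} (\<lambda>x. \<bar>dirichlet h x\<bar>)) / N"
    and sinc: "\<And>h N. h0 \<le> h \<Longrightarrow> N = 2 * real h + 1 \<Longrightarrow>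
       integrable M (\<lambda>\<omega>. sinc (N / 2 * ydiff b (w (2 * h) \<omega>))) \<and>
       expectation (\<lambda>\<omega>. \<bar>sinc (N / 2 * ydiff b (w (2 * h) \<omega>)) - 1\<bar>) \<le> C / N"
    using estimate_expansion[OF assms(10,9) assms(11)[folded mass] assms(7,8,12)] by blast
  have bw: "0 < bw n" for n using assms(6) by (simp add: bandwidth_sequence_def)
  define g where "g n \<mu> = scaled_kernel K bw n (\<mu> - \<eta>)" for n \<mu>
  have g: "continuous_on {-pi..pi} (g n)" "\<And>x. 0 \<le> g n x" "integral {-pi..pi} (g n) \<le> 1" for n
    using scaled_kernel_mass[of K bw n, OF assms(5) bw] by (simp_all add: g_def[abs_def])
  have main: "main_term M K bw f b w \<eta> n = (\<integral>\<omega>. of_real (sinc ((real n + 1) / 2 * ydiff b (w n \<omega>))) * smoothed_density (g n) b \<partial>M)" for n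
    by (simp only: main_term_def smoothed_density_def g_def)
  have lnn: "1 \<le> ln (real n)" if "3 \<le> n" for n :: nat
  proof -
    have "exp 1 \<le> real n" using that exp_le by (rule_tac order_trans[of _ 3]) auto
    then show ?thesis using that by (subst ln_ge_iff) auto
  qed
  \<comment> \<open>The Lebesgue constant bound gives 1 + I <= 3 + 2 pi ln pi + 2 pi ln(n + 1); then
    ln(n + 1) <= 2 ln n and 1 <= ln n, valid from n = 3 on, collect everything into a multiple of ln
    n.\<close>
  define C1 where "C1 = C * (3 + 2 * pi * ln pi + 4 * pi)"
  have p1: "(\<lambda>n. cmod ((\<integral>\<omega>. kernel_estimate X K bw n (w n \<omega>) \<eta> \<omega> \<partial>M) - main_term M K bw f b w \<eta> n))
           \<in> O[even_at_top](\<lambda>n. ln (real n) / real n)"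
  proof (rule bigoI[of _ C1], unfold eventually_even_at_top eventually_sequentially, intro exI allI impI)
    fix n assume n: "2 * h0 + 3 \<le> n" "even n"
    then obtain h where h: "n = 2 * h" by blast
    have hh: "h0 \<le> h" "real n + 1 = 2 * real h + 1" using n h by auto
    have kern: "kernel_estimate X K bw n v \<eta> \<omega> = bilinear_estimate (g n) h v (\<lambda>s t. X s \<omega> * X t \<omega>)" for v \<omega>
      using weighted_periodogram[OF h g(1), of X v \<omega> n] by (simp only: kernel_estimate_def bilinear_estimate_def g_def)
    define I where "I = integral {-pi..pi} (\<lambda>x. \<bar>dirichlet h x\<bar>)"
    have "cmod ((\<integral>\<omega>. kernel_estimate X K bw n (w n \<omega>) \<eta> \<omega> \<partial>M) - main_term M K bw f b w \<eta> n) \<le> C * (1 + I) / (real n + 1)"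
      using est[OF hh g] unfolding kern main I_def by (simp only: h)
    also have "\<dots> \<le> C * ((3 + 2 * pi * ln pi + 4 * pi) * ln (real n)) / real n"
    proof (intro frac_le mult_left_mono C)
      have l1: "1 \<le> ln (real n)" using n by (intro lnn) auto
      have "ln (2 * real h + 1) \<le> ln (real n * real n)"
      proof (subst ln_le_cancel_iff)
        have "3 * real n \<le> real n * real n" using n by (intro mult_right_mono) auto
        then show "2 * real h + 1 \<le> real n * real n" using hh(2) n by linarith
      qed (use n in auto)
      also have "\<dots> = 2 * ln (real n)" using n by (simp add: ln_mult)
      finally have l2: "ln (2 * real h + 1) \<le> 2 * ln (real n)" .
      have "1 + I \<le> 1 + 2 * (1 + pi * (ln pi + 2 * ln (real n)))"
        using lebesgue_constant_bound[of h] l2 unfolding I_def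
        by (intro add_left_mono order_trans[OF lebesgue_constant_bound] mult_left_mono) auto
      also have "\<dots> = 3 + 2 * pi * ln pi + 4 * pi * ln (real n)" by (simp add: algebra_simps)
      also have "\<dots> \<le> (3 + 2 * pi * ln pi) * ln (real n) + 4 * pi * ln (real n)"
      proof -
        have "0 \<le> ln pi" using pi_gt3 by simp
        then have "(3 + 2 * pi * ln pi) * 1 \<le> (3 + 2 * pi * ln pi) * ln (real n)" using l1 by (intro mult_left_mono add_nonneg_nonneg) auto
        then show ?thesis by simp
      qed
      finally show "1 + I \<le> (3 + 2 * pi * ln pi + 4 * pi) * ln (real n)" by (simp add: algebra_simps)
      have "0 \<le> ln pi" using pi_gt3 by simp
      then show "0 \<le> C * ((3 + 2 * pi * ln pi + 4 * pi) * ln (real n))" using C l1 by auto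
    qed (use n in auto)
    also have "\<dots> = C1 * norm (ln (real n) / real n)" using n lnn[of n] by (simp add: C1_def)
    finally show "norm (cmod ((\<integral>\<omega>. kernel_estimate X K bw n (w n \<omega>) \<eta> \<omega> \<partial>M) - main_term M K bw f b w \<eta> n)) \<le> C1 * norm (ln (real n) / real n)"
      by simp
  qed
  have p2: "(\<lambda>n. cmod (main_term M K bw f b w \<eta> n - (f b \<eta> + of_real ((bw n)\<^sup>2 / 2) * f2 * of_real (integral UNIV (\<lambda>x. x\<^sup>2 * K x)))))
        \<in> O[even_at_top](\<lambda>n. (bw n)\<^sup>2 + real n powr (-1/2) * sqrt (ln (real n)) + 1 / (real n * bw n))"
    if \<eta>: "\<eta> \<in> {-pi<..<pi}" and f2: "((\<lambda>\<mu>. vector_derivative (f b) (at \<mu>)) has_vector_derivative f2) (at \<eta>)" for f2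
  proof -
    have "f b C1_differentiable_on UNIV" using assms(2,10) by (simp add: assumption1_def)
    then obtain D where D: "\<And>x. (f b has_vector_derivative D x) (at x)" unfolding C1_differentiable_on_def by auto
    have "(\<lambda>\<mu>. vector_derivative (f b) (at \<mu>)) = D" using vector_derivative_at[OF D] by (rule ext)
    with f2 have D2: "(D has_vector_derivative f2) (at \<eta>)" by simp
    obtain C2 where C2: "0 \<le> C2" "eventually (\<lambda>n. cmod (integral {-pi..pi} (\<lambda>\<mu>. f b \<mu> * of_real (scaled_kernel K bw n (\<mu> - \<eta>))) - f b \<eta>) \<le> C2 * (bw n)\<^sup>2) sequentially"
      using kernel_smoothing_error[OF assms(5,6) \<eta> continuous[OF assms(10)] D D2] by blast
    obtain F where F: "0 \<le> F" "\<And>b x. b \<in> L \<Longrightarrow> x \<in> {-pi..pi} \<Longrightarrow> cmod (f b x) \<le> F"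
      using density_bound by blast
    \<comment> \<open>The curvature term has modulus m2 times b_n^2 and is moved into the error, so
      that only the distance of the main term from f b \<eta> remains to be bounded.\<close>
    define m2 where "m2 = cmod (f2 * of_real (integral UNIV (\<lambda>x. x\<^sup>2 * K x))) / 2"
    define C3 where "C3 = F * C + C2 + m2"
    show ?thesis
    proof (rule bigoI[of _ C3], unfold eventually_even_at_top)
      show "eventually (\<lambda>n. even n \<longrightarrow> norm (cmod (main_term M K bw f b w \<eta> n - (f b \<eta> + of_real ((bw n)\<^sup>2 / 2) * f2 * of_real (integral UNIV (\<lambda>x. x\<^sup>2 * K x)))))
         \<le> C3 * norm ((bw n)\<^sup>2 + real n powr (-1/2) * sqrt (ln (real n)) + 1 / (real n * bw n))) sequentially"
        using C2(2) eventually_ge_at_top[of "2 * h0 + 3"]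
      proof (eventually_elim, intro impI)
        fix n assume J: "cmod (integral {-pi..pi} (\<lambda>\<mu>. f b \<mu> * of_real (scaled_kernel K bw n (\<mu> - \<eta>))) - f b \<eta>) \<le> C2 * (bw n)\<^sup>2"
          and n: "2 * h0 + 3 \<le> n" "even n"
        obtain h where h: "n = 2 * h" using n by blast
        have hh: "h0 \<le> h" "real n + 1 = 2 * real h + 1" using n h by auto
        define y where "y \<omega> = sinc ((real n + 1) / 2 * ydiff b (w n \<omega>))" for \<omega>
        have y: "integrable M y" "expectation (\<lambda>\<omega>. \<bar>y \<omega> - 1\<bar>) \<le> C / (real n + 1)"
          using sinc[OF hh] unfolding y_def[abs_def] h by blast+
        define Jn where "Jn = smoothed_density (g n) b"
        have Jn: "cmod Jn \<le> F" unfolding Jn_def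
          by (rule norm_smoothed_density_le[OF g assms(10) F(1) F(2)[OF assms(10)]])
        have "main_term M K bw f b w \<eta> n = of_real (expectation y) * Jn"
          unfolding main y_def[symmetric] Jn_def[symmetric] by simp
        then have "main_term M K bw f b w \<eta> n - Jn = of_real (expectation y - 1) * Jn" by (simp add: algebra_simps)
        also have "expectation y - 1 = expectation (\<lambda>\<omega>. y \<omega> - 1)" using y(1) by (simp add: prob_space)
        finally have "cmod (main_term M K bw f b w \<eta> n - Jn) = \<bar>expectation (\<lambda>\<omega>. y \<omega> - 1)\<bar> * cmod Jn" by (simp only: norm_mult norm_of_real)
        also have "\<dots> \<le> C / (real n + 1) * F"
        proof (intro mult_mono Jn)
          show "\<bar>expectation (\<lambda>\<omega>. y \<omega> - 1)\<bar> \<le> C / (real n + 1)" by (rule order_trans[OF integral_abs_bound y(2)])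
        qed (use C in auto)
        also have "\<dots> \<le> F * C * (1 / real n)"
        proof -
          have "C / (real n + 1) * F \<le> C / real n * F" using C n F(1) by (intro mult_right_mono divide_left_mono) auto
          then show ?thesis by (simp add: mult_ac)
        qed
        finally have e1: "cmod (main_term M K bw f b w \<eta> n - Jn) \<le> F * C * (1 / real n)" .
        have e2: "cmod (Jn - f b \<eta>) \<le> C2 * (bw n)\<^sup>2" using J by (simp only: Jn_def smoothed_density_def g_def)
        have e3: "cmod (of_real ((bw n)\<^sup>2 / 2) * f2 * of_real (integral UNIV (\<lambda>x. x\<^sup>2 * K x))) = m2 * (bw n)\<^sup>2"
          unfolding m2_def mult.assoc norm_mult norm_of_real by simp
        define s1 where "s1 = real n powr (-1/2) * sqrt (ln (real n))"
        define s2 where "s2 = 1 / (real n * bw n)"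
        have s2: "0 \<le> s2" using bw[of n] by (simp add: s2_def)
        \<comment> \<open>The sinc factor costs only O(1 / n) in mean, which the claimed n^(-1/2)
          (ln n)^(1/2) majorises because ln n >= 1.\<close>
        have s1: "1 / real n \<le> s1"
        proof -
          have n1: "1 \<le> real n" using n by simp
          have "1 / real n = real n powr (-1)" using n by (simp add: powr_minus_divide)
          also have "\<dots> \<le> real n powr (-1/2)" using n1 by (intro powr_mono) auto
          also have "\<dots> = real n powr (-1/2) * 1" by simp
          also have "\<dots> \<le> s1" unfolding s1_def using lnn[of n] n by (intro mult_left_mono) auto
          finally show ?thesis .
        qed
        have s10: "0 \<le> s1" using s1 order_trans[of 0 "1 / real n" s1] by simp
        have "cmod (main_term M K bw f b w \<eta> n - (f b \<eta> + of_real ((bw n)\<^sup>2 / 2) * f2 * of_real (integral UNIV (\<lambda>x. x\<^sup>2 * K x))))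
          = cmod ((main_term M K bw f b w \<eta> n - Jn) + (Jn - f b \<eta>) - of_real ((bw n)\<^sup>2 / 2) * f2 * of_real (integral UNIV (\<lambda>x. x\<^sup>2 * K x)))"
          by (simp add: algebra_simps)
        also have "\<dots> \<le> cmod (main_term M K bw f b w \<eta> n - Jn) + cmod (Jn - f b \<eta>) + cmod (of_real ((bw n)\<^sup>2 / 2) * f2 * of_real (integral UNIV (\<lambda>x. x\<^sup>2 * K x)))"
          by (intro order_trans[OF norm_triangle_ineq4] add_right_mono norm_triangle_ineq)
        also have "\<dots> \<le> F * C * s1 + C2 * (bw n)\<^sup>2 + m2 * (bw n)\<^sup>2"
        proof (intro add_mono)
          have "F * C * (1 / real n) \<le> F * C * s1" using s1 F(1) C by (intro mult_left_mono) auto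
          with e1 show "cmod (main_term M K bw f b w \<eta> n - Jn) \<le> F * C * s1" by (rule order_trans)
        qed (use e2 e3 in auto)
        also have "\<dots> \<le> C3 * ((bw n)\<^sup>2 + s1 + s2)"
        proof -
          have nn: "0 \<le> F * C" "0 \<le> C2" "0 \<le> m2" using F(1) C C2(1) by (auto simp: m2_def)
          have "0 \<le> F * C * ((bw n)\<^sup>2 + s2)" "0 \<le> (C2 + m2) * (s1 + s2)" using nn s10 s2 by (auto intro!: mult_nonneg_nonneg)
          moreover have "C3 * ((bw n)\<^sup>2 + s1 + s2) = (F * C * s1 + C2 * (bw n)\<^sup>2 + m2 * (bw n)\<^sup>2) + F * C * ((bw n)\<^sup>2 + s2) + (C2 + m2) * (s1 + s2)"
            by (simp add: C3_def algebra_simps)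
          ultimately show ?thesis by argo
        qed
        also have "\<dots> = C3 * norm ((bw n)\<^sup>2 + s1 + s2)" using s10 s2 by simp
        finally show "norm (cmod (main_term M K bw f b w \<eta> n - (f b \<eta> + of_real ((bw n)\<^sup>2 / 2) * f2 * of_real (integral UNIV (\<lambda>x. x\<^sup>2 * K x)))))
         \<le> C3 * norm ((bw n)\<^sup>2 + real n powr (-1/2) * sqrt (ln (real n)) + 1 / (real n * bw n))"
          unfolding s1_def s2_def by simp
      qed
    qed
  qed
  show ?thesis using p1 p2 by blast
qed

end
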